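(* Let $\mathcal{C}$ be a modular category over $k$, and let $G(\mathcal{C})$ be the group of isomorphism classes of invertible objects of $\mathcal{C}$. Then: (i) Suppose $\mathcal{C}$ has a faithful simple object $X$. Then the group $G(\mathcal{C})$ is cyclic and its order divides the order of $X$. In particular, if $\mathcal{C}$ has a faithful self-dual simple object, then $G(\mathcal{C}) = 1$ or $G(\mathcal{C}) \simeq \mathbb{Z}_2$. (ii) Suppose $\mathcal{C}$ is nilpotent. If $G(\mathcal{C})$ is cyclic, then $\mathcal{C}$ has a faithful simple object.
   Context: $k$ is an algebraically closed field of characteristic zero. A fusion category over $k$ is a $k$-linear semisimple rigid tensor category with finitely many isomorphism classes of simple objects, finite-dimensional Hom spaces and simple unit object $\mathbf{1}$. A modular category is a braided fusion category with a ribbon structure whose $S$-matrix is invertible. A fusion subcategory is a full tensor subcategory stable under direct sums and subobjects. An object $X$ is faithful if the fusion subcategory generated by $X$ is all of $\mathcal{C}$. The order of a nonzero object $X$ is the smallest integer $n \geq 1$ such that $\mathbf{1}$ occurs with positive multiplicity in $X^{\otimes n}$. A simple object $X$ is self-dual if $X\simeq X^*$. The adjoint subcategory $\mathcal{C}_{\mathrm{ad}}$ is the fusion subcategory generated by $X \otimes X^*$, $X$ running over the simple objects of $\mathcal{C}$. Set $\mathcal{C}^{(0)} = \mathcal{C}$ and $\mathcal{C}^{(n)} = (\mathcal{C}^{(n-1)})_{\mathrm{ad}}$ for $n \geq 1$; $\mathcal{C}$ is nilpotent if $\mathcal{C}^{(n)} = \mathrm{Vec}_k$ for some $n\ge 0$.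 *)

theory Defs
  imports
    "HOL-Algebra.Elementary_Groups"
    "HOL-Computational_Algebra.Polynomial"
    "Jordan_Normal_Form.Matrix"
begin

section \<open>Linear and abelian categories\<close>

text \<open>
  The objects of a category form the type \<open>'o\<close>.  The hom-spaces of a linear category are
  subspaces of one ambient vector space \<open>'m\<close>.  Every small linear category can be presented in this
  way, with the product of all its hom-spaces as ambient space; composition then does not have to
  mention objects, and all zero morphisms are the vector 0.  Apart from that, nothing is assumed
  about morphisms shared by several hom-spaces, and operations are only constrained on hom-spaces.
\<close>

record ('o, 'm, 'k) lin_cat =
  Hom :: "'o \<Rightarrow> 'o \<Rightarrow> 'm set"
  Ident :: "'o \<Rightarrow> 'm"
  Comp :: "'m \<Rightarrow> 'm \<Rightarrow> 'm"  (infixr "\<cdot>\<index>" 70)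
  Scale :: "'k \<Rightarrow> 'm \<Rightarrow> 'm"

locale linear_category = vector_space "Scale C"
  for C :: "('o, 'm::ab_group_add, 'k::field, 'z) lin_cat_scheme" (structure) +
  assumes subspace_Hom: "subspace (Hom C X Y)"
    and Ident_in [simp, intro]: "Ident C X \<in> Hom C X X"
    and Comp_in [simp, intro]: "\<lbrakk>g \<in> Hom C Y Z; f \<in> Hom C X Y\<rbrakk> \<Longrightarrow> g \<cdot> f \<in> Hom C X Z"
    and Comp_assoc: "\<lbrakk>h \<in> Hom C Z W; g \<in> Hom C Y Z; f \<in> Hom C X Y\<rbrakk>
      \<Longrightarrow> (h \<cdot> g) \<cdot> f = h \<cdot> (g \<cdot> f)"
    and Ident_Comp: "f \<in> Hom C X Y \<Longrightarrow> Ident C Y \<cdot> f = f"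
    and Comp_Ident: "f \<in> Hom C X Y \<Longrightarrow> f \<cdot> Ident C X = f"
    and Comp_add_left: "\<lbrakk>g \<in> Hom C Y Z; g' \<in> Hom C Y Z; f \<in> Hom C X Y\<rbrakk>
      \<Longrightarrow> (g + g') \<cdot> f = g \<cdot> f + g' \<cdot> f"
    and Comp_add_right: "\<lbrakk>g \<in> Hom C Y Z; f \<in> Hom C X Y; f' \<in> Hom C X Y\<rbrakk>
      \<Longrightarrow> g \<cdot> (f + f') = g \<cdot> f + g \<cdot> f'"
    and Comp_scale_left: "\<lbrakk>g \<in> Hom C Y Z; f \<in> Hom C X Y\<rbrakk>
      \<Longrightarrow> Scale C a g \<cdot> f = Scale C a (g \<cdot> f)"
    and Comp_scale_right: "\<lbrakk>g \<in> Hom C Y Z; f \<in> Hom C X Y\<rbrakk>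
      \<Longrightarrow> g \<cdot> Scale C a f = Scale C a (g \<cdot> f)"

definition mutually_inverse ::
    "('o, 'm, 'k, 'z) lin_cat_scheme \<Rightarrow> 'o \<Rightarrow> 'o \<Rightarrow> 'm \<Rightarrow> 'm \<Rightarrow> bool" where
  "mutually_inverse C X Y f g \<longleftrightarrow> f \<in> Hom C X Y \<and> g \<in> Hom C Y X
     \<and> g \<cdot>\<^bsub>C\<^esub> f = Ident C X \<and> f \<cdot>\<^bsub>C\<^esub> g = Ident C Y"

definition isomorphism :: "('o, 'm, 'k, 'z) lin_cat_scheme \<Rightarrow> 'o \<Rightarrow> 'o \<Rightarrow> 'm \<Rightarrow> bool" where
  "isomorphism C X Y f \<longleftrightarrow> (\<exists>g. mutually_inverse C X Y f g)"

definition inverse_mor :: "('o, 'm, 'k, 'z) lin_cat_scheme \<Rightarrow> 'o \<Rightarrow> 'o \<Rightarrow> 'm \<Rightarrow> 'm" where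
  "inverse_mor C X Y f = (THE g. mutually_inverse C X Y f g)"

definition isomorphic :: "('o, 'm, 'k, 'z) lin_cat_scheme \<Rightarrow> 'o \<Rightarrow> 'o \<Rightarrow> bool" where
  "isomorphic C X Y \<longleftrightarrow> (\<exists>f. isomorphism C X Y f)"

definition iso_class :: "('o, 'm, 'k, 'z) lin_cat_scheme \<Rightarrow> 'o \<Rightarrow> 'o set" where
  "iso_class C X = {Y. isomorphic C X Y}"

definition zero_object :: "('o, 'm::zero, 'k, 'z) lin_cat_scheme \<Rightarrow> 'o \<Rightarrow> bool" where
  "zero_object C Z \<longleftrightarrow> (\<forall>X. Hom C X Z = {0} \<and> Hom C Z X = {0})"

definition monic :: "('o, 'm, 'k, 'z) lin_cat_scheme \<Rightarrow> 'o \<Rightarrow> 'o \<Rightarrow> 'm \<Rightarrow> bool" where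
  "monic C X Y f \<longleftrightarrow> f \<in> Hom C X Y \<and>
     (\<forall>W. \<forall>g\<in>Hom C W X. \<forall>h\<in>Hom C W X. f \<cdot>\<^bsub>C\<^esub> g = f \<cdot>\<^bsub>C\<^esub> h \<longrightarrow> g = h)"

definition epic :: "('o, 'm, 'k, 'z) lin_cat_scheme \<Rightarrow> 'o \<Rightarrow> 'o \<Rightarrow> 'm \<Rightarrow> bool" where
  "epic C X Y f \<longleftrightarrow> f \<in> Hom C X Y \<and>
     (\<forall>W. \<forall>g\<in>Hom C Y W. \<forall>h\<in>Hom C Y W. g \<cdot>\<^bsub>C\<^esub> f = h \<cdot>\<^bsub>C\<^esub> f \<longrightarrow> g = h)"

definition is_kernel ::
    "('o, 'm::zero, 'k, 'z) lin_cat_scheme \<Rightarrow> 'o \<Rightarrow> 'o \<Rightarrow> 'm \<Rightarrow> 'o \<Rightarrow> 'm \<Rightarrow> bool" where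
  "is_kernel C X Y f K i \<longleftrightarrow> i \<in> Hom C K X \<and> f \<cdot>\<^bsub>C\<^esub> i = 0 \<and>
     (\<forall>W. \<forall>g\<in>Hom C W X. f \<cdot>\<^bsub>C\<^esub> g = 0 \<longrightarrow> (\<exists>!h. h \<in> Hom C W K \<and> i \<cdot>\<^bsub>C\<^esub> h = g))"

definition is_cokernel ::
    "('o, 'm::zero, 'k, 'z) lin_cat_scheme \<Rightarrow> 'o \<Rightarrow> 'o \<Rightarrow> 'm \<Rightarrow> 'o \<Rightarrow> 'm \<Rightarrow> bool" where
  "is_cokernel C X Y f Q p \<longleftrightarrow> p \<in> Hom C Y Q \<and> p \<cdot>\<^bsub>C\<^esub> f = 0 \<and>
     (\<forall>W. \<forall>g\<in>Hom C Y W. g \<cdot>\<^bsub>C\<^esub> f = 0 \<longrightarrow> (\<exists>!h. h \<in> Hom C Q W \<and> h \<cdot>\<^bsub>C\<^esub> p = g))"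

definition is_direct_sum ::
    "('o, 'm::ab_group_add, 'k, 'z) lin_cat_scheme \<Rightarrow> 'o \<Rightarrow> 'o list \<Rightarrow> bool" where
  "is_direct_sum C Z Xs \<longleftrightarrow> (\<exists>\<iota> \<pi>.
     (\<forall>j<length Xs. \<iota> j \<in> Hom C (Xs ! j) Z \<and> \<pi> j \<in> Hom C Z (Xs ! j)) \<and>
     (\<forall>j<length Xs. \<forall>l<length Xs. \<pi> j \<cdot>\<^bsub>C\<^esub> \<iota> l = (if j = l then Ident C (Xs ! j) else 0)) \<and>
     (\<Sum>j<length Xs. \<iota> j \<cdot>\<^bsub>C\<^esub> \<pi> j) = Ident C Z)"

definition is_subobject :: "('o, 'm, 'k, 'z) lin_cat_scheme \<Rightarrow> 'o \<Rightarrow> 'o \<Rightarrow> bool" where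
  "is_subobject C Y X \<longleftrightarrow> (\<exists>i. monic C Y X i)"

definition simple_object :: "('o, 'm::zero, 'k, 'z) lin_cat_scheme \<Rightarrow> 'o \<Rightarrow> bool" where
  "simple_object C X \<longleftrightarrow> \<not> zero_object C X \<and>
     (\<forall>Y i. monic C Y X i \<longrightarrow> zero_object C Y \<or> isomorphism C Y X i)"

definition multiplicity_in ::
    "('o, 'm::ab_group_add, 'k::field, 'z) lin_cat_scheme \<Rightarrow> 'o \<Rightarrow> 'o \<Rightarrow> nat" where
  "multiplicity_in C S X = vector_space.dim (Scale C) (Hom C S X)"

locale abelian_category = linear_category +
  assumes ex_zero_object: "\<exists>Z. zero_object C Z"
    and ex_direct_sum: "\<exists>Z. is_direct_sum C Z [X, Y]"
    and ex_kernel: "f \<in> Hom C X Y \<Longrightarrow> \<exists>K i. is_kernel C X Y f K i"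
    and ex_cokernel: "f \<in> Hom C X Y \<Longrightarrow> \<exists>Q p. is_cokernel C X Y f Q p"
    and monic_is_kernel: "monic C X Y i \<Longrightarrow> \<exists>W. \<exists>f\<in>Hom C Y W. is_kernel C Y W f X i"
    and epic_is_cokernel: "epic C X Y p \<Longrightarrow> \<exists>W. \<exists>f\<in>Hom C W X. is_cokernel C W X f Y p"

locale semisimple_category = abelian_category +
  assumes semisimple: "\<exists>Xs. (\<forall>X\<in>set Xs. simple_object C X) \<and> is_direct_sum C Z Xs"

section \<open>Fusion categories\<close>

text \<open>\<open>Dual X\<close> with \<open>Ev X\<close> and \<open>Coev X\<close> is a chosen left dual of \<open>X\<close>.\<close>

record ('o, 'm, 'k) tensor_cat = "('o, 'm, 'k) lin_cat" +
  TObj :: "'o \<Rightarrow> 'o \<Rightarrow> 'o"  (infixl "\<otimes>\<^sub>o\<index>" 75)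
  TMor :: "'m \<Rightarrow> 'm \<Rightarrow> 'm"  (infixl "\<otimes>\<^sub>m\<index>" 75)
  Unit :: "'o"  ("\<I>\<index>")
  Assoc :: "'o \<Rightarrow> 'o \<Rightarrow> 'o \<Rightarrow> 'm"
  LUnit :: "'o \<Rightarrow> 'm"
  RUnit :: "'o \<Rightarrow> 'm"
  Dual :: "'o \<Rightarrow> 'o"
  Ev :: "'o \<Rightarrow> 'm"
  Coev :: "'o \<Rightarrow> 'm"

abbreviation Assoc_inv :: "('o, 'm, 'k, 'z) tensor_cat_scheme \<Rightarrow> 'o \<Rightarrow> 'o \<Rightarrow> 'o \<Rightarrow> 'm" where
  "Assoc_inv C X Y Z \<equiv>
     inverse_mor C ((X \<otimes>\<^sub>o\<^bsub>C\<^esub> Y) \<otimes>\<^sub>o\<^bsub>C\<^esub> Z) (X \<otimes>\<^sub>o\<^bsub>C\<^esub> (Y \<otimes>\<^sub>o\<^bsub>C\<^esub> Z)) (Assoc C X Y Z)"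

locale tensor_category = linear_category C
  for C :: "('o, 'm::ab_group_add, 'k::field, 'z) tensor_cat_scheme" (structure) +
  assumes TMor_in [simp, intro]: "\<lbrakk>f \<in> Hom C X X'; g \<in> Hom C Y Y'\<rbrakk>
      \<Longrightarrow> f \<otimes>\<^sub>m g \<in> Hom C (X \<otimes>\<^sub>o Y) (X' \<otimes>\<^sub>o Y')"
    and TMor_Ident: "Ident C X \<otimes>\<^sub>m Ident C Y = Ident C (X \<otimes>\<^sub>o Y)"
    and TMor_Comp: "\<lbrakk>f \<in> Hom C X X'; f' \<in> Hom C X' X''; g \<in> Hom C Y Y'; g' \<in> Hom C Y' Y''\<rbrakk>
      \<Longrightarrow> (f' \<cdot> f) \<otimes>\<^sub>m (g' \<cdot> g) = (f' \<otimes>\<^sub>m g') \<cdot> (f \<otimes>\<^sub>m g)"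
    and TMor_add_left: "\<lbrakk>f \<in> Hom C X X'; f' \<in> Hom C X X'; g \<in> Hom C Y Y'\<rbrakk>
      \<Longrightarrow> (f + f') \<otimes>\<^sub>m g = f \<otimes>\<^sub>m g + f' \<otimes>\<^sub>m g"
    and TMor_add_right: "\<lbrakk>f \<in> Hom C X X'; g \<in> Hom C Y Y'; g' \<in> Hom C Y Y'\<rbrakk>
      \<Longrightarrow> f \<otimes>\<^sub>m (g + g') = f \<otimes>\<^sub>m g + f \<otimes>\<^sub>m g'"
    and TMor_scale_left: "\<lbrakk>f \<in> Hom C X X'; g \<in> Hom C Y Y'\<rbrakk>
      \<Longrightarrow> Scale C a f \<otimes>\<^sub>m g = Scale C a (f \<otimes>\<^sub>m g)"
    and TMor_scale_right: "\<lbrakk>f \<in> Hom C X X'; g \<in> Hom C Y Y'\<rbrakk>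
      \<Longrightarrow> f \<otimes>\<^sub>m Scale C a g = Scale C a (f \<otimes>\<^sub>m g)"
    and Assoc_iso: "isomorphism C ((X \<otimes>\<^sub>o Y) \<otimes>\<^sub>o Z) (X \<otimes>\<^sub>o (Y \<otimes>\<^sub>o Z)) (Assoc C X Y Z)"
    and Assoc_natural: "\<lbrakk>f \<in> Hom C X X'; g \<in> Hom C Y Y'; h \<in> Hom C Z Z'\<rbrakk>
      \<Longrightarrow> Assoc C X' Y' Z' \<cdot> ((f \<otimes>\<^sub>m g) \<otimes>\<^sub>m h) = (f \<otimes>\<^sub>m (g \<otimes>\<^sub>m h)) \<cdot> Assoc C X Y Z"
    and LUnit_iso: "isomorphism C (\<I> \<otimes>\<^sub>o X) X (LUnit C X)"
    and LUnit_natural: "f \<in> Hom C X Y \<Longrightarrow> LUnit C Y \<cdot> (Ident C \<I> \<otimes>\<^sub>m f) = f \<cdot> LUnit C X"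
    and RUnit_iso: "isomorphism C (X \<otimes>\<^sub>o \<I>) X (RUnit C X)"
    and RUnit_natural: "f \<in> Hom C X Y \<Longrightarrow> RUnit C Y \<cdot> (f \<otimes>\<^sub>m Ident C \<I>) = f \<cdot> RUnit C X"
    and pentagon: "(Ident C W \<otimes>\<^sub>m Assoc C X Y Z) \<cdot> Assoc C W (X \<otimes>\<^sub>o Y) Z \<cdot> (Assoc C W X Y \<otimes>\<^sub>m Ident C Z)
      = Assoc C W X (Y \<otimes>\<^sub>o Z) \<cdot> Assoc C (W \<otimes>\<^sub>o X) Y Z"
    and triangle: "(Ident C X \<otimes>\<^sub>m LUnit C Y) \<cdot> Assoc C X \<I> Y = RUnit C X \<otimes>\<^sub>m Ident C Y"

text \<open>
  \<open>is_left_dual C X Y e c\<close>: \<open>Y\<close> is a left dual of \<open>X\<close> (so \<open>X\<close> is a right dual of \<open>Y\<close>), with evaluation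
  \<open>e : Y \<otimes> X \<rightarrow> \<I>\<close> and coevaluation \<open>c : \<I> \<rightarrow> X \<otimes> Y\<close>.  The zigzag identities are composed with unit
  constraints, in order not to invert the latter.
\<close>

definition is_left_dual ::
    "('o, 'm, 'k, 'z) tensor_cat_scheme \<Rightarrow> 'o \<Rightarrow> 'o \<Rightarrow> 'm \<Rightarrow> 'm \<Rightarrow> bool" where
  "is_left_dual C X Y e c \<longleftrightarrow>
     e \<in> Hom C (Y \<otimes>\<^sub>o\<^bsub>C\<^esub> X) \<I>\<^bsub>C\<^esub> \<and> c \<in> Hom C \<I>\<^bsub>C\<^esub> (X \<otimes>\<^sub>o\<^bsub>C\<^esub> Y) \<and>
     RUnit C X \<cdot>\<^bsub>C\<^esub> (Ident C X \<otimes>\<^sub>m\<^bsub>C\<^esub> e) \<cdot>\<^bsub>C\<^esub> Assoc C X Y X \<cdot>\<^bsub>C\<^esub> (c \<otimes>\<^sub>m\<^bsub>C\<^esub> Ident C X)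
       = LUnit C X \<and>
     LUnit C Y \<cdot>\<^bsub>C\<^esub> (e \<otimes>\<^sub>m\<^bsub>C\<^esub> Ident C Y) \<cdot>\<^bsub>C\<^esub> Assoc_inv C Y X Y \<cdot>\<^bsub>C\<^esub> (Ident C Y \<otimes>\<^sub>m\<^bsub>C\<^esub> c)
       = RUnit C Y"

locale rigid_category = tensor_category +
  assumes left_dual: "is_left_dual C X (Dual C X) (Ev C X) (Coev C X)"
    and right_dual: "\<exists>Y e c. is_left_dual C Y X e c"

locale fusion_category = rigid_category C + semisimple_category C
  for C :: "('o, 'm::ab_group_add, 'k::field, 'z) tensor_cat_scheme" (structure) +
  assumes finite_simples: "finite {iso_class C X |X. simple_object C X}"
    and finite_dim_Hom: "\<exists>B. finite B \<and> Hom C X Y = span B"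
    and simple_Unit: "simple_object C \<I>"

definition self_dual :: "('o, 'm, 'k, 'z) tensor_cat_scheme \<Rightarrow> 'o \<Rightarrow> bool" where
  "self_dual C X \<longleftrightarrow> isomorphic C X (Dual C X)"

fun tensor_power :: "('o, 'm, 'k, 'z) tensor_cat_scheme \<Rightarrow> 'o \<Rightarrow> nat \<Rightarrow> 'o" where
  "tensor_power C X 0 = \<I>\<^bsub>C\<^esub>"
| "tensor_power C X (Suc n) = tensor_power C X n \<otimes>\<^sub>o\<^bsub>C\<^esub> X"

definition object_order ::
    "('o, 'm::ab_group_add, 'k::field, 'z) tensor_cat_scheme \<Rightarrow> 'o \<Rightarrow> nat" where
  "object_order C X = (LEAST n. n \<ge> 1 \<and> multiplicity_in C \<I>\<^bsub>C\<^esub> (tensor_power C X n) > 0)"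

text \<open>A full subcategory is given by its set of objects.\<close>

definition fusion_subcategory ::
    "('o, 'm::ab_group_add, 'k, 'z) tensor_cat_scheme \<Rightarrow> 'o set \<Rightarrow> bool" where
  "fusion_subcategory C D \<longleftrightarrow> \<I>\<^bsub>C\<^esub> \<in> D \<and>
     (\<forall>X\<in>D. \<forall>Y\<in>D. X \<otimes>\<^sub>o\<^bsub>C\<^esub> Y \<in> D) \<and>
     (\<forall>Z Xs. set Xs \<subseteq> D \<and> is_direct_sum C Z Xs \<longrightarrow> Z \<in> D) \<and>
     (\<forall>X\<in>D. \<forall>Y. is_subobject C Y X \<longrightarrow> Y \<in> D)"

definition generated_fusion_subcategory ::
    "('o, 'm::ab_group_add, 'k, 'z) tensor_cat_scheme \<Rightarrow> 'o set \<Rightarrow> 'o set" where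
  "generated_fusion_subcategory C S = \<Inter> {D. fusion_subcategory C D \<and> S \<subseteq> D}"

definition faithful_object :: "('o, 'm::ab_group_add, 'k, 'z) tensor_cat_scheme \<Rightarrow> 'o \<Rightarrow> bool" where
  "faithful_object C X \<longleftrightarrow> generated_fusion_subcategory C {X} = UNIV"

text \<open>
  For a fusion subcategory \<open>D\<close> of \<open>C\<close>, simplicity, duals and the generated fusion subcategory may be
  taken in \<open>C\<close> rather than in \<open>D\<close>, since \<open>D\<close> is full and closed under subobjects and duals.
\<close>

definition adjoint_subcategory ::
    "('o, 'm::ab_group_add, 'k, 'z) tensor_cat_scheme \<Rightarrow> 'o set \<Rightarrow> 'o set" where
  "adjoint_subcategory C D =
     generated_fusion_subcategory C {X \<otimes>\<^sub>o\<^bsub>C\<^esub> Dual C X |X. X \<in> D \<and> simple_object C X}"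

definition Vec_subcategory :: "('o, 'm::ab_group_add, 'k, 'z) tensor_cat_scheme \<Rightarrow> 'o set" where
  "Vec_subcategory C = {Z. \<exists>n. is_direct_sum C Z (replicate n \<I>\<^bsub>C\<^esub>)}"

definition nilpotent_category :: "('o, 'm::ab_group_add, 'k, 'z) tensor_cat_scheme \<Rightarrow> bool" where
  "nilpotent_category C \<longleftrightarrow> (\<exists>n. (adjoint_subcategory C ^^ n) UNIV = Vec_subcategory C)"

definition invertible_object :: "('o, 'm, 'k, 'z) tensor_cat_scheme \<Rightarrow> 'o \<Rightarrow> bool" where
  "invertible_object C X \<longleftrightarrow>
     (\<exists>Y. isomorphic C (X \<otimes>\<^sub>o\<^bsub>C\<^esub> Y) \<I>\<^bsub>C\<^esub> \<and> isomorphic C (Y \<otimes>\<^sub>o\<^bsub>C\<^esub> X) \<I>\<^bsub>C\<^esub>)"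

text \<open>The product of the classes of \<open>X\<close> and \<open>Y\<close> is the class of \<open>X \<otimes> Y\<close>, see
  \<open>mult_invertibles_group\<close> below.\<close>

definition invertibles_group :: "('o, 'm, 'k, 'z) tensor_cat_scheme \<Rightarrow> 'o set monoid" where
  "invertibles_group C =
     \<lparr>carrier = {iso_class C X |X. invertible_object C X},
      monoid.mult = (\<lambda>A B. \<Union>X\<in>A. \<Union>Y\<in>B. iso_class C (X \<otimes>\<^sub>o\<^bsub>C\<^esub> Y)),
      one = iso_class C \<I>\<^bsub>C\<^esub>\<rparr>"

section \<open>Modular categories\<close>

record ('o, 'm, 'k) ribbon_cat = "('o, 'm, 'k) tensor_cat" +
  Braid :: "'o \<Rightarrow> 'o \<Rightarrow> 'm"
  Twist :: "'o \<Rightarrow> 'm"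

locale braided_fusion_category = fusion_category C
  for C :: "('o, 'm::ab_group_add, 'k::field, 'z) ribbon_cat_scheme" (structure) +
  assumes Braid_iso: "isomorphism C (X \<otimes>\<^sub>o Y) (Y \<otimes>\<^sub>o X) (Braid C X Y)"
    and Braid_natural: "\<lbrakk>f \<in> Hom C X X'; g \<in> Hom C Y Y'\<rbrakk>
      \<Longrightarrow> Braid C X' Y' \<cdot> (f \<otimes>\<^sub>m g) = (g \<otimes>\<^sub>m f) \<cdot> Braid C X Y"
    and hexagon1: "Assoc C Y Z X \<cdot> Braid C X (Y \<otimes>\<^sub>o Z) \<cdot> Assoc C X Y Z
      = (Ident C Y \<otimes>\<^sub>m Braid C X Z) \<cdot> Assoc C Y X Z \<cdot> (Braid C X Y \<otimes>\<^sub>m Ident C Z)"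
    and hexagon2: "Assoc_inv C Z X Y \<cdot> Braid C (X \<otimes>\<^sub>o Y) Z \<cdot> Assoc_inv C X Y Z
      = (Braid C X Z \<otimes>\<^sub>m Ident C Y) \<cdot> Assoc_inv C X Z Y \<cdot> (Ident C X \<otimes>\<^sub>m Braid C Y Z)"

text \<open>
  The transpose \<open>f\<^sup>* : Y\<^sup>* \<rightarrow> X\<^sup>*\<close> of \<open>f : X \<rightarrow> Y\<close> is the composite
  \<open>Y\<^sup>* \<rightarrow> Y\<^sup>* \<otimes> \<I> \<rightarrow> Y\<^sup>* \<otimes> (X \<otimes> X\<^sup>*) \<rightarrow> Y\<^sup>* \<otimes> (Y \<otimes> X\<^sup>*) \<rightarrow> (Y\<^sup>* \<otimes> Y) \<otimes> X\<^sup>* \<rightarrow> \<I> \<otimes> X\<^sup>* \<rightarrow> X\<^sup>*\<close>.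
\<close>

definition transpose_mor :: "('o, 'm, 'k, 'z) tensor_cat_scheme \<Rightarrow> 'o \<Rightarrow> 'o \<Rightarrow> 'm \<Rightarrow> 'm" where
  "transpose_mor C X Y f =
     LUnit C (Dual C X) \<cdot>\<^bsub>C\<^esub> (Ev C Y \<otimes>\<^sub>m\<^bsub>C\<^esub> Ident C (Dual C X))
     \<cdot>\<^bsub>C\<^esub> Assoc_inv C (Dual C Y) Y (Dual C X)
     \<cdot>\<^bsub>C\<^esub> (Ident C (Dual C Y) \<otimes>\<^sub>m\<^bsub>C\<^esub> (f \<otimes>\<^sub>m\<^bsub>C\<^esub> Ident C (Dual C X)))
     \<cdot>\<^bsub>C\<^esub> (Ident C (Dual C Y) \<otimes>\<^sub>m\<^bsub>C\<^esub> Coev C X)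
     \<cdot>\<^bsub>C\<^esub> inverse_mor C (Dual C Y \<otimes>\<^sub>o\<^bsub>C\<^esub> \<I>\<^bsub>C\<^esub>) (Dual C Y) (RUnit C (Dual C Y))"

locale ribbon_fusion_category = braided_fusion_category +
  assumes Twist_iso: "isomorphism C X X (Twist C X)"
    and Twist_natural: "f \<in> Hom C X Y \<Longrightarrow> Twist C Y \<cdot> f = f \<cdot> Twist C X"
    and Twist_tensor: "Twist C (X \<otimes>\<^sub>o Y) = Braid C Y X \<cdot> Braid C X Y \<cdot> (Twist C X \<otimes>\<^sub>m Twist C Y)"
    and Twist_Dual: "Twist C (Dual C X) = transpose_mor C X X (Twist C X)"

text \<open>
  The quantum trace of an endomorphism \<open>f\<close> of \<open>X\<close> is the composite
  \<open>\<I> \<rightarrow> X \<otimes> X\<^sup>* \<rightarrow> X \<otimes> X\<^sup>* \<rightarrow> X\<^sup>* \<otimes> X \<rightarrow> \<I>\<close> of \<open>coev\<close>, \<open>\<theta>f \<otimes> id\<close>, the braiding and \<open>ev\<close>.  It is a scalar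
  multiple of the identity of \<open>\<I>\<close>, and is identified with this scalar.
\<close>

definition quantum_trace :: "('o, 'm, 'k, 'z) ribbon_cat_scheme \<Rightarrow> 'o \<Rightarrow> 'm \<Rightarrow> 'k" where
  "quantum_trace C X f = (THE a. Scale C a (Ident C \<I>\<^bsub>C\<^esub>) =
     Ev C X \<cdot>\<^bsub>C\<^esub> Braid C X (Dual C X)
     \<cdot>\<^bsub>C\<^esub> ((Twist C X \<cdot>\<^bsub>C\<^esub> f) \<otimes>\<^sub>m\<^bsub>C\<^esub> Ident C (Dual C X)) \<cdot>\<^bsub>C\<^esub> Coev C X)"

definition S_entry :: "('o, 'm, 'k, 'z) ribbon_cat_scheme \<Rightarrow> 'o \<Rightarrow> 'o \<Rightarrow> 'k" where
  "S_entry C X Y = quantum_trace C (X \<otimes>\<^sub>o\<^bsub>C\<^esub> Y) (Braid C Y X \<cdot>\<^bsub>C\<^esub> Braid C X Y)"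

definition simple_representatives ::
    "('o, 'm::zero, 'k, 'z) lin_cat_scheme \<Rightarrow> 'o list \<Rightarrow> bool" where
  "simple_representatives C Xs \<longleftrightarrow>
     (\<forall>X\<in>set Xs. simple_object C X) \<and>
     (\<forall>i<length Xs. \<forall>j<length Xs. isomorphic C (Xs ! i) (Xs ! j) \<longrightarrow> i = j) \<and>
     (\<forall>Y. simple_object C Y \<longrightarrow> (\<exists>X\<in>set Xs. isomorphic C Y X))"

definition S_matrix :: "('o, 'm, 'k, 'z) ribbon_cat_scheme \<Rightarrow> 'o list \<Rightarrow> 'k mat" where
  "S_matrix C Xs =
     mat (length Xs) (length Xs) (\<lambda>(i, j). S_entry C (Xs ! i) (Xs ! j))"

locale modular_category = ribbon_fusion_category +
  assumes S_matrix_invertible: "\<exists>Xs. simple_representatives C Xs \<and> invertible_mat (S_matrix C Xs)"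

section \<open>The invertible objects form a group\<close>

context linear_category
begin

lemma isomorphic_refl [simp]: "isomorphic C X X"
  unfolding isomorphic_def isomorphism_def mutually_inverse_def
  using Ident_in[of X] Ident_Comp[OF Ident_in[of X]] by blast

lemma isomorphic_sym: "isomorphic C X Y \<Longrightarrow> isomorphic C Y X"
  unfolding isomorphic_def isomorphism_def mutually_inverse_def by blast

lemma isomorphic_trans [trans]:
  assumes "isomorphic C X Y" "isomorphic C Y Z"
  shows "isomorphic C X Z"
proof -
  obtain f g where f: "f \<in> Hom C X Y" "g \<in> Hom C Y X" "g \<cdot> f = Ident C X" "f \<cdot> g = Ident C Y"
    using assms(1) unfolding isomorphic_def isomorphism_def mutually_inverse_def by blast
  obtain h k where h: "h \<in> Hom C Y Z" "k \<in> Hom C Z Y" "k \<cdot> h = Ident C Y" "h \<cdot> k = Ident C Z"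
    using assms(2) unfolding isomorphic_def isomorphism_def mutually_inverse_def by blast
  have "(g \<cdot> k) \<cdot> (h \<cdot> f) = g \<cdot> ((k \<cdot> h) \<cdot> f)"
    using Comp_assoc[OF f(2) h(2) Comp_in[OF h(1) f(1)]] Comp_assoc[OF h(2,1) f(1)] by simp
  also have "\<dots> = Ident C X"
    using f h Ident_Comp[OF f(1)] Ident_Comp[OF h(2)] by simp
  finally have 1: "(g \<cdot> k) \<cdot> (h \<cdot> f) = Ident C X" .
  have "(h \<cdot> f) \<cdot> (g \<cdot> k) = h \<cdot> ((f \<cdot> g) \<cdot> k)"
    using Comp_assoc[OF h(1) f(1) Comp_in[OF f(2) h(2)]] Comp_assoc[OF f(1,2) h(2)] by simp
  also have "\<dots> = Ident C Z"
    using f h Ident_Comp[OF f(1)] Ident_Comp[OF h(2)] by simp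
  finally have 2: "(h \<cdot> f) \<cdot> (g \<cdot> k) = Ident C Z" .
  show ?thesis
    unfolding isomorphic_def isomorphism_def mutually_inverse_def
    using 1 2 Comp_in[OF h(1) f(1)] Comp_in[OF f(2) h(2)] by blast
qed

lemma iso_class_eq_iff: "iso_class C X = iso_class C Y \<longleftrightarrow> isomorphic C X Y"
  unfolding iso_class_def
  using isomorphic_refl[of Y] isomorphic_sym[of X Y] isomorphic_trans[of X Y]
    isomorphic_trans[of Y X] by blast

end

context tensor_category
begin

lemma isomorphic_TObj:
  assumes "isomorphic C X X'" "isomorphic C Y Y'"
  shows "isomorphic C (X \<otimes>\<^sub>o Y) (X' \<otimes>\<^sub>o Y')"
proof -
  obtain f g where f: "f \<in> Hom C X X'" "g \<in> Hom C X' X" "g \<cdot> f = Ident C X" "f \<cdot> g = Ident C X'"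
    using assms(1) unfolding isomorphic_def isomorphism_def mutually_inverse_def by blast
  obtain h k where h: "h \<in> Hom C Y Y'" "k \<in> Hom C Y' Y" "k \<cdot> h = Ident C Y" "h \<cdot> k = Ident C Y'"
    using assms(2) unfolding isomorphic_def isomorphism_def mutually_inverse_def by blast
  have 1: "(g \<otimes>\<^sub>m k) \<cdot> (f \<otimes>\<^sub>m h) = Ident C (X \<otimes>\<^sub>o Y)"
    using TMor_Comp[OF f(1,2) h(1,2)] f h TMor_Ident by simp
  have 2: "(f \<otimes>\<^sub>m h) \<cdot> (g \<otimes>\<^sub>m k) = Ident C (X' \<otimes>\<^sub>o Y')"
    using TMor_Comp[OF f(2,1) h(2,1)] f h TMor_Ident by simp
  show ?thesis
    unfolding isomorphic_def isomorphism_def mutually_inverse_def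
    using 1 2 TMor_in[OF f(1) h(1)] TMor_in[OF f(2) h(2)] by blast
qed

lemma mult_invertibles_group:
  "iso_class C X \<otimes>\<^bsub>invertibles_group C\<^esub> iso_class C Y = iso_class C (X \<otimes>\<^sub>o Y)"
proof -
  have "isomorphic C (X \<otimes>\<^sub>o Y) Z \<longleftrightarrow>
      (\<exists>X' Y'. isomorphic C X X' \<and> isomorphic C Y Y' \<and> isomorphic C (X' \<otimes>\<^sub>o Y') Z)" for Z
    using isomorphic_refl[of X] isomorphic_refl[of Y] isomorphic_TObj[of X _ Y]
      isomorphic_trans[of "X \<otimes>\<^sub>o Y"] by blast
  then show ?thesis
    unfolding invertibles_group_def iso_class_def by auto
qed

lemma isomorphic_assoc: "isomorphic C ((X \<otimes>\<^sub>o Y) \<otimes>\<^sub>o Z) (X \<otimes>\<^sub>o (Y \<otimes>\<^sub>o Z))"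
  using Assoc_iso unfolding isomorphic_def by blast

lemma isomorphic_unit: "isomorphic C (\<I> \<otimes>\<^sub>o X) X" "isomorphic C (X \<otimes>\<^sub>o \<I>) X"
  using LUnit_iso RUnit_iso unfolding isomorphic_def by blast+

lemma isomorphic_TObj_inverse:
  assumes "isomorphic C (X \<otimes>\<^sub>o X') \<I>" "isomorphic C (Y \<otimes>\<^sub>o Y') \<I>"
  shows "isomorphic C ((X \<otimes>\<^sub>o Y) \<otimes>\<^sub>o (Y' \<otimes>\<^sub>o X')) \<I>"
proof -
  have "isomorphic C (Y \<otimes>\<^sub>o (Y' \<otimes>\<^sub>o X')) ((Y \<otimes>\<^sub>o Y') \<otimes>\<^sub>o X')"
    by (rule isomorphic_sym[OF isomorphic_assoc])
  also have "isomorphic C \<dots> (\<I> \<otimes>\<^sub>o X')"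
    by (rule isomorphic_TObj[OF assms(2) isomorphic_refl])
  also have "isomorphic C \<dots> X'"
    by (rule isomorphic_unit)
  finally have *: "isomorphic C (Y \<otimes>\<^sub>o (Y' \<otimes>\<^sub>o X')) X'" .
  have "isomorphic C ((X \<otimes>\<^sub>o Y) \<otimes>\<^sub>o (Y' \<otimes>\<^sub>o X')) (X \<otimes>\<^sub>o (Y \<otimes>\<^sub>o (Y' \<otimes>\<^sub>o X')))"
    by (rule isomorphic_assoc)
  also have "isomorphic C \<dots> (X \<otimes>\<^sub>o X')"
    by (rule isomorphic_TObj[OF isomorphic_refl *])
  also have "isomorphic C \<dots> \<I>"
    by (rule assms(1))
  finally show ?thesis .
qed

lemma group_invertibles_group: "group (invertibles_group C)"
proof (rule groupI)
  let ?G = "invertibles_group C"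
  have car: "A \<in> carrier ?G \<longleftrightarrow> (\<exists>X. A = iso_class C X \<and> invertible_object C X)" for A
    unfolding invertibles_group_def by auto
  have one: "\<one>\<^bsub>?G\<^esub> = iso_class C \<I>"
    unfolding invertibles_group_def by simp
  show "\<one>\<^bsub>?G\<^esub> \<in> carrier ?G"
    unfolding car one invertible_object_def using isomorphic_unit by blast
  fix A B
  assume "A \<in> carrier ?G" "B \<in> carrier ?G"
  then obtain X Y where X: "A = iso_class C X" "invertible_object C X"
    and Y: "B = iso_class C Y" "invertible_object C Y"
    unfolding car by blast
  have "invertible_object C (X \<otimes>\<^sub>o Y)"
    using X(2) Y(2) isomorphic_TObj_inverse[of X _ Y] isomorphic_TObj_inverse[of _ Y _ X]
    unfolding invertible_object_def by blast
  then show "A \<otimes>\<^bsub>?G\<^esub> B \<in> carrier ?G"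
    unfolding car X Y mult_invertibles_group by blast
  fix D
  assume "D \<in> carrier ?G"
  then obtain Z where Z: "D = iso_class C Z" "invertible_object C Z"
    unfolding car by blast
  show "A \<otimes>\<^bsub>?G\<^esub> B \<otimes>\<^bsub>?G\<^esub> D = A \<otimes>\<^bsub>?G\<^esub> (B \<otimes>\<^bsub>?G\<^esub> D)"
    unfolding X Y Z mult_invertibles_group iso_class_eq_iff by (rule isomorphic_assoc)
next
  let ?G = "invertibles_group C"
  fix A
  assume "A \<in> carrier ?G"
  then obtain X where X: "A = iso_class C X" "invertible_object C X"
    unfolding invertibles_group_def by auto
  have one: "\<one>\<^bsub>?G\<^esub> = iso_class C \<I>"
    unfolding invertibles_group_def by simp
  show "\<one>\<^bsub>?G\<^esub> \<otimes>\<^bsub>?G\<^esub> A = A"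
    unfolding X one mult_invertibles_group iso_class_eq_iff by (rule isomorphic_unit)
  obtain Y where Y: "isomorphic C (X \<otimes>\<^sub>o Y) \<I>" "isomorphic C (Y \<otimes>\<^sub>o X) \<I>"
    using X(2) unfolding invertible_object_def by blast
  have "iso_class C Y \<in> carrier ?G"
    using Y unfolding invertibles_group_def invertible_object_def by auto
  moreover have "iso_class C Y \<otimes>\<^bsub>?G\<^esub> A = \<one>\<^bsub>?G\<^esub>"
    unfolding X one mult_invertibles_group iso_class_eq_iff by (rule Y)
  ultimately show "\<exists>B\<in>carrier ?G. B \<otimes>\<^bsub>?G\<^esub> A = \<one>\<^bsub>?G\<^esub>"
    by blast
qed

end

end

theory Submission
  imports Defs "HOL-Algebra.Multiplicative_Group"
begin

text \<open>
  The double braiding of an invertible object \<open>g\<close> with a simple object \<open>Y\<close> is a scalar \<open>\<chi>\<^sub>g(Y)\<close>, which is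
  multiplicative in \<open>g\<close> and on the constituents of tensor products in \<open>Y\<close>.  Invertibility of the
  \<open>S\<close>-matrix makes \<open>g \<mapsto> \<chi>\<^sub>g\<close> injective.  If \<open>X\<close> is faithful, \<open>\<chi>\<^sub>g\<close> is determined by \<open>\<chi>\<^sub>g(X)\<close>, so the
  invertible objects embed into the roots of unity of order the order of \<open>X\<close>.

  For (ii), the values of \<open>\<chi>\<^sub>g\<close> at a generator \<open>g\<close> form a cyclic group, generated by some \<open>\<chi>\<^sub>g(X)\<close>.  If \<open>X\<close>
  were not faithful, then by nilpotency the subcategory generated by \<open>X\<close> and the adjoint subcategory
  would be proper.  The rows of the \<open>S\<close>-matrix, divided by dimensions, are the characters of the
  Grothendieck ring; a proper fusion subcategory \<open>E\<close> cannot separate the unit from all other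
  simple objects, and an object not separated from the unit is invertible if \<open>E\<close> contains the adjoint
  subcategory.  So some \<open>h \<noteq> \<I>\<close> has \<open>\<chi>\<^sub>h(X) = 1\<close>, and as \<open>h\<close> is a power of \<open>g\<close>, \<open>\<chi>\<^sub>h = 1\<close>.

  The geometric input, multiplicativity of \<open>S\<^sub>X\<^sub>Y / dim X\<close> in \<open>Y\<close>, is a computation with partial traces
  in a strict ribbon category, transported along a strictification whose objects are words.
\<close>

section \<open>Traces in strict ribbon categories\<close>

text \<open>The field is abstract, so dimensions carry no positivity: no Frobenius-Perron
  dimensions, no norms. Where the usual arguments rely on positivity, the proof uses either
  dimensions of hom-spaces, which are natural numbers, or the linear independence of the rows of the
  S-matrix. The double centralizer theorem does not appear either; a nontrivial object centralizing
  a proper fusion subcategory is found by interpolation on the finitely many characters.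

  Strictness is forced by the trace computations. With brackets every move of a strand costs several
  associators; with lists as objects, append is associative by rewriting, composites of whiskered
  arrows have a normal form, and only the geometric moves are left to be spelled out. The chosen
  duals of the original category are not assumed compatible with tensor products. So the trace must
  be independent of the dual, which is the case of cyclicity in which one of the two maps is an
  identity.\<close>

locale strict_monoidal =
  fixes arr :: "'a \<Rightarrow> bool" and dom cod :: "'a \<Rightarrow> 'w list"
    and idn :: "'w list \<Rightarrow> 'a"
    and comp :: "'a \<Rightarrow> 'a \<Rightarrow> 'a"  (infixr "\<ast>" 70)
    and tens :: "'a \<Rightarrow> 'a \<Rightarrow> 'a"  (infixr "\<boxtimes>" 75)
    and smul :: "'k \<Rightarrow> 'a \<Rightarrow> 'a"
  assumes arr_idn [simp]: "arr (idn xs)" "dom (idn xs) = xs" "cod (idn xs) = xs"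
    and arr_comp [simp]: "\<lbrakk>arr f; arr g; cod f = dom g\<rbrakk> \<Longrightarrow> arr (g \<ast> f)"
    and dom_comp [simp]: "dom (g \<ast> f) = dom f" "cod (g \<ast> f) = cod g"
    and arr_tens [simp]: "\<lbrakk>arr f; arr g\<rbrakk> \<Longrightarrow> arr (f \<boxtimes> g)"
    and dom_tens [simp]: "dom (f \<boxtimes> g) = dom f @ dom g" "cod (f \<boxtimes> g) = cod f @ cod g"
    and arr_smul [simp]: "arr f \<Longrightarrow> arr (smul a f)"
    and dom_smul [simp]: "dom (smul a f) = dom f" "cod (smul a f) = cod f"
    and comp_assoc: "\<lbrakk>arr f; arr g; arr h; cod f = dom g; cod g = dom h\<rbrakk>
      \<Longrightarrow> (h \<ast> g) \<ast> f = h \<ast> (g \<ast> f)"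
    and comp_idn: "\<lbrakk>arr f; dom f = xs\<rbrakk> \<Longrightarrow> f \<ast> idn xs = f"
    and idn_comp: "\<lbrakk>arr f; cod f = xs\<rbrakk> \<Longrightarrow> idn xs \<ast> f = f"
    and tens_assoc: "\<lbrakk>arr f; arr g; arr h\<rbrakk> \<Longrightarrow> (f \<boxtimes> g) \<boxtimes> h = f \<boxtimes> (g \<boxtimes> h)"
    and tens_idn: "idn xs \<boxtimes> idn ys = idn (xs @ ys)"
    and idn_Nil_tens: "arr f \<Longrightarrow> idn [] \<boxtimes> f = f"
    and tens_idn_Nil: "arr f \<Longrightarrow> f \<boxtimes> idn [] = f"
    and interchange: "\<lbrakk>arr f; arr f'; arr g; arr g'; cod f = dom f'; cod g = dom g'\<rbrakk>
      \<Longrightarrow> (f' \<ast> f) \<boxtimes> (g' \<ast> g) = (f' \<boxtimes> g') \<ast> (f \<boxtimes> g)"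
    and smul_comp_left: "\<lbrakk>arr f; arr g; cod f = dom g\<rbrakk> \<Longrightarrow> smul a g \<ast> f = smul a (g \<ast> f)"
    and smul_comp_right: "\<lbrakk>arr f; arr g; cod f = dom g\<rbrakk> \<Longrightarrow> g \<ast> smul a f = smul a (g \<ast> f)"
    and smul_tens_left: "\<lbrakk>arr f; arr g\<rbrakk> \<Longrightarrow> smul a f \<boxtimes> g = smul a (f \<boxtimes> g)"
    and smul_tens_right: "\<lbrakk>arr f; arr g\<rbrakk> \<Longrightarrow> f \<boxtimes> smul a g = smul a (f \<boxtimes> g)"
begin

abbreviation lw :: "'w list \<Rightarrow> 'a \<Rightarrow> 'a"  (infixr "\<triangleright>" 76) where "xs \<triangleright> f \<equiv> idn xs \<boxtimes> f"
abbreviation rw :: "'a \<Rightarrow> 'w list \<Rightarrow> 'a"  (infixl "\<triangleleft>" 77) where "f \<triangleleft> xs \<equiv> f \<boxtimes> idn xs"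

lemma lw_lw: "arr f \<Longrightarrow> xs \<triangleright> (ys \<triangleright> f) = (xs @ ys) \<triangleright> f"
  by (simp add: tens_idn flip: tens_assoc)

lemma lw_comp: "\<lbrakk>arr f; arr g; cod f = dom g\<rbrakk> \<Longrightarrow> xs \<triangleright> (g \<ast> f) = (xs \<triangleright> g) \<ast> (xs \<triangleright> f)"
  using interchange[of "idn xs" "idn xs" f g] by (simp add: comp_idn)

lemma rw_comp: "\<lbrakk>arr f; arr g; cod f = dom g\<rbrakk> \<Longrightarrow> (g \<ast> f) \<triangleleft> xs = (g \<triangleleft> xs) \<ast> (f \<triangleleft> xs)"
  using interchange[of f g "idn xs" "idn xs"] by (simp add: comp_idn)

lemma exchange:
  assumes "arr f" "arr g" "dom f = x" "cod f = x'" "dom g = y" "cod g = y'"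
  shows "(x' \<triangleright> g) \<ast> (f \<triangleleft> y) = (f \<triangleleft> y') \<ast> (x \<triangleright> g)"
  using interchange[of f "idn x'" "idn y" g] interchange[of "idn x" f g "idn y'"] assms
  by (simp add: comp_idn idn_comp)

definition is_dual :: "'w list \<Rightarrow> 'w list \<Rightarrow> 'a \<Rightarrow> 'a \<Rightarrow> bool" where
  "is_dual x d e c \<longleftrightarrow> arr e \<and> dom e = d @ x \<and> cod e = [] \<and> arr c \<and> dom c = [] \<and> cod c = x @ d
     \<and> (x \<triangleright> e) \<ast> (c \<triangleleft> x) = idn x \<and> (e \<triangleleft> d) \<ast> (d \<triangleright> c) = idn d"


text \<open>The normal form of diagrams: whiskering is pushed inside composites, nested whiskers are
  merged, composites are nested to the right. \<open>exchange\<close> has no preferred direction;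
  like naturality and the zigzag identities it is applied by hand between such rewritings.\<close>

lemmas whisker_simps = lw_comp rw_comp tens_assoc lw_lw tens_idn comp_assoc
  idn_Nil_tens tens_idn_Nil comp_idn idn_comp

lemma is_dualD:
  assumes "is_dual x d e c"
  shows "arr e" "dom e = d @ x" "cod e = []" "arr c" "dom c = []" "cod c = x @ d"
    "(x \<triangleright> e) \<ast> (c \<triangleleft> x) = idn x" "(e \<triangleleft> d) \<ast> (d \<triangleright> c) = idn d"
  using assms unfolding is_dual_def by auto

text \<open>\<open>u\<close> is the transpose of \<open>f\<close>, obtained by bending both ends of
  \<open>f\<close>. The two equations let \<open>f\<close> pass through a coevaluation or an
  evaluation at the cost of becoming \<open>u\<close>, which is how it will travel around a closed
  loop.\<close>

lemma transpose_exists: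
  assumes X: "is_dual x d e c" and Y: "is_dual y d' e' c'"
    and f: "arr f" "dom f = x" "cod f = y"
  obtains u where "arr u" "dom u = d'" "cod u = d"
    "(y \<triangleright> u) \<ast> c' = (f \<triangleleft> d) \<ast> c" "e \<ast> (u \<triangleleft> x) = e' \<ast> (d' \<triangleright> f)"
proof -
  note [simp] = is_dualD(1-6)[OF X] is_dualD(1-6)[OF Y] f
  let ?w = "(f \<triangleleft> d) \<ast> c"
  let ?u = "(e' \<triangleleft> d) \<ast> (d' \<triangleright> ?w)"
  show ?thesis
  proof (rule that[of ?u])
    have 1: "((y @ d') \<triangleright> ?w) \<ast> c' = (c' \<triangleleft> (y @ d)) \<ast> ?w"
      using exchange[of c' ?w] by (simp add: idn_Nil_tens tens_idn_Nil)
    have "(y \<triangleright> ?u) \<ast> c' = (y \<triangleright> e' \<triangleleft> d) \<ast> (((y @ d') \<triangleright> ?w) \<ast> c')"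
      by (simp add: whisker_simps)
    also have "\<dots> = (((y \<triangleright> e') \<ast> (c' \<triangleleft> y)) \<triangleleft> d) \<ast> ?w"
      unfolding 1 by (simp add: whisker_simps)
    also have "\<dots> = ?w"
      by (simp add: is_dualD(7)[OF Y] whisker_simps)
    finally show "(y \<triangleright> ?u) \<ast> c' = ?w" .
    have 2: "e \<ast> (e' \<triangleleft> (d @ x)) = e' \<ast> ((d' @ y) \<triangleright> e)"
      using exchange[of e' e] by (simp add: idn_Nil_tens tens_idn_Nil)
    have 3: "(y \<triangleright> e) \<ast> (f \<triangleleft> (d @ x)) = f \<ast> (x \<triangleright> e)"
      using exchange[of f e] by (simp add: tens_idn_Nil)
    have "e \<ast> (?u \<triangleleft> x) = (e \<ast> (e' \<triangleleft> (d @ x))) \<ast> (d' \<triangleright> ?w \<triangleleft> x)"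
      by (simp add: whisker_simps)
    also have "\<dots> = e' \<ast> (d' \<triangleright> (((y \<triangleright> e) \<ast> (f \<triangleleft> (d @ x))) \<ast> (c \<triangleleft> x)))"
      unfolding 2 by (simp add: whisker_simps)
    also have "\<dots> = e' \<ast> (d' \<triangleright> (f \<ast> ((x \<triangleright> e) \<ast> (c \<triangleleft> x))))"
      unfolding 3 by (simp add: whisker_simps)
    also have "\<dots> = e' \<ast> (d' \<triangleright> f)"
      by (simp add: is_dualD(7)[OF X] whisker_simps)
    finally show "e \<ast> (?u \<triangleleft> x) = e' \<ast> (d' \<triangleright> f)" .
  qed simp_all
qed

text \<open>The cap of \<open>x\<close> is nested inside the cap of \<open>y\<close>, which reverses
  the order of the duals. After the disjoint arrows are exchanged, each zigzag of the product falls
  apart into the zigzags of the factors.\<close>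

lemma is_dual_append:
  assumes X: "is_dual x d e c" and Y: "is_dual y d' e' c'"
  shows "is_dual (x @ y) (d' @ d) (e' \<ast> (d' \<triangleright> e \<triangleleft> y)) ((x \<triangleright> c' \<triangleleft> d) \<ast> c)"
  unfolding is_dual_def
proof (intro conjI)
  note [simp] = is_dualD(1-6)[OF X] is_dualD(1-6)[OF Y]
  have 1: "((x @ y @ d') \<triangleright> e) \<ast> (x \<triangleright> c' \<triangleleft> (d @ x)) = (x \<triangleright> c') \<ast> (x \<triangleright> e)"
    using arg_cong[OF exchange[of c' e], where f = "\<lambda>t. x \<triangleright> t"] by (simp add: whisker_simps)
  have "((x @ y) \<triangleright> (e' \<ast> (d' \<triangleright> e \<triangleleft> y))) \<ast> (((x \<triangleright> c' \<triangleleft> d) \<ast> c) \<triangleleft> (x @ y))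
      = ((x @ y) \<triangleright> e') \<ast> ((((x @ y @ d') \<triangleright> e) \<ast> (x \<triangleright> c' \<triangleleft> (d @ x))) \<triangleleft> y) \<ast> (c \<triangleleft> (x @ y))"
    by (simp add: whisker_simps)
  also have "\<dots> = (x \<triangleright> ((y \<triangleright> e') \<ast> (c' \<triangleleft> y))) \<ast> (((x \<triangleright> e) \<ast> (c \<triangleleft> x)) \<triangleleft> y)"
    unfolding 1 by (simp add: whisker_simps)
  also have "\<dots> = idn (x @ y)"
    by (simp add: is_dualD(7)[OF Y] is_dualD(7)[OF X] whisker_simps)
  finally show "((x @ y) \<triangleright> (e' \<ast> (d' \<triangleright> e \<triangleleft> y))) \<ast> (((x \<triangleright> c' \<triangleleft> d) \<ast> c) \<triangleleft> (x @ y)) = idn (x @ y)" .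
  have 2: "(d' \<triangleright> e \<triangleleft> (y @ d')) \<ast> ((d' @ d @ x) \<triangleright> c') = (d' \<triangleright> c') \<ast> (d' \<triangleright> e)"
    using arg_cong[OF exchange[of e c'], where f = "\<lambda>t. d' \<triangleright> t"] by (simp add: whisker_simps)
  have "((e' \<ast> (d' \<triangleright> e \<triangleleft> y)) \<triangleleft> (d' @ d)) \<ast> ((d' @ d) \<triangleright> ((x \<triangleright> c' \<triangleleft> d) \<ast> c))
      = (e' \<triangleleft> (d' @ d)) \<ast> ((((d' \<triangleright> e \<triangleleft> (y @ d')) \<ast> ((d' @ d @ x) \<triangleright> c')) \<triangleleft> d)) \<ast> ((d' @ d) \<triangleright> c)"
    by (simp add: whisker_simps)
  also have "\<dots> = (((e' \<triangleleft> d') \<ast> (d' \<triangleright> c')) \<triangleleft> d) \<ast> (d' \<triangleright> ((e \<triangleleft> d) \<ast> (d \<triangleright> c)))"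
    unfolding 2 by (simp add: whisker_simps)
  also have "\<dots> = idn (d' @ d)"
    by (simp add: is_dualD(8)[OF Y] is_dualD(8)[OF X] whisker_simps)
  finally show "((e' \<ast> (d' \<triangleright> e \<triangleleft> y)) \<triangleleft> (d' @ d)) \<ast> ((d' @ d) \<triangleright> ((x \<triangleright> c' \<triangleleft> d) \<ast> c)) = idn (d' @ d)" .
qed (simp_all add: is_dualD(1-6)[OF X] is_dualD(1-6)[OF Y])

text \<open>The two round trips of the duality adjunction between arrows \<open>d @ a -> b\<close>
  and \<open>a -> z @ b\<close>; each becomes a zigzag after one exchange.\<close>

lemma dual_adjunction:
  assumes Z: "is_dual z d e c"
  shows "\<lbrakk>arr f; dom f = d @ a; cod f = b\<rbrakk> \<Longrightarrow> (e \<triangleleft> b) \<ast> (d \<triangleright> ((z \<triangleright> f) \<ast> (c \<triangleleft> a))) = f"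
    "\<lbrakk>arr g; dom g = a; cod g = z @ b\<rbrakk> \<Longrightarrow> (z \<triangleright> ((e \<triangleleft> b) \<ast> (d \<triangleright> g))) \<ast> (c \<triangleleft> a) = g"
proof -
  note [simp] = is_dualD(1-6)[OF Z]
  show "(e \<triangleleft> b) \<ast> (d \<triangleright> ((z \<triangleright> f) \<ast> (c \<triangleleft> a))) = f"
    if f [simp]: "arr f" "dom f = d @ a" "cod f = b"
  proof -
    have 1: "(e \<triangleleft> b) \<ast> ((d @ z) \<triangleright> f) = f \<ast> (e \<triangleleft> (d @ a))"
      using exchange[of e f] by (simp add: whisker_simps)
    have "(e \<triangleleft> b) \<ast> (d \<triangleright> ((z \<triangleright> f) \<ast> (c \<triangleleft> a))) = ((e \<triangleleft> b) \<ast> ((d @ z) \<triangleright> f)) \<ast> (d \<triangleright> c \<triangleleft> a)"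
      by (simp add: whisker_simps)
    also have "\<dots> = f \<ast> (((e \<triangleleft> d) \<ast> (d \<triangleright> c)) \<triangleleft> a)"
      unfolding 1 by (simp add: whisker_simps)
    finally show ?thesis
      by (simp add: is_dualD(8)[OF Z] whisker_simps)
  qed
  show "(z \<triangleright> ((e \<triangleleft> b) \<ast> (d \<triangleright> g))) \<ast> (c \<triangleleft> a) = g"
    if g [simp]: "arr g" "dom g = a" "cod g = z @ b"
  proof -
    have 1: "((z @ d) \<triangleright> g) \<ast> (c \<triangleleft> a) = (c \<triangleleft> (z @ b)) \<ast> g"
      using exchange[of c g] by (simp add: whisker_simps)
    have "(z \<triangleright> ((e \<triangleleft> b) \<ast> (d \<triangleright> g))) \<ast> (c \<triangleleft> a) = (z \<triangleright> e \<triangleleft> b) \<ast> (((z @ d) \<triangleright> g) \<ast> (c \<triangleleft> a))"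
      by (simp add: whisker_simps)
    also have "\<dots> = (((z \<triangleright> e) \<ast> (c \<triangleleft> z)) \<triangleleft> b) \<ast> g"
      unfolding 1 by (simp add: whisker_simps)
    finally show ?thesis
      by (simp add: is_dualD(7)[OF Z] whisker_simps)
  qed
qed

end

locale strict_ribbon = strict_monoidal arr dom cod idn comp tens smul
  for arr :: "'a \<Rightarrow> bool" and dom cod :: "'a \<Rightarrow> 'w list"
    and idn :: "'w list \<Rightarrow> 'a"
    and comp :: "'a \<Rightarrow> 'a \<Rightarrow> 'a"  (infixr "\<ast>" 70)
    and tens :: "'a \<Rightarrow> 'a \<Rightarrow> 'a"  (infixr "\<boxtimes>" 75)
    and smul :: "'k \<Rightarrow> 'a \<Rightarrow> 'a" +
  fixes br :: "'w list \<Rightarrow> 'w list \<Rightarrow> 'a" and tw :: "'w list \<Rightarrow> 'a"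
  assumes arr_br [simp]: "arr (br x y)" "dom (br x y) = x @ y" "cod (br x y) = y @ x"
    and br_inv: "\<exists>b. arr b \<and> dom b = y @ x \<and> cod b = x @ y
      \<and> b \<ast> br x y = idn (x @ y) \<and> br x y \<ast> b = idn (y @ x)"
    and br_natural: "\<lbrakk>arr f; arr g; dom f = x; cod f = x'; dom g = y; cod g = y'\<rbrakk>
      \<Longrightarrow> br x' y' \<ast> (f \<boxtimes> g) = (g \<boxtimes> f) \<ast> br x y"
    and br_append_right: "br x (y @ z) = (idn y \<boxtimes> br x z) \<ast> (br x y \<boxtimes> idn z)"
    and br_append_left: "br (x @ y) z = (br x z \<boxtimes> idn y) \<ast> (idn x \<boxtimes> br y z)"
    and arr_tw [simp]: "arr (tw x)" "dom (tw x) = x" "cod (tw x) = x"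
    and tw_natural: "\<lbrakk>arr f; dom f = x; cod f = y\<rbrakk> \<Longrightarrow> tw y \<ast> f = f \<ast> tw x"
    and tw_append: "tw (x @ y) = br y x \<ast> br x y \<ast> (tw x \<boxtimes> tw y)"
begin

text \<open>An invertible idempotent is an identity. This yields the unit law of the braiding: by
  the hexagon for two empty words, \<open>br x []\<close> is its own square.\<close>

lemma br_idem_imp_idn:
  assumes "br x y \<ast> br x y = br x y" "x @ y = y @ x"
  shows "br x y = idn (x @ y)"
proof -
  obtain b where b: "arr b" "dom b = y @ x" "cod b = x @ y" "b \<ast> br x y = idn (x @ y)"
    using br_inv by blast
  have "br x y = idn (x @ y) \<ast> br x y"
    using assms(2) by (intro idn_comp[symmetric]) simp_all
  also have "\<dots> = b \<ast> (br x y \<ast> br x y)"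
    unfolding b(4)[symmetric] using b(1-3) assms(2) by (intro comp_assoc) simp_all
  finally show ?thesis unfolding assms(1) b(4) .
qed

lemma br_Nil_right: "br x [] = idn x"
  using br_idem_imp_idn[of x "[]"] br_append_right[of x "[]" "[]"]
  by (simp add: idn_Nil_tens tens_idn_Nil)

lemma br_natural_left:
  "\<lbrakk>arr f; dom f = x; cod f = x'\<rbrakk> \<Longrightarrow> br x' y \<ast> (f \<triangleleft> y) = (y \<triangleright> f) \<ast> br x y"
  by (rule br_natural) simp_all

lemma br_natural_right:
  "\<lbrakk>arr g; dom g = y; cod g = y'\<rbrakk> \<Longrightarrow> br x y' \<ast> (x \<triangleright> g) = (g \<triangleleft> x) \<ast> br x y"
  by (rule br_natural) simp_all

text \<open>The closing of a right strand: with it, \<open>trc\<close> and \<open>ptr\<close> are the quantum trace and the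
  right partial trace.\<close>

definition cl :: "'w list \<Rightarrow> 'w list \<Rightarrow> 'a \<Rightarrow> 'a" where
  "cl x d e = e \<ast> br x d \<ast> (tw x \<triangleleft> d)"

definition trc :: "'w list \<Rightarrow> 'w list \<Rightarrow> 'a \<Rightarrow> 'a \<Rightarrow> 'a \<Rightarrow> 'a" where
  "trc x d e c f = cl x d e \<ast> (f \<triangleleft> d) \<ast> c"

definition ptr :: "'w list \<Rightarrow> 'w list \<Rightarrow> 'w list \<Rightarrow> 'a \<Rightarrow> 'a \<Rightarrow> 'a \<Rightarrow> 'a" where
  "ptr b z d e c K = (b \<triangleright> cl z d e) \<ast> (K \<triangleleft> d) \<ast> (b \<triangleright> c)"

text \<open>\<open>f\<close> travels once around the loop: through the coevaluation as its transpose
  \<open>u\<close>, along the braiding by naturality, back through the evaluation as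
  \<open>f\<close>, and past the twist. The duals of \<open>x\<close> and \<open>y\<close> are
  arbitrary, so the case \<open>x = y\<close> also compares two choices of dual.\<close>

lemma trc_cyclic:
  assumes X: "is_dual x d e c" and Y: "is_dual y d' e' c'"
    and f: "arr f" "dom f = x" "cod f = y" and g: "arr g" "dom g = y" "cod g = x"
  shows "trc x d e c (g \<ast> f) = trc y d' e' c' (f \<ast> g)"
proof -
  note [simp] = is_dualD(1-6)[OF X] is_dualD(1-6)[OF Y] f g
  obtain u where u [simp]: "arr u" "dom u = d'" "cod u = d"
    and u1: "(y \<triangleright> u) \<ast> c' = (f \<triangleleft> d) \<ast> c" and u2: "e \<ast> (u \<triangleleft> x) = e' \<ast> (d' \<triangleright> f)"
    using transpose_exists[OF X Y f] .
  have "trc x d e c (g \<ast> f) = e \<ast> br x d \<ast> ((tw x \<ast> g) \<triangleleft> d) \<ast> ((f \<triangleleft> d) \<ast> c)"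
    unfolding trc_def cl_def by (simp add: whisker_simps)
  also have "\<dots> = e \<ast> br x d \<ast> (((tw x \<ast> g) \<triangleleft> d) \<ast> (y \<triangleright> u)) \<ast> c'"
    unfolding u1[symmetric] by (simp add: whisker_simps)
  also have "((tw x \<ast> g) \<triangleleft> d) \<ast> (y \<triangleright> u) = (x \<triangleright> u) \<ast> ((tw x \<ast> g) \<triangleleft> d')"
    by (rule exchange[symmetric]) simp_all
  also have "e \<ast> br x d \<ast> ((x \<triangleright> u) \<ast> ((tw x \<ast> g) \<triangleleft> d')) \<ast> c'
      = e \<ast> (br x d \<ast> (x \<triangleright> u)) \<ast> ((tw x \<ast> g) \<triangleleft> d') \<ast> c'"
    by (simp add: whisker_simps)
  also have "br x d \<ast> (x \<triangleright> u) = (u \<triangleleft> x) \<ast> br x d'"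
    by (rule br_natural_right) simp_all
  also have "e \<ast> ((u \<triangleleft> x) \<ast> br x d') \<ast> ((tw x \<ast> g) \<triangleleft> d') \<ast> c'
      = (e \<ast> (u \<triangleleft> x)) \<ast> br x d' \<ast> ((tw x \<ast> g) \<triangleleft> d') \<ast> c'"
    by (simp add: whisker_simps)
  also have "\<dots> = e' \<ast> ((d' \<triangleright> f) \<ast> br x d') \<ast> ((tw x \<ast> g) \<triangleleft> d') \<ast> c'"
    unfolding u2 by (simp add: whisker_simps)
  also have "(d' \<triangleright> f) \<ast> br x d' = br y d' \<ast> (f \<triangleleft> d')"
    by (rule br_natural_left[symmetric]) simp_all
  also have "e' \<ast> (br y d' \<ast> (f \<triangleleft> d')) \<ast> ((tw x \<ast> g) \<triangleleft> d') \<ast> c'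
      = e' \<ast> br y d' \<ast> (((f \<ast> tw x) \<ast> g) \<triangleleft> d') \<ast> c'"
    by (simp add: whisker_simps)
  also have "f \<ast> tw x = tw y \<ast> f"
    by (rule tw_natural[symmetric]) simp_all
  also have "e' \<ast> br y d' \<ast> (((tw y \<ast> f) \<ast> g) \<triangleleft> d') \<ast> c' = trc y d' e' c' (f \<ast> g)"
    unfolding trc_def cl_def by (simp add: whisker_simps)
  finally show ?thesis .
qed

text \<open>The twist of a product contains a full double braiding of \<open>x\<close> and
  \<open>y\<close>. Together with the braidings of the strands with their duals it comes apart:
  \<open>YB\<close> is a Yang-Baxter move that brings one crossing of \<open>x\<close> and
  \<open>y\<close> next to each cap, and \<open>slideE\<close> and \<open>slideF\<close> pull the
  other strand off that cap.\<close>

lemma cl_append: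
  assumes X: "is_dual x d e c" and Y: "is_dual y d' e' c'"
  shows "cl (x @ y) (d' @ d) (e' \<ast> (d' \<triangleright> e \<triangleleft> y)) = cl x d e \<ast> (x \<triangleright> cl y d' e' \<triangleleft> d)"
proof -
  note [simp] = is_dualD(1-6)[OF X] is_dualD(1-6)[OF Y]
  let ?E = "e \<ast> br x d" and ?F = "e' \<ast> br y d'"
  \<comment> \<open>\<open>?E\<close> ends in the empty word, and braiding with the empty word is an
    identity, so naturality lets a strand pass across \<open>?E\<close>.\<close>
  have slideE: "(?E \<triangleleft> y) \<ast> (x \<triangleright> br y d) \<ast> (br y x \<triangleleft> d) = y \<triangleright> ?E"
    using br_natural_right[of ?E "x @ d" "[]" y]
    by (simp add: br_append_right br_Nil_right whisker_simps)
  have slideF: "(?F \<triangleleft> x) \<ast> (y \<triangleright> br x d') \<ast> (br x y \<triangleleft> d') = x \<triangleright> ?F"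
    using br_natural_right[of ?F "y @ d'" "[]" x]
    by (simp add: br_append_right br_Nil_right whisker_simps)
  have YB: "(br x d' \<triangleleft> y) \<ast> (x \<triangleright> br y d') \<ast> (br y x \<triangleleft> d')
      = (d' \<triangleright> br y x) \<ast> (br y d' \<triangleleft> x) \<ast> (y \<triangleright> br x d')"
    using br_natural_left[of "br y x" "y @ x" "x @ y" d']
    by (simp add: br_append_left whisker_simps)
  have "cl (x @ y) (d' @ d) (e' \<ast> (d' \<triangleright> e \<triangleleft> y))
      = e' \<ast> (d' \<triangleright> ((?E \<triangleleft> y) \<ast> (x \<triangleright> br y d)))
        \<ast> (((br x d' \<triangleleft> y) \<ast> (x \<triangleright> br y d') \<ast> (br y x \<triangleleft> d')) \<triangleleft> d)
        \<ast> (br x y \<triangleleft> (d' @ d)) \<ast> ((tw x \<boxtimes> tw y) \<triangleleft> (d' @ d))"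
    unfolding cl_def tw_append br_append_right br_append_left by (simp add: whisker_simps)
  also have "\<dots> = e' \<ast> (d' \<triangleright> ((?E \<triangleleft> y) \<ast> (x \<triangleright> br y d) \<ast> (br y x \<triangleleft> d)))
        \<ast> (br y d' \<triangleleft> (x @ d)) \<ast> (y \<triangleright> br x d' \<triangleleft> d)
        \<ast> (br x y \<triangleleft> (d' @ d)) \<ast> ((tw x \<boxtimes> tw y) \<triangleleft> (d' @ d))"
    unfolding YB by (simp add: whisker_simps)
  also have "\<dots> = (e' \<ast> ((d' @ y) \<triangleright> ?E)) \<ast> (br y d' \<triangleleft> (x @ d)) \<ast> (y \<triangleright> br x d' \<triangleleft> d)
        \<ast> (br x y \<triangleleft> (d' @ d)) \<ast> ((tw x \<boxtimes> tw y) \<triangleleft> (d' @ d))"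
    unfolding slideE by (simp add: whisker_simps)
  also have "e' \<ast> ((d' @ y) \<triangleright> ?E) = ?E \<ast> (e' \<triangleleft> (x @ d))"
    using exchange[of e' ?E] by (simp add: whisker_simps)
  also have "(?E \<ast> (e' \<triangleleft> (x @ d))) \<ast> (br y d' \<triangleleft> (x @ d)) \<ast> (y \<triangleright> br x d' \<triangleleft> d)
        \<ast> (br x y \<triangleleft> (d' @ d)) \<ast> ((tw x \<boxtimes> tw y) \<triangleleft> (d' @ d))
      = ?E \<ast> (((?F \<triangleleft> x) \<ast> (y \<triangleright> br x d') \<ast> (br x y \<triangleleft> d')) \<triangleleft> d) \<ast> ((tw x \<boxtimes> tw y) \<triangleleft> (d' @ d))"
    by (simp add: whisker_simps)
  also have "\<dots> = ?E \<ast> (x \<triangleright> ?F \<triangleleft> d) \<ast> ((tw x \<boxtimes> tw y) \<triangleleft> (d' @ d))"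
    unfolding slideF by (simp add: whisker_simps)
  also have "tw x \<boxtimes> tw y = (tw x \<triangleleft> y) \<ast> (x \<triangleright> tw y)"
    using interchange[of "idn x" "tw x" "tw y" "idn y"] by (simp add: whisker_simps)
  also have "?E \<ast> (x \<triangleright> ?F \<triangleleft> d) \<ast> (((tw x \<triangleleft> y) \<ast> (x \<triangleright> tw y)) \<triangleleft> (d' @ d))
      = ?E \<ast> (((x \<triangleright> ?F) \<ast> (tw x \<triangleleft> (y @ d'))) \<triangleleft> d) \<ast> (x \<triangleright> tw y \<triangleleft> (d' @ d))"
    by (simp add: whisker_simps)
  also have "(x \<triangleright> ?F) \<ast> (tw x \<triangleleft> (y @ d')) = tw x \<ast> (x \<triangleright> ?F)"
    using exchange[of "tw x" ?F] by (simp add: whisker_simps)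
  also have "?E \<ast> ((tw x \<ast> (x \<triangleright> ?F)) \<triangleleft> d) \<ast> (x \<triangleright> tw y \<triangleleft> (d' @ d))
      = cl x d e \<ast> (x \<triangleright> cl y d' e' \<triangleleft> d)"
    unfolding cl_def by (simp add: whisker_simps)
  finally show ?thesis .
qed

lemma trc_append:
  assumes X: "is_dual x d e c" and Y: "is_dual y d' e' c'"
    and K: "arr K" "dom K = x @ y" "cod K = x @ y"
  shows "trc (x @ y) (d' @ d) (e' \<ast> (d' \<triangleright> e \<triangleleft> y)) ((x \<triangleright> c' \<triangleleft> d) \<ast> c) K
    = trc x d e c (ptr x y d' e' c' K)"
proof -
  note [simp] = is_dualD(1-6)[OF X] is_dualD(1-6)[OF Y] K
  have [simp]: "arr (cl x d e)" "dom (cl x d e) = x @ d" "cod (cl x d e) = []"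
    "arr (cl y d' e')" "dom (cl y d' e') = y @ d'" "cod (cl y d' e') = []"
    unfolding cl_def by simp_all
  show ?thesis
    unfolding trc_def cl_append[OF X Y] ptr_def by (simp add: whisker_simps)
qed

lemma trc_smul:
  assumes "is_dual x d e c" "arr f" "dom f = x" "cod f = x"
  shows "trc x d e c (smul a f) = smul a (trc x d e c f)"
  using is_dualD(1-6)[OF assms(1)] assms(2-)
  unfolding trc_def cl_def by (simp add: smul_comp_left smul_comp_right smul_tens_left)

abbreviation db :: "'w list \<Rightarrow> 'w list \<Rightarrow> 'a" where "db x y \<equiv> br y x \<ast> br x y"

text \<open>\<open>H\<close> does not involve the strand \<open>z\<close> and can be moved out of
  the loop; what remains inside is the partial trace of \<open>G\<close>.\<close>

lemma ptr_slide:
  assumes Z: "is_dual z d e c" and H: "arr H" "dom H = y @ x" "cod H = y @ x"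
    and G: "arr G" "dom G = x @ z" "cod G = x @ z" and a: "ptr x z d e c G = smul a (idn x)"
  shows "ptr (y @ x) z d e c ((H \<triangleleft> z) \<ast> (y \<triangleright> G)) = smul a H"
proof -
  note [simp] = is_dualD(1-6)[OF Z] H G
  have [simp]: "arr (cl z d e)" "dom (cl z d e) = z @ d" "cod (cl z d e) = []"
    unfolding cl_def by simp_all
  have 1: "((y @ x) \<triangleright> cl z d e) \<ast> (H \<triangleleft> (z @ d)) = H \<ast> ((y @ x) \<triangleright> cl z d e)"
    using exchange[of H "cl z d e"] by (simp add: whisker_simps)
  have "ptr (y @ x) z d e c ((H \<triangleleft> z) \<ast> (y \<triangleright> G))
      = (((y @ x) \<triangleright> cl z d e) \<ast> (H \<triangleleft> (z @ d))) \<ast> (y \<triangleright> G \<triangleleft> d) \<ast> ((y @ x) \<triangleright> c)"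
    unfolding ptr_def by (simp add: whisker_simps)
  also have "\<dots> = H \<ast> (y \<triangleright> ptr x z d e c G)"
    unfolding 1 ptr_def by (simp add: whisker_simps)
  also have "\<dots> = smul a H"
    unfolding a by (simp add: smul_tens_right smul_comp_right whisker_simps)
  finally show ?thesis .
qed

text \<open>\<open>a\<close> is the partial trace over \<open>z\<close> of the double braiding of
  \<open>x\<close> and \<open>z\<close>, a scalar by Schur's lemma. It is the same in both
  equations; eliminating it makes the trace of \<open>db x\<close>, divided by the dimension of
  \<open>x\<close>, multiplicative in its second argument.\<close>

lemma trc_db_append:
  assumes X: "is_dual x dx ex cx" and Y: "is_dual y dy ey cy" and Z: "is_dual z dz ez cz"
    and XZ: "is_dual (x @ z) d1 e1 c1" and YX: "is_dual (y @ x) d2 e2 c2"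
    and XYZ: "is_dual (x @ y @ z) d3 e3 c3"
    and simple: "\<And>f. \<lbrakk>arr f; dom f = x; cod f = x\<rbrakk> \<Longrightarrow> \<exists>a. f = smul a (idn x)"
  obtains a where "trc (x @ z) d1 e1 c1 (db x z) = smul a (trc x dx ex cx (idn x))"
    "trc (x @ y @ z) d3 e3 c3 (db x (y @ z)) = smul a (trc (y @ x) d2 e2 c2 (db y x))"
proof -
  note [simp] = is_dualD(1-6)[OF X] is_dualD(1-6)[OF Y] is_dualD(1-6)[OF Z]
    is_dualD(1-6)[OF XZ] is_dualD(1-6)[OF YX] is_dualD(1-6)[OF XYZ]
  have [simp]: "arr (ptr x z dz ez cz (db x z))" "dom (ptr x z dz ez cz (db x z)) = x"
    "cod (ptr x z dz ez cz (db x z)) = x"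
    unfolding ptr_def cl_def by simp_all
  obtain a where a: "ptr x z dz ez cz (db x z) = smul a (idn x)"
    using simple[of "ptr x z dz ez cz (db x z)"] by auto
  \<comment> \<open>Independence of the chosen dual: cyclicity with an identity as the second
    map.\<close>
  have indep: "trc w d e c f = trc w d' e' c' f"
    if "is_dual w d e c" "is_dual w d' e' c'" "arr f" "dom f = w" "cod f = w" for w d e c d' e' c' f
    using trc_cyclic[OF that(1,2,3,4,5), of "idn w"] that by (simp add: comp_idn idn_comp)
  show ?thesis
  proof (rule that[of a])
    have "trc (x @ z) d1 e1 c1 (db x z) = trc x dx ex cx (ptr x z dz ez cz (db x z))"
      using trc_append[OF X Z] indep[OF XZ is_dual_append[OF X Z]] by simp
    then show "trc (x @ z) d1 e1 c1 (db x z) = smul a (trc x dx ex cx (idn x))"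
      unfolding a using trc_smul[OF X] by simp
    have YXZ: "is_dual ((y @ x) @ z) (dz @ d2) (ez \<ast> (dz \<triangleright> e2 \<triangleleft> z)) (((y @ x) \<triangleright> cz \<triangleleft> d2) \<ast> c2)"
      by (rule is_dual_append[OF YX Z])
    \<comment> \<open>The strand \<open>y\<close> separates \<open>x\<close> from \<open>z\<close>.
      Moving \<open>?f\<close> cyclically to the other end reorders the strands to \<open>y\<close>,
      \<open>x\<close>, \<open>z\<close>, so that the partial trace over \<open>z\<close> meets only
      \<open>db x z\<close>.\<close>
    let ?f = "br x y \<triangleleft> z" and ?g = "(br y x \<triangleleft> z) \<ast> (y \<triangleright> db x z)"
    have 1: "db x (y @ z) = ?g \<ast> ?f"
      by (simp add: br_append_left br_append_right whisker_simps)
    have 2: "?f \<ast> ?g = (db y x \<triangleleft> z) \<ast> (y \<triangleright> db x z)"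
      by (simp add: whisker_simps)
    have "trc (x @ y @ z) d3 e3 c3 (db x (y @ z)) = trc ((y @ x) @ z) (dz @ d2)
        (ez \<ast> (dz \<triangleright> e2 \<triangleleft> z)) (((y @ x) \<triangleright> cz \<triangleleft> d2) \<ast> c2) (?f \<ast> ?g)"
      unfolding 1 by (rule trc_cyclic[OF XYZ YXZ]) simp_all
    also have "\<dots> = trc (y @ x) d2 e2 c2 (ptr (y @ x) z dz ez cz ((db y x \<triangleleft> z) \<ast> (y \<triangleright> db x z)))"
      unfolding 2 by (rule trc_append[OF YX Z]) simp_all
    also have "\<dots> = smul a (trc (y @ x) d2 e2 c2 (db y x))"
      using ptr_slide[OF Z _ _ _ _ _ _ a, of "db y x" y] trc_smul[OF YX] by simp
    finally show "trc (x @ y @ z) d3 e3 c3 (db x (y @ z)) = smul a (trc (y @ x) d2 e2 c2 (db y x))" .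
  qed
qed

text \<open>The double braiding of \<open>x\<close> with \<open>z\<close> sits inside that of
  \<open>x\<close> with \<open>y\<close>; once the inner one is a scalar, the two halves of the
  outer one meet.\<close>

lemma db_append_smul:
  assumes "db x y = smul a (idn (x @ y))" "db x z = smul b (idn (x @ z))"
  shows "db x (y @ z) = smul b (smul a (idn (x @ y @ z)))"
proof -
  have "db x (y @ z) = (br y x \<triangleleft> z) \<ast> (y \<triangleright> db x z) \<ast> (br x y \<triangleleft> z)"
    by (simp add: br_append_left br_append_right whisker_simps)
  also have "\<dots> = smul b (db x y \<triangleleft> z)"
    unfolding assms(2) by (simp add: smul_tens_right smul_comp_left smul_comp_right whisker_simps)
  also have "\<dots> = smul b (smul a (idn (x @ y @ z)))"
    unfolding assms(1) by (simp add: smul_tens_left whisker_simps)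
  finally show ?thesis .
qed

end

section \<open>Coherence and strictification\<close>

text \<open>The non-strict counterpart of \<open>strict_monoidal\<close>. Inverses of the
  constraints are part of the data, so that coherence statements are plain equations between
  composites.\<close>

locale monoidal_arrows =
  fixes arr :: "'a \<Rightarrow> bool" and dom cod :: "'a \<Rightarrow> 'o"
    and idn :: "'o \<Rightarrow> 'a"
    and comp :: "'a \<Rightarrow> 'a \<Rightarrow> 'a"  (infixr "\<ast>" 70)
    and ot :: "'o \<Rightarrow> 'o \<Rightarrow> 'o"  (infixr "\<star>" 75)
    and unit :: 'o
    and tens :: "'a \<Rightarrow> 'a \<Rightarrow> 'a"  (infixr "\<boxtimes>" 75)
    and asc asc' :: "'o \<Rightarrow> 'o \<Rightarrow> 'o \<Rightarrow> 'a"
    and lu lu' ru ru' :: "'o \<Rightarrow> 'a"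
    and smul :: "'k \<Rightarrow> 'a \<Rightarrow> 'a"
  assumes arr_idn [simp]: "arr (idn x)" "dom (idn x) = x" "cod (idn x) = x"
    and arr_comp [simp]: "\<lbrakk>arr f; arr g; cod f = dom g\<rbrakk> \<Longrightarrow> arr (g \<ast> f)"
    and dom_comp [simp]: "dom (g \<ast> f) = dom f" "cod (g \<ast> f) = cod g"
    and arr_tens [simp]: "\<lbrakk>arr f; arr g\<rbrakk> \<Longrightarrow> arr (f \<boxtimes> g)"
    and dom_tens [simp]: "dom (f \<boxtimes> g) = dom f \<star> dom g" "cod (f \<boxtimes> g) = cod f \<star> cod g"
    and arr_smul [simp]: "arr f \<Longrightarrow> arr (smul a f)"
    and dom_smul [simp]: "dom (smul a f) = dom f" "cod (smul a f) = cod f"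
    and comp_assoc: "\<lbrakk>arr f; arr g; arr h; cod f = dom g; cod g = dom h\<rbrakk>
      \<Longrightarrow> (h \<ast> g) \<ast> f = h \<ast> (g \<ast> f)"
    and comp_idn: "\<lbrakk>arr f; dom f = x\<rbrakk> \<Longrightarrow> f \<ast> idn x = f"
    and idn_comp: "\<lbrakk>arr f; cod f = x\<rbrakk> \<Longrightarrow> idn x \<ast> f = f"
    and tens_idn: "idn x \<boxtimes> idn y = idn (x \<star> y)"
    and interchange: "\<lbrakk>arr f; arr f'; arr g; arr g'; cod f = dom f'; cod g = dom g'\<rbrakk>
      \<Longrightarrow> (f' \<ast> f) \<boxtimes> (g' \<ast> g) = (f' \<boxtimes> g') \<ast> (f \<boxtimes> g)"
    and smul_comp_left: "\<lbrakk>arr f; arr g; cod f = dom g\<rbrakk> \<Longrightarrow> smul a g \<ast> f = smul a (g \<ast> f)"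
    and smul_comp_right: "\<lbrakk>arr f; arr g; cod f = dom g\<rbrakk> \<Longrightarrow> g \<ast> smul a f = smul a (g \<ast> f)"
    and smul_tens_left: "\<lbrakk>arr f; arr g\<rbrakk> \<Longrightarrow> smul a f \<boxtimes> g = smul a (f \<boxtimes> g)"
    and smul_tens_right: "\<lbrakk>arr f; arr g\<rbrakk> \<Longrightarrow> f \<boxtimes> smul a g = smul a (f \<boxtimes> g)"
    and arr_asc [simp]: "arr (asc x y z)" "dom (asc x y z) = (x \<star> y) \<star> z" "cod (asc x y z) = x \<star> (y \<star> z)"
    and arr_asc' [simp]: "arr (asc' x y z)" "cod (asc' x y z) = (x \<star> y) \<star> z" "dom (asc' x y z) = x \<star> (y \<star> z)"
    and asc_inv: "asc x y z \<ast> asc' x y z = idn (x \<star> (y \<star> z))" "asc' x y z \<ast> asc x y z = idn ((x \<star> y) \<star> z)"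
    and asc_natural: "\<lbrakk>arr f; arr g; arr h; dom f = x; cod f = x'; dom g = y; cod g = y'; dom h = z; cod h = z'\<rbrakk>
      \<Longrightarrow> asc x' y' z' \<ast> ((f \<boxtimes> g) \<boxtimes> h) = (f \<boxtimes> (g \<boxtimes> h)) \<ast> asc x y z"
    and arr_lu [simp]: "arr (lu x)" "dom (lu x) = unit \<star> x" "cod (lu x) = x"
    and arr_lu' [simp]: "arr (lu' x)" "cod (lu' x) = unit \<star> x" "dom (lu' x) = x"
    and lu_inv: "lu x \<ast> lu' x = idn x" "lu' x \<ast> lu x = idn (unit \<star> x)"
    and lu_natural: "\<lbrakk>arr f; dom f = x; cod f = y\<rbrakk> \<Longrightarrow> lu y \<ast> (idn unit \<boxtimes> f) = f \<ast> lu x"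
    and arr_ru [simp]: "arr (ru x)" "dom (ru x) = x \<star> unit" "cod (ru x) = x"
    and arr_ru' [simp]: "arr (ru' x)" "cod (ru' x) = x \<star> unit" "dom (ru' x) = x"
    and ru_inv: "ru x \<ast> ru' x = idn x" "ru' x \<ast> ru x = idn (x \<star> unit)"
    and ru_natural: "\<lbrakk>arr f; dom f = x; cod f = y\<rbrakk> \<Longrightarrow> ru y \<ast> (f \<boxtimes> idn unit) = f \<ast> ru x"
    and pentagon: "(idn w \<boxtimes> asc x y z) \<ast> asc w (x \<star> y) z \<ast> (asc w x y \<boxtimes> idn z)
      = asc w x (y \<star> z) \<ast> asc (w \<star> x) y z"
    and triangle: "(idn x \<boxtimes> lu y) \<ast> asc x unit y = ru x \<boxtimes> idn y"
begin

lemma lw_comp: "\<lbrakk>arr f; arr g; cod f = dom g\<rbrakk> \<Longrightarrow> idn x \<boxtimes> (g \<ast> f) = (idn x \<boxtimes> g) \<ast> (idn x \<boxtimes> f)"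
  using interchange[of "idn x" "idn x" f g] by (simp add: comp_idn)

lemma rw_comp: "\<lbrakk>arr f; arr g; cod f = dom g\<rbrakk> \<Longrightarrow> (g \<ast> f) \<boxtimes> idn x = (g \<boxtimes> idn x) \<ast> (f \<boxtimes> idn x)"
  using interchange[of f g "idn x" "idn x"] by (simp add: comp_idn)

definition inv_pair :: "'a \<Rightarrow> 'a \<Rightarrow> bool" where
  "inv_pair f g \<longleftrightarrow> arr f \<and> arr g \<and> dom g = cod f \<and> cod g = dom f
     \<and> g \<ast> f = idn (dom f) \<and> f \<ast> g = idn (cod f)"

lemma inv_pairD:
  assumes "inv_pair f g"
  shows "arr f" "arr g" "dom g = cod f" "cod g = dom f" "g \<ast> f = idn (dom f)" "f \<ast> g = idn (cod f)"
  using assms unfolding inv_pair_def by auto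

lemma inv_pair_idn: "inv_pair (idn x) (idn x)"
  unfolding inv_pair_def by (simp add: comp_idn)

lemma inv_pair_sym: "inv_pair f g \<Longrightarrow> inv_pair g f"
  unfolding inv_pair_def by auto

lemma inv_pair_comp_cancel:
  assumes "inv_pair f g"
  shows "\<lbrakk>arr h; cod h = dom f\<rbrakk> \<Longrightarrow> g \<ast> (f \<ast> h) = h" "\<lbrakk>arr h; cod h = cod f\<rbrakk> \<Longrightarrow> f \<ast> (g \<ast> h) = h"
proof -
  note [simp] = inv_pairD(1-4)[OF assms]
  show "g \<ast> (f \<ast> h) = h" if "arr h" "cod h = dom f"
    using that comp_assoc[of h f g] inv_pairD(5)[OF assms] by (simp add: idn_comp)
  show "f \<ast> (g \<ast> h) = h" if "arr h" "cod h = cod f"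
    using that comp_assoc[of h g f] inv_pairD(6)[OF assms] by (simp add: idn_comp)
qed

lemma inv_pair_comp:
  assumes f: "inv_pair f f'" and g: "inv_pair g g'" and fg: "cod f = dom g"
  shows "inv_pair (g \<ast> f) (f' \<ast> g')"
  unfolding inv_pair_def
  using inv_pairD[OF f] inv_pairD[OF g] fg inv_pair_comp_cancel[OF f] inv_pair_comp_cancel[OF g]
  by (simp add: comp_assoc)

lemma inv_pair_tens:
  assumes f: "inv_pair f f'" and g: "inv_pair g g'"
  shows "inv_pair (f \<boxtimes> g) (f' \<boxtimes> g')"
  unfolding inv_pair_def
  using inv_pairD[OF f] inv_pairD[OF g] by (simp add: tens_idn flip: interchange)

lemma inv_pair_unique:
  assumes f: "inv_pair f g" and f': "inv_pair f g'"
  shows "g = g'"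
  using inv_pair_comp_cancel(1)[OF f, of g'] inv_pairD[OF f] inv_pairD[OF f'] by (simp add: comp_idn)

lemma inv_pair_constraints: "inv_pair (asc x y z) (asc' x y z)" "inv_pair (lu x) (lu' x)" "inv_pair (ru x) (ru' x)"
  unfolding inv_pair_def by (simp_all add: asc_inv lu_inv ru_inv)

lemma iso_cancel_right:
  assumes "inv_pair f g" "a \<ast> f = b \<ast> f" "arr a" "arr b" "dom a = cod f" "dom b = cod f"
  shows "a = b"
proof -
  note f = inv_pairD[OF assms(1)]
  have "(c \<ast> f) \<ast> g = c" if c: "arr c" "dom c = cod f" for c
  proof -
    have "(c \<ast> f) \<ast> g = c \<ast> (f \<ast> g)"
      by (rule comp_assoc) (simp_all add: c f)
    then show ?thesis
      by (simp add: f(6) comp_idn c)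
  qed
  from this[OF assms(3,5)] this[OF assms(4,6)] show ?thesis
    unfolding assms(2) by (rule trans[OF sym])
qed

lemma iso_cancel_left:
  assumes "inv_pair f g" "f \<ast> a = f \<ast> b" "arr a" "arr b" "cod a = dom f" "cod b = dom f"
  shows "a = b"
  using inv_pair_comp_cancel(1)[OF assms(1,3,5)] inv_pair_comp_cancel(1)[OF assms(1,4,6)]
  unfolding assms(2) by (rule trans[OF sym])

text \<open>By \<open>lu\<close>, tensoring with the unit is naturally isomorphic to the identity.
  An auxiliary unit can thus be introduced and cancelled again in the coherence proofs
  below.\<close>

lemma unit_tens_faithful:
  assumes "idn unit \<boxtimes> f = idn unit \<boxtimes> g" "arr f" "arr g" "dom f = dom g" "cod f = cod g"
  shows "f = g"
proof (rule iso_cancel_right[OF inv_pair_constraints(2)])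
  show "f \<ast> lu (dom g) = g \<ast> lu (dom g)"
    unfolding lu_natural[OF assms(2,4,5), symmetric] lu_natural[OF assms(3) refl refl, symmetric]
      assms(1) ..
qed (simp_all add: assms)

lemma tens_unit_faithful:
  assumes "f \<boxtimes> idn unit = g \<boxtimes> idn unit" "arr f" "arr g" "dom f = dom g" "cod f = cod g"
  shows "f = g"
proof (rule iso_cancel_right[OF inv_pair_constraints(3)])
  show "f \<ast> ru (dom g) = g \<ast> ru (dom g)"
    unfolding ru_natural[OF assms(2,4,5), symmetric] ru_natural[OF assms(3) refl refl, symmetric]
      assms(1) ..
qed (simp_all add: assms)

text \<open>Kelly's argument: with a further unit on the left, the pentagon and two instances of
  \<open>triangle\<close> give the identity, and \<open>unit_tens_faithful\<close> removes that
  unit.\<close>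

lemma lu_asc: "lu (y \<star> z) \<ast> asc unit y z = lu y \<boxtimes> idn z"
proof (rule unit_tens_faithful)
  let ?X = unit
  let ?i = "asc ?X (unit \<star> y) z \<ast> (asc ?X unit y \<boxtimes> idn z)"
  let ?j = "(asc' ?X unit y \<boxtimes> idn z) \<ast> asc' ?X (unit \<star> y) z"
  have i: "inv_pair ?i ?j"
    by (intro inv_pair_comp inv_pair_tens inv_pair_constraints inv_pair_idn) simp
  have "(idn ?X \<boxtimes> (lu (y \<star> z) \<ast> asc unit y z)) \<ast> ?i
      = (idn ?X \<boxtimes> lu (y \<star> z)) \<ast> ((idn ?X \<boxtimes> asc unit y z) \<ast> ?i)"
    by (simp add: lw_comp comp_assoc)
  also have "\<dots> = ((idn ?X \<boxtimes> lu (y \<star> z)) \<ast> asc ?X unit (y \<star> z)) \<ast> asc (?X \<star> unit) y z"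
    unfolding pentagon by (simp add: comp_assoc)
  also have "\<dots> = (ru ?X \<boxtimes> (idn y \<boxtimes> idn z)) \<ast> asc (?X \<star> unit) y z"
    unfolding triangle tens_idn by simp
  also have "\<dots> = asc ?X y z \<ast> ((ru ?X \<boxtimes> idn y) \<boxtimes> idn z)"
    by (rule asc_natural[symmetric]) simp_all
  also have "\<dots> = (asc ?X y z \<ast> ((idn ?X \<boxtimes> lu y) \<boxtimes> idn z)) \<ast> (asc ?X unit y \<boxtimes> idn z)"
    unfolding triangle[symmetric] by (simp add: rw_comp comp_assoc)
  also have "asc ?X y z \<ast> ((idn ?X \<boxtimes> lu y) \<boxtimes> idn z) = (idn ?X \<boxtimes> (lu y \<boxtimes> idn z)) \<ast> asc ?X (unit \<star> y) z"
    by (rule asc_natural) simp_all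
  finally have "(idn ?X \<boxtimes> (lu (y \<star> z) \<ast> asc unit y z)) \<ast> ?i = (idn ?X \<boxtimes> (lu y \<boxtimes> idn z)) \<ast> ?i"
    by (simp add: comp_assoc)
  then show "idn unit \<boxtimes> (lu (y \<star> z) \<ast> asc unit y z) = idn unit \<boxtimes> (lu y \<boxtimes> idn z)"
    by (rule iso_cancel_right[OF i]) simp_all
qed simp_all

lemma ru_asc: "(idn x \<boxtimes> ru y) \<ast> asc x y unit = ru (x \<star> y)"
proof (rule tens_unit_faithful)
  let ?Z = unit
  have "asc x y ?Z \<ast> (((idn x \<boxtimes> ru y) \<ast> asc x y unit) \<boxtimes> idn ?Z)
      = (asc x y ?Z \<ast> ((idn x \<boxtimes> ru y) \<boxtimes> idn ?Z)) \<ast> (asc x y unit \<boxtimes> idn ?Z)"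
    by (simp add: rw_comp comp_assoc)
  also have "asc x y ?Z \<ast> ((idn x \<boxtimes> ru y) \<boxtimes> idn ?Z) = (idn x \<boxtimes> (ru y \<boxtimes> idn ?Z)) \<ast> asc x (y \<star> unit) ?Z"
    by (rule asc_natural) simp_all
  also have "((idn x \<boxtimes> (ru y \<boxtimes> idn ?Z)) \<ast> asc x (y \<star> unit) ?Z) \<ast> (asc x y unit \<boxtimes> idn ?Z)
      = (idn x \<boxtimes> (idn y \<boxtimes> lu ?Z)) \<ast> ((idn x \<boxtimes> asc y unit ?Z) \<ast> asc x (y \<star> unit) ?Z \<ast> (asc x y unit \<boxtimes> idn ?Z))"
    unfolding triangle[symmetric] by (simp add: lw_comp comp_assoc)
  also have "\<dots> = ((idn x \<boxtimes> (idn y \<boxtimes> lu ?Z)) \<ast> asc x y (unit \<star> ?Z)) \<ast> asc (x \<star> y) unit ?Z"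
    unfolding pentagon by (simp add: comp_assoc)
  also have "(idn x \<boxtimes> (idn y \<boxtimes> lu ?Z)) \<ast> asc x y (unit \<star> ?Z) = asc x y ?Z \<ast> ((idn x \<boxtimes> idn y) \<boxtimes> lu ?Z)"
    by (rule asc_natural[symmetric]) simp_all
  also have "(asc x y ?Z \<ast> ((idn x \<boxtimes> idn y) \<boxtimes> lu ?Z)) \<ast> asc (x \<star> y) unit ?Z
      = asc x y ?Z \<ast> ((idn (x \<star> y) \<boxtimes> lu ?Z) \<ast> asc (x \<star> y) unit ?Z)"
    by (simp add: tens_idn comp_assoc)
  also have "\<dots> = asc x y ?Z \<ast> (ru (x \<star> y) \<boxtimes> idn ?Z)"
    unfolding triangle ..
  finally show "((idn x \<boxtimes> ru y) \<ast> asc x y unit) \<boxtimes> idn unit = ru (x \<star> y) \<boxtimes> idn unit"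
    by (rule iso_cancel_left[OF inv_pair_constraints(1)]) simp_all
qed simp_all

text \<open>Naturality of \<open>lu\<close> at \<open>lu unit\<close> gives
  \<open>lu (unit \<star> unit) = idn unit \<boxtimes> lu unit\<close>, after which
  \<open>lu_asc\<close> and \<open>triangle\<close> have the same left-hand side.\<close>

lemma lu_unit: "lu unit = ru unit"
proof (rule tens_unit_faithful)
  have "lu unit \<ast> lu (unit \<star> unit) = lu unit \<ast> (idn unit \<boxtimes> lu unit)"
    by (rule lu_natural[symmetric]) simp_all
  then have "lu (unit \<star> unit) = idn unit \<boxtimes> lu unit"
    by (rule iso_cancel_left[OF inv_pair_constraints(2)]) simp_all
  then show "lu unit \<boxtimes> idn unit = ru unit \<boxtimes> idn unit"
    using lu_asc[of unit unit] triangle[of unit unit] by simp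
qed simp_all

text \<open>The final unit is kept even for one-letter words, which spares a case distinction. Hence
  \<open>word [x]\<close> is only isomorphic to \<open>x\<close>, by \<open>ru x\<close>; this is
  where the many \<open>ru\<close> and \<open>ru'\<close> on words come from.\<close>

fun word :: "'o list \<Rightarrow> 'o" where
  "word [] = unit"
| "word (x # xs) = x \<star> word xs"

text \<open>The canonical rebracketing of two adjacent words into one. With its inverse
  \<open>jn'\<close> it carries all the rebracketing in the strict tensor product.\<close>

fun jn :: "'o list \<Rightarrow> 'o list \<Rightarrow> 'a" where
  "jn [] ys = lu (word ys)"
| "jn (x # xs) ys = (idn x \<boxtimes> jn xs ys) \<ast> asc x (word xs) (word ys)"

fun jn' :: "'o list \<Rightarrow> 'o list \<Rightarrow> 'a" where
  "jn' [] ys = lu' (word ys)"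
| "jn' (x # xs) ys = asc' x (word xs) (word ys) \<ast> (idn x \<boxtimes> jn' xs ys)"

lemma inv_pair_jn: "inv_pair (jn xs ys) (jn' xs ys) \<and> dom (jn xs ys) = word xs \<star> word ys \<and> cod (jn xs ys) = word (xs @ ys)"
proof (induction xs)
  case Nil
  show ?case by (simp add: inv_pair_constraints)
next
  case (Cons x xs)
  then show ?case
    by (auto intro!: inv_pair_comp inv_pair_tens inv_pair_constraints inv_pair_idn)
qed

lemma arr_jn [simp]:
  "arr (jn xs ys)" "dom (jn xs ys) = word xs \<star> word ys" "cod (jn xs ys) = word (xs @ ys)"
  "arr (jn' xs ys)" "cod (jn' xs ys) = word xs \<star> word ys" "dom (jn' xs ys) = word (xs @ ys)"
  using inv_pair_jn[of xs ys] unfolding inv_pair_def by auto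

lemma jn_Nil_right: "jn xs [] = ru (word xs)"
proof (induction xs)
  case (Cons x xs)
  show ?case by (simp add: Cons ru_asc)
qed (simp add: lu_unit)

text \<open>The coherence behind associativity of \<open>stens\<close>. The induction consumes one
  pentagon per letter of \<open>xs\<close>; the empty word is \<open>lu_asc\<close>.\<close>

lemma jn_assoc:
  "jn (xs @ ys) zs \<ast> (jn xs ys \<boxtimes> idn (word zs))
    = jn xs (ys @ zs) \<ast> (idn (word xs) \<boxtimes> jn ys zs) \<ast> asc (word xs) (word ys) (word zs)"
proof (induction xs)
  case Nil
  have "jn ys zs \<ast> (lu (word ys) \<boxtimes> idn (word zs)) = (jn ys zs \<ast> lu (word ys \<star> word zs)) \<ast> asc unit (word ys) (word zs)"
    by (simp add: comp_assoc flip: lu_asc)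
  also have "jn ys zs \<ast> lu (word ys \<star> word zs) = lu (word (ys @ zs)) \<ast> (idn unit \<boxtimes> jn ys zs)"
    by (rule lu_natural[symmetric]) simp_all
  finally show ?case by (simp add: comp_assoc)
next
  case (Cons x xs)
  let ?X = "word xs" and ?Y = "word ys" and ?Z = "word zs"
  have "jn ((x # xs) @ ys) zs \<ast> (jn (x # xs) ys \<boxtimes> idn ?Z)
      = (idn x \<boxtimes> jn (xs @ ys) zs) \<ast> (asc x (word (xs @ ys)) ?Z \<ast> ((idn x \<boxtimes> jn xs ys) \<boxtimes> idn ?Z)) \<ast> (asc x ?X ?Y \<boxtimes> idn ?Z)"
    by (simp add: rw_comp comp_assoc)
  also have "asc x (word (xs @ ys)) ?Z \<ast> ((idn x \<boxtimes> jn xs ys) \<boxtimes> idn ?Z) = (idn x \<boxtimes> (jn xs ys \<boxtimes> idn ?Z)) \<ast> asc x (?X \<star> ?Y) ?Z"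
    by (rule asc_natural) simp_all
  also have "(idn x \<boxtimes> jn (xs @ ys) zs) \<ast> ((idn x \<boxtimes> (jn xs ys \<boxtimes> idn ?Z)) \<ast> asc x (?X \<star> ?Y) ?Z) \<ast> (asc x ?X ?Y \<boxtimes> idn ?Z)
      = (idn x \<boxtimes> (jn (xs @ ys) zs \<ast> (jn xs ys \<boxtimes> idn ?Z))) \<ast> asc x (?X \<star> ?Y) ?Z \<ast> (asc x ?X ?Y \<boxtimes> idn ?Z)"
    by (simp add: lw_comp comp_assoc)
  also have "\<dots> = (idn x \<boxtimes> (jn xs (ys @ zs) \<ast> (idn ?X \<boxtimes> jn ys zs)))
      \<ast> ((idn x \<boxtimes> asc ?X ?Y ?Z) \<ast> asc x (?X \<star> ?Y) ?Z \<ast> (asc x ?X ?Y \<boxtimes> idn ?Z))"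
    unfolding Cons by (simp add: lw_comp comp_assoc)
  also have "\<dots> = (idn x \<boxtimes> jn xs (ys @ zs)) \<ast> ((idn x \<boxtimes> (idn ?X \<boxtimes> jn ys zs)) \<ast> asc x ?X (?Y \<star> ?Z)) \<ast> asc (x \<star> ?X) ?Y ?Z"
    unfolding pentagon by (simp add: lw_comp comp_assoc)
  also have "(idn x \<boxtimes> (idn ?X \<boxtimes> jn ys zs)) \<ast> asc x ?X (?Y \<star> ?Z) = asc x ?X (word (ys @ zs)) \<ast> ((idn x \<boxtimes> idn ?X) \<boxtimes> jn ys zs)"
    by (rule asc_natural[symmetric]) simp_all
  finally show ?case by (simp add: comp_assoc tens_idn)
qed

lemma jn'_assoc:
  "(jn' xs ys \<boxtimes> idn (word zs)) \<ast> jn' (xs @ ys) zs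
    = asc' (word xs) (word ys) (word zs) \<ast> (idn (word xs) \<boxtimes> jn' ys zs) \<ast> jn' xs (ys @ zs)"
proof (rule inv_pair_unique)
  show "inv_pair (jn (xs @ ys) zs \<ast> (jn xs ys \<boxtimes> idn (word zs))) ((jn' xs ys \<boxtimes> idn (word zs)) \<ast> jn' (xs @ ys) zs)"
    using inv_pair_jn by (auto intro!: inv_pair_comp inv_pair_tens inv_pair_idn)
  have "inv_pair (jn xs (ys @ zs) \<ast> ((idn (word xs) \<boxtimes> jn ys zs) \<ast> asc (word xs) (word ys) (word zs)))
    ((asc' (word xs) (word ys) (word zs) \<ast> (idn (word xs) \<boxtimes> jn' ys zs)) \<ast> jn' xs (ys @ zs))"
    using inv_pair_jn by (intro inv_pair_comp inv_pair_tens inv_pair_idn inv_pair_constraints) auto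
  then show "inv_pair (jn (xs @ ys) zs \<ast> (jn xs ys \<boxtimes> idn (word zs)))
    (asc' (word xs) (word ys) (word zs) \<ast> (idn (word xs) \<boxtimes> jn' ys zs) \<ast> jn' xs (ys @ zs))"
    unfolding jn_assoc by (simp add: comp_assoc)
qed

end

section \<open>Strictification of a ribbon category\<close>

locale ribbon_arrows = monoidal_arrows arr dom cod idn comp ot unit tens asc asc' lu lu' ru ru' smul
  for arr :: "'a \<Rightarrow> bool" and dom cod :: "'a \<Rightarrow> 'o"
    and idn :: "'o \<Rightarrow> 'a"
    and comp :: "'a \<Rightarrow> 'a \<Rightarrow> 'a"  (infixr "\<ast>" 70)
    and ot :: "'o \<Rightarrow> 'o \<Rightarrow> 'o"  (infixr "\<star>" 75)
    and unit :: 'o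
    and tens :: "'a \<Rightarrow> 'a \<Rightarrow> 'a"  (infixr "\<boxtimes>" 75)
    and asc asc' :: "'o \<Rightarrow> 'o \<Rightarrow> 'o \<Rightarrow> 'a"
    and lu lu' ru ru' :: "'o \<Rightarrow> 'a"
    and smul :: "'k \<Rightarrow> 'a \<Rightarrow> 'a" +
  fixes br :: "'o \<Rightarrow> 'o \<Rightarrow> 'a" and tw :: "'o \<Rightarrow> 'a"
  assumes arr_br [simp]: "arr (br x y)" "dom (br x y) = x \<star> y" "cod (br x y) = y \<star> x"
    and br_inv: "\<exists>b. inv_pair (br x y) b"
    and br_natural: "\<lbrakk>arr f; arr g; dom f = x; cod f = x'; dom g = y; cod g = y'\<rbrakk>
      \<Longrightarrow> br x' y' \<ast> (f \<boxtimes> g) = (g \<boxtimes> f) \<ast> br x y"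
    and hexagon1: "asc y z x \<ast> br x (y \<star> z) \<ast> asc x y z
      = (idn y \<boxtimes> br x z) \<ast> asc y x z \<ast> (br x y \<boxtimes> idn z)"
    and hexagon2: "asc' z x y \<ast> br (x \<star> y) z \<ast> asc' x y z
      = (br x z \<boxtimes> idn y) \<ast> asc' x z y \<ast> (idn x \<boxtimes> br y z)"
    and arr_tw [simp]: "arr (tw x)" "dom (tw x) = x" "cod (tw x) = x"
    and tw_natural: "\<lbrakk>arr f; dom f = x; cod f = y\<rbrakk> \<Longrightarrow> tw y \<ast> f = f \<ast> tw x"
    and tw_tens: "tw (x \<star> y) = br y x \<ast> br x y \<ast> (tw x \<boxtimes> tw y)"
begin

text \<open>Strictification: a strict arrow between words is an arrow between their bracketed products.\<close>

definition smor :: "'o list \<times> 'a \<times> 'o list \<Rightarrow> 'a" where "smor F = fst (snd F)"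
definition sdom :: "'o list \<times> 'a \<times> 'o list \<Rightarrow> 'o list" where "sdom F = fst F"
definition scod :: "'o list \<times> 'a \<times> 'o list \<Rightarrow> 'o list" where "scod F = snd (snd F)"

definition sarr :: "'o list \<times> 'a \<times> 'o list \<Rightarrow> bool" where
  "sarr F \<longleftrightarrow> arr (smor F) \<and> dom (smor F) = word (sdom F) \<and> cod (smor F) = word (scod F)"

definition sidn :: "'o list \<Rightarrow> 'o list \<times> 'a \<times> 'o list" where
  "sidn xs = (xs, idn (word xs), xs)"

definition scomp :: "'o list \<times> 'a \<times> 'o list \<Rightarrow> 'o list \<times> 'a \<times> 'o list \<Rightarrow> 'o list \<times> 'a \<times> 'o list" where
  "scomp G F = (sdom F, smor G \<ast> smor F, scod G)"

definition stens :: "'o list \<times> 'a \<times> 'o list \<Rightarrow> 'o list \<times> 'a \<times> 'o list \<Rightarrow> 'o list \<times> 'a \<times> 'o list" where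
  "stens F G = (sdom F @ sdom G,
     jn (scod F) (scod G) \<ast> (smor F \<boxtimes> smor G) \<ast> jn' (sdom F) (sdom G), scod F @ scod G)"

definition ssmul :: "'k \<Rightarrow> 'o list \<times> 'a \<times> 'o list \<Rightarrow> 'o list \<times> 'a \<times> 'o list" where
  "ssmul a F = (sdom F, smul a (smor F), scod F)"

definition sbr :: "'o list \<Rightarrow> 'o list \<Rightarrow> 'o list \<times> 'a \<times> 'o list" where
  "sbr xs ys = (xs @ ys, jn ys xs \<ast> br (word xs) (word ys) \<ast> jn' xs ys, ys @ xs)"

definition stw :: "'o list \<Rightarrow> 'o list \<times> 'a \<times> 'o list" where
  "stw xs = (xs, tw (word xs), xs)"

lemmas s_defs = smor_def sdom_def scod_def sidn_def scomp_def stens_def ssmul_def sbr_def stw_def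

lemma s_simps [simp]:
  "smor (xs, f, ys) = f" "sdom (xs, f, ys) = xs" "scod (xs, f, ys) = ys"
  "smor (sidn xs) = idn (word xs)" "sdom (sidn xs) = xs" "scod (sidn xs) = xs"
  "smor (scomp G F) = smor G \<ast> smor F" "sdom (scomp G F) = sdom F" "scod (scomp G F) = scod G"
  "smor (stens F G) = jn (scod F) (scod G) \<ast> (smor F \<boxtimes> smor G) \<ast> jn' (sdom F) (sdom G)"
  "sdom (stens F G) = sdom F @ sdom G" "scod (stens F G) = scod F @ scod G"
  "smor (ssmul a F) = smul a (smor F)" "sdom (ssmul a F) = sdom F" "scod (ssmul a F) = scod F"
  "smor (sbr xs ys) = jn ys xs \<ast> br (word xs) (word ys) \<ast> jn' xs ys"
  "sdom (sbr xs ys) = xs @ ys" "scod (sbr xs ys) = ys @ xs"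
  "smor (stw xs) = tw (word xs)" "sdom (stw xs) = xs" "scod (stw xs) = xs"
  by (simp_all add: s_defs)

lemma s_eqI: "\<lbrakk>sdom F = sdom G; scod F = scod G; smor F = smor G\<rbrakk> \<Longrightarrow> F = G"
  by (cases F; cases G) simp

lemma sarrD: "sarr F \<Longrightarrow> arr (smor F)" "sarr F \<Longrightarrow> dom (smor F) = word (sdom F)"
  "sarr F \<Longrightarrow> cod (smor F) = word (scod F)"
  unfolding sarr_def by auto

lemma jn_inv_pair: "inv_pair (jn xs ys) (jn' xs ys)"
  using inv_pair_jn by blast

lemma jn_cancel:
  "jn xs ys \<ast> jn' xs ys = idn (word (xs @ ys))" "jn' xs ys \<ast> jn xs ys = idn (word xs \<star> word ys)"
  "\<lbrakk>arr h; cod h = word (xs @ ys)\<rbrakk> \<Longrightarrow> jn xs ys \<ast> jn' xs ys \<ast> h = h"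
  "\<lbrakk>arr h; cod h = word xs \<star> word ys\<rbrakk> \<Longrightarrow> jn' xs ys \<ast> jn xs ys \<ast> h = h"
  using inv_pairD(5,6)[OF jn_inv_pair[of xs ys]] inv_pair_comp_cancel[OF jn_inv_pair[of xs ys]] by simp_all

lemma asc_cancel:
  "\<lbrakk>arr h; cod h = x \<star> (y \<star> z)\<rbrakk> \<Longrightarrow> asc x y z \<ast> asc' x y z \<ast> h = h"
  "\<lbrakk>arr h; cod h = (x \<star> y) \<star> z\<rbrakk> \<Longrightarrow> asc' x y z \<ast> asc x y z \<ast> h = h"
  using inv_pair_comp_cancel[OF inv_pair_constraints(1)[of x y z]] by simp_all

lemma stens_assoc:
  assumes "sarr F" "sarr G" "sarr H"
  shows "stens (stens F G) H = stens F (stens G H)"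
proof (rule s_eqI)
  note [simp] = sarrD[OF assms(1)] sarrD[OF assms(2)] sarrD[OF assms(3)]
  let ?f = "smor F" and ?g = "smor G" and ?h = "smor H"
  let ?x = "sdom F" and ?y = "sdom G" and ?z = "sdom H"
  let ?x' = "scod F" and ?y' = "scod G" and ?z' = "scod H"
  have 1: "(jn ?x' ?y' \<ast> (?f \<boxtimes> ?g) \<ast> jn' ?x ?y) \<boxtimes> ?h
      = (jn ?x' ?y' \<boxtimes> idn (word ?z')) \<ast> ((?f \<boxtimes> ?g) \<boxtimes> ?h) \<ast> (jn' ?x ?y \<boxtimes> idn (word ?z))"
    by (simp add: comp_idn idn_comp flip: interchange)
  have 2: "?f \<boxtimes> (jn ?y' ?z' \<ast> (?g \<boxtimes> ?h) \<ast> jn' ?y ?z)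
      = (idn (word ?x') \<boxtimes> jn ?y' ?z') \<ast> (?f \<boxtimes> (?g \<boxtimes> ?h)) \<ast> (idn (word ?x) \<boxtimes> jn' ?y ?z)"
    by (simp add: comp_idn idn_comp flip: interchange)
  have "smor (stens (stens F G) H)
      = (jn (?x' @ ?y') ?z' \<ast> (jn ?x' ?y' \<boxtimes> idn (word ?z'))) \<ast> ((?f \<boxtimes> ?g) \<boxtimes> ?h)
        \<ast> ((jn' ?x ?y \<boxtimes> idn (word ?z)) \<ast> jn' (?x @ ?y) ?z)"
    by (simp add: 1 comp_assoc)
  also have "\<dots> = jn ?x' (?y' @ ?z') \<ast> (idn (word ?x') \<boxtimes> jn ?y' ?z')
        \<ast> (asc (word ?x') (word ?y') (word ?z') \<ast> ((?f \<boxtimes> ?g) \<boxtimes> ?h)) \<ast> asc' (word ?x) (word ?y) (word ?z)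
        \<ast> (idn (word ?x) \<boxtimes> jn' ?y ?z) \<ast> jn' ?x (?y @ ?z)"
    unfolding jn_assoc jn'_assoc by (simp add: comp_assoc)
  also have "asc (word ?x') (word ?y') (word ?z') \<ast> ((?f \<boxtimes> ?g) \<boxtimes> ?h)
      = (?f \<boxtimes> (?g \<boxtimes> ?h)) \<ast> asc (word ?x) (word ?y) (word ?z)"
    by (rule asc_natural) simp_all
  finally show "smor (stens (stens F G) H) = smor (stens F (stens G H))"
    by (simp add: 2 comp_assoc asc_cancel)
qed simp_all

text \<open>The hexagon with its associators hidden in the joins: between the two braidings all
  joins collapse to the middle associator (\<open>inner\<close>), and the outer two come from
  \<open>left\<close> and \<open>jn'_assoc\<close>.\<close>

lemma sbr_append_right: "sbr xs (ys @ zs) = scomp (stens (sidn ys) (sbr xs zs)) (stens (sbr xs ys) (sidn zs))"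
proof (rule s_eqI)
  let ?x = "word xs" and ?y = "word ys" and ?z = "word zs"
  have inner: "(idn ?y \<boxtimes> jn' xs zs) \<ast> jn' ys (xs @ zs) \<ast> jn (ys @ xs) zs \<ast> (jn ys xs \<boxtimes> idn ?z) = asc ?y ?x ?z"
  proof -
    have "(idn ?y \<boxtimes> jn' xs zs) \<ast> (idn ?y \<boxtimes> jn xs zs) = idn (?y \<star> (?x \<star> ?z))"
      by (simp add: jn_cancel tens_idn flip: lw_comp)
    then have "(idn ?y \<boxtimes> jn' xs zs) \<ast> (idn ?y \<boxtimes> jn xs zs) \<ast> asc ?y ?x ?z = asc ?y ?x ?z"
      by (simp add: idn_comp flip: comp_assoc)
    then show ?thesis
      unfolding jn_assoc by (simp add: jn_cancel)
  qed
  have left: "jn ys (zs @ xs) \<ast> (idn ?y \<boxtimes> jn zs xs) = jn (ys @ zs) xs \<ast> (jn ys zs \<boxtimes> idn ?x) \<ast> asc' ?y ?z ?x"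
  proof -
    have "(jn (ys @ zs) xs \<ast> (jn ys zs \<boxtimes> idn ?x)) \<ast> asc' ?y ?z ?x = jn ys (zs @ xs) \<ast> (idn ?y \<boxtimes> jn zs xs)"
      unfolding jn_assoc by (simp add: comp_assoc asc_inv comp_idn)
    then show ?thesis by (simp add: comp_assoc)
  qed
  have hex: "asc' ?y ?z ?x \<ast> ((idn ?y \<boxtimes> br ?x ?z) \<ast> asc ?y ?x ?z \<ast> (br ?x ?y \<boxtimes> idn ?z)) \<ast> asc' ?x ?y ?z = br ?x (?y \<star> ?z)"
    unfolding hexagon1[symmetric] by (simp add: comp_assoc asc_inv asc_cancel comp_idn)
  have "smor (scomp (stens (sidn ys) (sbr xs zs)) (stens (sbr xs ys) (sidn zs)))
      = (jn ys (zs @ xs) \<ast> (idn ?y \<boxtimes> jn zs xs)) \<ast> (idn ?y \<boxtimes> br ?x ?z)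
        \<ast> ((idn ?y \<boxtimes> jn' xs zs) \<ast> jn' ys (xs @ zs) \<ast> jn (ys @ xs) zs \<ast> (jn ys xs \<boxtimes> idn ?z))
        \<ast> (br ?x ?y \<boxtimes> idn ?z) \<ast> ((jn' xs ys \<boxtimes> idn ?z) \<ast> jn' (xs @ ys) zs)"
    by (simp add: comp_assoc lw_comp rw_comp)
  also have "\<dots> = jn (ys @ zs) xs \<ast> (jn ys zs \<boxtimes> idn ?x)
      \<ast> (asc' ?y ?z ?x \<ast> ((idn ?y \<boxtimes> br ?x ?z) \<ast> asc ?y ?x ?z \<ast> (br ?x ?y \<boxtimes> idn ?z)) \<ast> asc' ?x ?y ?z)
      \<ast> (idn ?x \<boxtimes> jn' ys zs) \<ast> jn' xs (ys @ zs)"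
    unfolding inner left jn'_assoc by (simp add: comp_assoc)
  also have "\<dots> = jn (ys @ zs) xs \<ast> ((jn ys zs \<boxtimes> idn ?x) \<ast> br ?x (?y \<star> ?z)) \<ast> (idn ?x \<boxtimes> jn' ys zs) \<ast> jn' xs (ys @ zs)"
    unfolding hex by (simp add: comp_assoc)
  also have "(jn ys zs \<boxtimes> idn ?x) \<ast> br ?x (?y \<star> ?z) = br ?x (word (ys @ zs)) \<ast> (idn ?x \<boxtimes> jn ys zs)"
    by (rule br_natural[symmetric]) simp_all
  also have "jn (ys @ zs) xs \<ast> (br ?x (word (ys @ zs)) \<ast> (idn ?x \<boxtimes> jn ys zs)) \<ast> (idn ?x \<boxtimes> jn' ys zs) \<ast> jn' xs (ys @ zs)
      = jn (ys @ zs) xs \<ast> br ?x (word (ys @ zs)) \<ast> (idn ?x \<boxtimes> (jn ys zs \<ast> jn' ys zs)) \<ast> jn' xs (ys @ zs)"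
    by (simp add: comp_assoc lw_comp)
  also have "\<dots> = smor (sbr xs (ys @ zs))"
    by (simp add: jn_cancel tens_idn idn_comp)
  finally show "smor (sbr xs (ys @ zs)) = smor (scomp (stens (sidn ys) (sbr xs zs)) (stens (sbr xs ys) (sidn zs)))"
    by simp
qed simp_all

lemma sbr_append_left: "sbr (xs @ ys) zs = scomp (stens (sbr xs zs) (sidn ys)) (stens (sidn xs) (sbr ys zs))"
proof (rule s_eqI)
  let ?x = "word xs" and ?y = "word ys" and ?z = "word zs"
  have inner: "(jn' xs zs \<boxtimes> idn ?y) \<ast> jn' (xs @ zs) ys \<ast> jn xs (zs @ ys) \<ast> (idn ?x \<boxtimes> jn zs ys) = asc' ?x ?z ?y"
  proof -
    have 1: "(idn ?x \<boxtimes> jn' zs ys) \<ast> (idn ?x \<boxtimes> jn zs ys) = idn (?x \<star> (?z \<star> ?y))"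
      by (simp add: jn_cancel tens_idn flip: lw_comp)
    have "((jn' xs zs \<boxtimes> idn ?y) \<ast> jn' (xs @ zs) ys) \<ast> jn xs (zs @ ys) \<ast> (idn ?x \<boxtimes> jn zs ys)
        = asc' ?x ?z ?y \<ast> ((idn ?x \<boxtimes> jn' zs ys) \<ast> (idn ?x \<boxtimes> jn zs ys))"
      unfolding jn'_assoc by (simp add: comp_assoc jn_cancel)
    then show ?thesis
      by (simp add: 1 comp_assoc comp_idn)
  qed
  have right: "(idn ?x \<boxtimes> jn' ys zs) \<ast> jn' xs (ys @ zs) = asc ?x ?y ?z \<ast> (jn' xs ys \<boxtimes> idn ?z) \<ast> jn' (xs @ ys) zs"
    unfolding jn'_assoc by (simp add: comp_assoc asc_cancel)
  have hex: "asc ?z ?x ?y \<ast> ((br ?x ?z \<boxtimes> idn ?y) \<ast> asc' ?x ?z ?y \<ast> (idn ?x \<boxtimes> br ?y ?z)) \<ast> asc ?x ?y ?z = br (?x \<star> ?y) ?z"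
    unfolding hexagon2[symmetric] by (simp add: comp_assoc asc_inv asc_cancel comp_idn)
  have "smor (scomp (stens (sbr xs zs) (sidn ys)) (stens (sidn xs) (sbr ys zs)))
      = (jn (zs @ xs) ys \<ast> (jn zs xs \<boxtimes> idn ?y)) \<ast> (br ?x ?z \<boxtimes> idn ?y)
        \<ast> ((jn' xs zs \<boxtimes> idn ?y) \<ast> jn' (xs @ zs) ys \<ast> jn xs (zs @ ys) \<ast> (idn ?x \<boxtimes> jn zs ys))
        \<ast> (idn ?x \<boxtimes> br ?y ?z) \<ast> ((idn ?x \<boxtimes> jn' ys zs) \<ast> jn' xs (ys @ zs))"
    by (simp add: comp_assoc lw_comp rw_comp)
  also have "\<dots> = jn zs (xs @ ys) \<ast> (idn ?z \<boxtimes> jn xs ys)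
      \<ast> (asc ?z ?x ?y \<ast> ((br ?x ?z \<boxtimes> idn ?y) \<ast> asc' ?x ?z ?y \<ast> (idn ?x \<boxtimes> br ?y ?z)) \<ast> asc ?x ?y ?z)
      \<ast> (jn' xs ys \<boxtimes> idn ?z) \<ast> jn' (xs @ ys) zs"
    unfolding inner right jn_assoc by (simp add: comp_assoc)
  also have "\<dots> = jn zs (xs @ ys) \<ast> ((idn ?z \<boxtimes> jn xs ys) \<ast> br (?x \<star> ?y) ?z) \<ast> (jn' xs ys \<boxtimes> idn ?z) \<ast> jn' (xs @ ys) zs"
    unfolding hex by (simp add: comp_assoc)
  also have "(idn ?z \<boxtimes> jn xs ys) \<ast> br (?x \<star> ?y) ?z = br (word (xs @ ys)) ?z \<ast> (jn xs ys \<boxtimes> idn ?z)"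
    by (rule br_natural[symmetric]) simp_all
  also have "jn zs (xs @ ys) \<ast> (br (word (xs @ ys)) ?z \<ast> (jn xs ys \<boxtimes> idn ?z)) \<ast> (jn' xs ys \<boxtimes> idn ?z) \<ast> jn' (xs @ ys) zs
      = jn zs (xs @ ys) \<ast> br (word (xs @ ys)) ?z \<ast> ((jn xs ys \<ast> jn' xs ys) \<boxtimes> idn ?z) \<ast> jn' (xs @ ys) zs"
    by (simp add: comp_assoc rw_comp)
  also have "\<dots> = smor (sbr (xs @ ys) zs)"
    by (simp add: jn_cancel tens_idn idn_comp)
  finally show "smor (sbr (xs @ ys) zs) = smor (scomp (stens (sbr xs zs) (sidn ys)) (stens (sidn xs) (sbr ys zs)))"
    by simp
qed simp_all

lemma sinterchange:
  assumes "sarr F" "sarr F'" "sarr G" "sarr G'" "scod F = sdom F'" "scod G = sdom G'"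
  shows "stens (scomp F' F) (scomp G' G) = scomp (stens F' G') (stens F G)"
proof (rule s_eqI)
  note [simp] = sarrD[OF assms(1)] sarrD[OF assms(2)] sarrD[OF assms(3)] sarrD[OF assms(4)] assms(5,6)
  show "smor (stens (scomp F' F) (scomp G' G)) = smor (scomp (stens F' G') (stens F G))"
    by (simp add: comp_assoc jn_cancel interchange)
qed simp_all

lemma sidn_Nil_stens:
  assumes "sarr F"
  shows "stens (sidn []) F = F" "stens F (sidn []) = F"
proof -
  note [simp] = sarrD[OF assms]
  have 1: "lu (word (scod F)) \<ast> (idn unit \<boxtimes> smor F) = smor F \<ast> lu (word (sdom F))"
    by (rule lu_natural) simp_all
  have "(lu (word (scod F)) \<ast> (idn unit \<boxtimes> smor F)) \<ast> lu' (word (sdom F)) = smor F"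
    unfolding 1 by (simp add: comp_assoc lu_inv comp_idn)
  then show "stens (sidn []) F = F"
    by (intro s_eqI) (simp_all add: comp_assoc)
  have 2: "ru (word (scod F)) \<ast> (smor F \<boxtimes> idn unit) = smor F \<ast> ru (word (sdom F))"
    by (rule ru_natural) simp_all
  have 3: "jn' (sdom F) [] = ru' (word (sdom F))"
    by (rule inv_pair_unique[OF jn_inv_pair]) (simp add: jn_Nil_right inv_pair_constraints)
  have "(ru (word (scod F)) \<ast> (smor F \<boxtimes> idn unit)) \<ast> ru' (word (sdom F)) = smor F"
    unfolding 2 by (simp add: comp_assoc ru_inv comp_idn)
  then show "stens F (sidn []) = F"
    by (intro s_eqI) (simp_all add: comp_assoc jn_Nil_right 3)
qed

lemma sbr_natural:
  assumes "sarr F" "sarr G"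
  shows "scomp (sbr (scod F) (scod G)) (stens F G) = scomp (stens G F) (sbr (sdom F) (sdom G))"
proof (rule s_eqI)
  note [simp] = sarrD[OF assms(1)] sarrD[OF assms(2)]
  let ?f = "smor F" and ?g = "smor G"
  have "(br (word (scod F)) (word (scod G)) \<ast> (?f \<boxtimes> ?g)) \<ast> jn' (sdom F) (sdom G)
      = ((?g \<boxtimes> ?f) \<ast> br (word (sdom F)) (word (sdom G))) \<ast> jn' (sdom F) (sdom G)"
    by (subst br_natural[of ?f ?g]) simp_all
  then show "smor (scomp (sbr (scod F) (scod G)) (stens F G)) = smor (scomp (stens G F) (sbr (sdom F) (sdom G)))"
    by (simp add: comp_assoc jn_cancel)
qed simp_all

lemma stw_append: "stw (xs @ ys) = scomp (sbr ys xs) (scomp (sbr xs ys) (stens (stw xs) (stw ys)))"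
proof (rule s_eqI)
  have "tw (word (xs @ ys)) = (tw (word (xs @ ys)) \<ast> jn xs ys) \<ast> jn' xs ys"
    by (simp add: comp_assoc jn_cancel comp_idn)
  also have "tw (word (xs @ ys)) \<ast> jn xs ys = jn xs ys \<ast> tw (word xs \<star> word ys)"
    by (rule tw_natural) simp_all
  finally show "smor (stw (xs @ ys)) = smor (scomp (sbr ys xs) (scomp (sbr xs ys) (stens (stw xs) (stw ys))))"
    by (simp add: tw_tens comp_assoc jn_cancel)
qed simp_all

sublocale strict: strict_ribbon sarr sdom scod sidn scomp stens ssmul sbr stw
proof
  show "\<exists>b. sarr b \<and> sdom b = y @ x \<and> scod b = x @ y \<and> scomp b (sbr x y) = sidn (x @ y) \<and> scomp (sbr x y) b = sidn (y @ x)" for x y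
  proof -
    obtain b where b: "inv_pair (br (word x) (word y)) b"
      using br_inv by blast
    have *: "inv_pair (jn y x \<ast> (br (word x) (word y) \<ast> jn' x y)) ((jn x y \<ast> b) \<ast> jn' y x)"
      using inv_pair_comp[OF inv_pair_comp[OF inv_pair_sym[OF jn_inv_pair] b] jn_inv_pair] by simp
    show ?thesis
      using inv_pairD[OF *]
      by (intro exI[of _ "(y @ x, (jn x y \<ast> b) \<ast> jn' y x, x @ y)"]) (auto simp: sarr_def intro!: s_eqI)
  qed
next
  show "\<lbrakk>sarr f; sarr g; sdom f = x; scod f = x'; sdom g = y; scod g = y'\<rbrakk>
      \<Longrightarrow> scomp (sbr x' y') (stens f g) = scomp (stens g f) (sbr x y)" for f g x x' y y'
    using sbr_natural[of f g] by simp
next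
  show "sarr f \<Longrightarrow> sarr g \<Longrightarrow> stens (ssmul a f) g = ssmul a (stens f g)" for f g a
    by (rule s_eqI) (simp_all add: sarrD smul_tens_left smul_comp_left smul_comp_right)
  show "sarr f \<Longrightarrow> sarr g \<Longrightarrow> stens f (ssmul a g) = ssmul a (stens f g)" for f g a
    by (rule s_eqI) (simp_all add: sarrD smul_tens_right smul_comp_left smul_comp_right)
qed (auto simp: sarr_def stens_assoc sbr_append_right sbr_append_left sidn_Nil_stens stw_append
    comp_assoc comp_idn idn_comp tens_idn jn_cancel sinterchange[unfolded sarr_def]
    smul_comp_left smul_comp_right tw_natural
    intro!: s_eqI)

end

section \<open>Duals and traces on words\<close>

context ribbon_arrows
begin

definition left_dual :: "'o \<Rightarrow> 'o \<Rightarrow> 'a \<Rightarrow> 'a \<Rightarrow> bool" where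
  "left_dual x d e c \<longleftrightarrow> arr e \<and> dom e = d \<star> x \<and> cod e = unit \<and> arr c \<and> dom c = unit \<and> cod c = x \<star> d
     \<and> ru x \<ast> (idn x \<boxtimes> e) \<ast> asc x d x \<ast> (c \<boxtimes> idn x) = lu x
     \<and> lu d \<ast> (e \<boxtimes> idn d) \<ast> asc' d x d \<ast> (idn d \<boxtimes> c) = ru d"

definition atr :: "'o \<Rightarrow> 'o \<Rightarrow> 'a \<Rightarrow> 'a \<Rightarrow> 'a \<Rightarrow> 'a" where
  "atr x d e c f = e \<ast> br x d \<ast> ((tw x \<ast> f) \<boxtimes> idn d) \<ast> c"

abbreviation db :: "'o \<Rightarrow> 'o \<Rightarrow> 'a" where "db x y \<equiv> br y x \<ast> br x y"

lemma left_dualD: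
  assumes "left_dual x d e c"
  shows "arr e" "dom e = d \<star> x" "cod e = unit" "arr c" "dom c = unit" "cod c = x \<star> d"
    "ru x \<ast> (idn x \<boxtimes> e) \<ast> asc x d x \<ast> (c \<boxtimes> idn x) = lu x"
    "lu d \<ast> (e \<boxtimes> idn d) \<ast> asc' d x d \<ast> (idn d \<boxtimes> c) = ru d"
  using assms unfolding left_dual_def by auto

lemma asc'_natural:
  assumes "arr f" "arr g" "arr h" "dom f = x" "cod f = x'" "dom g = y" "cod g = y'" "dom h = z" "cod h = z'"
  shows "asc' x' y' z' \<ast> (f \<boxtimes> (g \<boxtimes> h)) = ((f \<boxtimes> g) \<boxtimes> h) \<ast> asc' x y z"
proof (rule iso_cancel_left[OF inv_pair_constraints(1)])
  have "asc x' y' z' \<ast> ((f \<boxtimes> g) \<boxtimes> h) \<ast> asc' x y z = (asc x' y' z' \<ast> ((f \<boxtimes> g) \<boxtimes> h)) \<ast> asc' x y z"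
    using assms by (simp add: comp_assoc)
  also have "\<dots> = f \<boxtimes> (g \<boxtimes> h)"
    unfolding asc_natural[OF assms] using assms by (simp add: comp_assoc asc_inv comp_idn)
  finally show "asc x' y' z' \<ast> asc' x' y' z' \<ast> (f \<boxtimes> (g \<boxtimes> h)) = asc x' y' z' \<ast> ((f \<boxtimes> g) \<boxtimes> h) \<ast> asc' x y z"
    using assms by (simp add: asc_cancel)
qed (use assms in simp_all)

lemma unitor_cancel:
  "\<lbrakk>arr h; cod h = x\<rbrakk> \<Longrightarrow> lu x \<ast> lu' x \<ast> h = h" "\<lbrakk>arr h; cod h = unit \<star> x\<rbrakk> \<Longrightarrow> lu' x \<ast> lu x \<ast> h = h"
  "\<lbrakk>arr h; cod h = x\<rbrakk> \<Longrightarrow> ru x \<ast> ru' x \<ast> h = h" "\<lbrakk>arr h; cod h = x \<star> unit\<rbrakk> \<Longrightarrow> ru' x \<ast> ru x \<ast> h = h"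
  using inv_pair_comp_cancel[OF inv_pair_constraints(2)[of x]] inv_pair_comp_cancel[OF inv_pair_constraints(3)[of x]]
  by simp_all

lemma lu'_natural:
  assumes "arr f" "dom f = x" "cod f = y"
  shows "(idn unit \<boxtimes> f) \<ast> lu' x = lu' y \<ast> f"
proof (rule iso_cancel_left[OF inv_pair_constraints(2)])
  have "(lu y \<ast> (idn unit \<boxtimes> f)) \<ast> lu' x = f"
    unfolding lu_natural[OF assms] using assms by (simp add: comp_assoc lu_inv comp_idn)
  then show "lu y \<ast> (idn unit \<boxtimes> f) \<ast> lu' x = lu y \<ast> lu' y \<ast> f"
    using assms by (simp add: comp_assoc unitor_cancel)
qed (use assms in simp_all)

lemma ru'_natural:
  assumes "arr f" "dom f = x" "cod f = y"
  shows "(f \<boxtimes> idn unit) \<ast> ru' x = ru' y \<ast> f"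
proof (rule iso_cancel_left[OF inv_pair_constraints(3)])
  have "(ru y \<ast> (f \<boxtimes> idn unit)) \<ast> ru' x = f"
    unfolding ru_natural[OF assms] using assms by (simp add: comp_assoc ru_inv comp_idn)
  then show "ru y \<ast> (f \<boxtimes> idn unit) \<ast> ru' x = ru y \<ast> ru' y \<ast> f"
    using assms by (simp add: comp_assoc unitor_cancel)
qed (use assms in simp_all)

text \<open>Here \<open>k : x -> word xs\<close> is an isomorphism with inverse \<open>k'\<close>,
  and \<open>d\<close> is a dual of the object \<open>x\<close>. The dual of the whole word
  \<open>xs\<close> is the one-letter word \<open>[d]\<close>, not a word of duals of letters. This
  allows the chosen dual of a tensor product to be used as it stands.\<close>

definition word_ev :: "'o list \<Rightarrow> 'o \<Rightarrow> 'a \<Rightarrow> 'a \<Rightarrow> 'o list \<times> 'a \<times> 'o list" where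
  "word_ev xs d e k' = (d # xs, e \<ast> (ru d \<boxtimes> k') \<ast> jn' [d] xs, [])"

definition word_coev :: "'o list \<Rightarrow> 'o \<Rightarrow> 'a \<Rightarrow> 'a \<Rightarrow> 'o list \<times> 'a \<times> 'o list" where
  "word_coev xs d c k = ([], jn xs [d] \<ast> (k \<boxtimes> ru' d) \<ast> c, xs @ [d])"

text \<open>Between coevaluation and evaluation the joins collapse to a single associator
  (\<open>1\<close> and \<open>3\<close>). Past it \<open>k\<close> and \<open>ru' d\<close> slide
  by naturality and cancel, which leaves the zigzag identities of \<open>x\<close>, framed by unit
  constraints.\<close>

lemma is_dual_word:
  assumes X: "left_dual x d e c" and k: "inv_pair k k'" "dom k = x" "cod k = word xs"
  shows "strict.is_dual xs [d] (word_ev xs d e k') (word_coev xs d c k)"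
proof -
  let ?w = "word xs" and ?D = "word [d]"
  note [simp] = left_dualD(1-6)[OF X] k(2,3)
  have [simp]: "arr k" "arr k'" "dom k' = ?w" "cod k' = x"
    using inv_pairD[OF k(1)] by auto
  have kk [simp]: "k' \<ast> k = idn x" "k \<ast> k' = idn ?w"
    using inv_pairD[OF k(1)] by auto
  have D: "?D = d \<star> unit" by simp
  have 1: "(idn ?w \<boxtimes> jn' [d] xs) \<ast> jn' xs ([d] @ xs) \<ast> jn (xs @ [d]) xs \<ast> (jn xs [d] \<boxtimes> idn ?w) = asc ?w ?D ?w"
  proof -
    have "(idn ?w \<boxtimes> jn' [d] xs) \<ast> (idn ?w \<boxtimes> jn [d] xs) = idn (?w \<star> (?D \<star> ?w))"
      by (simp add: jn_cancel tens_idn del: jn.simps jn'.simps word.simps flip: lw_comp)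
    then have "(idn ?w \<boxtimes> jn' [d] xs) \<ast> (idn ?w \<boxtimes> jn [d] xs) \<ast> asc ?w ?D ?w = asc ?w ?D ?w"
      by (simp add: idn_comp del: jn.simps jn'.simps word.simps flip: comp_assoc)
    then show ?thesis
      unfolding jn_assoc by (simp add: jn_cancel del: jn.simps jn'.simps word.simps append_Cons)
  qed
  have nat1: "asc ?w ?D ?w \<ast> ((k \<boxtimes> ru' d) \<boxtimes> k) = (k \<boxtimes> (ru' d \<boxtimes> k)) \<ast> asc x d x"
    by (rule asc_natural) simp_all
  have "(idn ?w \<boxtimes> (e \<ast> (ru d \<boxtimes> k'))) \<ast> asc ?w ?D ?w \<ast> (((k \<boxtimes> ru' d) \<ast> c) \<boxtimes> (k \<ast> k'))
      = (idn ?w \<boxtimes> (e \<ast> (ru d \<boxtimes> k'))) \<ast> (asc ?w ?D ?w \<ast> ((k \<boxtimes> ru' d) \<boxtimes> k)) \<ast> (c \<boxtimes> k')"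
    by (subst interchange) (simp_all add: comp_assoc del: kk)
  also have "\<dots> = ((idn ?w \<boxtimes> (e \<ast> (ru d \<boxtimes> k'))) \<ast> (k \<boxtimes> (ru' d \<boxtimes> k))) \<ast> asc x d x \<ast> (c \<boxtimes> k')"
    unfolding nat1 by (simp add: comp_assoc)
  also have "(idn ?w \<boxtimes> (e \<ast> (ru d \<boxtimes> k'))) \<ast> (k \<boxtimes> (ru' d \<boxtimes> k)) = k \<boxtimes> e"
    by (simp add: idn_comp comp_idn comp_assoc ru_inv tens_idn flip: interchange)
  also have "k \<boxtimes> e = (k \<boxtimes> idn unit) \<ast> (idn x \<boxtimes> e)"
    by (simp add: comp_idn idn_comp flip: interchange)
  also have "c \<boxtimes> k' = (c \<boxtimes> idn x) \<ast> (idn unit \<boxtimes> k')"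
    by (simp add: comp_idn idn_comp flip: interchange)
  finally have 2: "(idn ?w \<boxtimes> (e \<ast> (ru d \<boxtimes> k'))) \<ast> asc ?w ?D ?w \<ast> (((k \<boxtimes> ru' d) \<ast> c) \<boxtimes> idn ?w)
      = (k \<boxtimes> idn unit) \<ast> (idn x \<boxtimes> e) \<ast> asc x d x \<ast> (c \<boxtimes> idn x) \<ast> (idn unit \<boxtimes> k')"
    by (simp add: comp_assoc)
  have "smor (scomp (stens (sidn xs) (word_ev xs d e k')) (stens (word_coev xs d c k) (sidn xs)))
      = jn xs [] \<ast> (idn ?w \<boxtimes> (e \<ast> (ru d \<boxtimes> k'))) \<ast> ((idn ?w \<boxtimes> jn' [d] xs) \<ast> jn' xs ([d] @ xs) \<ast> jn (xs @ [d]) xs \<ast> (jn xs [d] \<boxtimes> idn ?w))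
        \<ast> (((k \<boxtimes> ru' d) \<ast> c) \<boxtimes> idn ?w) \<ast> jn' [] xs"
    by (simp add: word_ev_def word_coev_def comp_assoc lw_comp rw_comp del: jn.simps jn'.simps)
  also have "\<dots> = jn xs [] \<ast> ((idn ?w \<boxtimes> (e \<ast> (ru d \<boxtimes> k'))) \<ast> asc ?w ?D ?w \<ast> (((k \<boxtimes> ru' d) \<ast> c) \<boxtimes> idn ?w)) \<ast> jn' [] xs"
    unfolding 1 by (simp add: comp_assoc del: jn.simps jn'.simps)
  also have "\<dots> = (ru ?w \<ast> (k \<boxtimes> idn unit)) \<ast> (idn x \<boxtimes> e) \<ast> asc x d x \<ast> (c \<boxtimes> idn x) \<ast> ((idn unit \<boxtimes> k') \<ast> lu' ?w)"
    unfolding 2 jn_Nil_right by (simp add: comp_assoc)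
  also have "ru ?w \<ast> (k \<boxtimes> idn unit) = k \<ast> ru x"
    by (rule ru_natural) simp_all
  also have "(idn unit \<boxtimes> k') \<ast> lu' ?w = lu' x \<ast> k'"
    by (rule lu'_natural) simp_all
  also have "(k \<ast> ru x) \<ast> (idn x \<boxtimes> e) \<ast> asc x d x \<ast> (c \<boxtimes> idn x) \<ast> (lu' x \<ast> k')
      = k \<ast> (ru x \<ast> (idn x \<boxtimes> e) \<ast> asc x d x \<ast> (c \<boxtimes> idn x)) \<ast> (lu' x \<ast> k')"
    by (simp add: comp_assoc)
  also have "\<dots> = idn ?w"
    unfolding left_dualD(7)[OF X] by (simp add: unitor_cancel)
  finally have Z1: "scomp (stens (sidn xs) (word_ev xs d e k')) (stens (word_coev xs d c k) (sidn xs)) = sidn xs"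
    by (intro s_eqI) (simp_all add: word_ev_def word_coev_def)
  have 3: "(jn' [d] xs \<boxtimes> idn ?D) \<ast> jn' ([d] @ xs) [d] \<ast> jn [d] (xs @ [d]) \<ast> (idn ?D \<boxtimes> jn xs [d]) = asc' ?D ?w ?D"
  proof -
    have c: "(idn ?D \<boxtimes> jn' xs [d]) \<ast> (idn ?D \<boxtimes> jn xs [d]) = idn (?D \<star> (?w \<star> ?D))"
      by (simp add: jn_cancel tens_idn del: jn.simps jn'.simps word.simps flip: lw_comp)
    have "((jn' [d] xs \<boxtimes> idn ?D) \<ast> jn' ([d] @ xs) [d]) \<ast> jn [d] (xs @ [d]) \<ast> (idn ?D \<boxtimes> jn xs [d])
        = asc' ?D ?w ?D \<ast> ((idn ?D \<boxtimes> jn' xs [d]) \<ast> (idn ?D \<boxtimes> jn xs [d]))"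
      unfolding jn'_assoc by (simp add: comp_assoc jn_cancel del: jn.simps jn'.simps word.simps)
    then show ?thesis
      unfolding c by (simp add: comp_assoc comp_idn del: jn.simps jn'.simps word.simps append_Cons)
  qed
  have nat2: "asc' ?D ?w ?D \<ast> (ru' d \<boxtimes> (k \<boxtimes> ru' d)) = ((ru' d \<boxtimes> k) \<boxtimes> ru' d) \<ast> asc' d x d"
    by (rule asc'_natural) simp_all
  have "((e \<ast> (ru d \<boxtimes> k')) \<boxtimes> idn ?D) \<ast> asc' ?D ?w ?D \<ast> ((ru' d \<ast> ru d) \<boxtimes> ((k \<boxtimes> ru' d) \<ast> c))
      = ((e \<ast> (ru d \<boxtimes> k')) \<boxtimes> idn ?D) \<ast> (asc' ?D ?w ?D \<ast> (ru' d \<boxtimes> (k \<boxtimes> ru' d))) \<ast> (ru d \<boxtimes> c)"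
    by (subst interchange) (simp_all add: comp_assoc)
  also have "\<dots> = (((e \<ast> (ru d \<boxtimes> k')) \<boxtimes> idn ?D) \<ast> ((ru' d \<boxtimes> k) \<boxtimes> ru' d)) \<ast> asc' d x d \<ast> (ru d \<boxtimes> c)"
    unfolding nat2 by (simp add: comp_assoc)
  also have "((e \<ast> (ru d \<boxtimes> k')) \<boxtimes> idn ?D) \<ast> ((ru' d \<boxtimes> k) \<boxtimes> ru' d) = e \<boxtimes> ru' d"
    by (simp add: idn_comp comp_idn comp_assoc ru_inv tens_idn flip: interchange)
  also have "e \<boxtimes> ru' d = (idn unit \<boxtimes> ru' d) \<ast> (e \<boxtimes> idn d)"
    by (simp add: comp_idn idn_comp flip: interchange)
  also have "ru d \<boxtimes> c = (idn d \<boxtimes> c) \<ast> (ru d \<boxtimes> idn unit)"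
    by (simp add: comp_idn idn_comp flip: interchange)
  finally have 4: "((e \<ast> (ru d \<boxtimes> k')) \<boxtimes> idn ?D) \<ast> asc' ?D ?w ?D \<ast> (idn ?D \<boxtimes> ((k \<boxtimes> ru' d) \<ast> c))
      = (idn unit \<boxtimes> ru' d) \<ast> (e \<boxtimes> idn d) \<ast> asc' d x d \<ast> (idn d \<boxtimes> c) \<ast> (ru d \<boxtimes> idn unit)"
    by (simp add: ru_inv comp_assoc)
  have jn'_Nil: "jn' [d] [] = ru' ?D"
    by (rule inv_pair_unique[OF jn_inv_pair]) (simp only: jn_Nil_right inv_pair_constraints)
  have "smor (scomp (stens (word_ev xs d e k') (sidn [d])) (stens (sidn [d]) (word_coev xs d c k)))
      = jn [] [d] \<ast> ((e \<ast> (ru d \<boxtimes> k')) \<boxtimes> idn ?D) \<ast> ((jn' [d] xs \<boxtimes> idn ?D) \<ast> jn' ([d] @ xs) [d] \<ast> jn [d] (xs @ [d]) \<ast> (idn ?D \<boxtimes> jn xs [d]))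
        \<ast> (idn ?D \<boxtimes> ((k \<boxtimes> ru' d) \<ast> c)) \<ast> jn' [d] []"
    by (simp add: word_ev_def word_coev_def comp_assoc lw_comp rw_comp del: jn.simps jn'.simps)
  also have "\<dots> = jn [] [d] \<ast> (((e \<ast> (ru d \<boxtimes> k')) \<boxtimes> idn ?D) \<ast> asc' ?D ?w ?D \<ast> (idn ?D \<boxtimes> ((k \<boxtimes> ru' d) \<ast> c))) \<ast> jn' [d] []"
    unfolding 3 by (simp add: comp_assoc del: jn.simps jn'.simps)
  also have "\<dots> = (lu ?D \<ast> (idn unit \<boxtimes> ru' d)) \<ast> (e \<boxtimes> idn d) \<ast> asc' d x d \<ast> (idn d \<boxtimes> c) \<ast> ((ru d \<boxtimes> idn unit) \<ast> ru' ?D)"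
    unfolding 4 jn'_Nil by (simp add: comp_assoc)
  also have "lu ?D \<ast> (idn unit \<boxtimes> ru' d) = ru' d \<ast> lu d"
    by (rule lu_natural) simp_all
  also have "(ru d \<boxtimes> idn unit) \<ast> ru' ?D = ru' d \<ast> ru d"
    by (rule ru'_natural) simp_all
  also have "(ru' d \<ast> lu d) \<ast> (e \<boxtimes> idn d) \<ast> asc' d x d \<ast> (idn d \<boxtimes> c) \<ast> (ru' d \<ast> ru d)
      = ru' d \<ast> (lu d \<ast> (e \<boxtimes> idn d) \<ast> asc' d x d \<ast> (idn d \<boxtimes> c)) \<ast> (ru' d \<ast> ru d)"
    by (simp add: comp_assoc)
  also have "\<dots> = idn ?D"
    unfolding left_dualD(8)[OF X] by (simp add: unitor_cancel ru_inv)
  finally have Z2: "scomp (stens (word_ev xs d e k') (sidn [d])) (stens (sidn [d]) (word_coev xs d c k)) = sidn [d]"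
    by (intro s_eqI) (simp_all add: word_ev_def word_coev_def)
  show ?thesis
    unfolding strict.is_dual_def using Z1 Z2
    by (simp add: word_ev_def word_coev_def sarr_def del: jn.simps jn'.simps)
qed

text \<open>Twist and braiding are natural, so \<open>k\<close> reaches \<open>k'\<close> and
  cancels, and likewise \<open>ru' d\<close> against \<open>ru d\<close>. Traces may therefore be
  computed on any word that spells \<open>x\<close>.\<close>

lemma trc_word:
  assumes X: "left_dual x d e c" and k: "inv_pair k k'" "dom k = x" "cod k = word xs"
    and f: "arr f" "dom f = x" "cod f = x"
  shows "strict.trc xs [d] (word_ev xs d e k') (word_coev xs d c k) (xs, k \<ast> f \<ast> k', xs) = ([], atr x d e c f, [])"
proof (rule s_eqI)
  let ?w = "word xs" and ?D = "word [d]"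
  note [simp] = left_dualD(1-6)[OF X] k(2,3) f
  have [simp]: "arr k" "arr k'" "dom k' = ?w" "cod k' = x"
    using inv_pairD[OF k(1)] by auto
  have kk: "k' \<ast> k = idn x" "k \<ast> k' = idn ?w"
    using inv_pairD[OF k(1)] by auto
  have "smor (strict.trc xs [d] (word_ev xs d e k') (word_coev xs d c k) (xs, k \<ast> f \<ast> k', xs))
      = e \<ast> (ru d \<boxtimes> k') \<ast> br ?w ?D \<ast> ((tw ?w \<boxtimes> idn ?D) \<ast> ((k \<ast> f \<ast> k') \<boxtimes> idn ?D) \<ast> (k \<boxtimes> ru' d)) \<ast> c"
    unfolding strict.trc_def strict.cl_def
    by (simp add: word_ev_def word_coev_def comp_assoc jn_cancel del: jn.simps jn'.simps)
  also have "(tw ?w \<boxtimes> idn ?D) \<ast> ((k \<ast> f \<ast> k') \<boxtimes> idn ?D) \<ast> (k \<boxtimes> ru' d) = ((tw ?w \<ast> k) \<ast> f) \<boxtimes> ru' d"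
    by (simp add: kk comp_assoc comp_idn idn_comp flip: interchange)
  also have "tw ?w \<ast> k = k \<ast> tw x"
    by (rule tw_natural) simp_all
  also have "((k \<ast> tw x) \<ast> f) \<boxtimes> ru' d = (k \<boxtimes> ru' d) \<ast> ((tw x \<ast> f) \<boxtimes> idn d)"
    by (simp add: comp_assoc comp_idn flip: interchange)
  also have "e \<ast> (ru d \<boxtimes> k') \<ast> br ?w ?D \<ast> ((k \<boxtimes> ru' d) \<ast> ((tw x \<ast> f) \<boxtimes> idn d)) \<ast> c
      = e \<ast> (ru d \<boxtimes> k') \<ast> (br ?w ?D \<ast> (k \<boxtimes> ru' d)) \<ast> ((tw x \<ast> f) \<boxtimes> idn d) \<ast> c"
    by (simp add: comp_assoc)
  also have "br ?w ?D \<ast> (k \<boxtimes> ru' d) = (ru' d \<boxtimes> k) \<ast> br x d"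
    by (rule br_natural) simp_all
  also have "e \<ast> (ru d \<boxtimes> k') \<ast> ((ru' d \<boxtimes> k) \<ast> br x d) \<ast> ((tw x \<ast> f) \<boxtimes> idn d) \<ast> c
      = e \<ast> ((ru d \<boxtimes> k') \<ast> (ru' d \<boxtimes> k)) \<ast> br x d \<ast> ((tw x \<ast> f) \<boxtimes> idn d) \<ast> c"
    by (simp add: comp_assoc)
  also have "(ru d \<boxtimes> k') \<ast> (ru' d \<boxtimes> k) = idn (d \<star> x)"
    by (simp add: kk ru_inv tens_idn flip: interchange)
  finally show "smor (strict.trc xs [d] (word_ev xs d e k') (word_coev xs d c k) (xs, k \<ast> f \<ast> k', xs)) = smor ([], atr x d e c f, [])"
    unfolding atr_def by (simp add: idn_comp)
qed (simp_all add: strict.trc_def strict.cl_def word_ev_def word_coev_def)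

lemma atr_cyclic:
  assumes X: "left_dual x d e c" and Y: "left_dual y d' e' c'"
    and f: "arr f" "dom f = x" "cod f = y" and g: "arr g" "dom g = y" "cod g = x"
  shows "atr x d e c (g \<ast> f) = atr y d' e' c' (f \<ast> g)"
proof -
  note [simp] = f g
  note ki = inv_pair_sym[OF inv_pair_constraints(3)]
  let ?F = "([x], ru' y \<ast> f \<ast> ru x, [y])" and ?G = "([y], ru' x \<ast> g \<ast> ru y, [x])"
  have FG: "scomp ?G ?F = ([x], ru' x \<ast> (g \<ast> f) \<ast> ru x, [x])" "scomp ?F ?G = ([y], ru' y \<ast> (f \<ast> g) \<ast> ru y, [y])"
    by (auto intro!: s_eqI simp: comp_assoc unitor_cancel)
  have "strict.is_dual [x] [d] (word_ev [x] d e (ru x)) (word_coev [x] d c (ru' x))"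
    by (rule is_dual_word[OF X ki]) simp_all
  moreover have "strict.is_dual [y] [d'] (word_ev [y] d' e' (ru y)) (word_coev [y] d' c' (ru' y))"
    by (rule is_dual_word[OF Y ki]) simp_all
  ultimately have "strict.trc [x] [d] (word_ev [x] d e (ru x)) (word_coev [x] d c (ru' x)) (scomp ?G ?F)
      = strict.trc [y] [d'] (word_ev [y] d' e' (ru y)) (word_coev [y] d' c' (ru' y)) (scomp ?F ?G)"
    by (rule strict.trc_cyclic) (simp_all add: sarr_def)
  then show ?thesis
    unfolding FG
    using trc_word[OF X ki, where xs = "[x]" and f = "g \<ast> f"] trc_word[OF Y ki, where xs = "[y]" and f = "f \<ast> g"] by simp
qed

lemma db_word:
  assumes k: "inv_pair k k'" "dom k = x" "cod k = word xs" and l: "inv_pair l l'" "dom l = y" "cod l = word ys"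
  shows "strict.db xs ys = (xs @ ys, (jn xs ys \<ast> (k \<boxtimes> l)) \<ast> db x y \<ast> ((k' \<boxtimes> l') \<ast> jn' xs ys), xs @ ys)"
    "inv_pair (jn xs ys \<ast> (k \<boxtimes> l)) ((k' \<boxtimes> l') \<ast> jn' xs ys)"
proof -
  let ?w = "word xs" and ?v = "word ys"
  note [simp] = k(2,3) l(2,3)
  have [simp]: "arr k" "arr k'" "dom k' = ?w" "cod k' = x" "arr l" "arr l'" "dom l' = ?v" "cod l' = y"
    using inv_pairD[OF k(1)] inv_pairD[OF l(1)] by auto
  show "inv_pair (jn xs ys \<ast> (k \<boxtimes> l)) ((k' \<boxtimes> l') \<ast> jn' xs ys)"
    using k l by (intro inv_pair_comp inv_pair_tens jn_inv_pair) simp_all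
  have 1: "(k \<boxtimes> l) \<ast> br y x = br ?v ?w \<ast> (l \<boxtimes> k)"
    by (rule br_natural[symmetric]) simp_all
  have 2: "br x y \<ast> (k' \<boxtimes> l') = (l' \<boxtimes> k') \<ast> br ?w ?v"
    by (rule br_natural) simp_all
  have 3: "(l \<boxtimes> k) \<ast> (l' \<boxtimes> k') = idn (?v \<star> ?w)"
    using inv_pairD(6)[OF k(1)] inv_pairD(6)[OF l(1)] by (simp add: tens_idn flip: interchange)
  have "(k \<boxtimes> l) \<ast> br y x \<ast> br x y \<ast> (k' \<boxtimes> l') = ((k \<boxtimes> l) \<ast> br y x) \<ast> (br x y \<ast> (k' \<boxtimes> l'))"
    by (simp add: comp_assoc)
  also have "\<dots> = br ?v ?w \<ast> ((l \<boxtimes> k) \<ast> (l' \<boxtimes> k')) \<ast> br ?w ?v"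
    unfolding 1 2 by (simp add: comp_assoc)
  finally have "(k \<boxtimes> l) \<ast> br y x \<ast> br x y \<ast> (k' \<boxtimes> l') = br ?v ?w \<ast> br ?w ?v"
    unfolding 3 by (simp add: idn_comp)
  from arg_cong[OF this, of "\<lambda>t. jn xs ys \<ast> t \<ast> jn' xs ys"]
  show "strict.db xs ys = (xs @ ys, (jn xs ys \<ast> (k \<boxtimes> l)) \<ast> db x y \<ast> ((k' \<boxtimes> l') \<ast> jn' xs ys), xs @ ys)"
    by (intro s_eqI) (simp_all add: comp_assoc jn_cancel)
qed

text \<open>Transport of \<open>trc_db_append\<close> along the one-letter words of
  \<open>x\<close>, \<open>y\<close> and \<open>z\<close>. The duals \<open>d1\<close>,
  \<open>d2\<close>, \<open>d3\<close> of the products are arbitrary, because quantum traces are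
  formed with the chosen dual of each product.\<close>

theorem atr_db_tens:
  assumes X: "left_dual x dx ex cx" and Y: "left_dual y dy ey cy" and Z: "left_dual z dz ez cz"
    and XZ: "left_dual (x \<star> z) d1 e1 c1" and YX: "left_dual (y \<star> x) d2 e2 c2"
    and XYZ: "left_dual (x \<star> (y \<star> z)) d3 e3 c3"
    and simple: "\<And>f. \<lbrakk>arr f; dom f = x; cod f = x\<rbrakk> \<Longrightarrow> \<exists>a. f = smul a (idn x)"
  obtains a where "atr (x \<star> z) d1 e1 c1 (db x z) = smul a (atr x dx ex cx (idn x))"
    "atr (x \<star> (y \<star> z)) d3 e3 c3 (db x (y \<star> z)) = smul a (atr (y \<star> x) d2 e2 c2 (db y x))"
proof -
  have ki: "inv_pair (ru' x) (ru x)" "dom (ru' x) = x" "cod (ru' x) = word [x]" for x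
    using inv_pair_sym[OF inv_pair_constraints(3)] by simp_all
  let ?p = "\<lambda>xs ys k l. jn xs ys \<ast> (k \<boxtimes> l)" and ?q = "\<lambda>xs ys k l. (k \<boxtimes> l) \<ast> jn' xs ys"
  have pq: "inv_pair (?p xs ys k l) (?q xs ys k' l')" "dom (?p xs ys k l) = x \<star> y" "cod (?p xs ys k l) = word (xs @ ys)"
    if "inv_pair k k'" "dom k = x" "cod k = word xs" "inv_pair l l'" "dom l = y" "cod l = word ys" for xs ys k k' l l' x y
    using db_word(2)[OF that] that by simp_all
  note kxz = pq[OF ki ki, of x z] and kyx = pq[OF ki ki, of y x] and kyz = pq[OF ki ki, of y z]
  note kxyz = pq[OF ki kyz, of x]
  have dbtr: "strict.trc (xs @ ys) [d] (word_ev (xs @ ys) d e (?q xs ys k' l')) (word_coev (xs @ ys) d c (?p xs ys k l)) (strict.db xs ys)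
      = ([], atr (x \<star> y) d e c (db x y), [])"
    if "left_dual (x \<star> y) d e c"
      "inv_pair k k'" "dom k = x" "cod k = word xs" "inv_pair l l'" "dom l = y" "cod l = word ys" for xs ys k k' l l' x y d e c
    unfolding db_word(1)[OF that(2-)] by (rule trc_word[OF that(1) pq[OF that(2-)]]) simp_all
  have dx: "strict.trc [x] [dx] (word_ev [x] dx ex (ru x)) (word_coev [x] dx cx (ru' x)) (sidn [x]) = ([], atr x dx ex cx (idn x), [])"
    using trc_word[OF X ki, of "idn x"] by (simp add: idn_comp ru_inv sidn_def)
  have simple': "\<exists>a. F = ssmul a (sidn [x])" if F: "sarr F" "sdom F = [x]" "scod F = [x]" for F
  proof -
    have *: "arr (smor F)" "dom (smor F) = x \<star> unit" "cod (smor F) = x \<star> unit"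
      using sarrD[OF F(1)] F by simp_all
    obtain a where a: "ru x \<ast> smor F \<ast> ru' x = smul a (idn x)"
      using simple[of "ru x \<ast> smor F \<ast> ru' x"] * by auto
    have "smor F = ru' x \<ast> (ru x \<ast> smor F \<ast> ru' x) \<ast> ru x"
      using * by (simp add: comp_assoc unitor_cancel ru_inv comp_idn)
    also have "\<dots> = smul a (idn (x \<star> unit))"
      unfolding a by (simp add: smul_comp_left smul_comp_right idn_comp ru_inv)
    finally show ?thesis
      using F by (intro exI[of _ a] s_eqI) simp_all
  qed
  obtain a where a:
    "strict.trc ([x] @ [z]) [d1] (word_ev ([x] @ [z]) d1 e1 (?q [x] [z] (ru x) (ru z))) (word_coev ([x] @ [z]) d1 c1 (?p [x] [z] (ru' x) (ru' z))) (strict.db [x] [z])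
     = ssmul a (strict.trc [x] [dx] (word_ev [x] dx ex (ru x)) (word_coev [x] dx cx (ru' x)) (sidn [x]))"
    "strict.trc ([x] @ ([y] @ [z])) [d3] (word_ev ([x] @ ([y] @ [z])) d3 e3 (?q [x] ([y] @ [z]) (ru x) (?q [y] [z] (ru y) (ru z))))
       (word_coev ([x] @ ([y] @ [z])) d3 c3 (?p [x] ([y] @ [z]) (ru' x) (?p [y] [z] (ru' y) (ru' z)))) (strict.db [x] ([y] @ [z]))
     = ssmul a (strict.trc ([y] @ [x]) [d2] (word_ev ([y] @ [x]) d2 e2 (?q [y] [x] (ru y) (ru x))) (word_coev ([y] @ [x]) d2 c2 (?p [y] [x] (ru' y) (ru' x))) (strict.db [y] [x]))"
    by (rule strict.trc_db_append[OF is_dual_word[OF X ki] is_dual_word[OF Y ki] is_dual_word[OF Z ki]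
          is_dual_word[OF XZ kxz] is_dual_word[OF YX kyx] is_dual_word[OF XYZ kxyz] simple'])
  show ?thesis
    using that[of a] a(1) a(2)
    unfolding dx dbtr[OF XZ ki ki] dbtr[OF YX ki ki] dbtr[OF XYZ ki kyz] ssmul_def by simp
qed

lemma db_tens_smul:
  assumes "db x y = smul a (idn (x \<star> y))" "db x z = smul b (idn (x \<star> z))"
  shows "db x (y \<star> z) = smul b (smul a (idn (x \<star> (y \<star> z))))"
proof -
  have ki: "inv_pair (ru' x) (ru x)" "dom (ru' x) = x" "cod (ru' x) = word [x]" for x
    using inv_pair_sym[OF inv_pair_constraints(3)] by simp_all
  have scalar: "strict.db [x] [y] = ssmul a (sidn ([x] @ [y]))" if "db x y = smul a (idn (x \<star> y))" for y a
  proof (rule s_eqI)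
    let ?p = "jn [x] [y] \<ast> (ru' x \<boxtimes> ru' y)" and ?q = "(ru x \<boxtimes> ru y) \<ast> jn' [x] [y]"
    have "smor (strict.db [x] [y]) = ?p \<ast> smul a (idn (x \<star> y)) \<ast> ?q"
      unfolding db_word(1)[OF ki ki] that by simp
    also have "\<dots> = smul a (?p \<ast> ?q)"
      by (simp add: smul_comp_left smul_comp_right idn_comp del: jn.simps jn'.simps)
    also have "?p \<ast> ?q = idn (word ([x] @ [y]))"
      using inv_pairD(6)[OF db_word(2)[OF ki ki, of x y]] by simp
    finally show "smor (strict.db [x] [y]) = smor (ssmul a (sidn ([x] @ [y])))" by simp
  qed simp_all
  let ?k = "jn [y] [z] \<ast> (ru' y \<boxtimes> ru' z)" and ?k' = "(ru y \<boxtimes> ru z) \<ast> jn' [y] [z]"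
  have k: "inv_pair ?k ?k'" "dom ?k = y \<star> z" "cod ?k = word ([y] @ [z])"
    using db_word(2)[OF ki ki, of y z] by simp_all
  let ?p = "jn [x] ([y] @ [z]) \<ast> (ru' x \<boxtimes> ?k)" and ?q = "(ru x \<boxtimes> ?k') \<ast> jn' [x] ([y] @ [z])"
  note pq = inv_pairD[OF db_word(2)[OF ki k, of x]]
  have dom: "dom ?p = x \<star> (y \<star> z)" by simp
  have "?p \<ast> db x (y \<star> z) \<ast> ?q = smor (strict.db [x] ([y] @ [z]))"
    unfolding db_word(1)[OF ki k] by simp
  also have "\<dots> = smul b (smul a (idn (word ([x] @ [y] @ [z]))))"
    unfolding strict.db_append_smul[OF scalar[OF assms(1)] scalar[OF assms(2)]] by simp
  finally have eq: "?p \<ast> db x (y \<star> z) \<ast> ?q = smul b (smul a (idn (word ([x] @ [y] @ [z]))))" .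
  have "db x (y \<star> z) = (?q \<ast> ?p) \<ast> db x (y \<star> z) \<ast> (?q \<ast> ?p)"
    unfolding pq(5) dom by (simp add: idn_comp comp_idn)
  also have "\<dots> = ?q \<ast> (?p \<ast> db x (y \<star> z) \<ast> ?q) \<ast> ?p"
    by (simp add: comp_assoc del: jn.simps jn'.simps)
  also have "\<dots> = smul b (smul a (?q \<ast> ?p))"
    unfolding eq by (simp add: smul_comp_left smul_comp_right idn_comp del: jn.simps jn'.simps)
  finally show ?thesis unfolding pq(5) dom .
qed

end

section \<open>Linear and semisimple categories\<close>

context linear_category
begin

lemma zero_in_Hom [simp, intro]: "0 \<in> Hom C X Y"
  using subspace_0[OF subspace_Hom] .

lemma add_in_Hom [intro]: "\<lbrakk>f \<in> Hom C X Y; g \<in> Hom C X Y\<rbrakk> \<Longrightarrow> f + g \<in> Hom C X Y"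
  using subspace_add[OF subspace_Hom] .

lemma diff_in_Hom [intro]: "\<lbrakk>f \<in> Hom C X Y; g \<in> Hom C X Y\<rbrakk> \<Longrightarrow> f - g \<in> Hom C X Y"
  using subspace_diff[OF subspace_Hom] .

lemma scale_in_Hom [intro]: "f \<in> Hom C X Y \<Longrightarrow> Scale C a f \<in> Hom C X Y"
  using subspace_scale[OF subspace_Hom] .

lemma sum_in_Hom [intro]: "(\<And>i. i \<in> I \<Longrightarrow> f i \<in> Hom C X Y) \<Longrightarrow> (\<Sum>i\<in>I. f i) \<in> Hom C X Y"
  using subspace_sum[OF subspace_Hom] by blast

lemma Comp_0_left [simp]: "f \<in> Hom C X Y \<Longrightarrow> 0 \<cdot> f = 0"
  \<comment> \<open>The zero vector lies in every hom-space, so its target object may be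
    arbitrary.\<close>
  using Comp_scale_left[of 0 Y undefined f X 0] by simp

lemma Comp_0_right [simp]: "g \<in> Hom C Y Z \<Longrightarrow> g \<cdot> 0 = 0"
  using Comp_scale_right[of g Y Z 0 undefined 0] by simp

lemma Comp_diff_left:
  assumes "g \<in> Hom C Y Z" "g' \<in> Hom C Y Z" "f \<in> Hom C X Y"
  shows "(g - g') \<cdot> f = g \<cdot> f - g' \<cdot> f"
  using Comp_add_left[OF diff_in_Hom[OF assms(1,2)] assms(2,3)] by (simp add: algebra_simps)

lemma Comp_diff_right:
  assumes "g \<in> Hom C Y Z" "f \<in> Hom C X Y" "f' \<in> Hom C X Y"
  shows "g \<cdot> (f - f') = g \<cdot> f - g \<cdot> f'"
  using Comp_add_right[OF assms(1) diff_in_Hom[OF assms(2,3)] assms(3)] by (simp add: algebra_simps)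

lemma Comp_sum_left:
  assumes "\<And>i. i \<in> I \<Longrightarrow> g i \<in> Hom C Y Z" "f \<in> Hom C X Y"
  shows "(\<Sum>i\<in>I. g i) \<cdot> f = (\<Sum>i\<in>I. g i \<cdot> f)"
  using assms(1)
proof (induction I rule: infinite_finite_induct)
  case (insert i I)
  then show ?case
    using Comp_add_left[of "g i" Y Z "sum g I" f X] assms(2) sum_in_Hom[of I g Y Z] by simp
qed (use assms(2) in auto)

lemma Comp_sum_right:
  assumes "g \<in> Hom C Y Z" "\<And>i. i \<in> I \<Longrightarrow> f i \<in> Hom C X Y"
  shows "g \<cdot> (\<Sum>i\<in>I. f i) = (\<Sum>i\<in>I. g \<cdot> f i)"
  using assms(2)
proof (induction I rule: infinite_finite_induct)
  case (insert i I)
  then show ?case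
    using Comp_add_right[of g Y Z "f i" X "sum f I"] assms(1) sum_in_Hom[of I f X Y] by simp
qed (use assms(1) in auto)

lemma zero_object_iff: "zero_object C X \<longleftrightarrow> Ident C X = 0"
proof
  assume *: "Ident C X = 0"
  have "f = 0" if "f \<in> Hom C Y X" for f Y
    using Ident_Comp[OF that] that by (simp add: *)
  moreover have "f = 0" if "f \<in> Hom C X Y" for f Y
    using Comp_Ident[OF that] that by (simp add: *)
  ultimately show "zero_object C X"
    unfolding zero_object_def by auto
next
  assume "zero_object C X"
  then show "Ident C X = 0"
    unfolding zero_object_def using Ident_in[of X] by blast
qed

lemma monicI:
  assumes "f \<in> Hom C X Y" "\<And>W g. \<lbrakk>g \<in> Hom C W X; f \<cdot> g = 0\<rbrakk> \<Longrightarrow> g = 0"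
  shows "monic C X Y f"
  unfolding monic_def
proof (intro conjI allI ballI impI)
  fix W g h
  assume gh: "g \<in> Hom C W X" "h \<in> Hom C W X" "f \<cdot> g = f \<cdot> h"
  then have "f \<cdot> (g - h) = 0"
    using Comp_diff_right[OF assms(1) gh(1,2)] by simp
  then show "g = h"
    using assms(2)[of "g - h" W] gh by auto
qed (rule assms(1))

lemma isomorphicE:
  assumes "isomorphic C X Y"
  obtains f g where "f \<in> Hom C X Y" "g \<in> Hom C Y X" "g \<cdot> f = Ident C X" "f \<cdot> g = Ident C Y"
  using assms unfolding isomorphic_def isomorphism_def mutually_inverse_def by blast

lemma isomorphicI:
  assumes "f \<in> Hom C X Y" "g \<in> Hom C Y X" "g \<cdot> f = Ident C X" "f \<cdot> g = Ident C Y"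
  shows "isomorphic C X Y"
  using assms unfolding isomorphic_def isomorphism_def mutually_inverse_def by blast

lemma inverse_mor:
  assumes "isomorphism C X Y f"
  shows "f \<in> Hom C X Y" "inverse_mor C X Y f \<in> Hom C Y X"
    "inverse_mor C X Y f \<cdot> f = Ident C X" "f \<cdot> inverse_mor C X Y f = Ident C Y"
proof -
  obtain g where g: "mutually_inverse C X Y f g"
    using assms unfolding isomorphism_def by blast
  have "h = g" if h: "mutually_inverse C X Y f h" for h
  proof -
    have "h = h \<cdot> (f \<cdot> g)"
      using g h Comp_Ident[of h Y X] unfolding mutually_inverse_def by simp
    also have "\<dots> = (h \<cdot> f) \<cdot> g"
      using g h Comp_assoc[of h Y X f X g Y] unfolding mutually_inverse_def by simp
    also have "\<dots> = g"
      using g h Ident_Comp[of g Y X] unfolding mutually_inverse_def by simp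
    finally show "h = g" .
  qed
  then have "mutually_inverse C X Y f (inverse_mor C X Y f)"
    unfolding inverse_mor_def using theI[of "mutually_inverse C X Y f", OF g] by blast
  then show "f \<in> Hom C X Y" "inverse_mor C X Y f \<in> Hom C Y X"
    "inverse_mor C X Y f \<cdot> f = Ident C X" "f \<cdot> inverse_mor C X Y f = Ident C Y"
    unfolding mutually_inverse_def by auto
qed

lemma split_mono_monic:
  assumes "i \<in> Hom C X Y" "p \<in> Hom C Y X" "p \<cdot> i = Ident C X"
  shows "monic C X Y i"
proof (rule monicI[OF assms(1)])
  fix W g assume g: "g \<in> Hom C W X" "i \<cdot> g = 0"
  have "g = (p \<cdot> i) \<cdot> g"
    using Ident_Comp[OF g(1)] assms(3) by simp
  also have "\<dots> = 0"
    using Comp_assoc[OF assms(2,1) g(1)] g(2) assms(2) by simp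
  finally show "g = 0" .
qed

lemma is_direct_sum_single: "is_direct_sum C X [X]"
  unfolding is_direct_sum_def
  by (rule exI[of _ "\<lambda>_. Ident C X"], rule exI[of _ "\<lambda>_. Ident C X"]) (auto simp: Ident_Comp[OF Ident_in])

lemma is_direct_sum_single_iff: "is_direct_sum C Z [X] \<Longrightarrow> isomorphic C Z X"
  unfolding is_direct_sum_def
proof (elim exE conjE)
  fix \<iota> \<pi>
  assume "\<forall>j<length [X]. \<iota> j \<in> Hom C ([X] ! j) Z \<and> \<pi> j \<in> Hom C Z ([X] ! j)"
    "\<forall>j<length [X]. \<forall>l<length [X]. \<pi> j \<cdot> \<iota> l = (if j = l then Ident C ([X] ! j) else 0)"
    "(\<Sum>j<length [X]. \<iota> j \<cdot> \<pi> j) = Ident C Z"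
  then show "isomorphic C Z X"
    by (intro isomorphicI[of "\<pi> 0" _ _ "\<iota> 0"]) auto
qed

definition sum_system :: "'o list \<Rightarrow> 'o \<Rightarrow> (nat \<Rightarrow> 'm) \<Rightarrow> (nat \<Rightarrow> 'm) \<Rightarrow> bool" where
  "sum_system Xs Z \<iota> \<pi> \<longleftrightarrow>
     (\<forall>j<length Xs. \<iota> j \<in> Hom C (Xs ! j) Z \<and> \<pi> j \<in> Hom C Z (Xs ! j)) \<and>
     (\<forall>j<length Xs. \<forall>l<length Xs. \<pi> j \<cdot> \<iota> l = (if j = l then Ident C (Xs ! j) else 0)) \<and>
     (\<Sum>j<length Xs. \<iota> j \<cdot> \<pi> j) = Ident C Z"

lemma is_direct_sum_iff: "is_direct_sum C Z Xs \<longleftrightarrow> (\<exists>\<iota> \<pi>. sum_system Xs Z \<iota> \<pi>)"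
  unfolding is_direct_sum_def sum_system_def ..

lemma sum_systemD:
  assumes "sum_system Xs Z \<iota> \<pi>"
  shows "j < length Xs \<Longrightarrow> \<iota> j \<in> Hom C (Xs ! j) Z"
    "j < length Xs \<Longrightarrow> \<pi> j \<in> Hom C Z (Xs ! j)"
    "\<lbrakk>j < length Xs; l < length Xs\<rbrakk> \<Longrightarrow> \<pi> j \<cdot> \<iota> l = (if j = l then Ident C (Xs ! j) else 0)"
    "(\<Sum>j<length Xs. \<iota> j \<cdot> \<pi> j) = Ident C Z"
  using assms unfolding sum_system_def by simp_all

lemma is_direct_sum_iso:
  assumes "is_direct_sum C Z Xs" "isomorphic C Z Z'"
  shows "is_direct_sum C Z' Xs"
proof -
  obtain \<iota> \<pi> where ds: "sum_system Xs Z \<iota> \<pi>"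
    using assms(1) unfolding is_direct_sum_iff by blast
  note i = sum_systemD(1)[OF ds] and p = sum_systemD(2)[OF ds]
    and pi = sum_systemD(3)[OF ds] and s = sum_systemD(4)[OF ds]
  obtain f g where f: "f \<in> Hom C Z Z'" and g: "g \<in> Hom C Z' Z" and gf: "g \<cdot> f = Ident C Z" and fg: "f \<cdot> g = Ident C Z'"
    using isomorphicE[OF assms(2)] .
  show ?thesis
    unfolding is_direct_sum_def
  proof (rule exI[of _ "\<lambda>j. f \<cdot> \<iota> j"], rule exI[of _ "\<lambda>j. \<pi> j \<cdot> g"], intro conjI allI impI)
    fix j l assume jl: "j < length Xs" "l < length Xs"
    have "(\<pi> j \<cdot> g) \<cdot> (f \<cdot> \<iota> l) = \<pi> j \<cdot> ((g \<cdot> f) \<cdot> \<iota> l)"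
      using Comp_assoc[OF p g Comp_in[OF f i]] Comp_assoc[OF g f i] jl by simp
    then show "(\<pi> j \<cdot> g) \<cdot> (f \<cdot> \<iota> l) = (if j = l then Ident C (Xs ! j) else 0)"
      using jl pi Ident_Comp[OF i] by (simp add: gf)
  next
    have "(\<Sum>j<length Xs. (f \<cdot> \<iota> j) \<cdot> (\<pi> j \<cdot> g)) = (\<Sum>j<length Xs. f \<cdot> ((\<iota> j \<cdot> \<pi> j) \<cdot> g))"
      using Comp_assoc[OF f i Comp_in[OF p g]] Comp_assoc[OF i p g] by (intro sum.cong) auto
    also have "\<dots> = f \<cdot> (\<Sum>j<length Xs. (\<iota> j \<cdot> \<pi> j) \<cdot> g)"
      by (rule Comp_sum_right[OF f, symmetric]) (auto intro!: Comp_in[OF _ g] Comp_in[OF i p])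
    also have "(\<Sum>j<length Xs. (\<iota> j \<cdot> \<pi> j) \<cdot> g) = Ident C Z \<cdot> g"
      unfolding s[symmetric] by (rule Comp_sum_left[OF _ g, symmetric]) (auto intro!: Comp_in[OF i p])
    finally show "(\<Sum>j<length Xs. (f \<cdot> \<iota> j) \<cdot> (\<pi> j \<cdot> g)) = Ident C Z'"
      by (simp add: Ident_Comp[OF g] fg)
  qed (use f g i p in auto)
qed

text \<open>Linear maps between hom-spaces are only assumed to be linear on the hom-space, so the library
  facts about linear maps do not apply.\<close>

lemma dim_eq_of_bij:
  assumes V: "subspace V" "finite B0" "V \<subseteq> span B0" and W: "subspace W"
    and bij: "bij_betw f V W"
    and add: "\<And>x y. \<lbrakk>x \<in> V; y \<in> V\<rbrakk> \<Longrightarrow> f (x + y) = f x + f y"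
    and sc: "\<And>a x. x \<in> V \<Longrightarrow> f (Scale C a x) = Scale C a (f x)"
  shows "dim V = dim W"
proof -
  obtain B where B: "B \<subseteq> V" "independent B" "V \<subseteq> span B" "card B = dim V"
    using basis_exists[of V] by blast
  have finB: "finite B"
    using independent_span_bound[OF V(2) B(2)] B(1) V(3) by blast
  have inj: "inj_on f V" and im: "f ` V = W"
    using bij unfolding bij_betw_def by auto
  have f0: "f 0 = 0"
    using sc[of 0 0] subspace_0[OF V(1)] by simp
  have lin: "(\<Sum>b\<in>B. Scale C (u b) b) \<in> V" "f (\<Sum>b\<in>B. Scale C (u b) b) = (\<Sum>b\<in>B. Scale C (u b) (f b))" for u
  proof -
    have "T \<subseteq> B \<Longrightarrow> (\<Sum>b\<in>T. Scale C (u b) b) \<in> V \<and> f (\<Sum>b\<in>T. Scale C (u b) b) = (\<Sum>b\<in>T. Scale C (u b) (f b))" for T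
    proof (induction T rule: infinite_finite_induct)
      case (insert b T)
      then have "b \<in> V" using B(1) by auto
      then show ?case
        using insert add[of "Scale C (u b) b" "\<Sum>b\<in>T. Scale C (u b) b"] sc[of b "u b"]
          subspace_scale[OF V(1), of b "u b"] subspace_add[OF V(1)] by simp
    qed (simp_all add: f0 subspace_0[OF V(1)])
    then show "(\<Sum>b\<in>B. Scale C (u b) b) \<in> V" "f (\<Sum>b\<in>B. Scale C (u b) b) = (\<Sum>b\<in>B. Scale C (u b) (f b))" by auto
  qed
  have injB: "inj_on f B"
    using inj B(1) inj_on_subset by blast
  have "independent (f ` B)"
  proof (subst dependent_finite)
    show "\<not> (\<exists>u. (\<exists>v\<in>f ` B. u v \<noteq> 0) \<and> (\<Sum>v\<in>f ` B. Scale C (u v) v) = 0)"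
    proof (intro notI, elim exE conjE)
      fix u assume u: "\<exists>v\<in>f ` B. u v \<noteq> 0" "(\<Sum>v\<in>f ` B. Scale C (u v) v) = 0"
      have "f (\<Sum>b\<in>B. Scale C (u (f b)) b) = f 0"
        using u(2) lin(2)[of "\<lambda>b. u (f b)"] by (simp add: sum.reindex[OF injB] f0)
      then have "(\<Sum>b\<in>B. Scale C (u (f b)) b) = 0"
        using inj lin(1)[of "\<lambda>b. u (f b)"] subspace_0[OF V(1)] by (auto dest: inj_onD)
      then show False
        using u(1) B(2) dependent_finite[OF finB] by (auto intro!: exI[of _ "\<lambda>b. u (f b)"])
    qed
  qed (use finB in simp)
  moreover have "span (f ` B) = span W"
  proof
    show "span (f ` B) \<subseteq> span W"
      using im B(1) by (intro span_mono) auto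
    have "w \<in> span (f ` B)" if w: "w \<in> W" for w
    proof -
      obtain v where v: "v \<in> V" "w = f v" using w im by blast
      then obtain u where u: "v = (\<Sum>b\<in>B. Scale C (u b) b)"
        using B(3) span_finite[OF finB] by auto
      show ?thesis
        unfolding v(2) u lin(2) by (auto intro: span_sum span_scale span_base)
    qed
    then show "span W \<subseteq> span (f ` B)"
      by (simp add: span_minimal subsetI)
  qed
  ultimately have "dim W = card (f ` B)"
    by (intro dim_eq_card) auto
  then show ?thesis
    using B(4) card_image[OF injB] by simp
qed

lemma dim_le_of_inj:
  assumes V: "subspace V" "finite B0" "V \<subseteq> span B0" and W: "subspace W" "finite B1" "W \<subseteq> span B1"
    and inj: "inj_on f V" and into: "f ` V \<subseteq> W"
    and add: "\<And>x y. \<lbrakk>x \<in> V; y \<in> V\<rbrakk> \<Longrightarrow> f (x + y) = f x + f y"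
    and sc: "\<And>a x. x \<in> V \<Longrightarrow> f (Scale C a x) = Scale C a (f x)"
  shows "dim V \<le> dim W"
proof -
  have f0: "f 0 = 0"
    using sc[of 0 0] subspace_0[OF V(1)] by simp
  have im: "subspace (f ` V)"
  proof (rule subspaceI)
    show "0 \<in> f ` V" using f0 subspace_0[OF V(1)] by (metis imageI)
    show "x + y \<in> f ` V" if "x \<in> f ` V" "y \<in> f ` V" for x y
      using that add subspace_add[OF V(1)] by (auto simp flip: add)
    show "Scale C a x \<in> f ` V" if "x \<in> f ` V" for a x
      using that subspace_scale[OF V(1)] by (auto simp flip: sc)
  qed
  have "dim V = dim (f ` V)"
    by (rule dim_eq_of_bij[OF V im _ add sc]) (use inj in \<open>auto simp: bij_betw_def\<close>)
  also have "dim (f ` V) \<le> dim W"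
  proof -
    obtain B where B: "B \<subseteq> f ` V" "independent B" "f ` V \<subseteq> span B" "card B = dim (f ` V)"
      using basis_exists[of "f ` V"] by blast
    obtain B' where B': "B' \<subseteq> W" "independent B'" "W \<subseteq> span B'" "card B' = dim W"
      using basis_exists[of W] by blast
    have "finite B'"
      using independent_span_bound[OF W(2) B'(2)] B'(1) W(3) by blast
    then have "card B \<le> card B'"
      using independent_span_bound[of B' B] B(1,2) B'(3) into by blast
    then show ?thesis using B(4) B'(4) by simp
  qed
  finally show ?thesis .
qed

end

section \<open>Linearity of the tensor product and tensoring with invertible objects\<close>

context tensor_category
begin

lemma TMor_0_left: "g \<in> Hom C Y Y' \<Longrightarrow> 0 \<otimes>\<^sub>m g = 0"
  using TMor_scale_left[of 0 undefined undefined g Y Y' 0] by simp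

lemma TMor_0_right: "f \<in> Hom C X X' \<Longrightarrow> f \<otimes>\<^sub>m 0 = 0"
  using TMor_scale_right[of f X X' 0 undefined undefined 0] by simp

lemma TMor_sum_left:
  assumes "\<And>i. i \<in> I \<Longrightarrow> f i \<in> Hom C X X'" "g \<in> Hom C Y Y'"
  shows "(\<Sum>i\<in>I. f i) \<otimes>\<^sub>m g = (\<Sum>i\<in>I. f i \<otimes>\<^sub>m g)"
  using assms(1)
proof (induction I rule: infinite_finite_induct)
  case (insert i I)
  then show ?case
    using TMor_add_left[of "f i" X X' "sum f I" g Y Y'] assms(2) sum_in_Hom[of I f X X'] by simp
qed (simp_all add: TMor_0_left[OF assms(2)])

lemma TMor_sum_right:
  assumes "g \<in> Hom C Y Y'" "\<And>i. i \<in> I \<Longrightarrow> f i \<in> Hom C X X'"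
  shows "g \<otimes>\<^sub>m (\<Sum>i\<in>I. f i) = (\<Sum>i\<in>I. g \<otimes>\<^sub>m f i)"
  using assms(2)
proof (induction I rule: infinite_finite_induct)
  case (insert i I)
  then show ?case
    using TMor_add_right[of g Y Y' "f i" X X' "sum f I"] assms(1) sum_in_Hom[of I f X X'] by simp
qed (simp_all add: TMor_0_right[OF assms(1)])

text \<open>A one-sided inverse suffices: tensoring with \<open>h\<close> and using the isomorphism
  of \<open>h \<otimes>\<^sub>o g\<close> with the unit turns the hypothesis into the vanishing of
  the unit tensored with \<open>f\<close>, and the left unit constraint is natural.\<close>

lemma tens_invertible_faithful:
  assumes hg: "isomorphic C (h \<otimes>\<^sub>o g) \<I>" and f: "f \<in> Hom C A B" and 0: "Ident C g \<otimes>\<^sub>m f = 0"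
  shows "f = 0"
proof -
  obtain u v where u: "u \<in> Hom C (h \<otimes>\<^sub>o g) \<I>" "v \<in> Hom C \<I> (h \<otimes>\<^sub>o g)" "u \<cdot> v = Ident C \<I>"
    using isomorphicE[OF hg] .
  note a = inverse_mor[OF Assoc_iso[of h g B]] and a' = inverse_mor(1)[OF Assoc_iso[of h g A]]
  have hgf: "Ident C (h \<otimes>\<^sub>o g) \<otimes>\<^sub>m f \<in> Hom C ((h \<otimes>\<^sub>o g) \<otimes>\<^sub>o A) ((h \<otimes>\<^sub>o g) \<otimes>\<^sub>o B)"
    using TMor_in[OF Ident_in f] .
  have "Assoc C h g B \<cdot> (Ident C (h \<otimes>\<^sub>o g) \<otimes>\<^sub>m f) = 0"
    using Assoc_natural[OF Ident_in[of h] Ident_in[of g] f] TMor_0_right[OF Ident_in] a' by (simp add: 0 TMor_Ident)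
  then have "Ident C (h \<otimes>\<^sub>o g) \<otimes>\<^sub>m f = 0"
    using Comp_assoc[OF a(2,1) hgf] a(2,3) Ident_Comp[OF hgf] by simp
  moreover have "(u \<otimes>\<^sub>m Ident C B) \<cdot> ((Ident C (h \<otimes>\<^sub>o g) \<otimes>\<^sub>m f) \<cdot> (v \<otimes>\<^sub>m Ident C A)) = Ident C \<I> \<otimes>\<^sub>m f"
    using TMor_Comp[OF u(2) Ident_in[of "h \<otimes>\<^sub>o g"] Ident_in[of A] f] TMor_Comp[OF u(2,1) f Ident_in[of B]]
      Ident_Comp[OF u(2)] Comp_Ident[OF f] Ident_Comp[OF f] u(3) by simp
  ultimately have "Ident C \<I> \<otimes>\<^sub>m f = 0"
    using TMor_in[OF u(2) Ident_in[of A]] TMor_in[OF u(1) Ident_in[of B]] by simp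
  then have "f \<cdot> LUnit C A = 0"
    using LUnit_natural[OF f] inverse_mor(1)[OF LUnit_iso[of B]] by simp
  then show "f = 0"
    using Comp_assoc[OF f inverse_mor(1,2)[OF LUnit_iso[of A]]] inverse_mor[OF LUnit_iso[of A]] Comp_Ident[OF f] by simp
qed

lemma invertible_unit: "invertible_object C \<I>"
  unfolding invertible_object_def using isomorphic_unit by blast

lemma invertible_tens:
  "\<lbrakk>invertible_object C g; invertible_object C h\<rbrakk> \<Longrightarrow> invertible_object C (g \<otimes>\<^sub>o h)"
  unfolding invertible_object_def using isomorphic_TObj_inverse by blast

lemma iso_class_pow: "iso_class C X [^]\<^bsub>invertibles_group C\<^esub> (n::nat) = iso_class C (tensor_power C X n)"
proof (induction n)
  case 0
  show ?case by (simp add: invertibles_group_def nat_pow_def)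
next
  case (Suc n)
  interpret G: group "invertibles_group C" by (rule group_invertibles_group)
  show ?case by (simp add: Suc mult_invertibles_group)
qed

lemma invertible_tensor_power: "invertible_object C g \<Longrightarrow> invertible_object C (tensor_power C g n)"
  by (induction n) (simp_all add: invertible_unit invertible_tens)

lemma tensor_power_add: "isomorphic C (tensor_power C X m \<otimes>\<^sub>o tensor_power C X n) (tensor_power C X (m + n))"
proof (induction n)
  case 0
  show ?case by (simp add: isomorphic_unit)
next
  case (Suc n)
  have "isomorphic C (tensor_power C X m \<otimes>\<^sub>o (tensor_power C X n \<otimes>\<^sub>o X)) ((tensor_power C X m \<otimes>\<^sub>o tensor_power C X n) \<otimes>\<^sub>o X)"
    by (rule isomorphic_sym[OF isomorphic_assoc])
  also have "isomorphic C \<dots> (tensor_power C X (m + n) \<otimes>\<^sub>o X)"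
    by (rule isomorphic_TObj[OF Suc isomorphic_refl])
  finally show ?case by simp
qed

lemma carrier_invertibles: "carrier (invertibles_group C) = {iso_class C X |X. invertible_object C X}"
  unfolding invertibles_group_def by simp

lemma one_invertibles: "\<one>\<^bsub>invertibles_group C\<^esub> = iso_class C \<I>"
  unfolding invertibles_group_def by simp

end

section \<open>Simple objects and Schur's lemma\<close>

context abelian_category
begin

text \<open>The kernel of \<open>f\<close> is a subobject of the simple object \<open>X\<close>; it
  is not all of \<open>X\<close> since \<open>f\<close> is nonzero, so it is a zero object.\<close>

lemma simple_monic:
  assumes X: "simple_object C X" and f: "f \<in> Hom C X Y" "f \<noteq> 0"
  shows "monic C X Y f"
proof -
  obtain K i where K: "is_kernel C X Y f K i"
    using ex_kernel[OF f(1)] by blast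
  have i: "i \<in> Hom C K X" "f \<cdot> i = 0"
    and univ: "\<And>W g. \<lbrakk>g \<in> Hom C W X; f \<cdot> g = 0\<rbrakk> \<Longrightarrow> \<exists>!h. h \<in> Hom C W K \<and> i \<cdot> h = g"
    using K unfolding is_kernel_def by auto
  have "monic C K X i"
  proof (rule monicI[OF i(1)])
    fix W g assume g: "g \<in> Hom C W K" "i \<cdot> g = 0"
    have "\<exists>!h. h \<in> Hom C W K \<and> i \<cdot> h = 0"
      using univ[of 0 W] f(1) by simp
    then show "g = 0"
      using g i(1) by (metis Comp_0_right zero_in_Hom)
  qed
  then consider "zero_object C K" | "isomorphism C K X i"
    using X unfolding simple_object_def by blast
  then show ?thesis
  proof cases
    case 1
    show ?thesis
    proof (rule monicI[OF f(1)])
      fix W g assume "g \<in> Hom C W X" "f \<cdot> g = 0"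
      then obtain h where h: "h \<in> Hom C W K" "i \<cdot> h = g"
        using univ by blast
      then show "g = 0"
        using 1 i(1) unfolding zero_object_def by auto
    qed
  next
    case 2
    then obtain j where j: "j \<in> Hom C X K" "i \<cdot> j = Ident C X"
      unfolding isomorphism_def mutually_inverse_def by blast
    have "f = (f \<cdot> i) \<cdot> j"
      using Comp_assoc[OF f(1) i(1) j(1)] j(2) Comp_Ident[OF f(1)] by simp
    then show ?thesis
      using f(2) i(2) j(1) by simp
  qed
qed

lemma simple_not_zero: "simple_object C X \<Longrightarrow> Ident C X \<noteq> 0"
  unfolding simple_object_def zero_object_iff by blast

lemma simple_Hom_iso:
  assumes "simple_object C X" "simple_object C Y" "f \<in> Hom C X Y" "f \<noteq> 0"
  shows "isomorphism C X Y f"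
proof -
  have "\<not> zero_object C X"
    using assms(1) unfolding simple_object_def by blast
  then show ?thesis
    using simple_monic[OF assms(1,3,4)] assms(2) unfolding simple_object_def by blast
qed

lemma simple_Hom_nonzero:
  assumes "simple_object C X" "isomorphism C X Y f"
  shows "f \<noteq> 0"
  using inverse_mor[OF assms(2)] simple_not_zero[OF assms(1)] by auto

end

locale acf_fusion_category = fusion_category C
  for C :: "('o, 'm::ab_group_add, 'k::alg_closed_field, 'z) tensor_cat_scheme" (structure)
begin

text \<open>Schur's lemma: a polynomial annihilating \<open>f\<close> splits into linear factors, and one of them
  must vanish at \<open>f\<close>, since nonzero endomorphisms of \<open>X\<close> are invertible.\<close>

lemma schur:
  assumes X: "simple_object C X" and f: "f \<in> Hom C X X"
  obtains a where "f = Scale C a (Ident C X)"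
proof -
  define pw where "pw = rec_nat (Ident C X) (\<lambda>_ g. f \<cdot> g)"
  have pw0: "pw 0 = Ident C X" and pwS: "pw (Suc n) = f \<cdot> pw n" for n
    unfolding pw_def by simp_all
  have pw: "pw n \<in> Hom C X X" for n
    by (induction n) (use f in \<open>auto simp: pw0 pwS\<close>)
  \<comment> \<open>\<open>pe p\<close> is the value of the polynomial \<open>p\<close> at
    \<open>f\<close>; it is written as a sum because the endomorphisms of \<open>X\<close> form only
    a subspace of the ambient type. The next facts establish the one product rule needed, for a
    linear factor.\<close>
  define pe where "pe p = (\<Sum>i\<le>degree p. Scale C (Polynomial.coeff p i) (pw i))" for p
  have pe: "pe p \<in> Hom C X X" for p
    unfolding pe_def by (intro sum_in_Hom scale_in_Hom pw)
  have pe_eq: "pe p = (\<Sum>i\<le>n. Scale C (Polynomial.coeff p i) (pw i))" if "degree p \<le> n" for p n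
    unfolding pe_def using that by (intro sum.mono_neutral_left) (auto simp: coeff_eq_0)
  have pe_mult: "pe ([:- a, 1:] * q) = (f - Scale C a (Ident C X)) \<cdot> pe q" for a q
  proof -
    let ?n = "degree q"
    have deg: "degree ([:- a, 1:] * q) \<le> Suc ?n"
      using degree_mult_le[of "[:- a, 1:]" q] by simp
    have "pe ([:- a, 1:] * q) = (\<Sum>i\<le>Suc ?n. Scale C (Polynomial.coeff (pCons 0 q) i) (pw i)) - (\<Sum>i\<le>Suc ?n. Scale C (a * Polynomial.coeff q i) (pw i))"
      unfolding pe_eq[OF deg] sum_subtractf[symmetric]
      by (intro sum.cong) (auto simp: mult_pCons_left algebra_simps scale_left_diff_distrib)
    also have "(\<Sum>i\<le>Suc ?n. Scale C (Polynomial.coeff (pCons 0 q) i) (pw i)) = f \<cdot> pe q"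
    proof -
      have "(\<Sum>i\<le>Suc ?n. Scale C (Polynomial.coeff (pCons 0 q) i) (pw i)) = (\<Sum>i\<le>?n. Scale C (Polynomial.coeff q i) (f \<cdot> pw i))"
        by (subst sum.atMost_Suc_shift) (simp add: pwS)
      also have "\<dots> = f \<cdot> pe q"
        unfolding pe_def using f pw by (subst Comp_sum_right[OF f]) (auto simp: Comp_scale_right[OF f pw])
      finally show ?thesis .
    qed
    also have "(\<Sum>i\<le>Suc ?n. Scale C (a * Polynomial.coeff q i) (pw i)) = Scale C a (pe q)"
      by (simp add: pe_eq[of q "Suc ?n"] scale_sum_right scale_right_distrib)
    also have "f \<cdot> pe q - Scale C a (pe q) = (f - Scale C a (Ident C X)) \<cdot> pe q"
      using Comp_diff_left[OF f _ pe, of "Scale C a (Ident C X)" q] Comp_scale_left[OF Ident_in pe]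
      by (simp add: Ident_Comp[OF pe] scale_in_Hom)
    finally show ?thesis .
  qed
  have split: "\<exists>a. f = Scale C a (Ident C X)" if "p \<noteq> 0" "pe p = 0" for p
    using that
  proof (induction "degree p" arbitrary: p)
    case 0
    then obtain c where "p = [:c:]" "c \<noteq> 0"
      by (metis degree_eq_zeroE pCons_0_0)
    then show ?case
      using 0(3) simple_not_zero[OF X] by (simp add: pe_def pw0)
  next
    case (Suc n)
    then obtain a where "poly p a = 0"
      using alg_closed_imp_poly_has_root[of p] by auto
    then obtain q where q: "p = [:- a, 1:] * q"
      using poly_eq_0_iff_dvd[of p a] by (auto elim: dvdE)
    then have q0: "q \<noteq> 0" and dq: "n = degree q"
      using Suc.prems(1) Suc.hyps(2) by (auto simp: degree_mult_eq simp del: mult_pCons_left)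
    let ?h = "f - Scale C a (Ident C X)"
    have h: "?h \<in> Hom C X X" and hq: "?h \<cdot> pe q = 0"
      using f Suc.prems(2) pe_mult[of a q] unfolding q by auto
    show ?case
    proof (cases "?h = 0")
      case True
      then show ?thesis by auto
    next
      case False
      then have "monic C X X ?h"
        using simple_monic[OF X h] by blast
      then have "pe q = 0"
        using hq h pe[of q] unfolding monic_def by (metis Comp_0_right zero_in_Hom)
      then show ?thesis using Suc.hyps(1)[OF dq q0] by blast
    qed
  qed
  have "\<exists>p. p \<noteq> 0 \<and> pe p = 0"
  \<comment> \<open>\<open>dependent\<close> speaks about sets of vectors, so repeated powers of
    \<open>f\<close> need a separate case. Two equal powers give a difference of monomials;
    otherwise the powers form an infinite subset of a finite-dimensional space.\<close>
  proof (cases "inj pw")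
    case False
    then obtain i j where ij: "i < j" "pw i = pw j"
      by (metis injI linorder_neqE_nat)
    let ?p = "Polynomial.monom 1 j - Polynomial.monom 1 i :: 'k poly"
    have cf: "Polynomial.coeff ?p l = (if l = j then 1 else if l = i then -1 else 0)" for l
      using ij(1) by auto
    have "degree ?p \<le> j"
      using ij(1) by (intro degree_le) (auto simp: cf)
    then have "pe ?p = (\<Sum>l\<le>j. Scale C (if l = j then 1 else if l = i then -1 else 0) (pw l))"
      unfolding cf[symmetric] by (rule pe_eq)
    also have "\<dots> = (\<Sum>l\<in>{i, j}. Scale C (if l = j then 1 else if l = i then -1 else 0) (pw l))"
      using ij(1) by (intro sum.mono_neutral_right) auto
    also have "\<dots> = 0"
      using ij by (simp add: sum.insert_if)
    finally have "pe ?p = 0" .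
    moreover have "?p \<noteq> 0"
      using cf[of j] by (metis coeff_0 one_neq_zero)
    ultimately show ?thesis by blast
  next
    case True
    obtain B where B: "finite B" "Hom C X X = span B"
      using finite_dim_Hom by blast
    have "dependent (range pw)"
    proof (rule ccontr)
      assume "independent (range pw)"
      then have "finite (range pw)"
        using independent_span_bound[OF B(1)] pw B(2) by blast
      then show False using True finite_imageD infinite_UNIV_nat by blast
    qed
    then obtain t u where t: "finite t" "t \<subseteq> range pw" "(\<Sum>v\<in>t. Scale C (u v) v) = 0" "\<exists>v\<in>t. u v \<noteq> 0"
      unfolding dependent_explicit by blast
    define T where "T = pw -` t"
    have T: "finite T" "t = pw ` T"
      unfolding T_def using t(1,2) True by (auto intro: finite_vimageI)
    define p where "p = (\<Sum>i\<in>T. Polynomial.monom (u (pw i)) i)"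
    have cf: "Polynomial.coeff p i = (if i \<in> T then u (pw i) else 0)" for i
      unfolding p_def coeff_sum coeff_monom using T(1) by (auto simp: sum.delta if_distrib cong: if_cong)
    define N where "N = Max (insert 0 T)"
    have N: "i \<in> T \<Longrightarrow> i \<le> N" for i
      unfolding N_def using T(1) by simp
    have "degree p \<le> N"
      using N by (intro degree_le) (auto simp: cf not_le dest: leD)
    then have "pe p = (\<Sum>i\<le>N. Scale C (Polynomial.coeff p i) (pw i))"
      by (rule pe_eq)
    also have "\<dots> = (\<Sum>i\<in>T. Scale C (u (pw i)) (pw i))"
      using N by (intro sum.mono_neutral_cong_right) (auto simp: cf)
    also have "\<dots> = 0"
      using t(3) sum.reindex[of pw T "\<lambda>v. Scale C (u v) v"] True unfolding T(2) by (simp add: inj_on_subset)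
    finally have "pe p = 0" .
    moreover have "p \<noteq> 0"
      using t(4) cf unfolding T(2) by (metis coeff_0 imageE)
    ultimately show ?thesis by blast
  qed
  then show ?thesis using split that by blast
qed

end

section \<open>Braided and ribbon fusion categories\<close>

context braided_fusion_category
begin

lemma isomorphic_TObj_comm: "isomorphic C (X \<otimes>\<^sub>o Y) (Y \<otimes>\<^sub>o X)"
  using Braid_iso unfolding isomorphic_def by blast

lemma tens_middle_four: "isomorphic C ((A \<otimes>\<^sub>o B) \<otimes>\<^sub>o (A' \<otimes>\<^sub>o B')) ((A \<otimes>\<^sub>o A') \<otimes>\<^sub>o (B \<otimes>\<^sub>o B'))"
proof -
  have "isomorphic C (B \<otimes>\<^sub>o (A' \<otimes>\<^sub>o B')) ((B \<otimes>\<^sub>o A') \<otimes>\<^sub>o B')"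
    by (rule isomorphic_sym[OF isomorphic_assoc])
  also have "isomorphic C \<dots> ((A' \<otimes>\<^sub>o B) \<otimes>\<^sub>o B')"
    by (rule isomorphic_TObj[OF isomorphic_TObj_comm isomorphic_refl])
  also have "isomorphic C \<dots> (A' \<otimes>\<^sub>o (B \<otimes>\<^sub>o B'))"
    by (rule isomorphic_assoc)
  finally have *: "isomorphic C (B \<otimes>\<^sub>o (A' \<otimes>\<^sub>o B')) (A' \<otimes>\<^sub>o (B \<otimes>\<^sub>o B'))" .
  have "isomorphic C ((A \<otimes>\<^sub>o B) \<otimes>\<^sub>o (A' \<otimes>\<^sub>o B')) (A \<otimes>\<^sub>o (B \<otimes>\<^sub>o (A' \<otimes>\<^sub>o B')))"
    by (rule isomorphic_assoc)
  also have "isomorphic C \<dots> (A \<otimes>\<^sub>o (A' \<otimes>\<^sub>o (B \<otimes>\<^sub>o B')))"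
    by (rule isomorphic_TObj[OF isomorphic_refl *])
  also have "isomorphic C \<dots> ((A \<otimes>\<^sub>o A') \<otimes>\<^sub>o (B \<otimes>\<^sub>o B'))"
    by (rule isomorphic_sym[OF isomorphic_assoc])
  finally show ?thesis .
qed

end

context ribbon_fusion_category
begin

text \<open>Morphisms of \<open>C\<close> do not determine their objects, so arrows are triples of domain, morphism and
  codomain.\<close>

definition t_dom :: "'a \<times> 'b \<times> 'a \<Rightarrow> 'a" where "t_dom F = fst F"
definition t_mor :: "'a \<times> 'b \<times> 'a \<Rightarrow> 'b" where "t_mor F = fst (snd F)"
definition t_cod :: "'a \<times> 'b \<times> 'a \<Rightarrow> 'a" where "t_cod F = snd (snd F)"

definition t_arr where "t_arr F \<longleftrightarrow> t_mor F \<in> Hom C (t_dom F) (t_cod F)"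
definition t_idn where "t_idn X = (X, Ident C X, X)"
definition t_comp where "t_comp G F = (t_dom F, t_mor G \<cdot> t_mor F, t_cod G)"
definition t_tens where "t_tens F G = (t_dom F \<otimes>\<^sub>o t_dom G, t_mor F \<otimes>\<^sub>m t_mor G, t_cod F \<otimes>\<^sub>o t_cod G)"
definition t_smul where "t_smul a F = (t_dom F, Scale C a (t_mor F), t_cod F)"
definition t_inv where "t_inv F = (t_cod F, inverse_mor C (t_dom F) (t_cod F) (t_mor F), t_dom F)"
definition t_asc where "t_asc X Y Z = ((X \<otimes>\<^sub>o Y) \<otimes>\<^sub>o Z, Assoc C X Y Z, X \<otimes>\<^sub>o (Y \<otimes>\<^sub>o Z))"
definition t_lu where "t_lu X = (\<I> \<otimes>\<^sub>o X, LUnit C X, X)"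
definition t_ru where "t_ru X = (X \<otimes>\<^sub>o \<I>, RUnit C X, X)"
definition t_br where "t_br X Y = (X \<otimes>\<^sub>o Y, Braid C X Y, Y \<otimes>\<^sub>o X)"
definition t_tw where "t_tw X = (X, Twist C X, X)"

lemmas t_defs = t_dom_def t_mor_def t_cod_def t_arr_def t_idn_def t_comp_def t_tens_def t_smul_def
  t_inv_def t_asc_def t_lu_def t_ru_def t_br_def t_tw_def

sublocale cat: monoidal_arrows t_arr t_dom t_cod t_idn t_comp "(\<otimes>\<^sub>o)" \<I> t_tens
  t_asc "\<lambda>X Y Z. t_inv (t_asc X Y Z)" t_lu "\<lambda>X. t_inv (t_lu X)" t_ru "\<lambda>X. t_inv (t_ru X)" t_smul
  by standard (auto simp: t_defs Comp_assoc Ident_Comp Comp_Ident TMor_Comp TMor_Ident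
      Comp_scale_left Comp_scale_right TMor_scale_left TMor_scale_right Assoc_natural LUnit_natural RUnit_natural
      pentagon triangle inverse_mor[OF Assoc_iso] inverse_mor[OF LUnit_iso] inverse_mor[OF RUnit_iso]
      intro!: scale_in_Hom)

lemma inv_pair_isomorphism: "isomorphism C X Y f \<Longrightarrow> \<exists>b. cat.inv_pair (X, f, Y) b"
  unfolding cat.inv_pair_def
  by (rule exI[of _ "(Y, inverse_mor C X Y f, X)"]) (simp add: t_defs inverse_mor)

sublocale cat: ribbon_arrows t_arr t_dom t_cod t_idn t_comp "(\<otimes>\<^sub>o)" \<I> t_tens
  t_asc "\<lambda>X Y Z. t_inv (t_asc X Y Z)" t_lu "\<lambda>X. t_inv (t_lu X)" t_ru "\<lambda>X. t_inv (t_ru X)" t_smul t_br t_tw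
proof
  show "\<exists>b. cat.inv_pair (t_br X Y) b" for X Y
    unfolding t_br_def by (rule inv_pair_isomorphism[OF Braid_iso])
qed (auto simp: t_defs inverse_mor(1)[OF Braid_iso] inverse_mor(1)[OF Twist_iso] Braid_natural
    hexagon1 hexagon2 Twist_natural Twist_tensor)

definition t_ev where "t_ev X = (Dual C X \<otimes>\<^sub>o X, Ev C X, \<I>)"
definition t_coev where "t_coev X = (\<I>, Coev C X, X \<otimes>\<^sub>o Dual C X)"

lemma cat_left_dual: "cat.left_dual X (Dual C X) (t_ev X) (t_coev X)"
  using left_dual[of X] unfolding cat.left_dual_def is_left_dual_def
  by (simp add: t_defs t_ev_def t_coev_def)

text \<open>The endomorphism of the unit object of which \<open>quantum_trace\<close> is the scalar.\<close>

definition qtr_mor where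
  "qtr_mor X f = Ev C X \<cdot> Braid C X (Dual C X) \<cdot> ((Twist C X \<cdot> f) \<otimes>\<^sub>m Ident C (Dual C X)) \<cdot> Coev C X"

lemma atr_eq: "cat.atr X (Dual C X) (t_ev X) (t_coev X) (X, f, X) = (\<I>, qtr_mor X f, \<I>)"
  unfolding cat.atr_def qtr_mor_def by (simp add: t_defs t_ev_def t_coev_def)

lemma qtr_mor_cyclic:
  assumes "f \<in> Hom C X Y" "g \<in> Hom C Y X"
  shows "qtr_mor X (g \<cdot> f) = qtr_mor Y (f \<cdot> g)"
  using cat.atr_cyclic[OF cat_left_dual[of X] cat_left_dual[of Y], of "(X, f, Y)" "(Y, g, X)"] assms
  by (simp add: t_comp_def t_dom_def t_mor_def t_cod_def t_arr_def atr_eq)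

lemma Ev_in: "Ev C X \<in> Hom C (Dual C X \<otimes>\<^sub>o X) \<I>" and Coev_in: "Coev C X \<in> Hom C \<I> (X \<otimes>\<^sub>o Dual C X)"
  using left_dual[of X] unfolding is_left_dual_def by auto

lemma Braid_in: "Braid C X Y \<in> Hom C (X \<otimes>\<^sub>o Y) (Y \<otimes>\<^sub>o X)"
  and Twist_in: "Twist C X \<in> Hom C X X"
  using inverse_mor(1)[OF Braid_iso] inverse_mor(1)[OF Twist_iso] by auto

lemma qtr_mor_in: "f \<in> Hom C X X \<Longrightarrow> qtr_mor X f \<in> Hom C \<I> \<I>"
  unfolding qtr_mor_def
  by (rule Comp_in[OF Ev_in Comp_in[OF Braid_in Comp_in[OF TMor_in[OF Comp_in[OF Twist_in] Ident_in] Coev_in]]])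

lemma qtr_mor_add:
  assumes f: "f \<in> Hom C X X" and g: "g \<in> Hom C X X"
  shows "qtr_mor X (f + g) = qtr_mor X f + qtr_mor X g"
proof -
  note T = Twist_in[of X] and I = Ident_in[of "Dual C X"]
  note h = TMor_in[OF Comp_in[OF T f] I] TMor_in[OF Comp_in[OF T g] I]
  show ?thesis
    unfolding qtr_mor_def Comp_add_right[OF T f g] TMor_add_left[OF Comp_in[OF T f] Comp_in[OF T g] I]
      Comp_add_left[OF h Coev_in] Comp_add_right[OF Braid_in Comp_in[OF h(1) Coev_in] Comp_in[OF h(2) Coev_in]]
    by (rule Comp_add_right[OF Ev_in Comp_in[OF Braid_in Comp_in[OF h(1) Coev_in]]
          Comp_in[OF Braid_in Comp_in[OF h(2) Coev_in]]])
qed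

lemma qtr_mor_scale:
  assumes f: "f \<in> Hom C X X"
  shows "qtr_mor X (Scale C a f) = Scale C a (qtr_mor X f)"
proof -
  note T = Twist_in[of X] and I = Ident_in[of "Dual C X"]
  note h = TMor_in[OF Comp_in[OF T f] I]
  show ?thesis
    unfolding qtr_mor_def Comp_scale_right[OF T f] TMor_scale_left[OF Comp_in[OF T f] I]
      Comp_scale_left[OF h Coev_in] Comp_scale_right[OF Braid_in Comp_in[OF h Coev_in]]
    by (rule Comp_scale_right[OF Ev_in Comp_in[OF Braid_in Comp_in[OF h Coev_in]]])
qed

abbreviation dbr where "dbr X Y \<equiv> Braid C Y X \<cdot> Braid C X Y"

lemma dbr_in: "dbr X Y \<in> Hom C (X \<otimes>\<^sub>o Y) (X \<otimes>\<^sub>o Y)"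
  using Comp_in[OF Braid_in Braid_in] .

text \<open>Schur's lemma for \<open>X\<close> enters as a hypothesis, since the field is still
  arbitrary in this locale.\<close>

lemma qtr_mor_dbr_tens:
  assumes simple: "\<And>f. f \<in> Hom C X X \<Longrightarrow> \<exists>a. f = Scale C a (Ident C X)"
  obtains a where "qtr_mor (X \<otimes>\<^sub>o Z) (dbr X Z) = Scale C a (qtr_mor X (Ident C X))"
    "qtr_mor (X \<otimes>\<^sub>o (Y \<otimes>\<^sub>o Z)) (dbr X (Y \<otimes>\<^sub>o Z)) = Scale C a (qtr_mor (Y \<otimes>\<^sub>o X) (dbr Y X))"
proof -
  have db: "cat.db X Y = (X \<otimes>\<^sub>o Y, dbr X Y, X \<otimes>\<^sub>o Y)" for X Y
    by (simp add: t_defs)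
  have id: "t_idn X = (X, Ident C X, X)" for X
    by (simp add: t_defs)
  have simple': "\<exists>a. F = t_smul a (t_idn X)" if "t_arr F" "t_dom F = X" "t_cod F = X" for F
    using that simple[of "t_mor F"] by (cases F) (auto simp: t_defs)
  show ?thesis
    by (rule cat.atr_db_tens[OF cat_left_dual[of X] cat_left_dual[of Y] cat_left_dual[of Z] cat_left_dual
          cat_left_dual cat_left_dual simple'])
      (auto simp: db id atr_eq t_smul_def t_dom_def t_mor_def t_cod_def intro: that)
qed

lemma dbr_natural_left:
  assumes f: "f \<in> Hom C X X'"
  shows "dbr X' Y \<cdot> (f \<otimes>\<^sub>m Ident C Y) = (f \<otimes>\<^sub>m Ident C Y) \<cdot> dbr X Y"
proof -
  have "dbr X' Y \<cdot> (f \<otimes>\<^sub>m Ident C Y) = Braid C Y X' \<cdot> ((Ident C Y \<otimes>\<^sub>m f) \<cdot> Braid C X Y)"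
    using Comp_assoc[OF Braid_in Braid_in TMor_in[OF f Ident_in]] Braid_natural[OF f Ident_in[of Y]] by simp
  also have "\<dots> = ((f \<otimes>\<^sub>m Ident C Y) \<cdot> Braid C Y X) \<cdot> Braid C X Y"
    unfolding Comp_assoc[OF Braid_in TMor_in[OF Ident_in f] Braid_in, symmetric] Braid_natural[OF Ident_in[of Y] f] ..
  also have "\<dots> = (f \<otimes>\<^sub>m Ident C Y) \<cdot> dbr X Y"
    by (rule Comp_assoc[OF TMor_in[OF f Ident_in] Braid_in Braid_in])
  finally show ?thesis .
qed

lemma dbr_natural_right:
  assumes f: "f \<in> Hom C Y Y'"
  shows "dbr X Y' \<cdot> (Ident C X \<otimes>\<^sub>m f) = (Ident C X \<otimes>\<^sub>m f) \<cdot> dbr X Y"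
proof -
  have "dbr X Y' \<cdot> (Ident C X \<otimes>\<^sub>m f) = Braid C Y' X \<cdot> ((f \<otimes>\<^sub>m Ident C X) \<cdot> Braid C X Y)"
    using Comp_assoc[OF Braid_in Braid_in TMor_in[OF Ident_in f]] Braid_natural[OF Ident_in[of X] f] by simp
  also have "\<dots> = ((Ident C X \<otimes>\<^sub>m f) \<cdot> Braid C Y X) \<cdot> Braid C X Y"
    unfolding Comp_assoc[OF Braid_in TMor_in[OF f Ident_in] Braid_in, symmetric] Braid_natural[OF f Ident_in[of X]] ..
  also have "\<dots> = (Ident C X \<otimes>\<^sub>m f) \<cdot> dbr X Y"
    by (rule Comp_assoc[OF TMor_in[OF Ident_in f] Braid_in Braid_in])
  finally show ?thesis .
qed

lemma dbr_tens_scale: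
  assumes "dbr X Y = Scale C a (Ident C (X \<otimes>\<^sub>o Y))" "dbr X Z = Scale C b (Ident C (X \<otimes>\<^sub>o Z))"
  shows "dbr X (Y \<otimes>\<^sub>o Z) = Scale C (b * a) (Ident C (X \<otimes>\<^sub>o (Y \<otimes>\<^sub>o Z)))"
  using cat.db_tens_smul[where x = X and y = Y and z = Z and a = a and b = b] assms by (simp add: t_defs)

text \<open>\<open>dbr Y X\<close> is \<open>dbr X Y\<close> conjugated by
  \<open>Braid C Y X\<close>, and conjugation fixes scalars.\<close>

lemma dbr_swap_scale:
  assumes "dbr X Y = Scale C a (Ident C (X \<otimes>\<^sub>o Y))"
  shows "dbr Y X = Scale C a (Ident C (Y \<otimes>\<^sub>o X))"
proof -
  note B = inverse_mor[OF Braid_iso[of Y X]]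
  have "dbr Y X = (inverse_mor C (Y \<otimes>\<^sub>o X) (X \<otimes>\<^sub>o Y) (Braid C Y X) \<cdot> Braid C Y X) \<cdot> dbr Y X"
    unfolding B(3) using Ident_Comp[OF dbr_in] by simp
  also have "\<dots> = inverse_mor C (Y \<otimes>\<^sub>o X) (X \<otimes>\<^sub>o Y) (Braid C Y X) \<cdot> (dbr X Y \<cdot> Braid C Y X)"
    using Comp_assoc[OF B(2,1) dbr_in] Comp_assoc[OF Braid_in Braid_in Braid_in[of Y X]] by simp
  also have "dbr X Y \<cdot> Braid C Y X = Scale C a (Braid C Y X)"
    unfolding assms using Comp_scale_left[OF Ident_in B(1)] Ident_Comp[OF B(1)] by simp
  also have "inverse_mor C (Y \<otimes>\<^sub>o X) (X \<otimes>\<^sub>o Y) (Braid C Y X) \<cdot> Scale C a (Braid C Y X) = Scale C a (Ident C (Y \<otimes>\<^sub>o X))"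
    using Comp_scale_right[OF B(2,1)] B(3) by simp
  finally show ?thesis .
qed

end

section \<open>Dimensions of hom-spaces\<close>

context acf_fusion_category
begin

abbreviation hdim :: "'o \<Rightarrow> 'o \<Rightarrow> nat" where "hdim X Y \<equiv> dim (Hom C X Y)"

lemma multiplicity_in_eq: "multiplicity_in C X Y = hdim X Y"
  unfolding multiplicity_in_def ..

lemma hdim_bij:
  assumes bij: "bij_betw f (Hom C X Y) (Hom C X' Y')"
    and add: "\<And>x y. \<lbrakk>x \<in> Hom C X Y; y \<in> Hom C X Y\<rbrakk> \<Longrightarrow> f (x + y) = f x + f y"
    and sc: "\<And>a x. x \<in> Hom C X Y \<Longrightarrow> f (Scale C a x) = Scale C a (f x)"
  shows "hdim X Y = hdim X' Y'"
proof -
  obtain B where B: "finite B" "Hom C X Y = span B"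
    using finite_dim_Hom by blast
  show ?thesis
    by (rule dim_eq_of_bij[OF subspace_Hom B(1) _ subspace_Hom bij add sc]) (use B in auto)
qed

lemma Hom_simple_scale:
  assumes X: "simple_object C X" and u: "isomorphism C X Y u" and f: "f \<in> Hom C X Y"
  obtains a where "f = Scale C a u"
proof -
  note u = inverse_mor[OF u]
  obtain a where a: "inverse_mor C X Y u \<cdot> f = Scale C a (Ident C X)"
    using schur[OF X Comp_in[OF u(2) f]] .
  have "f = (u \<cdot> inverse_mor C X Y u) \<cdot> f"
    using u(4) Ident_Comp[OF f] by simp
  also have "\<dots> = u \<cdot> Scale C a (Ident C X)"
    using Comp_assoc[OF u(1,2) f] a by simp
  also have "\<dots> = Scale C a u"
    using Comp_scale_right[OF u(1) Ident_in] Comp_Ident[OF u(1)] by simp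
  finally show ?thesis using that by blast
qed

definition decomp :: "'o \<Rightarrow> 'o list \<Rightarrow> bool" where
  "decomp Z Xs \<longleftrightarrow> is_direct_sum C Z Xs \<and> (\<forall>X\<in>set Xs. simple_object C X)"

lemma decompD:
  assumes "decomp Z Xs"
  shows "is_direct_sum C Z Xs" "X \<in> set Xs \<Longrightarrow> simple_object C X"
  using assms unfolding decomp_def by auto

lemma ex_decomp: "\<exists>Xs. decomp Z Xs"
  using semisimple[of Z] unfolding decomp_def by blast

lemma decomp_single: "simple_object C X \<Longrightarrow> decomp X [X]"
  unfolding decomp_def by (simp add: is_direct_sum_single)

lemma decomp_iso: "\<lbrakk>decomp Z Xs; isomorphic C Z Z'\<rbrakk> \<Longrightarrow> decomp Z' Xs"
  unfolding decomp_def using is_direct_sum_iso by blast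

text \<open>Schur's lemma in matrix form. One isomorphism \<open>u\<close> is fixed for every
  isomorphic pair of summands; the composites of a projection of \<open>A\<close>, such a
  \<open>u\<close> and an inclusion into \<open>B\<close> form a basis. Expanding both identity
  morphisms shows that they span.\<close>

lemma hdim_decomp:
  assumes DA: "decomp A Xs" and DB: "decomp B Ys"
  shows "hdim A B = card {(j, l). j < length Xs \<and> l < length Ys \<and> isomorphic C (Xs ! j) (Ys ! l)}" (is "_ = card ?P")
proof -
  note A = decompD[OF DA] and B = decompD[OF DB]
  obtain \<iota> \<pi> where ds: "sum_system Xs A \<iota> \<pi>"
    using A(1) unfolding is_direct_sum_iff by blast
  note i = sum_systemD(1)[OF ds] and p = sum_systemD(2)[OF ds]
    and pi = sum_systemD(3)[OF ds] and s = sum_systemD(4)[OF ds]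
  obtain \<iota>' \<pi>' where ds': "sum_system Ys B \<iota>' \<pi>'"
    using B(1) unfolding is_direct_sum_iff by blast
  note i' = sum_systemD(1)[OF ds'] and p' = sum_systemD(2)[OF ds']
    and pi' = sum_systemD(3)[OF ds'] and s' = sum_systemD(4)[OF ds']
  define u where "u q = (SOME u. isomorphism C (Xs ! fst q) (Ys ! snd q) u)" for q
  have u: "isomorphism C (Xs ! fst q) (Ys ! snd q) (u q)" if "q \<in> ?P" for q
    unfolding u_def by (rule someI_ex) (use that in \<open>auto simp: isomorphic_def\<close>)
  note uin = inverse_mor(1)[OF u]
  have finP: "finite ?P"
    by (rule finite_subset[of _ "{..<length Xs} \<times> {..<length Ys}"]) auto
  define b where "b q = \<iota>' (snd q) \<cdot> u q \<cdot> \<pi> (fst q)" for q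
  have bin: "b q \<in> Hom C A B" if "q \<in> ?P" for q
    unfolding b_def using that by (intro Comp_in[OF i' Comp_in[OF uin p]]) auto
  \<comment> \<open>Viewed as a matrix between the summands, \<open>b q\<close> has a single nonzero
    entry, at \<open>q\<close>. Injectivity of \<open>b\<close> and linear independence are both
    read off from the entries.\<close>
  have bproj: "\<pi>' (snd r) \<cdot> (b q \<cdot> \<iota> (fst r)) = (if q = r then u q else 0)" if q: "q \<in> ?P" and r: "r \<in> ?P" for q r
  proof -
    obtain j l j' l' where [simp]: "q = (j, l)" "r = (j', l')"
      and jl: "j < length Xs" "l < length Ys" "j' < length Xs" "l' < length Ys"
      using q r by auto
    have ui: "u q \<in> Hom C (Xs ! j) (Ys ! l)"
      using uin[OF q] by simp
    have "\<pi>' l' \<cdot> ((\<iota>' l \<cdot> u q \<cdot> \<pi> j) \<cdot> \<iota> j') = \<pi>' l' \<cdot> (\<iota>' l \<cdot> (u q \<cdot> (\<pi> j \<cdot> \<iota> j')))"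
      using Comp_assoc[OF i' Comp_in[OF ui p] i] Comp_assoc[OF ui p i] jl by simp
    also have "\<dots> = (\<pi>' l' \<cdot> \<iota>' l) \<cdot> (u q \<cdot> (\<pi> j \<cdot> \<iota> j'))"
      by (rule Comp_assoc[OF p' i' Comp_in[OF ui Comp_in[OF p i]], symmetric]) (use jl in auto)
    also have "\<dots> = (if q = r then u q else 0)"
      using jl ui Comp_0_left[OF Comp_in[OF ui Comp_in[OF p i]]] Comp_0_right[OF ui] Comp_Ident[OF ui] Ident_Comp[OF ui]
        Comp_0_left[OF ui] Comp_0_right[OF Ident_in]
      by (auto simp: pi pi')
    finally show ?thesis
      unfolding b_def by simp
  qed
  have unz: "u q \<noteq> 0" if "q \<in> ?P" for q
    using simple_Hom_nonzero[OF _ u[OF that]] A(2) that by auto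
  have inj: "inj_on b ?P"
  proof (rule inj_onI)
    fix q r assume "q \<in> ?P" "r \<in> ?P" "b q = b r"
    then show "q = r"
      using bproj[of q r] bproj[of r r] unz[of r] by (metis (no_types, lifting))
  qed
  have "independent (b ` ?P)"
  proof (subst dependent_finite)
    show "finite (b ` ?P)" using finP by simp
    show "\<not> (\<exists>c. (\<exists>v\<in>b ` ?P. c v \<noteq> 0) \<and> (\<Sum>v\<in>b ` ?P. Scale C (c v) v) = 0)"
    proof (intro notI, elim exE conjE bexE)
      fix c v assume v: "v \<in> b ` ?P" "c v \<noteq> 0" and 0: "(\<Sum>v\<in>b ` ?P. Scale C (c v) v) = 0"
      obtain r where r: "r \<in> ?P" "v = b r" using v(1) by auto
      have jl: "fst r < length Xs" "snd r < length Ys" using r(1) by auto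
      have "0 = \<pi>' (snd r) \<cdot> ((\<Sum>q\<in>?P. Scale C (c (b q)) (b q)) \<cdot> \<iota> (fst r))"
        using 0 p'[OF jl(2)] i[OF jl(1)] by (simp add: sum.reindex[OF inj])
      also have "(\<Sum>q\<in>?P. Scale C (c (b q)) (b q)) \<cdot> \<iota> (fst r) = (\<Sum>q\<in>?P. Scale C (c (b q)) (b q) \<cdot> \<iota> (fst r))"
        by (rule Comp_sum_left[OF scale_in_Hom[OF bin] i[OF jl(1)]])
      also have "\<dots> = (\<Sum>q\<in>?P. Scale C (c (b q)) (b q \<cdot> \<iota> (fst r)))"
        by (intro sum.cong refl Comp_scale_left[OF bin i[OF jl(1)]])
      also have "\<pi>' (snd r) \<cdot> \<dots> = (\<Sum>q\<in>?P. \<pi>' (snd r) \<cdot> Scale C (c (b q)) (b q \<cdot> \<iota> (fst r)))"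
        by (rule Comp_sum_right[OF p'[OF jl(2)] scale_in_Hom[OF Comp_in[OF bin i[OF jl(1)]]]])
      also have "\<dots> = (\<Sum>q\<in>?P. Scale C (c (b q)) (\<pi>' (snd r) \<cdot> (b q \<cdot> \<iota> (fst r))))"
        by (intro sum.cong refl Comp_scale_right[OF p'[OF jl(2)] Comp_in[OF bin i[OF jl(1)]]])
      also have "\<dots> = (\<Sum>q\<in>?P. if q = r then Scale C (c (b r)) (u r) else 0)"
        using bproj[OF _ r(1)] by (intro sum.cong) auto
      also have "\<dots> = Scale C (c v) (u r)"
        using finP r by simp
      finally show False using v(2) unz[OF r(1)] by simp
    qed
  qed
  moreover have "span (b ` ?P) = span (Hom C A B)"
  proof
    show "span (b ` ?P) \<subseteq> span (Hom C A B)"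
      using bin by (intro span_mono) auto
    have "f \<in> span (b ` ?P)" if f: "f \<in> Hom C A B" for f
    proof -
      have "f = Ident C B \<cdot> (f \<cdot> Ident C A)"
        using Comp_Ident[OF f] Ident_Comp[OF f] by simp
      also have "\<dots> = (\<Sum>l<length Ys. (\<iota>' l \<cdot> \<pi>' l) \<cdot> (f \<cdot> Ident C A))"
        unfolding s'[symmetric] by (rule Comp_sum_left[OF Comp_in[OF i' p'] Comp_in[OF f Ident_in]]) simp_all
      also have "\<dots> = (\<Sum>l<length Ys. \<Sum>j<length Xs. (\<iota>' l \<cdot> \<pi>' l) \<cdot> (f \<cdot> (\<iota> j \<cdot> \<pi> j)))"
      proof (rule sum.cong[OF refl])
        fix l assume "l \<in> {..<length Ys}"
        then have l: "\<iota>' l \<cdot> \<pi>' l \<in> Hom C B B" by (intro Comp_in[OF i' p']) simp_all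
        have eq: "f \<cdot> Ident C A = (\<Sum>j<length Xs. f \<cdot> (\<iota> j \<cdot> \<pi> j))"
          unfolding s[symmetric] by (rule Comp_sum_right[OF f Comp_in[OF i p]]) simp_all
        show "(\<iota>' l \<cdot> \<pi>' l) \<cdot> (f \<cdot> Ident C A) = (\<Sum>j<length Xs. (\<iota>' l \<cdot> \<pi>' l) \<cdot> (f \<cdot> (\<iota> j \<cdot> \<pi> j)))"
          unfolding eq by (rule Comp_sum_right[OF l Comp_in[OF f Comp_in[OF i p]]]) simp_all
      qed
      also have "\<dots> \<in> span (b ` ?P)"
      proof (intro span_sum)
        fix l j assume "l \<in> {..<length Ys}" "j \<in> {..<length Xs}"
        then have lj: "l < length Ys" "j < length Xs" by auto
        let ?m = "\<pi>' l \<cdot> (f \<cdot> \<iota> j)"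
        have m: "?m \<in> Hom C (Xs ! j) (Ys ! l)"
          using Comp_in[OF p'[OF lj(1)] Comp_in[OF f i[OF lj(2)]]] .
        have eq: "(\<iota>' l \<cdot> \<pi>' l) \<cdot> (f \<cdot> (\<iota> j \<cdot> \<pi> j)) = \<iota>' l \<cdot> (?m \<cdot> \<pi> j)"
          using Comp_assoc[OF i'[OF lj(1)] p'[OF lj(1)] Comp_in[OF f Comp_in[OF i[OF lj(2)] p[OF lj(2)]]]]
            Comp_assoc[OF p'[OF lj(1)] Comp_in[OF f i[OF lj(2)]] p[OF lj(2)]] Comp_assoc[OF f i[OF lj(2)] p[OF lj(2)]]
          by simp
        show "(\<iota>' l \<cdot> \<pi>' l) \<cdot> (f \<cdot> (\<iota> j \<cdot> \<pi> j)) \<in> span (b ` ?P)"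
        proof (cases "?m = 0")
          case True
          then show ?thesis
            unfolding eq using p[OF lj(2)] i'[OF lj(1)] by (auto simp: span_zero)
        next
          case False
          then have q: "(j, l) \<in> ?P"
            using simple_Hom_iso[OF A(2) B(2) m] lj unfolding isomorphic_def by auto
          obtain a where a: "?m = Scale C a (u (j, l))"
            using Hom_simple_scale[OF A(2) u[OF q], of ?m] m lj by auto
          have uj: "u (j, l) \<in> Hom C (Xs ! j) (Ys ! l)"
            using uin[OF q] by simp
          have "\<iota>' l \<cdot> (?m \<cdot> \<pi> j) = Scale C a (b (j, l))"
            unfolding a b_def using Comp_scale_left[OF uj p[OF lj(2)]] Comp_scale_right[OF i'[OF lj(1)] Comp_in[OF uj p[OF lj(2)]]]
            by simp
          then show ?thesis
            unfolding eq using q by (auto intro: span_scale span_base)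
        qed
      qed
      finally show ?thesis .
    qed
    then show "span (Hom C A B) \<subseteq> span (b ` ?P)"
      by (simp add: span_minimal subsetI)
  qed
  ultimately show ?thesis
    using dim_eq_card[of "b ` ?P" "Hom C A B"] card_image[OF inj] by simp
qed

text \<open>An effect of semisimplicity: counting pairs of isomorphic summands is symmetric.\<close>

lemma hdim_sym: "hdim A B = hdim B A"
proof -
  obtain Xs where A: "decomp A Xs"
    using ex_decomp by blast
  obtain Ys where B: "decomp B Ys"
    using ex_decomp by blast
  have "bij_betw (\<lambda>(j, l). (l, j))
      {(j, l). j < length Xs \<and> l < length Ys \<and> isomorphic C (Xs ! j) (Ys ! l)}
      {(j, l). j < length Ys \<and> l < length Xs \<and> isomorphic C (Ys ! j) (Xs ! l)}"
    by (rule bij_betwI[of _ _ _ "\<lambda>(j, l). (l, j)"]) (auto intro: isomorphic_sym)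
  then show ?thesis
    unfolding hdim_decomp[OF A B] hdim_decomp[OF B A] by (rule bij_betw_same_card)
qed

lemma hdim_iso:
  assumes "isomorphic C A A'" "isomorphic C B B'"
  shows "hdim A B = hdim A' B'"
proof -
  obtain Xs where A: "decomp A Xs"
    using ex_decomp by blast
  obtain Ys where B: "decomp B Ys"
    using ex_decomp by blast
  show ?thesis
    unfolding hdim_decomp[OF A B]
      hdim_decomp[OF decomp_iso[OF A assms(1)] decomp_iso[OF B assms(2)]] ..
qed

lemma hdim_simple_left:
  assumes "simple_object C W" "decomp A Xs"
  shows "hdim W A = card {j. j < length Xs \<and> isomorphic C W (Xs ! j)}"
proof -
  have *: "{(j, l). j < length [W] \<and> l < length Xs \<and> isomorphic C ([W] ! j) (Xs ! l)}
      = (\<lambda>l. (0, l)) ` {j. j < length Xs \<and> isomorphic C W (Xs ! j)}"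
    by auto
  have "hdim W A = card {(j, l). j < length [W] \<and> l < length Xs \<and> isomorphic C ([W] ! j) (Xs ! l)}"
    using assms by (intro hdim_decomp decomp_single)
  also have "\<dots> = card {j. j < length Xs \<and> isomorphic C W (Xs ! j)}"
    unfolding * by (rule card_image) (auto intro: inj_onI)
  finally show ?thesis .
qed

lemma hdim_simple:
  assumes "simple_object C X" "simple_object C Y"
  shows "hdim X Y = (if isomorphic C X Y then 1 else 0)"
proof -
  have "hdim X Y = card {j. j < length [Y] \<and> isomorphic C X ([Y] ! j)}"
    using assms by (intro hdim_simple_left decomp_single)
  also have "{j. j < length [Y] \<and> isomorphic C X ([Y] ! j)} = (if isomorphic C X Y then {0} else {})"
    by auto
  finally show ?thesis by simp
qed

lemma hdim_pos_iff: "hdim A B > 0 \<longleftrightarrow> (\<exists>f\<in>Hom C A B. f \<noteq> 0)"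
proof -
  obtain B' where B': "B' \<subseteq> Hom C A B" "independent B'" "Hom C A B \<subseteq> span B'" "card B' = hdim A B"
    using basis_exists[of "Hom C A B"] by blast
  obtain B0 where B0: "finite B0" "Hom C A B = span B0"
    using finite_dim_Hom by blast
  have fin: "finite B'"
    using independent_span_bound[OF B0(1) B'(2)] B'(1) B0(2) by blast
  show ?thesis
  proof
    assume "hdim A B > 0"
    then have "B' \<noteq> {}" using B'(4) by auto
    then obtain f where f: "f \<in> B'" by blast
    have "f \<noteq> 0"
    proof
      assume "f = 0"
      then have "dependent B'" using f by (intro dependent_zero) simp
      then show False using B'(2) by simp
    qed
    then show "\<exists>f\<in>Hom C A B. f \<noteq> 0"
      using f B'(1) by (intro bexI[of _ f]) auto
  next
    assume "\<exists>f\<in>Hom C A B. f \<noteq> 0"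
    then have "B' \<noteq> {}" using B'(3) by auto
    then show "hdim A B > 0" unfolding B'(4)[symmetric] using fin by (simp add: card_gt_0_iff)
  qed
qed

text \<open>The diagonal pairs alone bound \<open>length Xs\<close> by the dimension of the
  endomorphism space, so \<open>X\<close> has exactly one simple summand. This is the criterion by
  which later objects are recognized as simple.\<close>

lemma hdim_one_simple:
  assumes "hdim X X = 1"
  shows "simple_object C X"
proof -
  obtain Xs where X: "decomp X Xs"
    using ex_decomp by blast
  let ?P = "{(j, l). j < length Xs \<and> l < length Xs \<and> isomorphic C (Xs ! j) (Xs ! l)}"
  have fin: "finite ?P"
    by (rule finite_subset[of _ "{..<length Xs} \<times> {..<length Xs}"]) auto
  have "card ((\<lambda>j. (j, j)) ` {..<length Xs}) \<le> card ?P"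
    by (rule card_mono[OF fin]) auto
  then have "length Xs \<le> card ?P"
    by (subst (asm) card_image) (auto simp: inj_on_def)
  moreover have "card ?P = 1"
    using assms hdim_decomp[OF X X] by simp
  moreover have "Xs \<noteq> []"
    using calculation(2) by auto
  ultimately have "length Xs = 1"
    by (cases Xs) auto
  then obtain Y where Xs: "Xs = [Y]"
    by (cases Xs) auto
  then have iso: "isomorphic C X Y" and Y: "simple_object C Y"
    using decompD[OF X] is_direct_sum_single_iff by auto
  \<comment> \<open>Simplicity is carried from \<open>Y\<close> to \<open>X\<close> by hand, because
    \<open>simple_iso\<close> is itself derived from this lemma.\<close>
  show ?thesis
    unfolding simple_object_def
  proof (intro conjI allI impI)
    obtain f g where f: "f \<in> Hom C X Y" "g \<in> Hom C Y X" "g \<cdot> f = Ident C X" "f \<cdot> g = Ident C Y"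
      using isomorphicE[OF iso] .
    show "\<not> zero_object C X"
    proof
      assume "zero_object C X"
      then have "f = 0"
        using Comp_Ident[OF f(1)] f(1) unfolding zero_object_iff by simp
      then show False
        using f(2,4) simple_not_zero[OF Y] by simp
    qed
    fix Z i assume m: "monic C Z X i"
    then have i: "i \<in> Hom C Z X" unfolding monic_def by blast
    have "monic C Z Y (f \<cdot> i)"
    proof (rule monicI)
      fix W h assume h: "h \<in> Hom C W Z" "(f \<cdot> i) \<cdot> h = 0"
      have "i \<cdot> h = g \<cdot> (f \<cdot> (i \<cdot> h))"
        using Comp_assoc[OF f(2,1) Comp_in[OF i h(1)]] f(3) Ident_Comp[OF Comp_in[OF i h(1)]] by simp
      also have "\<dots> = 0"
        using Comp_assoc[OF f(1) i h(1)] h(2) f(2) by simp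
      finally show "h = 0"
        using m h(1) i unfolding monic_def by (metis Comp_0_right zero_in_Hom)
    qed (rule Comp_in[OF f(1) i])
    then consider "zero_object C Z" | "isomorphism C Z Y (f \<cdot> i)"
      using Y unfolding simple_object_def by blast
    then show "zero_object C Z \<or> isomorphism C Z X i"
    proof cases
      case 2
      then obtain k where k: "k \<in> Hom C Y Z" "k \<cdot> (f \<cdot> i) = Ident C Z" "(f \<cdot> i) \<cdot> k = Ident C Y"
        unfolding isomorphism_def mutually_inverse_def by blast
      have "f \<cdot> (i \<cdot> (k \<cdot> f)) = ((f \<cdot> i) \<cdot> k) \<cdot> f"
        using Comp_assoc[OF f(1) i k(1)] Comp_assoc[OF i k(1) f(1)] Comp_assoc[OF f(1) Comp_in[OF i k(1)] f(1)] by simp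
      also have "\<dots> = f" using k(3) Ident_Comp[OF f(1)] by simp
      finally have "g \<cdot> (f \<cdot> (i \<cdot> (k \<cdot> f))) = Ident C X" using f(3) by simp
      then have "i \<cdot> (k \<cdot> f) = Ident C X"
        using Comp_assoc[OF f(2,1) Comp_in[OF i Comp_in[OF k(1) f(1)]]] f(3) Ident_Comp[OF Comp_in[OF i Comp_in[OF k(1) f(1)]]] by simp
      moreover have "(k \<cdot> f) \<cdot> i = Ident C Z"
        using k(2) Comp_assoc[OF k(1) f(1) i] by simp
      ultimately show ?thesis
        unfolding isomorphism_def mutually_inverse_def using i Comp_in[OF k(1) f(1)] by blast
    qed simp
  qed
qed

lemma simple_iso:
  assumes "simple_object C X" "isomorphic C X Y"
  shows "simple_object C Y"
  using hdim_one_simple[of Y] hdim_iso[OF assms(2,2)] hdim_simple[OF assms(1,1)] by simp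

end

section \<open>Duality and the S-matrix\<close>

text \<open>Characteristic zero lets the vanishing of a multiplicity be detected on its image in the
  field.\<close>

locale acf_modular_category = modular_category C
  for C :: "('o, 'm::ab_group_add, 'k::{alg_closed_field, field_char_0}, 'z) ribbon_cat_scheme" (structure)

sublocale acf_modular_category \<subseteq> acf_fusion_category C ..

context acf_modular_category
begin

text \<open>The adjunction bijection of \<open>hdim_dual\<close> has this shape, which makes it
  linear.\<close>

lemma sandwich_linear:
  assumes "j \<in> Hom C V W" "u \<in> Hom C V' V" "k \<in> Hom C U V'"
    and "f \<in> Hom C X Y" "g \<in> Hom C X Y" "V = T \<otimes>\<^sub>o Y" "V' = T \<otimes>\<^sub>o X"
  shows "(j \<cdot> (Ident C T \<otimes>\<^sub>m (f + g))) \<cdot> k = (j \<cdot> (Ident C T \<otimes>\<^sub>m f)) \<cdot> k + (j \<cdot> (Ident C T \<otimes>\<^sub>m g)) \<cdot> k"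
    "(j \<cdot> (Ident C T \<otimes>\<^sub>m Scale C a f)) \<cdot> k = Scale C a ((j \<cdot> (Ident C T \<otimes>\<^sub>m f)) \<cdot> k)"
  using assms
  by (simp_all add: TMor_add_right[OF Ident_in assms(4,5)] TMor_scale_right[OF Ident_in assms(4)]
      Comp_add_right[OF _ TMor_in[OF Ident_in assms(4)] TMor_in[OF Ident_in assms(5)]]
      Comp_scale_right[OF _ TMor_in[OF Ident_in assms(4)]]
      Comp_add_left[OF Comp_in[OF _ TMor_in[OF Ident_in assms(4)]] Comp_in[OF _ TMor_in[OF Ident_in assms(5)]]]
      Comp_scale_left[OF Comp_in[OF _ TMor_in[OF Ident_in assms(4)]]])

text \<open>The duality adjunction is borrowed from the strictification, where
  \<open>dual_adjunction\<close> makes \<open>U\<close> and \<open>V\<close> mutually inverse. Words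
  differ from the objects in the statement only by units, which \<open>hdim_iso\<close>
  absorbs.\<close>

lemma hdim_dual: "hdim (Dual C Z \<otimes>\<^sub>o A) B = hdim A (Z \<otimes>\<^sub>o B)"
proof -
  let ?D = "Dual C Z"
  note ki = cat.inv_pair_sym[OF cat.inv_pair_constraints(3)]
  let ?e = "cat.word_ev [Z] ?D (t_ev Z) (t_ru Z)" and ?c = "cat.word_coev [Z] ?D (t_coev Z) (t_inv (t_ru Z))"
  have dual: "cat.strict.is_dual [Z] [?D] ?e ?c"
    by (rule cat.is_dual_word[OF cat_left_dual ki]) simp_all
  note [simp] = cat.strict.is_dualD(1-6)[OF dual]
  let ?X = "cat.word [?D, A]" and ?Y = "cat.word [B]" and ?X' = "cat.word [A]" and ?Y' = "cat.word [Z, B]"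
  define up where "up F = cat.scomp (cat.stens (cat.sidn [Z]) F) (cat.stens ?c (cat.sidn [A]))" for F
  define dn where "dn G = cat.scomp (cat.stens ?e (cat.sidn [B])) (cat.stens (cat.sidn [?D]) G)" for G
  define U where "U f = t_mor (cat.smor (up ([?D, A], (?X, f, ?Y), [B])))" for f
  define V where "V g = t_mor (cat.smor (dn ([A], (?X', g, ?Y'), [Z, B])))" for g
  have arr: "cat.sarr (xs, (cat.word xs, f, cat.word ys), ys) \<longleftrightarrow> f \<in> Hom C (cat.word xs) (cat.word ys)" for xs ys f
    by (simp add: cat.sarr_def t_defs)
  have arrE: "F = (xs, (cat.word xs, t_mor (cat.smor F), cat.word ys), ys)"
    "t_mor (cat.smor F) \<in> Hom C (cat.word xs) (cat.word ys)"
    if "cat.sarr F" "cat.sdom F = xs" "cat.scod F = ys" for F xs ys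
    using that by (cases F; auto simp: cat.sarr_def t_defs cat.s_defs)+
  have up: "cat.sarr (up F)" "cat.sdom (up F) = [A]" "cat.scod (up F) = [Z, B]"
    if "cat.sarr F" "cat.sdom F = [?D, A]" "cat.scod F = [B]" for F
    using that unfolding up_def by simp_all
  have dn: "cat.sarr (dn G)" "cat.sdom (dn G) = [?D, A]" "cat.scod (dn G) = [B]"
    if "cat.sarr G" "cat.sdom G = [A]" "cat.scod G = [Z, B]" for G
    using that unfolding dn_def by simp_all
  have VU: "U f \<in> Hom C ?X' ?Y'" "V (U f) = f" if "f \<in> Hom C ?X ?Y" for f
  proof -
    from that have F: "cat.sarr ([?D, A], (?X, f, ?Y), [B])" by (simp only: arr)
    note u = up[OF F, simplified cat.s_simps, OF refl refl]
    show "U f \<in> Hom C ?X' ?Y'"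
      unfolding U_def by (rule arrE(2)[OF u])
    have "V (U f) = t_mor (cat.smor (dn (up ([?D, A], (?X, f, ?Y), [B]))))"
      unfolding V_def U_def by (simp only: arrE(1)[OF u, symmetric])
    also have "dn (up ([?D, A], (?X, f, ?Y), [B])) = ([?D, A], (?X, f, ?Y), [B])"
      unfolding dn_def up_def by (rule cat.strict.dual_adjunction(1)[OF dual F]) simp_all
    finally show "V (U f) = f" by (simp add: t_mor_def)
  qed
  have UV: "V g \<in> Hom C ?X ?Y" "U (V g) = g" if "g \<in> Hom C ?X' ?Y'" for g
  proof -
    from that have G: "cat.sarr ([A], (?X', g, ?Y'), [Z, B])" by (simp only: arr)
    note u = dn[OF G, simplified cat.s_simps, OF refl refl]
    show "V g \<in> Hom C ?X ?Y"
      unfolding V_def by (rule arrE(2)[OF u])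
    have "U (V g) = t_mor (cat.smor (up (dn ([A], (?X', g, ?Y'), [Z, B]))))"
      unfolding V_def U_def by (simp only: arrE(1)[OF u, symmetric])
    also have "up (dn ([A], (?X', g, ?Y'), [Z, B])) = ([A], (?X', g, ?Y'), [Z, B])"
      unfolding dn_def up_def by (rule cat.strict.dual_adjunction(2)[OF dual G]) simp_all
    finally show "U (V g) = g" by (simp add: t_mor_def)
  qed
  have bij: "bij_betw U (Hom C ?X ?Y) (Hom C ?X' ?Y')"
    using UV VU by (intro bij_betwI[of _ _ _ V]) (auto simp del: cat.word.simps)
  \<comment> \<open>The strict composite is cut open around \<open>f\<close>, so that
    \<open>U\<close> appears as composition with fixed maps on both sides.\<close>
  obtain j k where U: "j \<in> Hom C (cat.word [Z] \<otimes>\<^sub>o ?Y) ?Y'" "k \<in> Hom C ?X' (cat.word [Z] \<otimes>\<^sub>o ?X)"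
    "\<And>f. f \<in> Hom C ?X ?Y \<Longrightarrow> U f = (j \<cdot> (Ident C (cat.word [Z]) \<otimes>\<^sub>m f)) \<cdot> k"
  proof (rule that)
    let ?w = "cat.word [Z]"
    let ?j = "t_mor (cat.jn [Z] [B])" and ?j' = "t_mor (cat.jn' [Z] [?D, A])"
    let ?K = "t_mor (cat.smor (cat.stens ?c (cat.sidn [A])))"
    show j: "?j \<in> Hom C (?w \<otimes>\<^sub>o ?Y) ?Y'"
      using cat.arr_jn(1-3)[of "[Z]" "[B]"] unfolding t_arr_def by simp
    have j': "?j' \<in> Hom C (cat.word [Z, ?D, A]) (?w \<otimes>\<^sub>o ?X)"
      using cat.arr_jn(4-6)[of "[Z]" "[?D, A]"] unfolding t_arr_def by (simp del: cat.word.simps)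
    have K: "?K \<in> Hom C ?X' (cat.word [Z, ?D, A])"
      by (rule arrE(2)) simp_all
    show "?j' \<cdot> ?K \<in> Hom C ?X' (?w \<otimes>\<^sub>o ?X)"
      by (rule Comp_in[OF j' K])
    fix f assume f: "f \<in> Hom C ?X ?Y"
    have "U f = (?j \<cdot> ((Ident C ?w \<otimes>\<^sub>m f) \<cdot> ?j')) \<cdot> ?K"
      unfolding U_def up_def by (simp add: t_comp_def t_tens_def t_mor_def t_idn_def del: cat.jn.simps cat.jn'.simps cat.word.simps)
    also have "\<dots> = (?j \<cdot> (Ident C ?w \<otimes>\<^sub>m f)) \<cdot> (?j' \<cdot> ?K)"
      using Comp_assoc[OF j TMor_in[OF Ident_in f] j'] Comp_assoc[OF Comp_in[OF j TMor_in[OF Ident_in f]] j' K] by simp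
    finally show "U f = (?j \<cdot> (Ident C ?w \<otimes>\<^sub>m f)) \<cdot> (?j' \<cdot> ?K)" .
  qed
  have "hdim ?X ?Y = hdim ?X' ?Y'"
  proof (rule hdim_bij[OF bij])
    fix f g assume fg: "f \<in> Hom C ?X ?Y" "g \<in> Hom C ?X ?Y"
    show "U (f + g) = U f + U g"
      unfolding U(3)[OF fg(1)] U(3)[OF fg(2)] U(3)[OF add_in_Hom[OF fg]]
      by (rule sandwich_linear(1)[OF U(1) zero_in_Hom U(2) fg refl refl])
  next
    fix a f assume f: "f \<in> Hom C ?X ?Y"
    show "U (Scale C a f) = Scale C a (U f)"
      unfolding U(3)[OF f] U(3)[OF scale_in_Hom[OF f]]
      by (rule sandwich_linear(2)[OF U(1) zero_in_Hom U(2) f f refl refl])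
  qed
  moreover have "hdim ?X ?Y = hdim (?D \<otimes>\<^sub>o A) B"
    by (intro hdim_iso) (simp_all add: isomorphic_unit isomorphic_TObj)
  moreover have "hdim ?X' ?Y' = hdim A (Z \<otimes>\<^sub>o B)"
    by (intro hdim_iso) (simp_all add: isomorphic_unit isomorphic_TObj)
  ultimately show ?thesis by simp
qed

lemma quantum_trace_eq:
  assumes "f \<in> Hom C X X"
  shows "Scale C (quantum_trace C X f) (Ident C \<I>) = qtr_mor X f"
proof -
  obtain a where a: "qtr_mor X f = Scale C a (Ident C \<I>)"
    using schur[OF simple_Unit qtr_mor_in[OF assms]] .
  have "b = a" if "Scale C b (Ident C \<I>) = Scale C a (Ident C \<I>)" for b
    using that simple_not_zero[OF simple_Unit] by simp
  then have "(THE b. Scale C b (Ident C \<I>) = qtr_mor X f) = a"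
    using a by (intro the_equality) auto
  then show ?thesis
    unfolding quantum_trace_def using a by (simp add: qtr_mor_def)
qed

lemma quantum_trace_eqI:
  assumes "f \<in> Hom C X X" "qtr_mor X f = Scale C a (Ident C \<I>)"
  shows "quantum_trace C X f = a"
  using quantum_trace_eq[OF assms(1)] assms(2) simple_not_zero[OF simple_Unit] by simp

lemma quantum_trace_cyclic:
  assumes "f \<in> Hom C X Y" "g \<in> Hom C Y X"
  shows "quantum_trace C X (g \<cdot> f) = quantum_trace C Y (f \<cdot> g)"
  using quantum_trace_eq[of "f \<cdot> g" Y] qtr_mor_cyclic[OF assms] assms
  by (intro quantum_trace_eqI) auto

lemma quantum_trace_scale:
  assumes "f \<in> Hom C X X"
  shows "quantum_trace C X (Scale C a f) = a * quantum_trace C X f"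
  using quantum_trace_eq[OF assms, symmetric] assms
  by (intro quantum_trace_eqI) (auto simp: qtr_mor_scale)

lemma quantum_trace_add:
  assumes "f \<in> Hom C X X" "g \<in> Hom C X X"
  shows "quantum_trace C X (f + g) = quantum_trace C X f + quantum_trace C X g"
  using quantum_trace_eq[OF assms(1), symmetric] quantum_trace_eq[OF assms(2), symmetric] assms
  by (intro quantum_trace_eqI) (auto simp: qtr_mor_add scale_left_distrib)

lemma quantum_trace_sum:
  assumes "\<And>i. i \<in> I \<Longrightarrow> f i \<in> Hom C X X"
  shows "quantum_trace C X (\<Sum>i\<in>I. f i) = (\<Sum>i\<in>I. quantum_trace C X (f i))"
proof -
  have 0: "quantum_trace C X 0 = 0"
    using quantum_trace_scale[of 0 X 0] by simp
  show ?thesis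
    using assms
  proof (induction I rule: infinite_finite_induct)
    case (insert i I)
    then show ?case
      using quantum_trace_add[of "f i" X "sum f I"] sum_in_Hom[of I f X X] by simp
  qed (simp_all add: 0)
qed

definition qdim :: "'o \<Rightarrow> 'k" where "qdim X = quantum_trace C X (Ident C X)"

lemma S_entry_sym: "S_entry C X Y = S_entry C Y X"
  unfolding S_entry_def by (rule quantum_trace_cyclic[OF Braid_in Braid_in])

text \<open>Cyclicity moves the inclusions of the summands around the trace.\<close>

lemma quantum_trace_natural_sum:
  assumes "is_direct_sum C Z Xs"
    and F: "\<And>X. F X \<in> Hom C (T X) (T X)"
    and T: "\<And>X Y f. f \<in> Hom C X Y \<Longrightarrow> t f \<in> Hom C (T X) (T Y)"
    and nat: "\<And>X Y f. f \<in> Hom C X Y \<Longrightarrow> F Y \<cdot> t f = t f \<cdot> F X"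
    and comp: "\<And>X Y Z f g. \<lbrakk>f \<in> Hom C X Y; g \<in> Hom C Y Z\<rbrakk> \<Longrightarrow> t (g \<cdot> f) = t g \<cdot> t f"
    and id: "\<And>X. t (Ident C X) = Ident C (T X)"
    and add: "\<And>X Y f g. \<lbrakk>f \<in> Hom C X Y; g \<in> Hom C X Y\<rbrakk> \<Longrightarrow> t (f + g) = t f + t g"
  shows "quantum_trace C (T Z) (F Z) = (\<Sum>j<length Xs. quantum_trace C (T (Xs ! j)) (F (Xs ! j)))"
proof -
  obtain \<iota> \<pi> where ds: "sum_system Xs Z \<iota> \<pi>"
    using assms(1) unfolding is_direct_sum_iff by blast
  note i = sum_systemD(1)[OF ds] and p = sum_systemD(2)[OF ds]
    and pi = sum_systemD(3)[OF ds] and s = sum_systemD(4)[OF ds]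
  have t0: "t 0 = 0"
    using add[of 0 Z Z 0] by simp
  have tsum: "t (\<Sum>j\<in>J. f j) = (\<Sum>j\<in>J. t (f j))" if "\<And>j. j \<in> J \<Longrightarrow> f j \<in> Hom C Z Z" for J :: "nat set" and f
    using that
  proof (induction J rule: infinite_finite_induct)
    case (insert j J)
    then show ?case
      using add[of "f j" Z Z "sum f J"] sum_in_Hom[of J f Z Z] by simp
  qed (simp_all add: t0)
  have "F Z = F Z \<cdot> (\<Sum>j<length Xs. t (\<iota> j) \<cdot> t (\<pi> j))"
  proof -
    have "Ident C (T Z) = (\<Sum>j<length Xs. t (\<iota> j \<cdot> \<pi> j))"
      unfolding id[symmetric] s[symmetric] by (rule tsum) (use i p in auto)
    also have "\<dots> = (\<Sum>j<length Xs. t (\<iota> j) \<cdot> t (\<pi> j))"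
      by (intro sum.cong refl comp[OF p i]) simp_all
    finally show ?thesis
      using Comp_Ident[OF F[of Z]] by simp
  qed
  also have "\<dots> = (\<Sum>j<length Xs. F Z \<cdot> (t (\<iota> j) \<cdot> t (\<pi> j)))"
    by (rule Comp_sum_right[OF F Comp_in[OF T[OF i] T[OF p]]]) simp_all
  finally have "quantum_trace C (T Z) (F Z) = (\<Sum>j<length Xs. quantum_trace C (T Z) (F Z \<cdot> (t (\<iota> j) \<cdot> t (\<pi> j))))"
    using quantum_trace_sum[of "{..<length Xs}" "\<lambda>j. F Z \<cdot> (t (\<iota> j) \<cdot> t (\<pi> j))" "T Z"]
      Comp_in[OF F Comp_in[OF T[OF i] T[OF p]]] by simp
  also have "\<dots> = (\<Sum>j<length Xs. quantum_trace C (T (Xs ! j)) (F (Xs ! j)))"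
  proof (rule sum.cong[OF refl])
    fix j assume "j \<in> {..<length Xs}"
    then have j: "j < length Xs" by simp
    note ij = i[OF j] and pj = p[OF j]
    have "F Z \<cdot> (t (\<iota> j) \<cdot> t (\<pi> j)) = (t (\<iota> j) \<cdot> F (Xs ! j)) \<cdot> t (\<pi> j)"
      using Comp_assoc[OF F T[OF ij] T[OF pj]] nat[OF ij] by simp
    also have "quantum_trace C (T Z) \<dots> = quantum_trace C (T (Xs ! j)) (t (\<pi> j) \<cdot> (t (\<iota> j) \<cdot> F (Xs ! j)))"
      by (rule quantum_trace_cyclic[OF T[OF pj] Comp_in[OF T[OF ij] F]])
    also have "t (\<pi> j) \<cdot> (t (\<iota> j) \<cdot> F (Xs ! j)) = F (Xs ! j)"
      unfolding Comp_assoc[OF T[OF pj] T[OF ij] F, symmetric] comp[OF ij pj, symmetric] pi[OF j j]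
      by (simp add: id Ident_Comp[OF F])
    finally show "quantum_trace C (T Z) (F Z \<cdot> (t (\<iota> j) \<cdot> t (\<pi> j))) = quantum_trace C (T (Xs ! j)) (F (Xs ! j))" .
  qed
  finally show ?thesis .
qed

lemma S_entry_sum_left:
  assumes "is_direct_sum C Z Xs"
  shows "S_entry C Z Y = (\<Sum>j<length Xs. S_entry C (Xs ! j) Y)"
  unfolding S_entry_def
proof (rule quantum_trace_natural_sum[OF assms, where F = "\<lambda>X. dbr X Y" and T = "\<lambda>X. X \<otimes>\<^sub>o Y" and t = "\<lambda>f. f \<otimes>\<^sub>m Ident C Y"])
  show "(g \<cdot> f) \<otimes>\<^sub>m Ident C Y = (g \<otimes>\<^sub>m Ident C Y) \<cdot> (f \<otimes>\<^sub>m Ident C Y)"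
    if "f \<in> Hom C X X'" "g \<in> Hom C X' Z" for f g X X' Z
    using TMor_Comp[OF that Ident_in[of Y] Ident_in[of Y]] Ident_Comp[OF Ident_in] by simp
qed (auto simp: dbr_in dbr_natural_left TMor_Ident TMor_add_left[OF _ _ Ident_in])

lemma S_entry_sum_right:
  assumes "is_direct_sum C Z Xs"
  shows "S_entry C Y Z = (\<Sum>j<length Xs. S_entry C Y (Xs ! j))"
  using S_entry_sum_left[OF assms, of Y] by (simp add: S_entry_sym[of _ Y])

lemma qdim_sum:
  assumes "is_direct_sum C Z Xs"
  shows "qdim Z = (\<Sum>j<length Xs. qdim (Xs ! j))"
  unfolding qdim_def
  by (rule quantum_trace_natural_sum[OF assms, where F = "\<lambda>X. Ident C X" and T = "\<lambda>X. X" and t = "\<lambda>f. f"])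
    (auto simp: Ident_Comp Comp_Ident)

text \<open>An isomorphism is a direct sum with one summand, so invariance is a case of
  additivity.\<close>

lemma S_entry_iso:
  assumes "isomorphic C X X'" "isomorphic C Y Y'"
  shows "S_entry C X Y = S_entry C X' Y'"
  using S_entry_sum_left[OF is_direct_sum_iso[OF is_direct_sum_single assms(1)], of Y]
    S_entry_sum_right[OF is_direct_sum_iso[OF is_direct_sum_single assms(2)], of X'] by simp

lemma qdim_iso: "isomorphic C X X' \<Longrightarrow> qdim X = qdim X'"
  using qdim_sum[OF is_direct_sum_iso[OF is_direct_sum_single, of X X']] by simp

text \<open>Both sides come from eliminating the scalar of \<open>qtr_mor_dbr_tens\<close>. The
  factor \<open>qdim X\<close> is not divided out, because its being nonzero will be deduced from
  this very identity.\<close>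

lemma S_entry_tens:
  assumes X: "simple_object C X"
  shows "S_entry C X (Y \<otimes>\<^sub>o Z) * qdim X = S_entry C X Y * S_entry C X Z"
proof -
  have "\<exists>a. f = Scale C a (Ident C X)" if "f \<in> Hom C X X" for f
    using schur[OF X that] by blast
  then obtain a where a: "qtr_mor (X \<otimes>\<^sub>o Z) (dbr X Z) = Scale C a (qtr_mor X (Ident C X))"
    "qtr_mor (X \<otimes>\<^sub>o (Y \<otimes>\<^sub>o Z)) (dbr X (Y \<otimes>\<^sub>o Z)) = Scale C a (qtr_mor (Y \<otimes>\<^sub>o X) (dbr Y X))"
    by (rule qtr_mor_dbr_tens[of X])
  have "S_entry C X Z = a * qdim X"
    unfolding S_entry_def qdim_def
    by (rule quantum_trace_eqI[OF dbr_in]) (simp only: a(1) quantum_trace_eq[OF Ident_in[of X], symmetric] scale_scale)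
  moreover have "S_entry C X (Y \<otimes>\<^sub>o Z) = a * S_entry C Y X"
    unfolding S_entry_def
    by (rule quantum_trace_eqI[OF dbr_in]) (simp only: a(2) quantum_trace_eq[OF dbr_in[where X = Y and Y = X], symmetric] scale_scale)
  ultimately show ?thesis
    by (simp add: S_entry_sym[of Y X])
qed

end

section \<open>Fusion subcategories\<close>

context acf_fusion_category
begin

lemma decomp_nth: "\<lbrakk>decomp A Xs; j < length Xs\<rbrakk> \<Longrightarrow> simple_object C (Xs ! j)"
  using decompD(2) nth_mem by blast

lemma hdim_decomp_nth_pos:
  assumes "decomp A Xs" "j < length Xs"
  shows "hdim (Xs ! j) A > 0"
proof -
  have "finite {l. l < length Xs \<and> isomorphic C (Xs ! j) (Xs ! l)}" by simp
  moreover have "j \<in> {l. l < length Xs \<and> isomorphic C (Xs ! j) (Xs ! l)}"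
    using assms(2) by simp
  ultimately show ?thesis
    unfolding hdim_simple_left[OF decomp_nth[OF assms] assms(1)] by (auto simp: card_gt_0_iff)
qed

lemma hdim_simple_pos_iff:
  assumes "simple_object C X" "simple_object C Y"
  shows "hdim X Y > 0 \<longleftrightarrow> isomorphic C X Y"
  using hdim_simple[OF assms] by simp

lemma hdim_direct_sum_pos:
  assumes "is_direct_sum C A Xs" "hdim W A > 0"
  obtains j where "j < length Xs" "hdim W (Xs ! j) > 0"
proof -
  obtain \<iota> \<pi> where ds: "sum_system Xs A \<iota> \<pi>"
    using assms(1) unfolding is_direct_sum_iff by blast
  note i = sum_systemD(1)[OF ds] and p = sum_systemD(2)[OF ds] and s = sum_systemD(4)[OF ds]
  obtain f where f: "f \<in> Hom C W A" "f \<noteq> 0"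
    using assms(2) unfolding hdim_pos_iff by blast
  have "Ident C A \<cdot> f = (\<Sum>j<length Xs. (\<iota> j \<cdot> \<pi> j) \<cdot> f)"
    unfolding s[symmetric] by (rule Comp_sum_left[OF Comp_in[OF i p] f(1)]) simp_all
  then have f_eq: "f = (\<Sum>j<length Xs. (\<iota> j \<cdot> \<pi> j) \<cdot> f)"
    using Ident_Comp[OF f(1)] by simp
  have "\<exists>j<length Xs. (\<iota> j \<cdot> \<pi> j) \<cdot> f \<noteq> 0"
  proof (rule ccontr)
    assume "\<not> ?thesis"
    then have "(\<Sum>j<length Xs. (\<iota> j \<cdot> \<pi> j) \<cdot> f) = 0"
      by (intro sum.neutral ballI) auto
    then show False using f_eq f(2) by simp
  qed
  then obtain j where j: "j < length Xs" "(\<iota> j \<cdot> \<pi> j) \<cdot> f \<noteq> 0"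
    by blast
  have "\<pi> j \<cdot> f \<noteq> 0"
    using j(2) Comp_assoc[OF i[OF j(1)] p[OF j(1)] f(1)] i[OF j(1)] by auto
  then have "hdim W (Xs ! j) > 0"
    unfolding hdim_pos_iff using Comp_in[OF p[OF j(1)] f(1)] by blast
  then show ?thesis using that j(1) by blast
qed

lemma hdim_subobject_pos:
  assumes "is_subobject C Y X" "hdim W Y > 0"
  shows "hdim W X > 0"
proof -
  obtain i where i: "monic C Y X i" using assms(1) unfolding is_subobject_def by blast
  then have iH: "i \<in> Hom C Y X" unfolding monic_def by blast
  obtain f where f: "f \<in> Hom C W Y" "f \<noteq> 0"
    using assms(2) unfolding hdim_pos_iff by blast
  have "i \<cdot> f \<noteq> 0"
  proof
    assume "i \<cdot> f = 0"
    then have "i \<cdot> f = i \<cdot> 0" using iH by simp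
    then show False using i f zero_in_Hom unfolding monic_def by blast
  qed
  then show ?thesis
    unfolding hdim_pos_iff using Comp_in[OF iH f(1)] by blast
qed

lemma simple_retract:
  assumes P: "simple_object C P" "hdim P A > 0"
  obtains i p where "i \<in> Hom C P A" "p \<in> Hom C A P" "p \<cdot> i = Ident C P"
proof -
  obtain Xs where Xs: "decomp A Xs" using ex_decomp by blast
  obtain \<iota> \<pi> where ds: "sum_system Xs A \<iota> \<pi>"
    using decompD(1)[OF Xs] unfolding is_direct_sum_iff by blast
  note i = sum_systemD(1)[OF ds] and p = sum_systemD(2)[OF ds] and pi = sum_systemD(3)[OF ds]
  obtain j where j: "j < length Xs" "hdim P (Xs ! j) > 0"
    by (rule hdim_direct_sum_pos[OF decompD(1)[OF Xs] P(2)])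
  then have "isomorphic C P (Xs ! j)"
    using hdim_simple_pos_iff[OF P(1) decomp_nth[OF Xs j(1)]] by simp
  then obtain u v where u: "u \<in> Hom C P (Xs ! j)" "v \<in> Hom C (Xs ! j) P" "v \<cdot> u = Ident C P" "u \<cdot> v = Ident C (Xs ! j)"
    by (rule isomorphicE)
  have "(v \<cdot> \<pi> j) \<cdot> (\<iota> j \<cdot> u) = v \<cdot> ((\<pi> j \<cdot> \<iota> j) \<cdot> u)"
    using Comp_assoc[OF u(2) p[OF j(1)] Comp_in[OF i[OF j(1)] u(1)]] Comp_assoc[OF p[OF j(1)] i[OF j(1)] u(1)] by simp
  also have "\<dots> = Ident C P"
    using pi[OF j(1) j(1)] Ident_Comp[OF u(1)] u(3) by simp
  finally show ?thesis
    using that Comp_in[OF i[OF j(1)] u(1)] Comp_in[OF u(2) p[OF j(1)]] by blast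
qed

lemma simple_subobject:
  assumes "simple_object C P" "hdim P A > 0"
  shows "is_subobject C P A"
proof -
  obtain i p where "i \<in> Hom C P A" "p \<in> Hom C A P" "p \<cdot> i = Ident C P"
    by (rule simple_retract[OF assms])
  then show ?thesis
    unfolding is_subobject_def using split_mono_monic by blast
qed

text \<open>The identity of \<open>A \<otimes>\<^sub>o B\<close> is the sum of the tensor products
  of the idempotents of the summands, and a nonzero morphism survives composition with one of
  them.\<close>

lemma hdim_tens_pos:
  assumes "hdim W (A \<otimes>\<^sub>o B) > 0"
  obtains P Q where "simple_object C P" "simple_object C Q" "hdim P A > 0" "hdim Q B > 0" "hdim W (P \<otimes>\<^sub>o Q) > 0"
proof -
  obtain Xs where Xs: "decomp A Xs" using ex_decomp by blast
  obtain Ys where Ys: "decomp B Ys" using ex_decomp by blast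
  obtain \<iota> \<pi> where ds: "sum_system Xs A \<iota> \<pi>"
    using decompD(1)[OF Xs] unfolding is_direct_sum_iff by blast
  obtain \<iota>' \<pi>' where ds': "sum_system Ys B \<iota>' \<pi>'"
    using decompD(1)[OF Ys] unfolding is_direct_sum_iff by blast
  note i = sum_systemD(1)[OF ds] and p = sum_systemD(2)[OF ds] and s = sum_systemD(4)[OF ds]
  note i' = sum_systemD(1)[OF ds'] and p' = sum_systemD(2)[OF ds'] and s' = sum_systemD(4)[OF ds']
  obtain f where f: "f \<in> Hom C W (A \<otimes>\<^sub>o B)" "f \<noteq> 0"
    using assms unfolding hdim_pos_iff by blast
  have e: "\<iota> j \<cdot> \<pi> j \<in> Hom C A A" if "j < length Xs" for j
    using Comp_in[OF i p] that by blast
  have e': "\<iota>' l \<cdot> \<pi>' l \<in> Hom C B B" if "l < length Ys" for l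
    using Comp_in[OF i' p'] that by blast
  have "Ident C (A \<otimes>\<^sub>o B) = (\<Sum>j<length Xs. \<Sum>l<length Ys. (\<iota> j \<cdot> \<pi> j) \<otimes>\<^sub>m (\<iota>' l \<cdot> \<pi>' l))"
  proof -
    have "Ident C (A \<otimes>\<^sub>o B) = (\<Sum>j<length Xs. (\<iota> j \<cdot> \<pi> j) \<otimes>\<^sub>m Ident C B)"
      unfolding TMor_Ident[symmetric] s[symmetric] by (rule TMor_sum_left[OF e Ident_in]) simp
    also have "\<dots> = (\<Sum>j<length Xs. \<Sum>l<length Ys. (\<iota> j \<cdot> \<pi> j) \<otimes>\<^sub>m (\<iota>' l \<cdot> \<pi>' l))"
      unfolding s'[symmetric] by (intro sum.cong refl TMor_sum_right[OF e e']) simp_all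
    finally show ?thesis .
  qed
  note id_eq = this
  have E: "(\<iota> j \<cdot> \<pi> j) \<otimes>\<^sub>m (\<iota>' l \<cdot> \<pi>' l) \<in> Hom C (A \<otimes>\<^sub>o B) (A \<otimes>\<^sub>o B)" if "j < length Xs" "l < length Ys" for j l
    using TMor_in[OF e e'] that by blast
  have "Ident C (A \<otimes>\<^sub>o B) \<cdot> f = (\<Sum>j<length Xs. (\<Sum>l<length Ys. (\<iota> j \<cdot> \<pi> j) \<otimes>\<^sub>m (\<iota>' l \<cdot> \<pi>' l)) \<cdot> f)"
    unfolding id_eq by (rule Comp_sum_left[OF sum_in_Hom[OF E] f(1)]) simp_all
  also have "\<dots> = (\<Sum>j<length Xs. \<Sum>l<length Ys. ((\<iota> j \<cdot> \<pi> j) \<otimes>\<^sub>m (\<iota>' l \<cdot> \<pi>' l)) \<cdot> f)"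
    by (intro sum.cong refl Comp_sum_left[OF E f(1)]) simp_all
  finally have f_eq: "f = (\<Sum>j<length Xs. \<Sum>l<length Ys. ((\<iota> j \<cdot> \<pi> j) \<otimes>\<^sub>m (\<iota>' l \<cdot> \<pi>' l)) \<cdot> f)"
    using Ident_Comp[OF f(1)] by simp
  have "\<exists>j<length Xs. \<exists>l<length Ys. ((\<iota> j \<cdot> \<pi> j) \<otimes>\<^sub>m (\<iota>' l \<cdot> \<pi>' l)) \<cdot> f \<noteq> 0"
  proof (rule ccontr)
    assume "\<not> ?thesis"
    then have "(\<Sum>j<length Xs. \<Sum>l<length Ys. ((\<iota> j \<cdot> \<pi> j) \<otimes>\<^sub>m (\<iota>' l \<cdot> \<pi>' l)) \<cdot> f) = 0"
      by (intro sum.neutral ballI) auto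
    then show False using f_eq f(2) by simp
  qed
  then obtain j l where jl: "j < length Xs" "l < length Ys" "((\<iota> j \<cdot> \<pi> j) \<otimes>\<^sub>m (\<iota>' l \<cdot> \<pi>' l)) \<cdot> f \<noteq> 0"
    by blast
  note m = TMor_in[OF i[OF jl(1)] i'[OF jl(2)]] TMor_in[OF p[OF jl(1)] p'[OF jl(2)]]
  have "(\<pi> j \<otimes>\<^sub>m \<pi>' l) \<cdot> f \<noteq> 0"
    using jl(3) TMor_Comp[OF p[OF jl(1)] i[OF jl(1)] p'[OF jl(2)] i'[OF jl(2)]] Comp_assoc[OF m f(1)] m(1) by auto
  then have "hdim W (Xs ! j \<otimes>\<^sub>o Ys ! l) > 0"
    unfolding hdim_pos_iff using Comp_in[OF m(2) f(1)] by blast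
  then show ?thesis
    using that decomp_nth[OF Xs jl(1)] decomp_nth[OF Ys jl(2)] hdim_decomp_nth_pos[OF Xs jl(1)] hdim_decomp_nth_pos[OF Ys jl(2)] by blast
qed

lemma hdim_tens_mono:
  assumes P: "simple_object C P" "hdim P A > 0" and Q: "simple_object C Q" "hdim Q B > 0"
    and W: "hdim W (P \<otimes>\<^sub>o Q) > 0"
  shows "hdim W (A \<otimes>\<^sub>o B) > 0"
proof -
  obtain i p where ip: "i \<in> Hom C P A" "p \<in> Hom C A P" "p \<cdot> i = Ident C P"
    by (rule simple_retract[OF P])
  obtain j q where jq: "j \<in> Hom C Q B" "q \<in> Hom C B Q" "q \<cdot> j = Ident C Q"
    by (rule simple_retract[OF Q])
  have "is_subobject C (P \<otimes>\<^sub>o Q) (A \<otimes>\<^sub>o B)"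
    unfolding is_subobject_def
    using split_mono_monic[OF TMor_in[OF ip(1) jq(1)] TMor_in[OF ip(2) jq(2)]]
      TMor_Comp[OF ip(1,2) jq(1,2)] ip(3) jq(3) TMor_Ident by auto
  then show ?thesis
    using hdim_subobject_pos W by blast
qed

text \<open>Closure under subobjects gives one direction, closure under direct sums together with
  semisimplicity the other. Membership can henceforth be tested on simple constituents.\<close>

lemma fusion_subcategory_mem_iff:
  assumes D: "fusion_subcategory C D"
  shows "A \<in> D \<longleftrightarrow> (\<forall>W. simple_object C W \<and> hdim W A > 0 \<longrightarrow> W \<in> D)"
proof
  assume "A \<in> D"
  then show "\<forall>W. simple_object C W \<and> hdim W A > 0 \<longrightarrow> W \<in> D"
    using D simple_subobject unfolding fusion_subcategory_def by blast
next
  assume *: "\<forall>W. simple_object C W \<and> hdim W A > 0 \<longrightarrow> W \<in> D"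
  obtain Xs where Xs: "decomp A Xs" using ex_decomp by blast
  have "set Xs \<subseteq> D"
    using * decomp_nth[OF Xs] hdim_decomp_nth_pos[OF Xs] by (auto simp: in_set_conv_nth)
  then show "A \<in> D"
    using D decompD(1)[OF Xs] unfolding fusion_subcategory_def by blast
qed

lemma fusion_subcategory_tens: "\<lbrakk>fusion_subcategory C D; X \<in> D; Y \<in> D\<rbrakk> \<Longrightarrow> X \<otimes>\<^sub>o Y \<in> D"
  unfolding fusion_subcategory_def by blast

lemma fusion_subcategory_unit: "fusion_subcategory C D \<Longrightarrow> \<I> \<in> D"
  unfolding fusion_subcategory_def by blast

lemma fusion_subcategory_hdim:
  "\<lbrakk>fusion_subcategory C D; A \<in> D; simple_object C W; hdim W A > 0\<rbrakk> \<Longrightarrow> W \<in> D"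
  using fusion_subcategory_mem_iff by blast

lemma fusion_subcategory_iso:
  assumes "fusion_subcategory C D" "X \<in> D" "isomorphic C X Y"
  shows "Y \<in> D"
proof -
  have "hdim W Y = hdim W X" for W
    using hdim_iso[OF isomorphic_refl isomorphic_sym[OF assms(3)]] .
  then show ?thesis
    using fusion_subcategory_hdim[OF assms(1,2)]
    by (intro iffD2[OF fusion_subcategory_mem_iff[OF assms(1), of Y]]) auto
qed

text \<open>A fusion subcategory is the same as a set of simple objects that is closed under tensor
  products and constituents.\<close>

definition all_constituents :: "('o \<Rightarrow> bool) \<Rightarrow> 'o set" where
  "all_constituents Q = {A. \<forall>W. simple_object C W \<and> hdim W A > 0 \<longrightarrow> Q W}"

lemma fusion_subcategory_all_constituents:
  assumes unit: "\<And>W. \<lbrakk>simple_object C W; isomorphic C W \<I>\<rbrakk> \<Longrightarrow> Q W"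
    and tens: "\<And>X Y W. \<lbrakk>simple_object C X; simple_object C Y; simple_object C W; Q X; Q Y; hdim W (X \<otimes>\<^sub>o Y) > 0\<rbrakk> \<Longrightarrow> Q W"
  shows "fusion_subcategory C (all_constituents Q)"
  unfolding fusion_subcategory_def
proof (intro conjI ballI allI impI)
  show "\<I> \<in> all_constituents Q"
    using unit hdim_simple_pos_iff[OF _ simple_Unit] unfolding all_constituents_def by blast
next
  fix X Y assume XY: "X \<in> all_constituents Q" "Y \<in> all_constituents Q"
  show "X \<otimes>\<^sub>o Y \<in> all_constituents Q"
    unfolding all_constituents_def mem_Collect_eq
  proof (intro allI impI, elim conjE)
    fix W assume W: "simple_object C W" "hdim W (X \<otimes>\<^sub>o Y) > 0"
    obtain P R where "simple_object C P" "simple_object C R" "hdim P X > 0" "hdim R Y > 0" "hdim W (P \<otimes>\<^sub>o R) > 0"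
      by (rule hdim_tens_pos[OF W(2)])
    then show "Q W"
      using XY tens W(1) unfolding all_constituents_def by blast
  qed
next
  fix Z Xs assume *: "set Xs \<subseteq> all_constituents Q \<and> is_direct_sum C Z Xs"
  show "Z \<in> all_constituents Q"
    unfolding all_constituents_def mem_Collect_eq
  proof (intro allI impI, elim conjE)
    fix W assume W: "simple_object C W" "hdim W Z > 0"
    obtain j where j: "j < length Xs" "hdim W (Xs ! j) > 0"
      by (rule hdim_direct_sum_pos[OF conjunct2[OF *] W(2)])
    then have "Xs ! j \<in> all_constituents Q" using * by auto
    then show "Q W" using j(2) W(1) unfolding all_constituents_def by blast
  qed
next
  fix X Y assume "X \<in> all_constituents Q" "is_subobject C Y X"
  then show "Y \<in> all_constituents Q"
    unfolding all_constituents_def using hdim_subobject_pos by blast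
qed

lemma generated_fusion_subcategory:
  "fusion_subcategory C (generated_fusion_subcategory C S)" "S \<subseteq> generated_fusion_subcategory C S"
  unfolding generated_fusion_subcategory_def fusion_subcategory_def by blast+

lemma generated_fusion_subcategory_subset:
  "\<lbrakk>fusion_subcategory C D; S \<subseteq> D\<rbrakk> \<Longrightarrow> generated_fusion_subcategory C S \<subseteq> D"
  unfolding generated_fusion_subcategory_def by blast

end

section \<open>Duals of simple objects\<close>

context acf_modular_category
begin

lemma hdim_unit_tens: "hdim \<I> (X \<otimes>\<^sub>o Y) = hdim (Dual C X) Y"
  using hdim_dual[of X \<I> Y] hdim_iso[OF isomorphic_unit(2)[of "Dual C X"] isomorphic_refl[of Y]] by simp

lemma hdim_dual_unit: "hdim (Dual C X \<otimes>\<^sub>o Y) \<I> = hdim X Y"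
  using hdim_dual[of X Y \<I>] hdim_iso[OF isomorphic_refl[of Y] isomorphic_unit(2)[of X]] hdim_sym[of X Y] by simp

text \<open>The two adjunctions express the endomorphism dimensions of \<open>Dual C X\<close> and
  of \<open>X\<close> through \<open>X \<otimes>\<^sub>o Dual C X\<close> and
  \<open>Dual C X \<otimes>\<^sub>o X\<close>, and the braiding identifies these two
  objects.\<close>

lemma simple_Dual:
  assumes "simple_object C X"
  shows "simple_object C (Dual C X)"
proof (rule hdim_one_simple)
  have "hdim (Dual C X) (Dual C X) = hdim (X \<otimes>\<^sub>o Dual C X) \<I>"
    unfolding hdim_unit_tens[symmetric] by (rule hdim_sym)
  also have "\<dots> = hdim (Dual C X \<otimes>\<^sub>o X) \<I>"
    by (rule hdim_iso[OF isomorphic_TObj_comm isomorphic_refl])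
  finally show "hdim (Dual C X) (Dual C X) = 1"
    unfolding hdim_dual_unit using hdim_simple[OF assms assms] by simp
qed

end

section \<open>Characters of the Grothendieck ring\<close>

context acf_modular_category
begin

definition reps :: "'o list" where
  "reps = (SOME Xs. simple_representatives C Xs \<and> invertible_mat (S_matrix C Xs))"

abbreviation nr :: nat where "nr \<equiv> length reps"

lemma reps: "simple_representatives C reps" "invertible_mat (S_matrix C reps)"
  using someI_ex[OF S_matrix_invertible] unfolding reps_def by auto

lemma reps_simple: "i < nr \<Longrightarrow> simple_object C (reps ! i)"
  using reps(1) unfolding simple_representatives_def by simp

lemma reps_iso_iff: "\<lbrakk>i < nr; j < nr\<rbrakk> \<Longrightarrow> isomorphic C (reps ! i) (reps ! j) \<longleftrightarrow> i = j"
  using reps(1) isomorphic_refl unfolding simple_representatives_def by metis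

lemma ex_rep:
  assumes "simple_object C Y"
  obtains i where "i < nr" "isomorphic C Y (reps ! i)"
  using reps(1) assms unfolding simple_representatives_def by (metis in_set_conv_nth)

lemma hdim_reps: "\<lbrakk>i < nr; j < nr\<rbrakk> \<Longrightarrow> hdim (reps ! i) (reps ! j) = (if i = j then 1 else 0)"
  using hdim_simple[OF reps_simple reps_simple] reps_iso_iff by simp

text \<open>Regrouping of the summands by isomorphism class. The values lie in a semiring so that
  the lemma serves both for dimensions, which are natural numbers, and for characters with values in
  the field.\<close>

lemma sum_decomp_reps:
  fixes F :: "'o \<Rightarrow> 'b::semiring_1"
  assumes Xs: "decomp A Xs" and F: "\<And>X Y. \<lbrakk>simple_object C X; isomorphic C X Y\<rbrakk> \<Longrightarrow> F X = F Y"
  shows "(\<Sum>l<length Xs. F (Xs ! l)) = (\<Sum>j<nr. of_nat (hdim (reps ! j) A) * F (reps ! j))"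
proof -
  have "(\<Sum>j<nr. of_nat (hdim (reps ! j) A) * F (reps ! j))
      = (\<Sum>j<nr. \<Sum>l<length Xs. if isomorphic C (reps ! j) (Xs ! l) then F (reps ! j) else 0)"
  proof (rule sum.cong[OF refl])
    fix j assume "j \<in> {..<nr}"
    then have "hdim (reps ! j) A = card {l \<in> {..<length Xs}. isomorphic C (reps ! j) (Xs ! l)}"
      using hdim_simple_left[OF reps_simple Xs] by simp
    then show "of_nat (hdim (reps ! j) A) * F (reps ! j) = (\<Sum>l<length Xs. if isomorphic C (reps ! j) (Xs ! l) then F (reps ! j) else 0)"
      by (simp add: sum.inter_filter[symmetric])
  qed
  also have "\<dots> = (\<Sum>l<length Xs. \<Sum>j<nr. if isomorphic C (reps ! j) (Xs ! l) then F (reps ! j) else 0)"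
    by (rule sum.swap)
  also have "\<dots> = (\<Sum>l<length Xs. F (Xs ! l))"
  proof (rule sum.cong[OF refl])
    fix l assume "l \<in> {..<length Xs}"
    then have l: "simple_object C (Xs ! l)" using decomp_nth[OF Xs] by simp
    obtain i where i: "i < nr" "isomorphic C (Xs ! l) (reps ! i)"
      by (rule ex_rep[OF l])
    have "isomorphic C (reps ! j) (Xs ! l) \<longleftrightarrow> j = i" if "j < nr" for j
      using reps_iso_iff[OF that i(1)] i(2) isomorphic_trans[of "reps ! j" "Xs ! l" "reps ! i"] isomorphic_sym[OF i(2)] by auto
    then have "(\<Sum>j<nr. if isomorphic C (reps ! j) (Xs ! l) then F (reps ! j) else 0) = (\<Sum>j<nr. if j = i then F (reps ! i) else 0)"
      by (intro sum.cong) auto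
    also have "\<dots> = F (Xs ! l)"
      using i F[OF l i(2)] by simp
    finally show "(\<Sum>j<nr. if isomorphic C (reps ! j) (Xs ! l) then F (reps ! j) else 0) = F (Xs ! l)" .
  qed
  finally show ?thesis ..
qed

text \<open>The simple classes form an orthonormal basis for the pairing
  \<open>hdim\<close>.\<close>

lemma hdim_eq_sum: "hdim A B = (\<Sum>j<nr. hdim (reps ! j) A * hdim (reps ! j) B)"
proof -
  obtain Xs where Xs: "decomp A Xs" using ex_decomp by blast
  obtain Ys where Ys: "decomp B Ys" using ex_decomp by blast
  let ?P = "{(l, m). l < length Xs \<and> m < length Ys \<and> isomorphic C (Xs ! l) (Ys ! m)}"
  have "?P = (SIGMA l:{..<length Xs}. {m. m < length Ys \<and> isomorphic C (Xs ! l) (Ys ! m)})"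
    by auto
  then have "hdim A B = (\<Sum>l<length Xs. card {m. m < length Ys \<and> isomorphic C (Xs ! l) (Ys ! m)})"
    unfolding hdim_decomp[OF Xs Ys] by (simp add: card_SigmaI)
  also have "\<dots> = (\<Sum>l<length Xs. hdim (Xs ! l) B)"
    by (intro sum.cong refl hdim_simple_left[OF decomp_nth[OF Xs] Ys, symmetric]) simp
  also have "\<dots> = (\<Sum>j<nr. of_nat (hdim (reps ! j) A) * hdim (reps ! j) B)"
    by (rule sum_decomp_reps[OF Xs]) (rule hdim_iso[OF _ isomorphic_refl])
  finally show ?thesis by simp
qed

text \<open>Multiplication by \<open>Z\<close> is a normal matrix of non-negative integers.  Its restriction to the
  simple objects of \<open>D\<close> is a block, and comparing the traces of the products of this block with its
  transpose shows that the off-diagonal block vanishes.\<close>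

lemma fusion_subcategory_reflects:
  assumes D: "fusion_subcategory C D" and Z: "Z \<in> D"
    and P: "simple_object C P" "P \<in> D" and Q: "simple_object C Q" and PQ: "hdim P (Z \<otimes>\<^sub>o Q) > 0"
  shows "Q \<in> D"
proof -
  define N where "N i j = hdim (reps ! i) (Z \<otimes>\<^sub>o reps ! j)" for i j
  define B where "B = {i. i < nr \<and> reps ! i \<in> D}"
  have B: "finite B" "B \<subseteq> {..<nr}" unfolding B_def by auto
  \<comment> \<open>Row \<open>i\<close> and column \<open>i\<close> of the matrix of
    \<open>Z\<close> have the same sum of squares: these sums are endomorphism dimensions of
    products with \<open>Dual C Z\<close> and with \<open>Z\<close>, and the two factors commute up
    to isomorphism.\<close>
  have normal: "(\<Sum>j<nr. N i j * N i j) = (\<Sum>j<nr. N j i * N j i)" if i: "i < nr" for i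
  proof -
    let ?D = "Dual C Z" and ?R = "reps ! i"
    have "N i j = hdim (reps ! j) (?D \<otimes>\<^sub>o ?R)" for j
      unfolding N_def by (subst hdim_dual[symmetric]) (rule hdim_sym)
    then have "(\<Sum>j<nr. N i j * N i j) = hdim (?D \<otimes>\<^sub>o ?R) (?D \<otimes>\<^sub>o ?R)"
      using hdim_eq_sum[of "?D \<otimes>\<^sub>o ?R" "?D \<otimes>\<^sub>o ?R"] by simp
    also have "\<dots> = hdim ?R (Z \<otimes>\<^sub>o (?D \<otimes>\<^sub>o ?R))"
      by (rule hdim_dual)
    also have "\<dots> = hdim ?R (?D \<otimes>\<^sub>o (Z \<otimes>\<^sub>o ?R))"
    proof (rule hdim_iso[OF isomorphic_refl])
      have "isomorphic C (Z \<otimes>\<^sub>o (?D \<otimes>\<^sub>o ?R)) ((Z \<otimes>\<^sub>o ?D) \<otimes>\<^sub>o ?R)"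
        by (rule isomorphic_sym[OF isomorphic_assoc])
      also have "isomorphic C \<dots> ((?D \<otimes>\<^sub>o Z) \<otimes>\<^sub>o ?R)"
        by (rule isomorphic_TObj[OF isomorphic_TObj_comm isomorphic_refl])
      also have "isomorphic C \<dots> (?D \<otimes>\<^sub>o (Z \<otimes>\<^sub>o ?R))"
        by (rule isomorphic_assoc)
      finally show "isomorphic C (Z \<otimes>\<^sub>o (?D \<otimes>\<^sub>o ?R)) (?D \<otimes>\<^sub>o (Z \<otimes>\<^sub>o ?R))" .
    qed
    also have "\<dots> = hdim (Z \<otimes>\<^sub>o ?R) (Z \<otimes>\<^sub>o ?R)"
      unfolding hdim_sym[of ?R] by (rule hdim_dual)
    also have "\<dots> = (\<Sum>j<nr. N j i * N j i)"
      unfolding N_def by (rule hdim_eq_sum)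
    finally show ?thesis .
  qed
  have closed: "N j i = 0" if "i \<in> B" "j < nr" "j \<notin> B" for i j
  proof (rule ccontr)
    assume "N j i \<noteq> 0"
    then have "reps ! j \<in> D"
      using fusion_subcategory_hdim[OF D fusion_subcategory_tens[OF D Z] reps_simple] that
      unfolding N_def B_def by auto
    then show False using that unfolding B_def by simp
  qed
  have "(\<Sum>i\<in>B. \<Sum>j<nr. N i j * N i j) = (\<Sum>i\<in>B. \<Sum>j<nr. N j i * N j i)"
    by (rule sum.cong[OF refl normal]) (use B(2) in auto)
  also have "\<dots> = (\<Sum>i\<in>B. \<Sum>j\<in>B. N j i * N j i)"
    by (rule sum.cong[OF refl], rule sum.mono_neutral_right) (use closed B(2) in auto)
  also have "\<dots> = (\<Sum>i\<in>B. \<Sum>j\<in>B. N i j * N i j)"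
    by (rule sum.swap)
  finally have eq: "(\<Sum>i\<in>B. \<Sum>j<nr. N i j * N i j) = (\<Sum>i\<in>B. \<Sum>j\<in>B. N i j * N i j)" .
  have "(\<Sum>i\<in>B. \<Sum>j<nr. N i j * N i j) = (\<Sum>i\<in>B. \<Sum>j\<in>B. N i j * N i j) + (\<Sum>i\<in>B. \<Sum>j\<in>{..<nr} - B. N i j * N i j)"
    unfolding sum.distrib[symmetric]
    by (rule sum.cong[OF refl]) (simp add: sum.subset_diff[OF B(2)] add.commute)
  \<comment> \<open>The columns indexed by \<open>B\<close> vanish outside the block, so comparing
    with the rows leaves a zero sum of squares of natural numbers outside it.\<close>
  then have zero: "(\<Sum>i\<in>B. \<Sum>j\<in>{..<nr} - B. N i j * N i j) = 0"
    using eq by simp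
  obtain p where p: "p < nr" "isomorphic C P (reps ! p)" by (rule ex_rep[OF P(1)])
  obtain q where q: "q < nr" "isomorphic C Q (reps ! q)" by (rule ex_rep[OF Q])
  have "p \<in> B"
    unfolding B_def using p fusion_subcategory_iso[OF D P(2)] by simp
  have "N p q \<noteq> 0"
    unfolding N_def using PQ hdim_iso[OF p(2) isomorphic_TObj[OF isomorphic_refl q(2), of Z]] by simp
  have "q \<in> B"
  proof (rule ccontr)
    assume "q \<notin> B"
    then have "N p q * N p q = 0"
      using zero \<open>p \<in> B\<close> q(1) B(1) by (auto simp: sum_eq_0_iff)
    then show False using \<open>N p q \<noteq> 0\<close> by simp
  qed
  then show ?thesis
    using fusion_subcategory_iso[OF D _ isomorphic_sym[OF q(2)]] unfolding B_def by simp
qed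

text \<open>Closure under duals is not part of the definition of a fusion subcategory. It follows
  because the unit, which lies in \<open>D\<close>, is a constituent of
  \<open>Z \<otimes>\<^sub>o Dual C Z\<close>.\<close>

lemma fusion_subcategory_Dual:
  assumes D: "fusion_subcategory C D" and Z: "simple_object C Z" "Z \<in> D"
  shows "Dual C Z \<in> D"
proof (rule fusion_subcategory_reflects[OF D Z(2) simple_Unit fusion_subcategory_unit[OF D] simple_Dual[OF Z(1)]])
  show "hdim \<I> (Z \<otimes>\<^sub>o Dual C Z) > 0"
    unfolding hdim_unit_tens using hdim_simple[OF simple_Dual simple_Dual, OF Z(1) Z(1)] by simp
qed

section \<open>Consequences of the invertibility of the S-matrix\<close>

lemma S_inverse:
  "\<exists>T. (\<forall>i<nr. \<forall>j<nr. (\<Sum>l<nr. S_entry C (reps ! i) (reps ! l) * T l j) = (if i = j then 1 else 0)) \<and>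
     (\<forall>i<nr. \<forall>j<nr. (\<Sum>l<nr. T i l * S_entry C (reps ! l) (reps ! j)) = (if i = j then 1 else 0))"
proof -
  let ?S = "S_matrix C reps"
  have S: "dim_row ?S = nr" "dim_col ?S = nr" unfolding S_matrix_def by simp_all
  obtain T where T: "?S * T = 1\<^sub>m nr" "T * ?S = 1\<^sub>m (dim_row T)"
    using reps(2) S unfolding invertible_mat_def inverts_mat_def by auto
  have dT: "dim_col T = nr" "dim_row T = nr"
    using arg_cong[OF T(1), of dim_col] arg_cong[OF T(2), of dim_col] S by simp_all
  have 1: "(\<Sum>l<nr. S_entry C (reps ! i) (reps ! l) * T $$ (l, j)) = (if i = j then 1 else 0)" if "i < nr" "j < nr" for i j
  proof -
    have "(?S * T) $$ (i, j) = (if i = j then 1 else 0)" unfolding T(1) using that by simp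
    then show ?thesis
      using that S dT by (simp add: scalar_prod_def S_matrix_def atLeast0LessThan)
  qed
  have 2: "(\<Sum>l<nr. T $$ (i, l) * S_entry C (reps ! l) (reps ! j)) = (if i = j then 1 else 0)" if "i < nr" "j < nr" for i j
  proof -
    have "(T * ?S) $$ (i, j) = (if i = j then 1 else 0)" unfolding T(2) dT using that by simp
    then show ?thesis
      using that S dT by (simp add: scalar_prod_def S_matrix_def atLeast0LessThan)
  qed
  show ?thesis using 1 2 by (intro exI[of _ "\<lambda>i j. T $$ (i, j)"]) simp
qed

lemma S_rows_independent:
  assumes "\<And>j. j < nr \<Longrightarrow> (\<Sum>i<nr. b i * S_entry C (reps ! i) (reps ! j)) = 0" and "k < nr"
  shows "b k = 0"
proof -
  obtain T where T: "\<forall>i<nr. \<forall>j<nr. (\<Sum>l<nr. S_entry C (reps ! i) (reps ! l) * T l j) = (if i = j then 1 else 0)"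
    using S_inverse by blast
  have "0 = (\<Sum>j<nr. (\<Sum>i<nr. b i * S_entry C (reps ! i) (reps ! j)) * T j k)"
    using assms(1) by simp
  also have "\<dots> = (\<Sum>i<nr. b i * (\<Sum>j<nr. S_entry C (reps ! i) (reps ! j) * T j k))"
    unfolding sum_distrib_right sum_distrib_left by (subst sum.swap) (simp add: mult.assoc)
  also have "\<dots> = (\<Sum>i<nr. if i = k then b k else 0)"
    using T assms(2) by (intro sum.cong) auto
  also have "\<dots> = b k" using assms(2) by simp
  finally show ?thesis ..
qed

lemma S_rows_span: "\<exists>b. \<forall>j<nr. \<psi> j = (\<Sum>i<nr. b i * S_entry C (reps ! i) (reps ! j))"
proof -
  obtain T where T: "\<forall>i<nr. \<forall>j<nr. (\<Sum>l<nr. T i l * S_entry C (reps ! l) (reps ! j)) = (if i = j then 1 else 0)"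
    using S_inverse by blast
  have "\<psi> j = (\<Sum>i<nr. (\<Sum>l<nr. \<psi> l * T l i) * S_entry C (reps ! i) (reps ! j))" if j: "j < nr" for j
  proof -
    have "(\<Sum>i<nr. (\<Sum>l<nr. \<psi> l * T l i) * S_entry C (reps ! i) (reps ! j)) = (\<Sum>l<nr. \<psi> l * (\<Sum>i<nr. T l i * S_entry C (reps ! i) (reps ! j)))"
      unfolding sum_distrib_right sum_distrib_left by (subst sum.swap) (simp add: mult.assoc)
    also have "\<dots> = (\<Sum>l<nr. if l = j then \<psi> j else 0)"
      using T j by (intro sum.cong) auto
    finally show ?thesis using j by simp
  qed
  then show ?thesis by (intro exI[of _ "\<lambda>i. \<Sum>l<nr. \<psi> l * T l i"]) simp
qed

lemma S_row_nonzero: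
  assumes X: "simple_object C X"
  obtains Y where "simple_object C Y" "S_entry C X Y \<noteq> 0"
proof -
  obtain k where k: "k < nr" "isomorphic C X (reps ! k)" by (rule ex_rep[OF X])
  have "\<exists>j<nr. S_entry C (reps ! k) (reps ! j) \<noteq> 0"
  proof (rule ccontr)
    assume *: "\<not> ?thesis"
    have "(if k = k then 1 else 0 :: 'k) = 0"
    proof (rule S_rows_independent[of "\<lambda>i. if i = k then 1 else 0", OF _ k(1)])
      fix j assume "j < nr"
      have "(\<Sum>i<nr. (if i = k then 1 else 0) * S_entry C (reps ! i) (reps ! j)) = (\<Sum>i<nr. if i = k then S_entry C (reps ! k) (reps ! j) else 0)"
        by (intro sum.cong) auto
      then show "(\<Sum>i<nr. (if i = k then 1 else 0) * S_entry C (reps ! i) (reps ! j)) = 0"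
        using * k(1) \<open>j < nr\<close> by simp
    qed
    then show False by simp
  qed
  then obtain j where j: "j < nr" "S_entry C (reps ! k) (reps ! j) \<noteq> 0" by blast
  then show ?thesis
    using that[OF reps_simple[OF j(1)]] S_entry_iso[OF k(2) isomorphic_refl, of "reps ! j"] by simp
qed

text \<open>If \<open>qdim X\<close> vanished, \<open>S_entry_tens\<close> with two equal factors
  would give every entry of the row of \<open>X\<close> square zero.\<close>

lemma qdim_nonzero:
  assumes X: "simple_object C X"
  shows "qdim X \<noteq> 0"
proof
  assume "qdim X = 0"
  then have "S_entry C X Y = 0" for Y
    using S_entry_tens[OF X, of Y Y] by simp
  then show False
    using S_row_nonzero[OF X] by metis
qed

text \<open>The character of the Grothendieck ring defined by a row of the \<open>S\<close>-matrix.\<close>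

definition ch :: "'o \<Rightarrow> 'o \<Rightarrow> 'k" where "ch X Y = S_entry C X Y / qdim X"

lemma S_entry_eq_ch: "simple_object C X \<Longrightarrow> S_entry C X Y = ch X Y * qdim X"
  unfolding ch_def using qdim_nonzero by simp

lemma ch_tens: "simple_object C X \<Longrightarrow> ch X (Y \<otimes>\<^sub>o Z) = ch X Y * ch X Z"
  using S_entry_tens[of X Y Z] qdim_nonzero[of X] unfolding ch_def by (simp add: field_simps)

lemma ch_sum: "is_direct_sum C Z Xs \<Longrightarrow> ch X Z = (\<Sum>j<length Xs. ch X (Xs ! j))"
  unfolding ch_def using S_entry_sum_right[of Z Xs X] by (simp add: sum_divide_distrib)

lemma ch_iso: "\<lbrakk>isomorphic C X X'; isomorphic C Y Y'\<rbrakk> \<Longrightarrow> ch X Y = ch X' Y'"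
  unfolding ch_def using S_entry_iso qdim_iso by metis

lemma ch_unit:
  assumes X: "simple_object C X"
  shows "ch X \<I> = 1"
proof -
  obtain Y where Y: "S_entry C X Y \<noteq> 0" by (rule S_row_nonzero[OF X])
  then have "ch X Y \<noteq> 0" unfolding ch_def using qdim_nonzero[OF X] by simp
  moreover have "ch X Y = ch X \<I> * ch X Y"
    using ch_tens[OF X, of \<I> Y] ch_iso[OF isomorphic_refl isomorphic_unit(1), of X Y] by simp
  ultimately show ?thesis by simp
qed

text \<open>Symmetry, additivity and \<open>ch_unit\<close> replace a computation of the braiding
  with the unit.\<close>

lemma S_entry_unit: "S_entry C \<I> A = qdim A"
proof -
  obtain Xs where Xs: "decomp A Xs" using ex_decomp by blast
  have "S_entry C (Xs ! j) \<I> = qdim (Xs ! j)" if "j < length Xs" for j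
    using S_entry_eq_ch[OF decomp_nth[OF Xs that]] ch_unit[OF decomp_nth[OF Xs that]] by simp
  then show ?thesis
    using S_entry_sum_left[OF decompD(1)[OF Xs], of \<I>] qdim_sum[OF decompD(1)[OF Xs]]
    by (simp add: S_entry_sym[of \<I>])
qed

lemma ch_unit_left: "ch \<I> A = qdim A / qdim \<I>"
  unfolding ch_def S_entry_unit ..

lemma ch_unit_nonzero: "simple_object C Y \<Longrightarrow> ch \<I> Y \<noteq> 0"
  unfolding ch_unit_left using qdim_nonzero simple_Unit by simp

lemma ch_expand: "ch X A = (\<Sum>j<nr. of_nat (hdim (reps ! j) A) * ch X (reps ! j))"
proof -
  obtain Xs where Xs: "decomp A Xs" using ex_decomp by blast
  show ?thesis
    unfolding ch_sum[OF decompD(1)[OF Xs]]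
    by (rule sum_decomp_reps[OF Xs]) (rule ch_iso[OF isomorphic_refl])
qed

lemma ch_columns_independent:
  assumes "\<And>i. i < nr \<Longrightarrow> (\<Sum>j<nr. b j * ch (reps ! i) (reps ! j)) = (\<Sum>j<nr. c j * ch (reps ! i) (reps ! j))"
    and "k < nr"
  shows "b k = c k"
proof -
  have "b k - c k = 0"
  proof (rule S_rows_independent[of "\<lambda>j. b j - c j", OF _ assms(2)])
    fix i assume i: "i < nr"
    have "(\<Sum>j<nr. (b j - c j) * S_entry C (reps ! j) (reps ! i)) = (\<Sum>j<nr. (b j - c j) * ch (reps ! i) (reps ! j)) * qdim (reps ! i)"
      unfolding sum_distrib_right S_entry_sym[of _ "reps ! i"] S_entry_eq_ch[OF reps_simple[OF i]] by (simp add: mult.assoc)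
    also have "(\<Sum>j<nr. (b j - c j) * ch (reps ! i) (reps ! j)) = 0"
      using assms(1)[OF i] by (simp add: left_diff_distrib sum_subtractf)
    finally show "(\<Sum>j<nr. (b j - c j) * S_entry C (reps ! j) (reps ! i)) = 0" by simp
  qed
  then show ?thesis by simp
qed

text \<open>If no \<open>X\<close> other than the unit restricts to the character \<open>ch \<I>\<close> on \<open>E\<close>, then a product of
  factors \<open>ch _ Y - ch X Y\<close> exhibits the indicator function of the unit as a combination of columns
  from \<open>E\<close>.  Its coefficient at \<open>Z\<close> is \<open>ch \<I> (Dual Z)\<close> times the one at \<open>\<I>\<close>, hence never 0.\<close>

lemma fusion_subcategory_centralizer:
  assumes E: "fusion_subcategory C E" "E \<noteq> UNIV"
  shows "\<exists>X. simple_object C X \<and> \<not> isomorphic C X \<I> \<and> (\<forall>Y. simple_object C Y \<and> Y \<in> E \<longrightarrow> ch X Y = ch \<I> Y)"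
proof (rule ccontr)
  assume "\<not> ?thesis"
  then have sep: "\<exists>Y. simple_object C Y \<and> Y \<in> E \<and> ch X Y \<noteq> ch \<I> Y" if "simple_object C X" "\<not> isomorphic C X \<I>" for X
    using that by blast
  obtain u where u: "u < nr" "isomorphic C \<I> (reps ! u)" by (rule ex_rep[OF simple_Unit])
  \<comment> \<open>A function \<open>c\<close> stands for the element of the Grothendieck ring over
    the field with coefficients \<open>c j\<close> at \<open>reps ! j\<close>.
    \<open>comb c i\<close> is its value under the character of \<open>reps ! i\<close>,
    \<open>supp c\<close> places it in the span of \<open>E\<close>, and \<open>act Y c\<close> is
    its product with \<open>Y\<close>.\<close>
  define comb where "comb c i = (\<Sum>j<nr. c j * ch (reps ! i) (reps ! j))" for c and i :: nat
  define supp where "supp c \<longleftrightarrow> (\<forall>j<nr. reps ! j \<notin> E \<longrightarrow> c j = 0)" for c :: "nat \<Rightarrow> 'k"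
  define act where "act Y c m = (\<Sum>j<nr. c j * of_nat (hdim (reps ! m) (Y \<otimes>\<^sub>o reps ! j)))" for Y and c :: "nat \<Rightarrow> 'k" and m
  have act: "comb (act Y c) i = ch (reps ! i) Y * comb c i" if i: "i < nr" for Y c i
  proof -
    have "comb (act Y c) i = (\<Sum>j<nr. c j * (\<Sum>m<nr. of_nat (hdim (reps ! m) (Y \<otimes>\<^sub>o reps ! j)) * ch (reps ! i) (reps ! m)))"
      unfolding comb_def act_def sum_distrib_right sum_distrib_left by (subst sum.swap) (simp add: mult.assoc)
    also have "\<dots> = (\<Sum>j<nr. c j * (ch (reps ! i) Y * ch (reps ! i) (reps ! j)))"
      unfolding ch_expand[symmetric] ch_tens[OF reps_simple[OF i]] ..
    finally show ?thesis
      unfolding comb_def sum_distrib_left by (simp add: algebra_simps)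
  qed
  have act_supp: "supp (act Y c)" if "supp c" "Y \<in> E" for Y c
    unfolding supp_def
  proof (intro allI impI)
    fix m assume m: "m < nr" "reps ! m \<notin> E"
    have "c j * of_nat (hdim (reps ! m) (Y \<otimes>\<^sub>o reps ! j)) = 0" if j: "j < nr" for j
    proof (cases "reps ! j \<in> E")
      case True
      then have "hdim (reps ! m) (Y \<otimes>\<^sub>o reps ! j) = 0"
        using fusion_subcategory_hdim[OF E(1) fusion_subcategory_tens[OF E(1) \<open>Y \<in> E\<close>] reps_simple] m by blast
      then show ?thesis by simp
    next
      case False
      then show ?thesis using \<open>supp c\<close> j unfolding supp_def by simp
    qed
    then show "act Y c m = 0" unfolding act_def by (intro sum.neutral ballI) simp
  qed
  have "\<exists>c. supp c \<and> comb c u = 1 \<and> (\<forall>i\<in>T. comb c i = 0)" if "T \<subseteq> {..<nr} - {u}" for T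
  proof -
    have "finite T" using that finite_subset by blast
    then show ?thesis
      using that
    proof (induction T)
      case empty
      define c where "c j = (if j = u then 1 else 0 :: 'k)" for j
      have "comb c u = ch (reps ! u) (reps ! u)"
        unfolding comb_def c_def using u(1) by (simp add: if_distrib[of "\<lambda>t. t * _"] cong: if_cong)
      also have "\<dots> = 1"
        using ch_iso[OF isomorphic_refl u(2), of "reps ! u"] ch_unit[OF reps_simple[OF u(1)]] by simp
      finally have "comb c u = 1" .
      moreover have "supp c"
        using fusion_subcategory_iso[OF E(1) fusion_subcategory_unit[OF E(1)] u(2)] unfolding supp_def c_def by auto
      ultimately show ?case by blast
    next
      case (insert i T)
      then obtain c where c: "supp c" "comb c u = 1" "\<forall>i\<in>T. comb c i = 0" by auto
      have i: "i < nr" "i \<noteq> u" using insert.prems by auto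
      have "\<not> isomorphic C (reps ! i) \<I>"
        using isomorphic_trans[OF _ u(2), of "reps ! i"] reps_iso_iff[OF i(1) u(1)] i(2) by blast
      then obtain Y where Y: "simple_object C Y" "Y \<in> E" "ch (reps ! i) Y \<noteq> ch \<I> Y"
        using sep[OF reps_simple[OF i(1)]] by blast
      have Yu: "ch (reps ! u) Y = ch \<I> Y" using ch_iso[OF u(2) isomorphic_refl] by simp
      let ?a = "ch (reps ! i) Y" and ?d = "ch \<I> Y - ch (reps ! i) Y"
      \<comment> \<open>Multiplication by \<open>Y - ?a\<close>, divided by \<open>?d\<close>: the
        character of \<open>reps ! i\<close> now vanishes, the value at the unit stays 1, and zeros
        already achieved persist.\<close>
      define c' where "c' j = (act Y c j - ?a * c j) / ?d" for j
      have comb': "comb c' l = (ch (reps ! l) Y - ?a) * comb c l / ?d" if "l < nr" for l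
      proof -
        have "comb c' l = (comb (act Y c) l - ?a * comb c l) / ?d"
          unfolding comb_def c'_def sum_distrib_left sum_subtractf[symmetric] sum_divide_distrib
          by (intro sum.cong) (auto simp: algebra_simps)
        then show ?thesis unfolding act[OF that] by (simp add: algebra_simps)
      qed
      have "supp c'"
        using c(1) act_supp[OF c(1) Y(2)] unfolding supp_def c'_def by simp
      moreover have "comb c' u = 1"
        using comb'[OF u(1)] c(2) Yu Y(3) by simp
      moreover have "\<forall>l\<in>insert i T. comb c' l = 0"
        using comb' c(3) insert.prems by auto
      ultimately show ?case by blast
    qed
  qed
  then obtain c where c: "supp c" "comb c u = 1" "\<forall>i\<in>{..<nr} - {u}. comb c i = 0" by blast
  \<comment> \<open>Both sides have the same value under every character: at the unit by
    multiplicativity, at all others because \<open>c\<close> vanishes there. Independence of the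
    columns then identifies the coefficients.\<close>
  have key: "act Y c m = ch \<I> Y * c m" if m: "m < nr" for Y m
  proof (rule ch_columns_independent[OF _ m])
    fix i assume i: "i < nr"
    have "comb (act Y c) i = ch \<I> Y * comb c i"
      using act[OF i, of Y c] c(3) i ch_iso[OF u(2) isomorphic_refl, of Y] by (cases "i = u") auto
    then show "(\<Sum>j<nr. act Y c j * ch (reps ! i) (reps ! j)) = (\<Sum>j<nr. (ch \<I> Y * c j) * ch (reps ! i) (reps ! j))"
      unfolding comb_def sum_distrib_left by (simp add: mult.assoc)
  qed
  \<comment> \<open>\<open>key\<close> is compared at the unit coefficient, for \<open>Y\<close> the
    dual of \<open>reps ! k\<close>: the unit occurs in the product of that dual with
    \<open>reps ! j\<close> only when \<open>j = k\<close>.\<close>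
  have coeff: "c k = ch \<I> (Dual C (reps ! k)) * c u" if k: "k < nr" for k
  proof -
    have "hdim (reps ! u) (Dual C (reps ! k) \<otimes>\<^sub>o reps ! j) = (if j = k then 1 else 0)" if j: "j < nr" for j
    proof -
      have "hdim (reps ! u) (Dual C (reps ! k) \<otimes>\<^sub>o reps ! j) = hdim (Dual C (reps ! k) \<otimes>\<^sub>o reps ! j) \<I>"
        using hdim_iso[OF isomorphic_sym[OF u(2)] isomorphic_refl] hdim_sym by metis
      then show ?thesis
        unfolding hdim_dual_unit using hdim_reps[OF k j] by auto
    qed
    then have "act (Dual C (reps ! k)) c u = (\<Sum>j<nr. if j = k then c k else 0)"
      unfolding act_def by (intro sum.cong) auto
    then show ?thesis using key[OF u(1)] k by simp
  qed
  have "c u \<noteq> 0"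
  proof
    assume "c u = 0"
    then have "c k = 0" if "k < nr" for k using coeff[OF that] by simp
    then have "comb c u = 0" unfolding comb_def by simp
    then show False using c(2) by simp
  qed
  then have "reps ! k \<in> E" if k: "k < nr" for k
    using coeff[OF k] ch_unit_nonzero[OF simple_Dual[OF reps_simple[OF k]]] c(1) k unfolding supp_def by auto
  then have "W \<in> E" if W: "simple_object C W" for W
    using ex_rep[OF W] fusion_subcategory_iso[OF E(1) _ isomorphic_sym] by metis
  then have "E = UNIV"
    using fusion_subcategory_mem_iff[OF E(1)] by blast
  then show False using E(2) by simp
qed

end

section \<open>Invertible objects\<close>

context acf_modular_category
begin

lemma hdim_tens_invertible_le:
  assumes "isomorphic C (h \<otimes>\<^sub>o g) \<I>"
  shows "hdim A B \<le> hdim (g \<otimes>\<^sub>o A) (g \<otimes>\<^sub>o B)"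
proof -
  obtain B0 where B0: "finite B0" "Hom C A B = span B0"
    using finite_dim_Hom by blast
  obtain B1 where B1: "finite B1" "Hom C (g \<otimes>\<^sub>o A) (g \<otimes>\<^sub>o B) = span B1"
    using finite_dim_Hom by blast
  have add: "Ident C g \<otimes>\<^sub>m (x + y) = Ident C g \<otimes>\<^sub>m x + Ident C g \<otimes>\<^sub>m y" if "x \<in> Hom C A B" "y \<in> Hom C A B" for x y
    using TMor_add_right[OF Ident_in that] .
  show ?thesis
  proof (rule dim_le_of_inj[OF subspace_Hom B0(1) equalityD1[OF B0(2)] subspace_Hom B1(1) equalityD1[OF B1(2)] _ _ add])
    show "inj_on (\<lambda>f. Ident C g \<otimes>\<^sub>m f) (Hom C A B)"
    proof (rule inj_onI)
      fix x y assume xy: "x \<in> Hom C A B" "y \<in> Hom C A B" "Ident C g \<otimes>\<^sub>m x = Ident C g \<otimes>\<^sub>m y"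
      have "Ident C g \<otimes>\<^sub>m (x - y) + Ident C g \<otimes>\<^sub>m y = Ident C g \<otimes>\<^sub>m x"
        using add[OF diff_in_Hom[OF xy(1,2)] xy(2)] by simp
      then have "Ident C g \<otimes>\<^sub>m (x - y) = 0" using xy(3) by simp
      then show "x = y"
        using tens_invertible_faithful[OF assms diff_in_Hom[OF xy(1,2)]] by simp
    qed
    show "(\<lambda>f. Ident C g \<otimes>\<^sub>m f) ` Hom C A B \<subseteq> Hom C (g \<otimes>\<^sub>o A) (g \<otimes>\<^sub>o B)"
      using TMor_in[OF Ident_in[of g]] by auto
    show "Ident C g \<otimes>\<^sub>m Scale C a x = Scale C a (Ident C g \<otimes>\<^sub>m x)" if "x \<in> Hom C A B" for a x
      using TMor_scale_right[OF Ident_in that] .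
  qed
qed

text \<open>Tensoring with \<open>g\<close> and with its inverse both do not decrease hom
  dimensions, so the endomorphism space of the product is one-dimensional.\<close>

lemma simple_invertible_tens:
  assumes g: "invertible_object C g" and Y: "simple_object C Y"
  shows "simple_object C (g \<otimes>\<^sub>o Y)"
proof -
  obtain h where h: "isomorphic C (g \<otimes>\<^sub>o h) \<I>" "isomorphic C (h \<otimes>\<^sub>o g) \<I>"
    using g unfolding invertible_object_def by blast
  have "isomorphic C (h \<otimes>\<^sub>o (g \<otimes>\<^sub>o Y)) Y"
  proof -
    have "isomorphic C (h \<otimes>\<^sub>o (g \<otimes>\<^sub>o Y)) ((h \<otimes>\<^sub>o g) \<otimes>\<^sub>o Y)"
      by (rule isomorphic_sym[OF isomorphic_assoc])
    also have "isomorphic C \<dots> (\<I> \<otimes>\<^sub>o Y)"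
      by (rule isomorphic_TObj[OF h(2) isomorphic_refl])
    also have "isomorphic C \<dots> Y"
      by (rule isomorphic_unit)
    finally show ?thesis .
  qed
  then have "hdim (g \<otimes>\<^sub>o Y) (g \<otimes>\<^sub>o Y) \<le> hdim Y Y"
    using hdim_tens_invertible_le[OF h(1), of "g \<otimes>\<^sub>o Y" "g \<otimes>\<^sub>o Y"] hdim_iso by metis
  moreover have "hdim Y Y \<le> hdim (g \<otimes>\<^sub>o Y) (g \<otimes>\<^sub>o Y)"
    by (rule hdim_tens_invertible_le[OF h(2)])
  ultimately show ?thesis
    using hdim_simple[OF Y Y] by (intro hdim_one_simple) simp
qed

lemma simple_invertible: "invertible_object C g \<Longrightarrow> simple_object C g"
  using simple_iso[OF simple_invertible_tens[OF _ simple_Unit] isomorphic_unit(2)] .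

text \<open>For invertible \<open>g\<close>, \<open>chi g Y\<close> is the scalar by which the double braiding acts on \<open>g \<otimes> Y\<close>.\<close>

definition chi :: "'o \<Rightarrow> 'o \<Rightarrow> 'k" where "chi g Y = ch g Y / ch \<I> Y"

lemma chi_iso: "\<lbrakk>isomorphic C g g'; isomorphic C Y Y'\<rbrakk> \<Longrightarrow> chi g Y = chi g' Y'"
  unfolding chi_def using ch_iso isomorphic_refl by metis

text \<open>The trace of a scalar double braiding is the scalar times the dimension of the product,
  which \<open>S_entry_tens\<close> at the unit factors. The number \<open>qdim \<I>\<close> is
  carried along and cancels in the quotient.\<close>

lemma chi_eqI:
  assumes g: "invertible_object C g" and Y: "simple_object C Y" and a: "dbr g Y = Scale C a (Ident C (g \<otimes>\<^sub>o Y))"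
  shows "chi g Y = a"
proof -
  have "S_entry C g Y = a * qdim (g \<otimes>\<^sub>o Y)"
    unfolding S_entry_def a qdim_def by (rule quantum_trace_scale[OF Ident_in])
  then have "S_entry C g Y * qdim \<I> = a * (qdim g * qdim Y)"
    using S_entry_tens[OF simple_Unit, of g Y] by (simp add: S_entry_unit mult.assoc)
  then have "ch g Y = a * (qdim Y / qdim \<I>)"
    unfolding ch_def using qdim_nonzero[OF simple_invertible[OF g]] qdim_nonzero[OF simple_Unit]
    by (simp add: field_simps)
  then show ?thesis
    unfolding chi_def using ch_unit_nonzero[OF Y] by (simp add: ch_unit_left)
qed

lemma dbr_chi:
  assumes g: "invertible_object C g" and Y: "simple_object C Y"
  shows "dbr g Y = Scale C (chi g Y) (Ident C (g \<otimes>\<^sub>o Y))"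
proof -
  obtain a where a: "dbr g Y = Scale C a (Ident C (g \<otimes>\<^sub>o Y))"
    using schur[OF simple_invertible_tens[OF g Y] dbr_in] .
  then show ?thesis using chi_eqI[OF g Y a] by simp
qed

text \<open>\<open>dbr_tens_scale\<close> handles products in the second argument, so the scalars
  are swapped over, multiplied and swapped back.\<close>

lemma chi_tens_left:
  assumes g: "invertible_object C g" and h: "invertible_object C h" and Y: "simple_object C Y"
  shows "chi (g \<otimes>\<^sub>o h) Y = chi g Y * chi h Y"
proof -
  have "dbr Y (g \<otimes>\<^sub>o h) = Scale C (chi h Y * chi g Y) (Ident C (Y \<otimes>\<^sub>o (g \<otimes>\<^sub>o h)))"
    by (rule dbr_tens_scale[OF dbr_swap_scale[OF dbr_chi[OF g Y]] dbr_swap_scale[OF dbr_chi[OF h Y]]])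
  then show ?thesis
    using chi_eqI[OF invertible_tens[OF g h] Y dbr_swap_scale] by (simp add: mult.commute)
qed

text \<open>A nonzero \<open>f\<close> from \<open>W\<close> into the product intertwines the two
  scalars by naturality. It stays nonzero after tensoring with \<open>g\<close> because
  \<open>g\<close> is invertible, so the scalars agree.\<close>

lemma chi_tens_right:
  assumes g: "invertible_object C g" and Y: "simple_object C Y" and Z: "simple_object C Z"
    and W: "simple_object C W" "hdim W (Y \<otimes>\<^sub>o Z) > 0"
  shows "chi g W = chi g Y * chi g Z"
proof -
  obtain h where h: "isomorphic C (h \<otimes>\<^sub>o g) \<I>"
    using g unfolding invertible_object_def by blast
  obtain f where f: "f \<in> Hom C W (Y \<otimes>\<^sub>o Z)" "f \<noteq> 0"
    using W(2) unfolding hdim_pos_iff by blast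
  let ?f = "Ident C g \<otimes>\<^sub>m f"
  have fH: "?f \<in> Hom C (g \<otimes>\<^sub>o W) (g \<otimes>\<^sub>o (Y \<otimes>\<^sub>o Z))"
    using TMor_in[OF Ident_in f(1)] .
  have "?f \<noteq> 0"
    using tens_invertible_faithful[OF h f(1)] f(2) by blast
  moreover have "Scale C (chi g Z * chi g Y) ?f = Scale C (chi g W) ?f"
    using dbr_natural_right[OF f(1), of g] dbr_tens_scale[OF dbr_chi[OF g Y] dbr_chi[OF g Z]] dbr_chi[OF g W(1)]
      Comp_scale_left[OF Ident_in fH] Comp_scale_right[OF fH Ident_in] Ident_Comp[OF fH] Comp_Ident[OF fH] by simp
  ultimately show ?thesis by (simp add: mult.commute)
qed

lemma chi_unit_right: "invertible_object C g \<Longrightarrow> chi g \<I> = 1"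
  unfolding chi_def using ch_unit simple_invertible simple_Unit by simp

lemma chi_unit_left: "simple_object C Y \<Longrightarrow> chi \<I> Y = 1"
  unfolding chi_def using ch_unit_nonzero by simp

lemma ch_rows_independent:
  assumes "\<And>j. j < nr \<Longrightarrow> (\<Sum>i<nr. b i * ch (reps ! i) (reps ! j)) = 0" and "k < nr"
  shows "b k = 0"
proof -
  have "b k / qdim (reps ! k) = 0"
  proof (rule S_rows_independent[of "\<lambda>i. b i / qdim (reps ! i)", OF _ assms(2)])
    fix j assume "j < nr"
    then show "(\<Sum>i<nr. b i / qdim (reps ! i) * S_entry C (reps ! i) (reps ! j)) = 0"
      using assms(1)[of j] unfolding ch_def by simp
  qed
  then show ?thesis using qdim_nonzero[OF reps_simple[OF assms(2)]] by simp
qed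

lemma ch_inj:
  assumes X: "simple_object C X" "simple_object C X'" and eq: "\<And>Y. simple_object C Y \<Longrightarrow> ch X Y = ch X' Y"
  shows "isomorphic C X X'"
proof -
  obtain i where i: "i < nr" "isomorphic C X (reps ! i)" by (rule ex_rep[OF X(1)])
  obtain i' where i': "i' < nr" "isomorphic C X' (reps ! i')" by (rule ex_rep[OF X(2)])
  have "i = i'"
  proof (rule ccontr)
    assume ne: "i \<noteq> i'"
    define b where "b l = (if l = i then 1 else 0) - (if l = i' then 1 else 0 :: 'k)" for l
    have "b i = 0"
    proof (rule ch_rows_independent[OF _ i(1)])
      fix j assume j: "j < nr"
      have "(\<Sum>l<nr. b l * ch (reps ! l) (reps ! j)) = (\<Sum>l<nr. (if l = i then ch (reps ! i) (reps ! j) else 0) - (if l = i' then ch (reps ! i') (reps ! j) else 0))"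
        unfolding b_def by (intro sum.cong) (auto simp: algebra_simps)
      also have "\<dots> = ch (reps ! i) (reps ! j) - ch (reps ! i') (reps ! j)"
        using i(1) i'(1) by (simp add: sum_subtractf)
      also have "\<dots> = 0"
        using eq[OF reps_simple[OF j]] ch_iso[OF i(2) isomorphic_refl, of "reps ! j"] ch_iso[OF i'(2) isomorphic_refl, of "reps ! j"] by simp
      finally show "(\<Sum>l<nr. b l * ch (reps ! l) (reps ! j)) = 0" .
    qed
    then show False using ne unfolding b_def by simp
  qed
  then show ?thesis
    using i(2) isomorphic_sym[OF i'(2)] isomorphic_trans by blast
qed

lemma chi_inj:
  assumes g: "invertible_object C g" and eq: "\<And>Y. simple_object C Y \<Longrightarrow> chi g Y = 1"
  shows "isomorphic C g \<I>"
proof (rule ch_inj[OF simple_invertible[OF g] simple_Unit])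
  fix Y assume Y: "simple_object C Y"
  then show "ch g Y = ch \<I> Y"
    using eq[OF Y] ch_unit_nonzero[OF Y] unfolding chi_def by simp
qed

text \<open>By Frobenius reciprocity \<open>Dual C Z2\<close> occurs in
  \<open>Dual C Y1 \<otimes>\<^sub>o Dual C Y2\<close>. Exchanging the two middle factors then
  places all constituents of \<open>Z1 \<otimes>\<^sub>o Dual C Z2\<close> in the product of the two
  objects assumed to lie in \<open>F\<close>.\<close>

lemma constituents_tens_Dual:
  assumes F: "fusion_subcategory C F"
    and Y: "Y1 \<otimes>\<^sub>o Dual C Y1 \<in> F" "Y2 \<otimes>\<^sub>o Dual C Y2 \<in> F"
    and Z: "simple_object C Z1" "simple_object C Z2" "hdim Z1 (Y1 \<otimes>\<^sub>o Y2) > 0" "hdim Z2 (Y1 \<otimes>\<^sub>o Y2) > 0"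
  shows "Z1 \<otimes>\<^sub>o Dual C Z2 \<in> F"
proof -
  let ?D1 = "Dual C Y1" and ?D2 = "Dual C Y2"
  have "hdim (Dual C Z2) (?D1 \<otimes>\<^sub>o ?D2) = hdim \<I> (Z2 \<otimes>\<^sub>o (?D1 \<otimes>\<^sub>o ?D2))"
    by (rule hdim_unit_tens[symmetric])
  also have "\<dots> = hdim \<I> (?D1 \<otimes>\<^sub>o (?D2 \<otimes>\<^sub>o Z2))"
    using isomorphic_trans[OF isomorphic_TObj_comm isomorphic_assoc] by (rule hdim_iso[OF isomorphic_refl])
  also have "\<dots> = hdim Y1 (?D2 \<otimes>\<^sub>o Z2)"
    using hdim_dual_unit hdim_sym by metis
  also have "\<dots> = hdim Z2 (Y2 \<otimes>\<^sub>o Y1)"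
    using hdim_dual hdim_sym by metis
  also have "\<dots> = hdim Z2 (Y1 \<otimes>\<^sub>o Y2)"
    by (rule hdim_iso[OF isomorphic_refl isomorphic_TObj_comm])
  finally have D: "hdim (Dual C Z2) (?D1 \<otimes>\<^sub>o ?D2) > 0"
    using Z(4) by simp
  have "(Y1 \<otimes>\<^sub>o ?D1) \<otimes>\<^sub>o (Y2 \<otimes>\<^sub>o ?D2) \<in> F"
    by (rule fusion_subcategory_tens[OF F Y])
  then have FF: "(Y1 \<otimes>\<^sub>o Y2) \<otimes>\<^sub>o (?D1 \<otimes>\<^sub>o ?D2) \<in> F"
    using fusion_subcategory_iso[OF F _ tens_middle_four] by blast
  show ?thesis
  proof (rule iffD2[OF fusion_subcategory_mem_iff[OF F]], intro allI impI, elim conjE)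
    fix W assume W: "simple_object C W" "hdim W (Z1 \<otimes>\<^sub>o Dual C Z2) > 0"
    have "hdim W ((Y1 \<otimes>\<^sub>o Y2) \<otimes>\<^sub>o (?D1 \<otimes>\<^sub>o ?D2)) > 0"
      by (rule hdim_tens_mono[OF Z(1,3) simple_Dual[OF Z(2)] D W(2)])
    then show "W \<in> F"
      using fusion_subcategory_hdim[OF F FF W(1)] by blast
  qed
qed

text \<open>An object whose character agrees with the dimension on the adjoint subcategory is invertible:
  the quotient \<open>\<phi>\<close> of the two characters is a grading, so dividing instead of multiplying by \<open>\<phi>\<close>
  gives another character.  By independence of characters it belongs to some \<open>X'\<close>, which is inverse
  to \<open>X\<close>.\<close>

lemma invertible_of_centralizes_adjoint:
  assumes E: "fusion_subcategory C E" "\<And>Y. simple_object C Y \<Longrightarrow> Y \<otimes>\<^sub>o Dual C Y \<in> E"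
    and X: "simple_object C X" and eq: "\<And>Y. \<lbrakk>simple_object C Y; Y \<in> E\<rbrakk> \<Longrightarrow> ch X Y = ch \<I> Y"
  shows "invertible_object C X"
proof -
  have eqE: "ch X A = ch \<I> A" if "A \<in> E" for A
  proof -
    obtain Xs where Xs: "decomp A Xs" using ex_decomp by blast
    have "ch X (Xs ! j) = ch \<I> (Xs ! j)" if "j < length Xs" for j
      using eq[OF decomp_nth[OF Xs that]] fusion_subcategory_hdim[OF E(1) \<open>A \<in> E\<close> decomp_nth[OF Xs that] hdim_decomp_nth_pos[OF Xs that]] by blast
    then show ?thesis
      unfolding ch_sum[OF decompD(1)[OF Xs]] by simp
  qed
  have ch_tens_E: "ch X Y * ch X Z = ch \<I> Y * ch \<I> Z" if "Y \<otimes>\<^sub>o Z \<in> E" for Y Z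
    using eqE[OF that] ch_tens[OF X] ch_tens[OF simple_Unit] by simp
  have nz: "ch X Y \<noteq> 0" if "simple_object C Y" for Y
    using ch_tens_E[OF E(2)[OF that]] ch_unit_nonzero[OF that] ch_unit_nonzero[OF simple_Dual[OF that]] by auto
  define \<phi> where "\<phi> Y = ch X Y / ch \<I> Y" for Y
  have \<phi>nz: "\<phi> Y \<noteq> 0" if "simple_object C Y" for Y
    unfolding \<phi>_def using nz[OF that] ch_unit_nonzero[OF that] by simp
  have ch\<phi>: "ch X Y = \<phi> Y * ch \<I> Y" if "simple_object C Y" for Y
    unfolding \<phi>_def using ch_unit_nonzero[OF that] by simp
  have \<phi>_E: "\<phi> Y * \<phi> Z = 1" if "simple_object C Y" "simple_object C Z" "Y \<otimes>\<^sub>o Z \<in> E" for Y Z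
    using ch_tens_E[OF that(3)] ch_unit_nonzero[OF that(1)] ch_unit_nonzero[OF that(2)] unfolding \<phi>_def by simp
  \<comment> \<open>Two constituents of one product differ by an element of \<open>E\<close>, where
    the two characters agree: \<open>Z1\<close> and \<open>Z2\<close> have the same product with
    \<open>Dual C Z2\<close> under \<open>\<phi>\<close>.\<close>
  have \<phi>_const: "\<phi> Z1 = \<phi> Z2"
    if "simple_object C Y1" "simple_object C Y2" "simple_object C Z1" "simple_object C Z2"
      "hdim Z1 (Y1 \<otimes>\<^sub>o Y2) > 0" "hdim Z2 (Y1 \<otimes>\<^sub>o Y2) > 0" for Y1 Y2 Z1 Z2
  proof -
    have "\<phi> Z1 * \<phi> (Dual C Z2) = 1"
      using \<phi>_E[OF that(3) simple_Dual[OF that(4)]] constituents_tens_Dual[OF E(1) E(2)[OF that(1)] E(2)[OF that(2)] that(3-6)] by blast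
    moreover have "\<phi> Z2 * \<phi> (Dual C Z2) = 1"
      using \<phi>_E[OF that(4) simple_Dual[OF that(4)] E(2)[OF that(4)]] .
    ultimately show ?thesis
      using \<phi>nz[OF simple_Dual[OF that(4)]] by (metis mult_right_cancel)
  qed
  have \<phi>_mult: "\<phi> W = \<phi> Y * \<phi> Z"
    if YZ: "simple_object C Y" "simple_object C Z" and W: "simple_object C W" "hdim W (Y \<otimes>\<^sub>o Z) > 0" for Y Z W
  proof -
    obtain Xs where Xs: "decomp (Y \<otimes>\<^sub>o Z) Xs" using ex_decomp by blast
    have "ch X (Xs ! j) = \<phi> W * ch \<I> (Xs ! j)" if "j < length Xs" for j
      using ch\<phi>[OF decomp_nth[OF Xs that]] \<phi>_const[OF YZ decomp_nth[OF Xs that] W(1) hdim_decomp_nth_pos[OF Xs that] W(2)] by simp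
    then have "ch X (Y \<otimes>\<^sub>o Z) = \<phi> W * ch \<I> (Y \<otimes>\<^sub>o Z)"
      unfolding ch_sum[OF decompD(1)[OF Xs]] sum_distrib_left by simp
    then have "ch X Y * ch X Z = \<phi> W * (ch \<I> Y * ch \<I> Z)"
      using ch_tens[OF X] ch_tens[OF simple_Unit] by simp
    then show ?thesis
      unfolding \<phi>_def using ch_unit_nonzero[OF YZ(1)] ch_unit_nonzero[OF YZ(2)] by (simp add: field_simps)
  qed
  \<comment> \<open>The character of \<open>X\<close> is the dimension times the grading
    \<open>\<phi>\<close>; a tensor inverse of \<open>X\<close> must have the dimension divided by
    \<open>\<phi>\<close> as its character.\<close>
  define \<psi> where "\<psi> Y = ch \<I> Y / \<phi> Y" for Y
  have \<phi>_iso: "\<phi> Y = \<phi> Y'" if "isomorphic C Y Y'" for Y Y'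
    unfolding \<phi>_def using ch_iso[OF isomorphic_refl that] by simp
  have \<psi>_iso: "\<psi> Y = \<psi> Y'" if "isomorphic C Y Y'" for Y Y'
    unfolding \<psi>_def using \<phi>_iso[OF that] ch_iso[OF isomorphic_refl that] by simp
  obtain b0 where b0: "\<forall>j<nr. \<psi> (reps ! j) = (\<Sum>i<nr. b0 i * S_entry C (reps ! i) (reps ! j))"
    using S_rows_span[of "\<lambda>j. \<psi> (reps ! j)"] by blast
  define b where "b i = b0 i * qdim (reps ! i)" for i
  define \<Psi> where "\<Psi> A = (\<Sum>i<nr. b i * ch (reps ! i) A)" for A
  have \<Psi>: "\<Psi> Y = \<psi> Y" if Y: "simple_object C Y" for Y
  proof -
    obtain j where j: "j < nr" "isomorphic C Y (reps ! j)" by (rule ex_rep[OF Y])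
    have "\<Psi> Y = \<Psi> (reps ! j)"
      unfolding \<Psi>_def using ch_iso[OF isomorphic_refl j(2)] by simp
    also have "\<dots> = \<psi> (reps ! j)"
      unfolding \<Psi>_def b_def b0[rule_format, OF j(1)] by (intro sum.cong) (auto simp: S_entry_eq_ch[OF reps_simple] mult_ac)
    finally show ?thesis using \<psi>_iso[OF j(2)] by simp
  qed
  have \<Psi>_tens: "\<Psi> (Y \<otimes>\<^sub>o Z) = \<psi> Y * \<psi> Z" if YZ: "simple_object C Y" "simple_object C Z" for Y Z
  proof -
    obtain Xs where Xs: "decomp (Y \<otimes>\<^sub>o Z) Xs" using ex_decomp by blast
    have "\<Psi> (Y \<otimes>\<^sub>o Z) = (\<Sum>l<length Xs. \<Psi> (Xs ! l))"
      unfolding \<Psi>_def ch_sum[OF decompD(1)[OF Xs]] sum_distrib_left by (rule sum.swap)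
    also have "\<dots> = (\<Sum>l<length Xs. ch \<I> (Xs ! l) / (\<phi> Y * \<phi> Z))"
    proof (rule sum.cong[OF refl])
      fix l assume "l \<in> {..<length Xs}"
      then have l: "l < length Xs" by simp
      show "\<Psi> (Xs ! l) = ch \<I> (Xs ! l) / (\<phi> Y * \<phi> Z)"
        using \<Psi>[OF decomp_nth[OF Xs l]] \<phi>_mult[OF YZ decomp_nth[OF Xs l] hdim_decomp_nth_pos[OF Xs l]] unfolding \<psi>_def by simp
    qed
    also have "\<dots> = ch \<I> (Y \<otimes>\<^sub>o Z) / (\<phi> Y * \<phi> Z)"
      unfolding ch_sum[OF decompD(1)[OF Xs]] sum_divide_distrib ..
    finally show ?thesis
      unfolding \<psi>_def ch_tens[OF simple_Unit] by simp
  qed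
  \<comment> \<open>Dedekind's argument: \<open>\<Psi>\<close> at
    \<open>Y \<otimes>\<^sub>o reps ! j\<close> is evaluated once through the characters and once by
    multiplicativity. Independence of the rows then kills every coefficient whose character differs
    from \<open>\<psi>\<close>.\<close>
  have dedekind: "b i * (ch (reps ! i) Y - \<psi> Y) = 0" if Y: "simple_object C Y" and i: "i < nr" for Y i
  proof (rule ch_rows_independent[of "\<lambda>i. b i * (ch (reps ! i) Y - \<psi> Y)", OF _ i])
    fix j assume j: "j < nr"
    have "(\<Sum>i<nr. b i * (ch (reps ! i) Y - \<psi> Y) * ch (reps ! i) (reps ! j))
        = (\<Sum>i<nr. b i * (ch (reps ! i) Y * ch (reps ! i) (reps ! j))) - \<psi> Y * \<Psi> (reps ! j)"
      unfolding \<Psi>_def sum_distrib_left sum_subtractf[symmetric] by (intro sum.cong) (auto simp: algebra_simps)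
    also have "(\<Sum>i<nr. b i * (ch (reps ! i) Y * ch (reps ! i) (reps ! j))) = \<Psi> (Y \<otimes>\<^sub>o reps ! j)"
      unfolding \<Psi>_def by (intro sum.cong) (auto simp: ch_tens[OF reps_simple])
    also have "\<dots> - \<psi> Y * \<Psi> (reps ! j) = 0"
      using \<Psi>_tens[OF Y reps_simple[OF j]] \<Psi>[OF reps_simple[OF j]] by simp
    finally show "(\<Sum>i<nr. b i * (ch (reps ! i) Y - \<psi> Y) * ch (reps ! i) (reps ! j)) = 0" .
  qed
  have "\<exists>i<nr. b i \<noteq> 0"
  proof (rule ccontr)
    assume "\<not> ?thesis"
    then have "\<Psi> \<I> = 0" unfolding \<Psi>_def by simp
    then show False
      using \<Psi>[OF simple_Unit] \<phi>nz[OF simple_Unit] ch_unit_nonzero[OF simple_Unit] unfolding \<psi>_def by simp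
  qed
  then obtain i where i: "i < nr" "b i \<noteq> 0" by blast
  define X' where "X' = reps ! i"
  have X': "simple_object C X'" unfolding X'_def using reps_simple[OF i(1)] .
  have chX': "ch X' Y = \<psi> Y" if "simple_object C Y" for Y
    using dedekind[OF that i(1)] i(2) unfolding X'_def by simp
  \<comment> \<open>Symmetry of the S-matrix exchanges the object that defines the character with
    its argument.\<close>
  have swap: "ch Y A = ch A Y * qdim A / qdim Y" if "simple_object C A" for A Y
    using S_entry_eq_ch[OF that, of Y] S_entry_sym[of A Y] unfolding ch_def[of Y A] by simp
  \<comment> \<open>The common value at \<open>X \<otimes>\<^sub>o X'\<close> of all characters:
    \<open>\<phi>\<close> cancels, and so does the dimension of \<open>Y\<close>. Having constant
    characters, the class of this product is \<open>\<kappa>\<close> times the unit.\<close>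
  define \<kappa> where "\<kappa> = qdim X * qdim X' / (qdim \<I> * qdim \<I>)"
  have const: "ch Y (X \<otimes>\<^sub>o X') = \<kappa>" if Y: "simple_object C Y" for Y
  proof -
    have "ch Y (X \<otimes>\<^sub>o X') = (ch X Y * qdim X / qdim Y) * (ch X' Y * qdim X' / qdim Y)"
      unfolding ch_tens[OF Y] swap[OF X] swap[OF X'] ..
    also have "ch X Y * qdim X / qdim Y * (ch X' Y * qdim X' / qdim Y) = (ch X Y * ch X' Y) * (qdim X * qdim X') / (qdim Y * qdim Y)"
      by simp
    also have "ch X Y * ch X' Y = ch \<I> Y * ch \<I> Y"
      unfolding chX'[OF Y] ch\<phi>[OF Y] \<psi>_def using \<phi>nz[OF Y] by simp
    finally show ?thesis
      unfolding \<kappa>_def ch_unit_left using qdim_nonzero[OF Y] by simp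
  qed
  obtain u where u: "u < nr" "isomorphic C \<I> (reps ! u)" by (rule ex_rep[OF simple_Unit])
  have mult: "of_nat (hdim (reps ! j) (X \<otimes>\<^sub>o X')) = (if j = u then \<kappa> else 0)" if j: "j < nr" for j
  proof (rule ch_columns_independent[of "\<lambda>j. of_nat (hdim (reps ! j) (X \<otimes>\<^sub>o X'))", OF _ j])
    fix l assume l: "l < nr"
    have "(\<Sum>j<nr. (if j = u then \<kappa> else 0) * ch (reps ! l) (reps ! j)) = (\<Sum>j<nr. if j = u then \<kappa> * ch (reps ! l) (reps ! u) else 0)"
      by (intro sum.cong) auto
    also have "\<dots> = \<kappa>"
      using u(1) ch_unit[OF reps_simple[OF l]] ch_iso[OF isomorphic_refl u(2), of "reps ! l"] by simp
    finally show "(\<Sum>j<nr. of_nat (hdim (reps ! j) (X \<otimes>\<^sub>o X')) * ch (reps ! l) (reps ! j)) = (\<Sum>j<nr. (if j = u then \<kappa> else 0) * ch (reps ! l) (reps ! j))"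
      unfolding ch_expand[symmetric] const[OF reps_simple[OF l]] by simp
  qed
  \<comment> \<open>Here the characteristic matters: a multiplicity with zero image in the field is
    zero.\<close>
  have off: "hdim (reps ! j) (X \<otimes>\<^sub>o X') = 0" if "j < nr" "j \<noteq> u" for j
    using mult[OF that(1)] that(2) by simp
  have "hdim (reps ! u) (X \<otimes>\<^sub>o X') = hdim (Dual C X) X'"
    using hdim_iso[OF u(2) isomorphic_refl] hdim_unit_tens by metis
  moreover have "\<kappa> \<noteq> 0"
    unfolding \<kappa>_def using qdim_nonzero X X' simple_Unit by simp
  \<comment> \<open>The multiplicity is 0 or 1, being a hom dimension between the simple objects
    \<open>Dual C X\<close> and \<open>X'\<close>, and it is nonzero because \<open>\<kappa>\<close>
    is.\<close>
  ultimately have one: "hdim (reps ! u) (X \<otimes>\<^sub>o X') = 1"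
    using mult[OF u(1)] hdim_simple[OF simple_Dual[OF X] X'] by (auto split: if_splits)
  have "hdim (X \<otimes>\<^sub>o X') (X \<otimes>\<^sub>o X') = (\<Sum>j<nr. if j = u then 1 else 0)"
    unfolding hdim_eq_sum[of "X \<otimes>\<^sub>o X'"] using off one by (intro sum.cong) auto
  then have "simple_object C (X \<otimes>\<^sub>o X')"
    using u(1) by (intro hdim_one_simple) simp
  then have "isomorphic C (reps ! u) (X \<otimes>\<^sub>o X')"
    using hdim_simple_pos_iff[OF reps_simple[OF u(1)], of "X \<otimes>\<^sub>o X'"] one by simp
  then have XX': "isomorphic C (X \<otimes>\<^sub>o X') \<I>"
    using isomorphic_trans[OF u(2)] isomorphic_sym by blast
  then show ?thesis
    unfolding invertible_object_def using isomorphic_trans[OF isomorphic_TObj_comm[of X' X]] by blast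
qed

end

section \<open>Cyclic groups and faithful objects\<close>

context comm_group
begin

lemma ord_mult_coprime:
  assumes x: "x \<in> carrier G" and y: "y \<in> carrier G" and coprime: "coprime (ord x) (ord y)"
  shows "ord (x \<otimes> y) = ord x * ord y"
proof (subst ord_unique)
  \<comment> \<open>The power \<open>n * ord b\<close> removes \<open>b\<close> and leaves a power
    of \<open>a\<close>; coprimality then drops the factor \<open>ord b\<close> from the
    exponent.\<close>
  have half: "ord a dvd n" if a: "a \<in> carrier G" and b: "b \<in> carrier G" and cop: "coprime (ord a) (ord b)"
    and eq: "(a \<otimes> b) [^] n = \<one>" for a b and n :: nat
  proof -
    have "(a \<otimes> b) [^] (n * ord b) = \<one>"
      using eq a b by (simp flip: nat_pow_pow)
    then have "a [^] (n * ord b) \<otimes> b [^] (n * ord b) = \<one>"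
      using a b by (simp add: pow_mult_distrib m_comm)
    moreover have "b [^] (n * ord b) = \<one>"
      using b by (simp add: pow_eq_id)
    ultimately have "a [^] (n * ord b) = \<one>"
      using a by simp
    then have "ord a dvd n * ord b"
      using a by (simp add: pow_eq_id)
    then show ?thesis
      using cop by (simp add: coprime_dvd_mult_left_iff)
  qed
  show "x \<otimes> y \<in> carrier G" using x y by simp
  show "\<forall>n. ((x \<otimes> y) [^] n = \<one>) = (ord x * ord y dvd n)"
  proof (intro allI iffI)
    fix n :: nat assume eq: "(x \<otimes> y) [^] n = \<one>"
    have "ord x dvd n" "ord y dvd n"
      using half[OF x y coprime eq] half[OF y x _ eq[unfolded m_comm[OF x y]]] coprime by (simp_all add: coprime_commute)
    then show "ord x * ord y dvd n"
      using coprime by (simp add: divides_mult)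
  next
    fix n assume "ord x * ord y dvd n"
    then have "ord x dvd n" "ord y dvd n"
      using dvd_mult_left dvd_mult_right by blast+
    then have "x [^] n = \<one>" "y [^] n = \<one>"
      using pow_eq_id[OF x] pow_eq_id[OF y] by blast+
    then show "(x \<otimes> y) [^] n = \<one>"
      using x y by (simp add: pow_mult_distrib m_comm)
  qed
qed

text \<open>If a prime \<open>p\<close> occurred in \<open>ord b\<close> to a higher power than in
  \<open>ord z\<close>, then exchanging the \<open>p\<close>-part of \<open>z\<close> for that of
  \<open>b\<close> would produce an element of larger order. The two parts are
  \<open>z [^] (p ^ i)\<close> and \<open>b [^] l'\<close>, of coprime orders.\<close>

lemma ord_dvd_max_ord:
  assumes fin: "finite (carrier G)" and z: "z \<in> carrier G" and max: "\<And>x. x \<in> carrier G \<Longrightarrow> ord x \<le> ord z"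
    and b: "b \<in> carrier G"
  shows "ord b dvd ord z"
proof (rule ccontr)
  assume not_dvd: "\<not> ord b dvd ord z"
  let ?m = "ord z" and ?l = "ord b"
  have pos: "?m > 0" "?l > 0"
    using ord_ge_1[OF fin z] ord_ge_1[OF fin b] by auto
  then obtain p where p: "Factorial_Ring.prime p" "multiplicity p ?l > multiplicity p ?m"
    using not_dvd multiplicity_le_imp_dvd[of ?l ?m] by (metis not_le not_gr_zero)
  define i where "i = multiplicity p ?m"
  define j where "j = multiplicity p ?l"
  have im: "p ^ i dvd ?m" and jl: "p ^ j dvd ?l"
    unfolding i_def j_def by (rule multiplicity_dvd)+
  have p0: "p > 0" using p(1) by (simp add: prime_gt_0_nat)
  obtain m' where m': "?m = p ^ i * m'" using im by (rule dvdE)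
  obtain l' where l': "?l = p ^ j * l'" using jl by (rule dvdE)
  have m'0: "m' > 0" and l'0: "l' > 0" using m' l' pos by (auto intro: Nat.gr0I)
  have "\<not> p dvd m'"
    using multiplicity_decompose[of ?m p] p(1) pos m' p0 unfolding i_def[symmetric]
    by (metis div_mult_self1_is_m not_prime_unit power_eq_0_iff zero_less_power neq0_conv)
  then have cop: "coprime m' (p ^ j)"
    using p(1) by (metis coprime_commute coprime_power_right_iff prime_imp_coprime)
  have "ord (z [^] (p ^ i)) = m'"
    using ord_pow_gen[OF z, of "p ^ i"] p0 m' by (simp add: gcd_proj2_if_dvd_nat[of "p ^ i"])
  moreover have "ord (b [^] l') = p ^ j"
    using ord_pow_gen[OF b, of l'] l'0 l' by (simp add: gcd_proj2_if_dvd_nat[of l'])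
  ultimately have "ord (z [^] (p ^ i) \<otimes> b [^] l') = m' * p ^ j"
    using ord_mult_coprime[of "z [^] (p ^ i)" "b [^] l'"] z b cop by simp
  moreover have "ord (z [^] (p ^ i) \<otimes> b [^] l') \<le> ?m"
    using max z b by simp
  moreover have "m' * p ^ j > ?m"
    unfolding m' using p(2) m'0 prime_gt_1_nat[OF p(1)] unfolding i_def[symmetric] j_def[symmetric]
    by (simp add: mult.commute power_strict_increasing)
  ultimately show False by simp
qed

text \<open>The maximal element order is an exponent of the group, so the bound on roots applies to
  the whole group and an element of that order generates.\<close>

lemma cyclic_groupI_card_roots:
  assumes fin: "finite (carrier G)"
    and roots: "\<And>d. d > 0 \<Longrightarrow> card {x \<in> carrier G. x [^] (d::nat) = \<one>} \<le> d"
  shows "cyclic_group G"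
proof -
  have ne: "ord ` carrier G \<noteq> {}" by auto
  obtain z where z: "z \<in> carrier G" "ord z = Max (ord ` carrier G)"
    using Max_in[OF finite_imageI[OF fin] ne] by auto
  have max: "ord x \<le> ord z" if "x \<in> carrier G" for x
    unfolding z(2) using that fin by simp
  have "x [^] ord z = \<one>" if "x \<in> carrier G" for x
    using ord_dvd_max_ord[OF fin z(1) max that] that by (simp add: pow_eq_id)
  then have "{x \<in> carrier G. x [^] ord z = \<one>} = carrier G" by auto
  then have "card (carrier G) \<le> ord z"
    using roots[of "ord z"] ord_ge_1[OF fin z(1)] by simp
  also have "ord z = card (generate G {z})"
    by (simp add: generate_pow_card[OF z(1)])
  finally have "generate G {z} = carrier G"
    using card_seteq[OF fin, of "generate G {z}"] generate_incl[of "{z}"] z(1) by simp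
  then have "carrier G = range (\<lambda>n::int. z [^] n)"
    unfolding generate_pow[OF z(1)] by auto
  then show ?thesis
    unfolding cyclic_group using z(1) by blast
qed

end

text \<open>Injectivity makes the group commutative, like its image, and embeds the elements killed
  by \<open>d\<close> into the roots of the polynomial \<open>?p\<close>. A generator then has order
  dividing any common exponent of the values.\<close>

lemma cyclic_group_of_field_character:
  fixes \<chi> :: "'a \<Rightarrow> 'k::field"
  assumes G: "group G" and fin: "finite (carrier G)" and inj: "inj_on \<chi> (carrier G)"
    and mult: "\<And>x y. \<lbrakk>x \<in> carrier G; y \<in> carrier G\<rbrakk> \<Longrightarrow> \<chi> (x \<otimes>\<^bsub>G\<^esub> y) = \<chi> x * \<chi> y"
    and one: "\<chi> \<one>\<^bsub>G\<^esub> = 1"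
  shows "cyclic_group G"
    and "\<lbrakk>\<And>x. x \<in> carrier G \<Longrightarrow> \<chi> x ^ n = 1\<rbrakk> \<Longrightarrow> Coset.order G dvd n"
proof -
  interpret group G by (rule G)
  have comm: "x \<otimes>\<^bsub>G\<^esub> y = y \<otimes>\<^bsub>G\<^esub> x" if "x \<in> carrier G" "y \<in> carrier G" for x y
    using inj_onD[OF inj, of "x \<otimes>\<^bsub>G\<^esub> y" "y \<otimes>\<^bsub>G\<^esub> x"] that mult by (simp add: mult.commute)
  interpret comm_group G
    by (rule group_comm_groupI) (rule comm)
  have pow: "\<chi> (x [^]\<^bsub>G\<^esub> (d::nat)) = \<chi> x ^ d" if "x \<in> carrier G" for x d
    by (induction d) (simp_all add: one mult that)
  show cyc: "cyclic_group G"
  proof (rule cyclic_groupI_card_roots[OF fin])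
    fix d :: nat assume d: "d > 0"
    let ?p = "Polynomial.monom 1 d - 1 :: 'k poly"
    have deg: "degree ?p = d" "?p \<noteq> 0"
    proof -
      show "degree ?p = d"
        using d degree_add_eq_left[of "-1" "Polynomial.monom (1::'k) d"]
        by (simp add: degree_monom_eq)
      then show "?p \<noteq> 0" using d by auto
    qed
    have "\<chi> ` {x \<in> carrier G. x [^]\<^bsub>G\<^esub> d = \<one>\<^bsub>G\<^esub>} \<subseteq> {a. poly ?p a = 0}"
      using pow one by (auto simp: poly_monom) (metis one)
    then have "card (\<chi> ` {x \<in> carrier G. x [^]\<^bsub>G\<^esub> d = \<one>\<^bsub>G\<^esub>}) \<le> card {a. poly ?p a = 0}"
      by (rule card_mono[OF poly_roots_finite[OF deg(2)]])
    also have "\<dots> \<le> d"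
      using card_poly_roots_bound[OF deg(2)] deg(1) by simp
    also have "card (\<chi> ` {x \<in> carrier G. x [^]\<^bsub>G\<^esub> d = \<one>\<^bsub>G\<^esub>}) = card {x \<in> carrier G. x [^]\<^bsub>G\<^esub> d = \<one>\<^bsub>G\<^esub>}"
      by (rule card_image) (use inj in \<open>auto intro: inj_on_subset\<close>)
    finally show "card {x \<in> carrier G. x [^]\<^bsub>G\<^esub> d = \<one>\<^bsub>G\<^esub>} \<le> d" .
  qed
  show "Coset.order G dvd n" if n: "\<And>x. x \<in> carrier G \<Longrightarrow> \<chi> x ^ n = 1"
  proof -
    obtain z where z: "z \<in> carrier G" "subgroup_generated G {z} = G"
      using cyc unfolding cyclic_group_def by blast
    have "\<chi> (z [^]\<^bsub>G\<^esub> n) = \<chi> \<one>\<^bsub>G\<^esub>"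
      using pow[OF z(1)] n[OF z(1)] one by simp
    then have "z [^]\<^bsub>G\<^esub> n = \<one>\<^bsub>G\<^esub>"
      using inj_onD[OF inj] z(1) by simp
    then show ?thesis
      using cyclic_order_is_ord[OF z(1)] z pow_eq_id[OF z(1)] by simp
  qed
qed

lemma group_order_2_iso:
  assumes G: "group G" and card: "card (carrier G) = 2"
  shows "G \<cong> integer_mod_group 2"
proof -
  interpret group G by (rule G)
  have "card (carrier G - {\<one>\<^bsub>G\<^esub>}) = 1"
    using card one_closed by simp
  then obtain x where "carrier G - {\<one>\<^bsub>G\<^esub>} = {x}"
    using card_1_singletonE by blast
  then have x: "carrier G = {\<one>\<^bsub>G\<^esub>, x}" "x \<noteq> \<one>\<^bsub>G\<^esub>"
    using one_closed by auto
  have xx: "x \<otimes>\<^bsub>G\<^esub> x = \<one>\<^bsub>G\<^esub>"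
  proof (rule ccontr)
    assume "x \<otimes>\<^bsub>G\<^esub> x \<noteq> \<one>\<^bsub>G\<^esub>"
    moreover have "x \<otimes>\<^bsub>G\<^esub> x \<in> carrier G" using x(1) by (intro m_closed) auto
    ultimately have "x \<otimes>\<^bsub>G\<^esub> x = x" using x(1) by auto
    then have "x = \<one>\<^bsub>G\<^esub>" using x(1) l_cancel_one[of x x] by simp
    then show False using x(2) by simp
  qed
  let ?f = "\<lambda>a. if a = \<one>\<^bsub>G\<^esub> then 0 else 1 :: int"
  have "?f \<in> iso G (integer_mod_group 2)"
  proof (rule isoI)
    have xc: "x \<in> carrier G" using x(1) by simp
    show "?f \<in> hom G (integer_mod_group 2)"
      using x(2) xx xc by (intro homI) (auto simp: x(1) carrier_integer_mod_group)
    show "bij_betw ?f (carrier G) (carrier (integer_mod_group 2))"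
      using x(2) unfolding x(1) by (auto simp: bij_betw_def inj_on_def carrier_integer_mod_group)
  qed
  then show ?thesis unfolding is_iso_def by blast
qed

section \<open>Joins of fusion subcategories, nilpotency and faithful objects\<close>

context acf_modular_category
begin

text \<open>For fusion subcategories this is the one generated by both. Thanks to the braiding,
  constituents of products of just two factors are already closed under tensor products.\<close>

definition join :: "'o set \<Rightarrow> 'o set \<Rightarrow> 'o set" where
  "join D A = all_constituents (\<lambda>W. \<exists>Y B. simple_object C Y \<and> Y \<in> D \<and> simple_object C B \<and> B \<in> A \<and> hdim W (Y \<otimes>\<^sub>o B) > 0)"

lemma fusion_subcategory_join:
  assumes D: "fusion_subcategory C D" and A: "fusion_subcategory C A"
  shows "fusion_subcategory C (join D A)"
  unfolding join_def
proof (rule fusion_subcategory_all_constituents)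
  fix W assume "simple_object C W" "isomorphic C W \<I>"
  then have "hdim W (\<I> \<otimes>\<^sub>o \<I>) > 0"
    using hdim_iso[OF isomorphic_refl isomorphic_unit(1)[of \<I>]] hdim_simple_pos_iff[OF _ simple_Unit] by simp
  then show "\<exists>Y B. simple_object C Y \<and> Y \<in> D \<and> simple_object C B \<and> B \<in> A \<and> hdim W (Y \<otimes>\<^sub>o B) > 0"
    using simple_Unit fusion_subcategory_unit[OF D] fusion_subcategory_unit[OF A] by blast
next
  fix X1 X2 W
  assume W: "hdim W (X1 \<otimes>\<^sub>o X2) > 0" and X: "simple_object C X1" "simple_object C X2"
  assume "\<exists>Y B. simple_object C Y \<and> Y \<in> D \<and> simple_object C B \<and> B \<in> A \<and> hdim X1 (Y \<otimes>\<^sub>o B) > 0"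
  then obtain Y1 B1 where 1: "Y1 \<in> D" "B1 \<in> A" "hdim X1 (Y1 \<otimes>\<^sub>o B1) > 0" by blast
  assume "\<exists>Y B. simple_object C Y \<and> Y \<in> D \<and> simple_object C B \<and> B \<in> A \<and> hdim X2 (Y \<otimes>\<^sub>o B) > 0"
  then obtain Y2 B2 where 2: "Y2 \<in> D" "B2 \<in> A" "hdim X2 (Y2 \<otimes>\<^sub>o B2) > 0" by blast
  have "hdim W ((Y1 \<otimes>\<^sub>o B1) \<otimes>\<^sub>o (Y2 \<otimes>\<^sub>o B2)) > 0"
    by (rule hdim_tens_mono[OF X(1) 1(3) X(2) 2(3) W])
  then have "hdim W ((Y1 \<otimes>\<^sub>o Y2) \<otimes>\<^sub>o (B1 \<otimes>\<^sub>o B2)) > 0"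
    using hdim_iso[OF isomorphic_refl tens_middle_four] by simp
  then obtain Y B where "simple_object C Y" "simple_object C B" "hdim Y (Y1 \<otimes>\<^sub>o Y2) > 0" "hdim B (B1 \<otimes>\<^sub>o B2) > 0" "hdim W (Y \<otimes>\<^sub>o B) > 0"
    by (rule hdim_tens_pos)
  then show "\<exists>Y B. simple_object C Y \<and> Y \<in> D \<and> simple_object C B \<and> B \<in> A \<and> hdim W (Y \<otimes>\<^sub>o B) > 0"
    using fusion_subcategory_hdim[OF D fusion_subcategory_tens[OF D 1(1) 2(1)]]
      fusion_subcategory_hdim[OF A fusion_subcategory_tens[OF A 1(2) 2(2)]] by blast
qed

lemma subset_join:
  assumes D: "fusion_subcategory C D" and A: "fusion_subcategory C A"
  shows "D \<subseteq> join D A" "A \<subseteq> join D A"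
proof -
  have "X \<in> join D A" if "X \<in> D" for X
    unfolding join_def all_constituents_def mem_Collect_eq
  proof (intro allI impI, elim conjE)
    fix W assume W: "simple_object C W" "hdim W X > 0"
    have "hdim W (W \<otimes>\<^sub>o \<I>) > 0"
      using hdim_iso[OF isomorphic_refl isomorphic_unit(2)] hdim_simple_pos_iff[OF W(1) W(1)] by simp
    then show "\<exists>Y B. simple_object C Y \<and> Y \<in> D \<and> simple_object C B \<and> B \<in> A \<and> hdim W (Y \<otimes>\<^sub>o B) > 0"
      using W(1) fusion_subcategory_hdim[OF D that W] simple_Unit fusion_subcategory_unit[OF A] by blast
  qed
  then show "D \<subseteq> join D A" by blast
  have "X \<in> join D A" if "X \<in> A" for X
    unfolding join_def all_constituents_def mem_Collect_eq
  proof (intro allI impI, elim conjE)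
    fix W assume W: "simple_object C W" "hdim W X > 0"
    have "hdim W (\<I> \<otimes>\<^sub>o W) > 0"
      using hdim_iso[OF isomorphic_refl isomorphic_unit(1)] hdim_simple_pos_iff[OF W(1) W(1)] by simp
    then show "\<exists>Y B. simple_object C Y \<and> Y \<in> D \<and> simple_object C B \<and> B \<in> A \<and> hdim W (Y \<otimes>\<^sub>o B) > 0"
      using W(1) fusion_subcategory_hdim[OF A that W] simple_Unit fusion_subcategory_unit[OF D] by blast
  qed
  then show "A \<subseteq> join D A" by blast
qed

lemma join_subset:
  assumes F: "fusion_subcategory C F" and "D \<subseteq> F" "A \<subseteq> F"
  shows "join D A \<subseteq> F"
proof
  fix X assume X: "X \<in> join D A"
  show "X \<in> F"
  proof (rule iffD2[OF fusion_subcategory_mem_iff[OF F]], intro allI impI, elim conjE)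
    fix W assume W: "simple_object C W" "hdim W X > 0"
    then obtain Y B where "Y \<in> D" "B \<in> A" "hdim W (Y \<otimes>\<^sub>o B) > 0"
      using X unfolding join_def all_constituents_def by blast
    then show "W \<in> F"
      using fusion_subcategory_hdim[OF F fusion_subcategory_tens[OF F] W(1)] assms(2,3) by blast
  qed
qed

lemma fusion_subcategory_UNIV: "fusion_subcategory C UNIV"
  unfolding fusion_subcategory_def by simp

lemma fusion_subcategory_adjoint: "fusion_subcategory C (adjoint_subcategory C D)"
  unfolding adjoint_subcategory_def by (rule generated_fusion_subcategory)

lemma tens_Dual_in_adjoint: "\<lbrakk>simple_object C X; X \<in> D\<rbrakk> \<Longrightarrow> X \<otimes>\<^sub>o Dual C X \<in> adjoint_subcategory C D"
  unfolding adjoint_subcategory_def by (rule subsetD[OF generated_fusion_subcategory(2)]) blast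

text \<open>The analogue of the fact that the Frattini subgroup of a nilpotent group contains the
  commutator subgroup.\<close>

lemma nilpotent_join_adjoint:
  assumes nil: "nilpotent_category C" and D: "fusion_subcategory C D" "D \<noteq> UNIV"
  shows "join D (adjoint_subcategory C UNIV) \<noteq> UNIV"
proof
  assume J: "join D (adjoint_subcategory C UNIV) = UNIV"
  define A where "A n = (adjoint_subcategory C ^^ n) UNIV" for n
  have A_Suc: "A (Suc n) = adjoint_subcategory C (A n)" for n
    unfolding A_def by simp
  have A: "fusion_subcategory C (A n)" for n
    by (cases n) (simp_all add: A_Suc fusion_subcategory_adjoint, simp add: A_def fusion_subcategory_UNIV)
  have join_A: "join D (A n) = UNIV" for n
  proof (induction n)
    case 0
    show ?case using subset_join(2)[OF D(1) A[of 0]] unfolding A_def by auto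
  next
    case (Suc n)
    note F = fusion_subcategory_join[OF D(1) A[of "Suc n"]]
    have "X \<otimes>\<^sub>o Dual C X \<in> join D (A (Suc n))" if X: "simple_object C X" for X
    proof -
      \<comment> \<open>\<open>X\<close> lies in some \<open>Y \<otimes>\<^sub>o B\<close>. The
        object \<open>Y \<otimes>\<^sub>o Dual C Y\<close> stays in \<open>D\<close>, while
        \<open>B \<otimes>\<^sub>o Dual C B\<close> drops one step down the adjoint series, so the
        adjoint subcategory is contained in the next join.\<close>
      have "X \<in> join D (A n)" using Suc by simp
      moreover have "hdim X X > 0" using hdim_simple_pos_iff[OF X X] by simp
      ultimately obtain Y B where YB: "simple_object C Y" "Y \<in> D" "simple_object C B" "B \<in> A n" "hdim X (Y \<otimes>\<^sub>o B) > 0"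
        using X unfolding join_def all_constituents_def by blast
      have "Y \<otimes>\<^sub>o Dual C Y \<in> join D (A (Suc n))"
        using fusion_subcategory_tens[OF D(1) YB(2) fusion_subcategory_Dual[OF D(1) YB(1,2)]] subset_join(1)[OF D(1) A] by blast
      moreover have "B \<otimes>\<^sub>o Dual C B \<in> join D (A (Suc n))"
        using tens_Dual_in_adjoint[OF YB(3,4), folded A_Suc] subset_join(2)[OF D(1) A] by blast
      ultimately show ?thesis
        using constituents_tens_Dual[OF F _ _ X X YB(5,5)] by blast
    qed
    then have "adjoint_subcategory C UNIV \<subseteq> join D (A (Suc n))"
      unfolding adjoint_subcategory_def by (intro generated_fusion_subcategory_subset[OF F]) auto
    then have "join D (adjoint_subcategory C UNIV) \<subseteq> join D (A (Suc n))"
      by (rule join_subset[OF F subset_join(1)[OF D(1) A]])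
    then show ?case using J by blast
  qed
  obtain n where n: "A n = Vec_subcategory C"
    using nil unfolding nilpotent_category_def A_def by blast
  \<comment> \<open>At the end of the series the second factor is trivial, and the join has shrunk
    to \<open>D\<close>.\<close>
  have "W \<in> D" if W: "simple_object C W" for W
  proof -
    have "hdim W W > 0" using hdim_simple_pos_iff[OF W W] by simp
    then obtain Y B where YB: "simple_object C Y" "Y \<in> D" "simple_object C B" "B \<in> Vec_subcategory C" "hdim W (Y \<otimes>\<^sub>o B) > 0"
      using join_A[of n] W unfolding n join_def all_constituents_def by blast
    obtain m where m: "is_direct_sum C B (replicate m \<I>)"
      using YB(4) unfolding Vec_subcategory_def by blast
    have "hdim B B > 0" using hdim_simple_pos_iff[OF YB(3,3)] by simp
    then obtain j where "j < length (replicate m \<I>)" "hdim B (replicate m \<I> ! j) > 0"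
      by (rule hdim_direct_sum_pos[OF m])
    then have "isomorphic C B \<I>"
      using hdim_simple_pos_iff[OF YB(3) simple_Unit] by simp
    then have "isomorphic C (Y \<otimes>\<^sub>o B) Y"
      using isomorphic_trans[OF isomorphic_TObj[OF isomorphic_refl] isomorphic_unit(2)] by blast
    then have "hdim W Y > 0"
      using YB(5) hdim_iso[OF isomorphic_refl] by metis
    then show ?thesis
      using fusion_subcategory_hdim[OF D(1) YB(2) W] by blast
  qed
  then show False
    using fusion_subcategory_mem_iff[OF D(1)] D(2) by blast
qed

lemma chi_tensor_power_left:
  assumes "invertible_object C g" "simple_object C Y"
  shows "chi (tensor_power C g n) Y = chi g Y ^ n"
proof (induction n)
  case (Suc n)
  then show ?case
    using chi_tens_left[OF invertible_tensor_power[OF assms(1)] assms(1,2)] by (simp add: mult.commute)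
qed (simp add: chi_unit_left assms)

text \<open>Applied with the unit as \<open>W\<close>, where \<open>chi g\<close> is 1, this turns
  \<open>chi g X\<close> into a root of unity.\<close>

lemma chi_tensor_power_right:
  assumes g: "invertible_object C g" and X: "simple_object C X"
  shows "\<lbrakk>simple_object C W; hdim W (tensor_power C X n) > 0\<rbrakk> \<Longrightarrow> chi g W = chi g X ^ n"
proof (induction n arbitrary: W)
  case 0
  then have "isomorphic C W \<I>" using hdim_simple_pos_iff[OF 0(1) simple_Unit] by simp
  then show ?case using chi_iso[OF isomorphic_refl] chi_unit_right[OF g] by simp
next
  case (Suc n)
  obtain P Q where PQ: "simple_object C P" "simple_object C Q" "hdim P (tensor_power C X n) > 0" "hdim Q X > 0" "hdim W (P \<otimes>\<^sub>o Q) > 0"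
    using hdim_tens_pos[of W "tensor_power C X n" X] Suc.prems(2) by auto
  have "isomorphic C Q X" using hdim_simple_pos_iff[OF PQ(2) X] PQ(4) by simp
  then show ?case
    using chi_tens_right[OF g PQ(1,2) Suc.prems(1) PQ(5)] Suc.IH[OF PQ(1,3)] chi_iso[OF isomorphic_refl] by simp
qed

lemma finite_invertibles: "finite (carrier (invertibles_group C))"
proof (rule finite_subset)
  show "carrier (invertibles_group C) \<subseteq> {iso_class C X |X. simple_object C X}"
    unfolding carrier_invertibles using simple_invertible by blast
qed (rule finite_simples)

definition class_chi :: "'o \<Rightarrow> 'o set \<Rightarrow> 'k" where
  "class_chi Y A = chi (SOME g. A = iso_class C g) Y"

lemma class_chi: "class_chi Y (iso_class C g) = chi g Y"
proof -
  have "iso_class C g = iso_class C (SOME h. iso_class C g = iso_class C h)"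
    by (rule someI) (rule refl)
  then show ?thesis
    unfolding class_chi_def iso_class_eq_iff using chi_iso[OF _ isomorphic_refl] by metis
qed

text \<open>The objects centralized by \<open>g\<close> form a fusion subcategory; containing the
  faithful \<open>X\<close>, it is everything, and nondegeneracy applies.\<close>

lemma faithful_chi_trivial:
  assumes X: "simple_object C X" "faithful_object C X" and g: "invertible_object C g" "chi g X = 1"
  shows "isomorphic C g \<I>"
proof (rule chi_inj[OF g(1)])
  let ?D = "all_constituents (\<lambda>W. chi g W = 1)"
  have D: "fusion_subcategory C ?D"
  proof (rule fusion_subcategory_all_constituents)
    show "chi g W = 1" if "isomorphic C W \<I>" for W
      using chi_iso[OF isomorphic_refl that] chi_unit_right[OF g(1)] by simp
    show "chi g W = 1" if "simple_object C Y" "simple_object C Z" "simple_object C W" "chi g Y = 1" "chi g Z = 1" "hdim W (Y \<otimes>\<^sub>o Z) > 0" for Y Z W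
      using chi_tens_right[OF g(1) that(1-3,6)] that(4,5) by simp
  qed
  have "X \<in> ?D"
    unfolding all_constituents_def using hdim_simple_pos_iff[OF _ X(1)] chi_iso[OF isomorphic_refl] g(2) by fastforce
  then have "?D = UNIV"
    using X(2) generated_fusion_subcategory_subset[OF D, of "{X}"] unfolding faithful_object_def by auto
  then show "chi g Y = 1" if "simple_object C Y" for Y
    using that hdim_simple_pos_iff[OF that that] unfolding all_constituents_def by auto
qed

text \<open>\<open>object_order\<close> is a least element of a set that is nonempty because the dual of \<open>X\<close> occurs in
  some power of \<open>X\<close>.\<close>

lemma object_order_faithful:
  assumes X: "simple_object C X" "faithful_object C X"
  shows "object_order C X \<ge> 1" "hdim \<I> (tensor_power C X (object_order C X)) > 0"
    "\<lbrakk>n \<ge> 1; hdim \<I> (tensor_power C X n) > 0\<rbrakk> \<Longrightarrow> object_order C X \<le> n"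
proof -
  let ?P = "\<lambda>n. n \<ge> 1 \<and> hdim \<I> (tensor_power C X n) > 0"
  have oo: "object_order C X = (LEAST n. ?P n)"
    unfolding object_order_def multiplicity_in_eq ..
  let ?D = "all_constituents (\<lambda>W. \<exists>n. hdim W (tensor_power C X n) > 0)"
  have D: "fusion_subcategory C ?D"
  proof (rule fusion_subcategory_all_constituents)
    fix W assume "simple_object C W" "isomorphic C W \<I>"
    then have "hdim W (tensor_power C X 0) > 0"
      using hdim_simple_pos_iff[OF _ simple_Unit] by simp
    then show "\<exists>n. hdim W (tensor_power C X n) > 0" ..
  next
    fix Y Z W assume YZ: "simple_object C Y" "simple_object C Z" and W: "hdim W (Y \<otimes>\<^sub>o Z) > 0"
      and ex: "\<exists>n. hdim Y (tensor_power C X n) > 0" "\<exists>n. hdim Z (tensor_power C X n) > 0"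
    then obtain m n where mn: "hdim Y (tensor_power C X m) > 0" "hdim Z (tensor_power C X n) > 0" by blast
    have "hdim W (tensor_power C X (m + n)) > 0"
      using hdim_tens_mono[OF YZ(1) mn(1) YZ(2) mn(2) W] hdim_iso[OF isomorphic_refl tensor_power_add] by metis
    then show "\<exists>n. hdim W (tensor_power C X n) > 0" ..
  qed
  have X1: "hdim W (tensor_power C X 1) = hdim W X" for W
    using hdim_iso[OF isomorphic_refl isomorphic_unit(1)] by simp
  have "X \<in> ?D"
    unfolding all_constituents_def using X1 by (auto intro!: exI[of _ 1])
  then have "?D = UNIV"
    using X(2) generated_fusion_subcategory_subset[OF D, of "{X}"] unfolding faithful_object_def by auto
  moreover note D' = simple_Dual[OF X(1)]
  ultimately obtain n where n: "hdim (Dual C X) (tensor_power C X n) > 0"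
    using hdim_simple_pos_iff[OF D' D'] unfolding all_constituents_def by auto
  have "hdim \<I> (Dual C X \<otimes>\<^sub>o X) > 0"
    using hdim_dual_unit[of X X] hdim_sym[of \<I>] hdim_simple_pos_iff[OF X(1) X(1)] by simp
  then have "hdim \<I> (tensor_power C X (Suc n)) > 0"
    using hdim_tens_mono[OF D' n X(1), of X \<I>] hdim_simple_pos_iff[OF X(1) X(1)] by simp
  then have "?P (Suc n)" by simp
  then have "?P (object_order C X)"
    unfolding oo by (rule LeastI)
  then show "object_order C X \<ge> 1" "hdim \<I> (tensor_power C X (object_order C X)) > 0" by auto
  show "object_order C X \<le> n" if "n \<ge> 1" "hdim \<I> (tensor_power C X n) > 0" for n
    unfolding oo using that by (intro Least_le) simp
qed

theorem faithful_cyclic: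
  assumes X: "simple_object C X" "faithful_object C X"
  shows "cyclic_group (invertibles_group C)" "Coset.order (invertibles_group C) dvd object_order C X"
proof -
  let ?G = "invertibles_group C"
  interpret G: group ?G by (rule group_invertibles_group)
  have mult: "class_chi X (A \<otimes>\<^bsub>?G\<^esub> B) = class_chi X A * class_chi X B" if "A \<in> carrier ?G" "B \<in> carrier ?G" for A B
    using that chi_tens_left[OF _ _ X(1)] unfolding carrier_invertibles by (auto simp: mult_invertibles_group class_chi)
  have one: "class_chi X \<one>\<^bsub>?G\<^esub> = 1"
    unfolding one_invertibles class_chi by (rule chi_unit_left[OF X(1)])
  have kernel: "A = \<one>\<^bsub>?G\<^esub>" if A: "A \<in> carrier ?G" "class_chi X A = 1" for A
  proof -
    obtain g where g: "A = iso_class C g" "invertible_object C g"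
      using A(1) unfolding carrier_invertibles by blast
    then show ?thesis
      using faithful_chi_trivial[OF X g(2)] A(2) unfolding one_invertibles by (simp add: class_chi iso_class_eq_iff)
  qed
  have inj: "inj_on (class_chi X) (carrier ?G)"
  proof (rule inj_onI)
    fix A B assume A: "A \<in> carrier ?G" and B: "B \<in> carrier ?G" and eq: "class_chi X A = class_chi X B"
    have "class_chi X (A \<otimes>\<^bsub>?G\<^esub> inv\<^bsub>?G\<^esub> B) = class_chi X (B \<otimes>\<^bsub>?G\<^esub> inv\<^bsub>?G\<^esub> B)"
      unfolding mult[OF A G.inv_closed[OF B]] mult[OF B G.inv_closed[OF B]] eq ..
    then have "A \<otimes>\<^bsub>?G\<^esub> inv\<^bsub>?G\<^esub> B = \<one>\<^bsub>?G\<^esub>"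
      using A B one by (intro kernel) simp_all
    then show "A = B"
      using A B G.inv_equality[of A "inv\<^bsub>?G\<^esub> B"] by simp
  qed
  have root: "class_chi X A ^ object_order C X = 1" if "A \<in> carrier ?G" for A
  proof -
    obtain g where g: "A = iso_class C g" "invertible_object C g"
      using \<open>A \<in> carrier ?G\<close> unfolding carrier_invertibles by blast
    show ?thesis
      using chi_tensor_power_right[OF g(2) X(1) simple_Unit object_order_faithful(2)[OF X]] chi_unit_right[OF g(2)]
      unfolding g(1) class_chi by simp
  qed
  show "cyclic_group ?G"
    by (rule cyclic_group_of_field_character(1)[OF G.is_group finite_invertibles inj mult one])
  show "Coset.order ?G dvd object_order C X"
    by (rule cyclic_group_of_field_character(2)[OF G.is_group finite_invertibles inj mult one root])
qed

text \<open>Self-duality puts the unit into the second tensor power of \<open>X\<close>, so the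
  order of \<open>X\<close> is 1 or 2.\<close>

theorem faithful_self_dual:
  assumes X: "simple_object C X" "faithful_object C X" "self_dual C X"
  shows "trivial_group (invertibles_group C) \<or> invertibles_group C \<cong> integer_mod_group 2"
proof -
  let ?G = "invertibles_group C"
  interpret G: group ?G by (rule group_invertibles_group)
  have "isomorphic C (tensor_power C X 2) (X \<otimes>\<^sub>o Dual C X)"
    using X(3) isomorphic_TObj[OF isomorphic_unit(1)] unfolding self_dual_def by (simp add: numeral_2_eq_2)
  then have "hdim \<I> (tensor_power C X 2) = hdim (Dual C X) (Dual C X)"
    unfolding hdim_unit_tens[symmetric] by (rule hdim_iso[OF isomorphic_refl])
  then have "object_order C X \<le> 2"
    using object_order_faithful(3)[OF X(1,2), of 2] hdim_simple_pos_iff[OF simple_Dual simple_Dual, OF X(1) X(1)] by simp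
  then have "object_order C X = 1 \<or> object_order C X = 2"
    using object_order_faithful(1)[OF X(1,2)] by linarith
  then have "Coset.order ?G dvd 2"
    using faithful_cyclic(2)[OF X(1,2)] by (auto intro: dvd_trans)
  then have "Coset.order ?G = 1 \<or> Coset.order ?G = 2"
    using dvd_imp_le[of "Coset.order ?G" 2] by (cases "Coset.order ?G = 0") auto
  then show ?thesis
  proof
    assume "Coset.order ?G = 1"
    then obtain a where "carrier ?G = {a}"
      unfolding Coset.order_def using card_1_singletonE by blast
    then show ?thesis using G.trivial_group by blast
  next
    assume "Coset.order ?G = 2"
    then show ?thesis
      using group_order_2_iso[OF G.is_group] unfolding Coset.order_def by blast
  qed
qed

text \<open>The values of \<open>chi g\<close> form a finite subgroup of the multiplicative group of the field.\<close>

lemma chi_values_cyclic: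
  assumes g: "invertible_object C g"
  obtains X where "simple_object C X" "\<And>Y. simple_object C Y \<Longrightarrow> \<exists>m::nat. chi g Y = chi g X ^ m"
proof -
  let ?V = "{chi g Y |Y. simple_object C Y}"
  let ?H = "\<lparr>carrier = ?V, monoid.mult = (*), one = 1\<rparr> :: 'k monoid"
  have fin: "finite ?V"
  proof (rule finite_subset)
    show "?V \<subseteq> (\<lambda>i. chi g (reps ! i)) ` {..<nr}"
    proof
      fix v assume "v \<in> ?V"
      then obtain Y where Y: "simple_object C Y" "v = chi g Y" by blast
      obtain i where i: "i < nr" "isomorphic C Y (reps ! i)" by (rule ex_rep[OF Y(1)])
      then show "v \<in> (\<lambda>i. chi g (reps ! i)) ` {..<nr}"
        using chi_iso[OF isomorphic_refl i(2)] Y(2) by auto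
    qed
  qed simp
  have one: "1 \<in> ?V"
    using chi_unit_right[OF g] simple_Unit by (metis (mono_tags, lifting) mem_Collect_eq)
  have closed: "v * w \<in> ?V" if vw: "v \<in> ?V" "w \<in> ?V" for v w
  proof -
    obtain Y Z where YZ: "simple_object C Y" "v = chi g Y" "simple_object C Z" "w = chi g Z"
      using vw by blast
    obtain Xs where Xs: "decomp (Y \<otimes>\<^sub>o Z) Xs" using ex_decomp by blast
    \<comment> \<open>A nonzero character value excludes an empty decomposition, so the product has
      a constituent at which to evaluate \<open>chi g\<close>.\<close>
    have "ch \<I> (Y \<otimes>\<^sub>o Z) \<noteq> 0"
      unfolding ch_tens[OF simple_Unit] using ch_unit_nonzero YZ by simp
    then have "0 < length Xs"
      unfolding ch_sum[OF decompD(1)[OF Xs]] by (cases Xs) auto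
    then show ?thesis
      using chi_tens_right[OF g YZ(1,3) decomp_nth[OF Xs] hdim_decomp_nth_pos[OF Xs]] decomp_nth[OF Xs] YZ(2,4)
      by (metis (mono_tags, lifting) mem_Collect_eq)
  qed
  have inverse: "\<exists>w\<in>?V. w * v = 1" if v: "v \<in> ?V" for v
  proof -
    obtain Y where Y: "simple_object C Y" "v = chi g Y" using v by blast
    have "hdim \<I> (Y \<otimes>\<^sub>o Dual C Y) > 0"
      unfolding hdim_unit_tens using hdim_simple_pos_iff[OF simple_Dual simple_Dual, OF Y(1) Y(1)] by simp
    then have "chi g Y * chi g (Dual C Y) = 1"
      using chi_tens_right[OF g Y(1) simple_Dual[OF Y(1)] simple_Unit] chi_unit_right[OF g] by simp
    then show ?thesis
      using Y simple_Dual[OF Y(1)] by (intro bexI[of _ "chi g (Dual C Y)"]) (auto simp: mult.commute)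
  qed
  have H: "group ?H"
    by (rule groupI) (use one closed inverse in \<open>auto simp: mult.assoc\<close>)
  interpret H: group ?H by (rule H)
  have "cyclic_group ?H"
    by (rule cyclic_group_of_field_character(1)[OF H, of "\<lambda>v. v"]) (use fin in auto)
  then obtain z where z: "z \<in> carrier ?H" "subgroup_generated ?H {z} = ?H"
    unfolding cyclic_group_def by blast
  have "generate ?H {z} = ?V"
    using carrier_subgroup_generated[of ?H "{z}"] z by simp
  then have gen: "?V = {z [^]\<^bsub>?H\<^esub> m |m::nat. m \<in> UNIV}"
    using H.generate_pow_nat[of z] H.ord_ge_1[of z] z(1) fin by simp
  have pow: "z [^]\<^bsub>?H\<^esub> (m::nat) = z ^ m" for m
    by (induction m) (simp_all add: nat_pow_def)
  obtain X where X: "simple_object C X" "z = chi g X"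
    using z(1) by auto
  show ?thesis
  proof (rule that[OF X(1)])
    fix Y assume "simple_object C Y"
    then have "chi g Y \<in> ?V" by blast
    then have "chi g Y \<in> {z ^ m |m::nat. m \<in> UNIV}"
      using equalityD1[OF gen[unfolded pow]] by (rule rev_subsetD)
    then show "\<exists>m::nat. chi g Y = chi g X ^ m"
      unfolding X(2)[symmetric] by simp
  qed
qed

theorem nilpotent_faithful:
  assumes nil: "nilpotent_category C" and cyc: "cyclic_group (invertibles_group C)"
  shows "\<exists>X. simple_object C X \<and> faithful_object C X"
proof -
  let ?G = "invertibles_group C"
  interpret G: group ?G by (rule group_invertibles_group)
  obtain A where A: "A \<in> carrier ?G" "subgroup_generated ?G {A} = ?G"
    using cyc unfolding cyclic_group_def by blast
  obtain g where g: "A = iso_class C g" "invertible_object C g"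
    using A(1) unfolding carrier_invertibles by blast
  have "generate ?G {A} = carrier ?G"
    using carrier_subgroup_generated[of ?G "{A}"] A by simp
  \<comment> \<open>In a finite group natural exponents suffice, and these correspond to
    \<open>tensor_power\<close>.\<close>
  then have gen: "carrier ?G = {A [^]\<^bsub>?G\<^esub> m |m::nat. m \<in> UNIV}"
    using G.generate_pow_nat[OF A(1)] G.ord_ge_1[OF finite_invertibles A(1)] by simp
  obtain X where X: "simple_object C X" and vals: "\<And>Y. simple_object C Y \<Longrightarrow> \<exists>m::nat. chi g Y = chi g X ^ m"
    using chi_values_cyclic[OF g(2)] by metis
  have "faithful_object C X"
  proof (rule ccontr)
    let ?D = "generated_fusion_subcategory C {X}"
    let ?E = "join ?D (adjoint_subcategory C UNIV)"
    assume "\<not> faithful_object C X"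
    then have D: "fusion_subcategory C ?D" "?D \<noteq> UNIV"
      unfolding faithful_object_def using generated_fusion_subcategory(1) by auto
    have E: "fusion_subcategory C ?E"
      by (rule fusion_subcategory_join[OF D(1) fusion_subcategory_adjoint])
    note sub = subset_join[OF D(1) fusion_subcategory_adjoint[of UNIV]]
    obtain H where H: "simple_object C H" "\<not> isomorphic C H \<I>" "\<And>Y. \<lbrakk>simple_object C Y; Y \<in> ?E\<rbrakk> \<Longrightarrow> ch H Y = ch \<I> Y"
      using fusion_subcategory_centralizer[OF E nilpotent_join_adjoint[OF nil D]] by blast
    \<comment> \<open>The reason for joining the adjoint subcategory to \<open>?D\<close>:
      \<open>H\<close> becomes invertible, and hence isomorphic to a tensor power of
      \<open>g\<close>.\<close>
    have inv: "invertible_object C H"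
      by (rule invertible_of_centralizes_adjoint[OF E _ H(1) H(3)]) (use tens_Dual_in_adjoint sub(2) in blast)+
    then have "iso_class C H \<in> carrier ?G"
      unfolding carrier_invertibles by blast
    then obtain k :: nat where "iso_class C H = A [^]\<^bsub>?G\<^esub> k"
      unfolding gen by blast
    then have k: "isomorphic C H (tensor_power C g k)"
      unfolding g(1) iso_class_pow iso_class_eq_iff .
    have chiH: "chi H Y = chi g Y ^ k" if "simple_object C Y" for Y
      using chi_iso[OF k isomorphic_refl] chi_tensor_power_left[OF g(2) that] by simp
    have "X \<in> ?E"
      using sub(1) generated_fusion_subcategory(2)[of "{X}"] by blast
    then have "chi H X = 1"
      using H(3)[OF X] ch_unit_nonzero[OF X] unfolding chi_def by simp
    then have 1: "chi g X ^ k = 1" using chiH[OF X] by simp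
    have "chi H Y = 1" if Y: "simple_object C Y" for Y
    proof -
      obtain m :: nat where "chi g Y = chi g X ^ m" using vals[OF Y] by blast
      then have "chi H Y = (chi g X ^ k) ^ m"
        using chiH[OF Y] by (simp add: mult.commute flip: power_mult)
      then show ?thesis using 1 by simp
    qed
    then have "isomorphic C H \<I>"
      by (rule chi_inj[OF inv])
    then show False using H(2) by blast
  qed
  then show ?thesis using X by blast
qed

end

theorem corollary4p9:
  fixes C :: "('o, 'm::ab_group_add, 'k::{alg_closed_field, field_char_0}) ribbon_cat"
  assumes "modular_category C"
  shows
    "(\<forall>X. simple_object C X \<and> faithful_object C X \<longrightarrow>
        cyclic_group (invertibles_group C) \<and> Coset.order (invertibles_group C) dvd object_order C X) \<and>
     ((\<exists>X. simple_object C X \<and> faithful_object C X \<and> self_dual C X) \<longrightarrow>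
        trivial_group (invertibles_group C) \<or> invertibles_group C \<cong> integer_mod_group 2) \<and>
     (nilpotent_category C \<and> cyclic_group (invertibles_group C) \<longrightarrow>
        (\<exists>X. simple_object C X \<and> faithful_object C X))"
proof -
  interpret modular_category C by (rule assms)
  interpret acf_modular_category C ..
  show ?thesis
    using faithful_cyclic faithful_self_dual nilpotent_faithful by blast
qed

end
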